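(* Let $\mathbf{k}$ be a field, let $n\ge 0$ be an integer, and let $S=\{s_1<s_2<\dots<s_m\}$ and $T=\{t_1<t_2<\dots<t_m\}$ (with $m\ge 0$) be subsets of $\{0,1,\dots,n\}$ with $t_j-s_j\ge 2$ for all $j$. Let $\mathcal{A}_{S,T}$ be the directed $A_\infty$-category associated with the path algebra with relations $R_{S,T}$, and let $\mathcal{B}_{S,T}$ be the directed $A_\infty$-category defined combinatorially from $(n,S,T)$ (both are defined in the context). Then $\mathcal{B}_{S,T}$ is an $A_\infty$-Koszul dual of $\mathcal{A}_{S,T}$.
   Context: **$A_\infty$-conventions.** All categories are over $\mathbf{k}$ and all graded vector spaces have finite total dimension. An $A_\infty$-category has $\mathbb{Z}$-graded hom spaces and maps $\mu^d\colon \hom(X_{d-1},X_d)\otimes\cdots\otimes\hom(X_0,X_1)\to\hom(X_0,X_d)[2-d]$, $d\ge1$, satisfying $\sum_{i,j,l}(-1)^{\bigstar_i}\mu^l(a_d,\dots,a_{i+j+1},\mu^j(a_{i+j},\dots,a_{i+1}),a_i,\dots,a_1)=0$ with $\bigstar_i=\sum_{1\le r\le i}(|a_r|-1)$. $A_\infty$-categories are assumed cohomologically unital. A quasi-isomorphism is an $A_\infty$-functor inducing an isomorphism of cohomology categories. Conventions follow Seidel's book "Fukaya categories and Picard-Lefschetz theory". An $A_\infty$-category $\mathcal{A}$ is *directed* if $Ob(\mathcal{A})$ is finite, $\hom_{\mathcal{A}}(X,X)=\mathbf{k}\cdot 1_X$, and there is a total order on $Ob(\mathcal{A})$ with $\hom_{\mathcal{A}}(X,Y)\ne0$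 only when $X\le Y$. For objects $\boldsymbol{Y}=(Y_1,\dots,Y_r)$ of an $A_\infty$-category $\mathcal{C}$, the directed subcategory $\mathcal{C}^\to(\boldsymbol{Y})$ has objects $Y_1,\dots,Y_r$, hom spaces $\hom_{\mathcal{C}}(Y_i,Y_j)$ for $i<j$, $\mathbf{k}\cdot e_i$ for $i=j$, and $0$ for $i>j$, with $\mu$'s induced from $\mathcal{C}$. **$A_\infty$-Koszul dual.** For a directed $A_\infty$-category $\mathcal{A}$ with objects $0<1<\dots<n$, let $\mathcal{Q}=mod(\mathcal{A})$ be the dg category of (right) $A_\infty$-modules, i.e. $A_\infty$-functors from $\mathcal{A}^{op}$ to the dg category of bounded complexes of finite dimensional $\mathbf{k}$-vector spaces. The simple module $\mathcal{S}(j)$ has $\mathcal{S}(j)(i)=\mathbf{k}$ (in degree $0$) if $i=j$ and $0$ otherwise. Let $\mathcal{A}^!_\infty$ be the full $A_\infty$-subcategory of $\mathcal{Q}$ with objects $\mathcal{S}(n)<\mathcal{S}(n-1)<\dots<\mathcal{S}(0)$, which is identified with the directed $A_\infty$-category $\mathcal{Q}^\to(\mathcal{S}(n),\dots,\mathcal{S}(0))$. A directed $A_\infty$-category quasi-isomorphic to $\mathcal{A}^!_\infty$ is called an $A_\infty$-Koszul dual of $\mathcal{A}$. **The category $\mathcal{A}_{S,T}$.** Let $\overrightarrow{\Delta}_n$ be the quiver with vertices $0,1,\dots,n$ and arrows $\alpha_i\colon i-1\to i$ ($1\le i\le n$). Put $R_{S,T}=\mathbf{k}\overrightarrow{\Delta}_n/(\rho_1,\dots,\rho_m)$,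 where $\rho_j=\alpha_{t_j}\alpha_{t_j-1}\cdots\alpha_{s_j+1}$ is the path from $s_j$ to $t_j$ (the product of $\alpha\colon i\to j$ and $\beta\colon j\to l$ is written $\beta\alpha$). $\mathcal{A}_{S,T}$ has objects $0<1<\dots<n$, $\hom^0(i,j)=e_jR_{S,T}e_i$, $\hom^d=0$ for $d\ne0$, $\mu^2$ induced by the product of $R_{S,T}$, and $\mu^d=0$ for $d\neq2$. **The category $\mathcal{B}_{S,T}$.** For $p\in\{0,\dots,n\}$ let $d(p)=\max\{s_j\mid t_j\le p\}$, with $d(p)=-\infty$ if there is no such $j$. Define finite sequences $\{a^{(p)}_i\}_{0\le i\le l_p}$ as follows: $a^{(0)}_0=0$, $l_0=0$. For $p\ge1$: $a^{(p)}_0=p$, $a^{(p)}_1=p-1$, and for $i\ge 2$, once $a^{(p)}_q$ is defined for $q<i$: if $d(a^{(p)}_{i-2})\ne d(a^{(p)}_{i-1})$ set $a^{(p)}_i=d(a^{(p)}_{i-2})$; if they are equal set $l_p=i-1$ and stop. (These sequences are strictly decreasing with values in $\{0,\dots,n\}$.) $\mathcal{B}_{S,T}$ has objects $B(n)<B(n-1)<\dots<B(0)$, with $\hom^i(B(p),B(a^{(p)}_i))=\mathbf{k}\cdot\eta^i_p$ for $0\le i\le l_p$ ($\eta^i_p$ a formal symbol of degree $i$), and all other hom spaces zero. Write $\tilde\eta_{p,q}=\eta^i_p\in \hom(B(p),B(q))$ when $q=a^{(p)}_i$, and $|x|$ for the degree of $x$. The compositions are $$\mu^d(\tilde\eta_{j_{d-1},j_d},\tilde\eta_{j_{d-2},j_{d-1}},\dots,\tilde\eta_{j_0,j_1})=(-1)^{(|\tilde\eta_{j_{d-1},j_d}|+1)\,|\tilde\eta_{j_0,j_d}|}\,\tilde\eta_{j_0,j_d}$$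 if $\hom_{\mathcal{B}_{S,T}}(B(j_0),B(j_d))\ne0$ and $|\tilde\eta_{j_0,j_d}|=|\tilde\eta_{j_0,j_1}|+\dots+|\tilde\eta_{j_{d-1},j_d}|+(2-d)$, and $\mu^d(\dots)=0$ otherwise. This defines a directed $A_\infty$-category. *)

theory Defs
  imports Complex_Main "HOL-Library.Function_Algebras" "HOL-Algebra.QuotRing"
begin

section \<open>Graded vector spaces\<close>

text \<open>
  A \<open>\<int>\<close>-graded vector space is given by its homogeneous components, which are subspaces of an
  ambient vector space (with scalar multiplication \<open>scl\<close>) whose sum is direct.
\<close>

definition graded_space :: "('k::field \<Rightarrow> 'v \<Rightarrow> 'v::ab_group_add) \<Rightarrow> (int \<Rightarrow> 'v set) \<Rightarrow> bool" where
  "graded_space scl V \<longleftrightarrow>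
     (\<forall>g. module.subspace scl (V g)) \<and>
     (\<forall>x. (\<forall>g. x g \<in> V g) \<and> finite {g. x g \<noteq> 0} \<and> (\<Sum>g | x g \<noteq> 0. x g) = 0 \<longrightarrow> (\<forall>g. x g = 0))"

definition finite_total_dim :: "('k::field \<Rightarrow> 'v \<Rightarrow> 'v::ab_group_add) \<Rightarrow> (int \<Rightarrow> 'v set) \<Rightarrow> bool" where
  "finite_total_dim scl V \<longleftrightarrow> (\<exists>B. finite B \<and> (\<Union>g. V g) \<subseteq> module.span scl B)"

definition multilinear_on ::
  "('k \<Rightarrow> 'v \<Rightarrow> 'v::ab_group_add) \<Rightarrow> ('k \<Rightarrow> 'w \<Rightarrow> 'w::ab_group_add) \<Rightarrow> 'v set list \<Rightarrow> ('v list \<Rightarrow> 'w) \<Rightarrow> bool" where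
  "multilinear_on scl scl' Vs f \<longleftrightarrow>
     (\<forall>as\<in>listset Vs. \<forall>i<length Vs. \<forall>x\<in>Vs ! i. \<forall>y\<in>Vs ! i. \<forall>c.
        f (as[i := x + y]) = f (as[i := x]) + f (as[i := y]) \<and>
        f (as[i := scl c x]) = scl' c (f (as[i := x])))"


section \<open>Cohomologically unital \<open>A\<^sub>\<infinity>\<close>-categories\<close>

text \<open>
  Conventions are those of Seidel's book. A composable string
  \<open>a\<^sub>1 \<in> hom(X\<^sub>0,X\<^sub>1), \<dots>, a\<^sub>d \<in> hom(X\<^sub>d\<^sub>-\<^sub>1,X\<^sub>d)\<close> is encoded by the lists \<open>Xs = [X\<^sub>0, \<dots>, X\<^sub>d]\<close> and
  \<open>as = [a\<^sub>1, \<dots>, a\<^sub>d]\<close>, so \<open>Mu C Xs as\<close> is \<open>\<mu>\<^sup>d(a\<^sub>d, \<dots>, a\<^sub>1)\<close>: the lists run in the order opposite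
  to the arguments in the written formula. The operations are only relevant on homogeneous
  arguments, and \<open>Hom C X Y g\<close> is the degree \<open>g\<close> component of \<open>hom(X,Y)\<close>.
\<close>

record ('o, 'k, 'v) ainf =
  Ob :: "'o set"
  Hom :: "'o \<Rightarrow> 'o \<Rightarrow> int \<Rightarrow> 'v set"
  Mu :: "'o list \<Rightarrow> 'v list \<Rightarrow> 'v"
  Scl :: "'k \<Rightarrow> 'v \<Rightarrow> 'v"

definition hom_spaces :: "('o, 'k, 'v) ainf \<Rightarrow> 'o list \<Rightarrow> int list \<Rightarrow> 'v set list" where
  "hom_spaces C Xs gs = map (\<lambda>i. Hom C (Xs ! i) (Xs ! Suc i) (gs ! i)) [0..<length gs]"

definition composable :: "('o, 'k, 'v) ainf \<Rightarrow> 'o list \<Rightarrow> int list \<Rightarrow> 'v list \<Rightarrow> bool" where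
  "composable C Xs gs as \<longleftrightarrow>
     set Xs \<subseteq> Ob C \<and> length Xs = Suc (length gs) \<and> as \<in> listset (hom_spaces C Xs gs)"

text \<open>The exponent \<open>\<Sum>\<^bsub>1 \<le> r \<le> i\<^esub> (|a\<^sub>r| - 1)\<close>.\<close>

definition star :: "int list \<Rightarrow> nat \<Rightarrow> int" where
  "star gs i = (\<Sum>r<i. gs ! r - 1)"

definition ainf_relations :: "('o, 'k::field, 'v::ab_group_add) ainf \<Rightarrow> bool" where
  "ainf_relations C \<longleftrightarrow>
     (\<forall>Xs gs as. composable C Xs gs as \<and> as \<noteq> [] \<longrightarrow>
        (\<Sum>i<length as. \<Sum>j=1..length as - i.
           Scl C ((-1) powi star gs i)
             (Mu C (take (Suc i) Xs @ drop (i + j) Xs)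
                   (take i as @ Mu C (take (Suc j) (drop i Xs)) (take j (drop i as)) # drop (i + j) as)))
        = 0)"

definition cocycles :: "('o, 'k, 'v::ab_group_add) ainf \<Rightarrow> 'o \<Rightarrow> 'o \<Rightarrow> int \<Rightarrow> 'v set" where
  "cocycles C X Y g = {a \<in> Hom C X Y g. Mu C [X, Y] [a] = 0}"

definition cohomologous :: "('o, 'k, 'v::ab_group_add) ainf \<Rightarrow> 'o \<Rightarrow> 'o \<Rightarrow> int \<Rightarrow> ('v \<times> 'v) set" where
  "cohomologous C X Y g =
     {(a, b). a \<in> cocycles C X Y g \<and> b \<in> cocycles C X Y g \<and>
              (\<exists>c\<in>Hom C X Y (g - 1). a - b = Mu C [X, Y] [c])}"

definition cohomology :: "('o, 'k, 'v::ab_group_add) ainf \<Rightarrow> 'o \<Rightarrow> 'o \<Rightarrow> int \<Rightarrow> 'v set set" where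
  "cohomology C X Y g = cocycles C X Y g // cohomologous C X Y g"

text \<open>
  Composition in the cohomology category is
  \<open>[a\<^sub>2] \<cdot> [a\<^sub>1] = (-1)\<^bsup>|a\<^sub>1|\<^esup> [\<mu>\<^sup>2(a\<^sub>2, a\<^sub>1)]\<close>; this is the origin of the sign in the next two definitions.
\<close>

definition cohomology_unit :: "('o, 'k::field, 'v::ab_group_add) ainf \<Rightarrow> 'o \<Rightarrow> 'v \<Rightarrow> bool" where
  "cohomology_unit C X e \<longleftrightarrow>
     e \<in> cocycles C X X 0 \<and>
     (\<forall>Y\<in>Ob C. \<forall>g.
        (\<forall>a\<in>cocycles C X Y g. (Mu C [X, X, Y] [e, a], a) \<in> cohomologous C X Y g) \<and>
        (\<forall>a\<in>cocycles C Y X g.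
           (Scl C ((-1) powi g) (Mu C [Y, X, X] [a, e]), a) \<in> cohomologous C Y X g))"

definition strict_unit :: "('o, 'k::field, 'v::ab_group_add) ainf \<Rightarrow> 'o \<Rightarrow> 'v \<Rightarrow> bool" where
  "strict_unit C X e \<longleftrightarrow>
     e \<in> Hom C X X 0 \<and> Mu C [X, X] [e] = 0 \<and>
     (\<forall>Y\<in>Ob C. \<forall>g.
        (\<forall>a\<in>Hom C X Y g. Mu C [X, X, Y] [e, a] = a) \<and>
        (\<forall>a\<in>Hom C Y X g. Scl C ((-1) powi g) (Mu C [Y, X, X] [a, e]) = a)) \<and>
     (\<forall>Xs gs as i. composable C Xs gs as \<and> length as \<ge> 3 \<and> i < length as \<and>
        Xs ! i = X \<and> Xs ! Suc i = X \<and> as ! i = e \<longrightarrow> Mu C Xs as = 0)"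

definition ainf_category :: "('o, 'k::field, 'v::ab_group_add) ainf \<Rightarrow> bool" where
  "ainf_category C \<longleftrightarrow>
     vector_space (Scl C) \<and>
     (\<forall>X\<in>Ob C. \<forall>Y\<in>Ob C. graded_space (Scl C) (Hom C X Y)) \<and>
     (\<forall>Xs gs. set Xs \<subseteq> Ob C \<and> length Xs = Suc (length gs) \<and> gs \<noteq> [] \<longrightarrow>
        multilinear_on (Scl C) (Scl C) (hom_spaces C Xs gs) (Mu C Xs) \<and>
        (\<forall>as\<in>listset (hom_spaces C Xs gs).
           Mu C Xs as \<in> Hom C (hd Xs) (last Xs) (sum_list gs + 2 - int (length gs)))) \<and>
     ainf_relations C \<and>
     (\<forall>X\<in>Ob C. \<exists>e. cohomology_unit C X e)"

definition full_subcategory :: "('o, 'k, 'v) ainf \<Rightarrow> 'o set \<Rightarrow> ('o, 'k, 'v) ainf" where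
  "full_subcategory C S = C\<lparr>Ob := Ob C \<inter> S\<rparr>"


section \<open>\<open>A\<^sub>\<infinity>\<close>-functors and quasi-isomorphisms\<close>

text \<open>
  \<open>fmor F Xs as\<close> is \<open>F\<^sup>d(a\<^sub>d, \<dots>, a\<^sub>1)\<close>, with lists as for \<open>Mu\<close>. In the functor equation, \<open>ss = [s\<^sub>1, \<dots>, s\<^sub>r]\<close>
  runs over the compositions of \<open>d\<close>, and the \<open>k\<close>-th block (counting from \<open>0\<close>) of the string starts
  at position \<open>offset ss k\<close>.
\<close>

record ('o, 'v, 'p, 'w) ainf_fun =
  fob :: "'o \<Rightarrow> 'p"
  fmor :: "'o list \<Rightarrow> 'v list \<Rightarrow> 'w"

definition compositions :: "nat \<Rightarrow> nat list set" where
  "compositions d = {ss. sum_list ss = d \<and> 0 \<notin> set ss}"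

definition offset :: "nat list \<Rightarrow> nat \<Rightarrow> nat" where
  "offset ss k = sum_list (take k ss)"

definition ainf_functor ::
  "('o, 'k::field, 'v::ab_group_add) ainf \<Rightarrow> ('p, 'k, 'w::ab_group_add) ainf \<Rightarrow> ('o, 'v, 'p, 'w) ainf_fun \<Rightarrow> bool" where
  "ainf_functor C D F \<longleftrightarrow>
     ainf_category C \<and> ainf_category D \<and> fob F ` Ob C \<subseteq> Ob D \<and>
     (\<forall>Xs gs. set Xs \<subseteq> Ob C \<and> length Xs = Suc (length gs) \<and> gs \<noteq> [] \<longrightarrow>
        multilinear_on (Scl C) (Scl D) (hom_spaces C Xs gs) (fmor F Xs) \<and>
        (\<forall>as\<in>listset (hom_spaces C Xs gs).
           fmor F Xs as \<in> Hom D (fob F (hd Xs)) (fob F (last Xs)) (sum_list gs + 1 - int (length gs)))) \<and>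
     (\<forall>Xs gs as. composable C Xs gs as \<and> as \<noteq> [] \<longrightarrow>
        (\<Sum>ss\<in>compositions (length as).
           Mu D (map (\<lambda>k. fob F (Xs ! offset ss k)) [0..<Suc (length ss)])
                (map (\<lambda>k. fmor F (take (Suc (ss ! k)) (drop (offset ss k) Xs))
                                 (take (ss ! k) (drop (offset ss k) as))) [0..<length ss]))
        = (\<Sum>i<length as. \<Sum>j=1..length as - i.
             Scl D ((-1) powi star gs i)
               (fmor F (take (Suc i) Xs @ drop (i + j) Xs)
                       (take i as @ Mu C (take (Suc j) (drop i Xs)) (take j (drop i as)) # drop (i + j) as))))"

text \<open>
  The functor equations make \<open>[a] \<mapsto> [F\<^sup>1(a)]\<close> well defined and compatible with composition, and
  a bijective composition-preserving map preserves identities. So the induced functor on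
  cohomology categories is an isomorphism iff it is bijective on objects and on morphism spaces.
\<close>

definition quasi_isomorphism ::
  "('o, 'k::field, 'v::ab_group_add) ainf \<Rightarrow> ('p, 'k, 'w::ab_group_add) ainf \<Rightarrow> ('o, 'v, 'p, 'w) ainf_fun \<Rightarrow> bool" where
  "quasi_isomorphism C D F \<longleftrightarrow>
     ainf_functor C D F \<and> bij_betw (fob F) (Ob C) (Ob D) \<and>
     (\<forall>X\<in>Ob C. \<forall>Y\<in>Ob C. \<forall>g.
        bij_betw (\<lambda>c. cohomologous D (fob F X) (fob F Y) g `` ((\<lambda>a. fmor F [X, Y] [a]) ` c))
          (cohomology C X Y g) (cohomology D (fob F X) (fob F Y) g))"


section \<open>Directed \<open>A\<^sub>\<infinity>\<close>-categories\<close>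

definition directed :: "('o, 'k::field, 'v::ab_group_add) ainf \<Rightarrow> bool" where
  "directed C \<longleftrightarrow>
     ainf_category C \<and> finite (Ob C) \<and>
     (\<forall>X\<in>Ob C. \<forall>Y\<in>Ob C. finite_total_dim (Scl C) (Hom C X Y)) \<and>
     (\<forall>X\<in>Ob C. \<exists>e. strict_unit C X e \<and> e \<noteq> 0 \<and>
        Hom C X X 0 = range (\<lambda>c. Scl C c e) \<and> (\<forall>g. g \<noteq> 0 \<longrightarrow> Hom C X X g = {0})) \<and>
     (\<exists>r. linear_order_on (Ob C) r \<and>
        (\<forall>X\<in>Ob C. \<forall>Y\<in>Ob C. (\<exists>g. Hom C X Y g \<noteq> {0}) \<longrightarrow> (X, Y) \<in> r))"

definition unit_of :: "('o, 'k::field, 'v::ab_group_add) ainf \<Rightarrow> 'o \<Rightarrow> 'v" where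
  "unit_of C X = (THE e. strict_unit C X e)"


section \<open>The dg category of right \<open>A\<^sub>\<infinity>\<close>-modules\<close>

text \<open>
  The finite dimensional graded vector spaces \<open>M(X)\<close> are taken inside the coordinate space
  \<open>nat \<Rightarrow> 'k\<close>, which contains a copy of every finite dimensional vector space over \<open>'k\<close>.
\<close>

type_synonym 'k vec = "nat \<Rightarrow> 'k"

definition vscale :: "'k::field \<Rightarrow> 'k vec \<Rightarrow> 'k vec" where
  "vscale c v = (\<lambda>i. c * v i)"

text \<open>
  \<open>MMu M [X\<^sub>0, \<dots>, X\<^sub>d\<^sub>-\<^sub>1] b [a\<^sub>1, \<dots>, a\<^sub>d\<^sub>-\<^sub>1]\<close> is \<open>\<mu>\<^sub>M\<^sup>d(b, a\<^sub>d\<^sub>-\<^sub>1, \<dots>, a\<^sub>1) \<in> M(X\<^sub>0)\<close> for \<open>b \<in> M(X\<^sub>d\<^sub>-\<^sub>1)\<close>.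
\<close>

record ('o, 'v, 'm) amod =
  MSp :: "'o \<Rightarrow> int \<Rightarrow> 'm set"
  MMu :: "'o list \<Rightarrow> 'm \<Rightarrow> 'v list \<Rightarrow> 'm"

definition mod_arg ::
  "('o, 'k, 'v) ainf \<Rightarrow> ('o, 'v, 'k vec) amod \<Rightarrow> 'o list \<Rightarrow> int \<Rightarrow> 'k vec \<Rightarrow> int list \<Rightarrow> 'v list \<Rightarrow> bool" where
  "mod_arg A M Xs h b gs as \<longleftrightarrow>
     Xs \<noteq> [] \<and> composable A Xs gs as \<and> b \<in> MSp M (last Xs) h"

text \<open>
  Multilinear families \<open>t\<^sup>d: M(X\<^sub>d\<^sub>-\<^sub>1) \<otimes> hom(X\<^sub>d\<^sub>-\<^sub>2,X\<^sub>d\<^sub>-\<^sub>1) \<otimes> \<cdots> \<otimes> hom(X\<^sub>0,X\<^sub>1) \<rightarrow> N(X\<^sub>0)[g - d + 1]\<close>, \<open>d \<ge> 1\<close>.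
\<close>

definition multilinear_family ::
  "('o, 'k::field, 'v::ab_group_add) ainf \<Rightarrow> ('o, 'v, 'k vec) amod \<Rightarrow> ('o, 'v, 'k vec) amod \<Rightarrow> int
   \<Rightarrow> ('o list \<Rightarrow> 'k vec \<Rightarrow> 'v list \<Rightarrow> 'k vec) \<Rightarrow> bool" where
  "multilinear_family A M N g t \<longleftrightarrow>
     (\<forall>Xs gs h. set Xs \<subseteq> Ob A \<and> length Xs = Suc (length gs) \<longrightarrow>
        (\<forall>b\<in>MSp M (last Xs) h. multilinear_on (Scl A) vscale (hom_spaces A Xs gs) (t Xs b)) \<and>
        (\<forall>as\<in>listset (hom_spaces A Xs gs). \<forall>b\<in>MSp M (last Xs) h.
           t Xs b as \<in> MSp N (hd Xs) (h + sum_list gs + g - int (length Xs) + 1) \<and>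
           (\<forall>b'\<in>MSp M (last Xs) h. t Xs (b + b') as = t Xs b as + t Xs b' as) \<and>
           (\<forall>c. t Xs (vscale c b) as = vscale c (t Xs b as))))"

definition module_relations ::
  "('o, 'k::field, 'v::ab_group_add) ainf \<Rightarrow> ('o, 'v, 'k vec) amod \<Rightarrow> bool" where
  "module_relations A M \<longleftrightarrow>
     (\<forall>Xs h b gs as. mod_arg A M Xs h b gs as \<longrightarrow>
        (\<Sum>i<length Xs. vscale ((-1) powi star gs i)
           (MMu M (take (Suc i) Xs) (MMu M (drop i Xs) b (drop i as)) (take i as))) +
        (\<Sum>i<length as. \<Sum>j=1..length as - i. vscale ((-1) powi star gs i)
           (MMu M (take (Suc i) Xs @ drop (i + j) Xs) b
                  (take i as @ Mu A (take (Suc j) (drop i Xs)) (take j (drop i as)) # drop (i + j) as)))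
        = 0)"

text \<open>
  Modules are cohomologically unital \<open>A\<^sub>\<infinity>\<close>-functors from the opposite category to complexes,
  written out as in Seidel's book. The structure maps form a multilinear family of degree \<open>1\<close>.
\<close>

definition ainf_module ::
  "('o, 'k::field, 'v::ab_group_add) ainf \<Rightarrow> ('o, 'v, 'k vec) amod \<Rightarrow> bool" where
  "ainf_module A M \<longleftrightarrow>
     (\<forall>X\<in>Ob A. graded_space vscale (MSp M X) \<and> finite_total_dim vscale (MSp M X)) \<and>
     multilinear_family A M M 1 (MMu M) \<and>
     module_relations A M \<and>
     (\<forall>X\<in>Ob A. \<forall>e g. \<forall>b\<in>MSp M X g. cohomology_unit A X e \<and> MMu M [X] b [] = 0 \<longrightarrow>
        (\<exists>c\<in>MSp M X (g - 1). MMu M [X, X] b [e] - b = MMu M [X] c []))"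

text \<open>
  Families are normalised to be \<open>0\<close> outside their domain of homogeneous arguments, so that equality
  of functions is equality of morphisms.
\<close>

definition mod_hom ::
  "('o, 'k::field, 'v::ab_group_add) ainf \<Rightarrow> ('o, 'v, 'k vec) amod \<Rightarrow> ('o, 'v, 'k vec) amod \<Rightarrow> int
   \<Rightarrow> ('o list \<Rightarrow> 'k vec \<Rightarrow> 'v list \<Rightarrow> 'k vec) set" where
  "mod_hom A M N g =
     {t. multilinear_family A M N g t \<and>
         (\<forall>Xs b as. (\<nexists>h gs. mod_arg A M Xs h b gs as) \<longrightarrow> t Xs b as = 0)}"

text \<open>
  The sign exponent \<open>|a\<^sub>i\<^sub>+\<^sub>1| + \<cdots> + |a\<^sub>d\<^sub>-\<^sub>1| + |b| - d + i + 1\<close> in the dg structure. The degrees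
  are read off from the arguments; they are unambiguous unless one argument is zero, in which case
  all terms carrying the sign vanish by multilinearity.
\<close>

definition mod_sign ::
  "('o, 'k::field, 'v) ainf \<Rightarrow> ('o, 'v, 'k vec) amod \<Rightarrow> 'o list \<Rightarrow> 'k vec \<Rightarrow> 'v list \<Rightarrow> nat \<Rightarrow> 'k" where
  "mod_sign A M Xs b as i =
     (let (h, gs) = (SOME (h, gs). mod_arg A M Xs h b gs as)
      in (-1) powi (sum_list (drop i gs) + h - int (length Xs) + int i + 1))"

definition mod_differential ::
  "('o, 'k::field, 'v::ab_group_add) ainf \<Rightarrow> ('o, 'v, 'k vec) amod \<Rightarrow> ('o, 'v, 'k vec) amod
   \<Rightarrow> ('o list \<Rightarrow> 'k vec \<Rightarrow> 'v list \<Rightarrow> 'k vec) \<Rightarrow> ('o list \<Rightarrow> 'k vec \<Rightarrow> 'v list \<Rightarrow> 'k vec)" where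
  "mod_differential A M N t = (\<lambda>Xs b as.
     if \<exists>h gs. mod_arg A M Xs h b gs as then
       (\<Sum>i<length Xs. vscale (mod_sign A M Xs b as i)
          (MMu N (take (Suc i) Xs) (t (drop i Xs) b (drop i as)) (take i as))) +
       (\<Sum>i<length Xs. vscale (mod_sign A M Xs b as i)
          (t (take (Suc i) Xs) (MMu M (drop i Xs) b (drop i as)) (take i as))) +
       (\<Sum>i<length as. \<Sum>j=1..length as - i. vscale (mod_sign A M Xs b as i)
          (t (take (Suc i) Xs @ drop (i + j) Xs) b
             (take i as @ Mu A (take (Suc j) (drop i Xs)) (take j (drop i as)) # drop (i + j) as)))
     else 0)"

definition mod_composition ::
  "('o, 'k::field, 'v::ab_group_add) ainf \<Rightarrow> ('o, 'v, 'k vec) amod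
   \<Rightarrow> ('o list \<Rightarrow> 'k vec \<Rightarrow> 'v list \<Rightarrow> 'k vec) \<Rightarrow> ('o list \<Rightarrow> 'k vec \<Rightarrow> 'v list \<Rightarrow> 'k vec)
   \<Rightarrow> ('o list \<Rightarrow> 'k vec \<Rightarrow> 'v list \<Rightarrow> 'k vec)" where
  "mod_composition A M t2 t1 = (\<lambda>Xs b as.
     if \<exists>h gs. mod_arg A M Xs h b gs as then
       (\<Sum>i<length Xs. vscale (mod_sign A M Xs b as i)
          (t2 (take (Suc i) Xs) (t1 (drop i Xs) b (drop i as)) (take i as)))
     else 0)"

definition mod_category ::
  "('o, 'k::field, 'v::ab_group_add) ainf
   \<Rightarrow> (('o, 'v, 'k vec) amod, 'k, 'o list \<Rightarrow> 'k vec \<Rightarrow> 'v list \<Rightarrow> 'k vec) ainf" where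
  "mod_category A =
     \<lparr> Ob = {M. ainf_module A M},
       Hom = mod_hom A,
       Mu = (\<lambda>Ms ts. case (Ms, ts) of
               ([M0, M1], [t]) \<Rightarrow> mod_differential A M0 M1 t
             | ([M0, M1, M2], [t1, t2]) \<Rightarrow> mod_composition A M0 t2 t1
             | _ \<Rightarrow> 0),
       Scl = (\<lambda>c t Xs b as. vscale c (t Xs b as)) \<rparr>"


section \<open>The \<open>A\<^sub>\<infinity>\<close>-Koszul dual\<close>

text \<open>
  The one-dimensional space \<open>\<S>(j)(j)\<close> is realised as the first coordinate axis of \<open>nat \<Rightarrow> 'k\<close>. For
  degree reasons the only structure map of \<open>\<S>(j)\<close> that can be nonzero is \<open>\<mu>\<^sup>2\<close>, and unitality forces
  \<open>\<mu>\<^sup>2(b, c\<cdot>1\<^sub>j) = c\<cdot>b\<close>.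
\<close>

definition simple_module :: "('o, 'k::field, 'v::ab_group_add) ainf \<Rightarrow> 'o \<Rightarrow> ('o, 'v, 'k vec) amod" where
  "simple_module A j =
     \<lparr> MSp = (\<lambda>X g. if X = j \<and> g = 0 then {v. \<forall>i>0. v i = 0} else {0}),
       MMu = (\<lambda>Xs b as. case (Xs, as) of
                ([X0, X1], [a]) \<Rightarrow>
                   if X0 = j \<and> X1 = j then vscale (THE c. a = Scl A c (unit_of A j)) b else 0
              | _ \<Rightarrow> 0) \<rparr>"

definition koszul_category ::
  "('o, 'k::field, 'v::ab_group_add) ainf
   \<Rightarrow> (('o, 'v, 'k vec) amod, 'k, 'o list \<Rightarrow> 'k vec \<Rightarrow> 'v list \<Rightarrow> 'k vec) ainf" where
  "koszul_category A = full_subcategory (mod_category A) (simple_module A ` Ob A)"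

definition ainf_koszul_dual ::
  "('o, 'k::field, 'v::ab_group_add) ainf \<Rightarrow> ('p, 'k, 'w::ab_group_add) ainf \<Rightarrow> bool" where
  "ainf_koszul_dual A B \<longleftrightarrow>
     directed A \<and> directed B \<and> (\<exists>F. quasi_isomorphism B (koszul_category A) F)"


section \<open>The category \<open>\<A>\<^sub>S\<^sub>,\<^sub>T\<close>\<close>

text \<open>
  The sets \<open>S\<close> and \<open>T\<close> are given by \<open>m\<close> and the enumerations \<open>s\<^sub>1 < \<dots> < s\<^sub>m\<close>, \<open>t\<^sub>1 < \<dots> < t\<^sub>m\<close>.

  The linear quiver has exactly one path from \<open>i\<close> to \<open>j\<close> for \<open>i \<le> j \<le> n\<close>, encoded as \<open>(i, j)\<close>. Elements
  of the path algebra are the coefficient functions of linear combinations of paths.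
\<close>

definition path :: "nat \<Rightarrow> nat \<Rightarrow> nat \<times> nat \<Rightarrow> 'k::field" where
  "path i j = (\<lambda>p. if p = (i, j) then 1 else 0)"

definition path_algebra :: "nat \<Rightarrow> (nat \<times> nat \<Rightarrow> 'k::field) ring" where
  "path_algebra n =
     \<lparr> carrier = {x. \<forall>i j. x (i, j) \<noteq> 0 \<longrightarrow> i \<le> j \<and> j \<le> n},
       mult = (\<lambda>y x (i, l). \<Sum>j=i..l. y (j, l) * x (i, j)),
       one = (\<lambda>(i, j). if i = j \<and> i \<le> n then 1 else 0),
       zero = 0,
       add = (+) \<rparr>"

definition relation_ideal :: "nat \<Rightarrow> nat \<Rightarrow> (nat \<Rightarrow> nat) \<Rightarrow> (nat \<Rightarrow> nat) \<Rightarrow> (nat \<times> nat \<Rightarrow> 'k::field) set" where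
  "relation_ideal n m s t = genideal (path_algebra n) ((\<lambda>j. path (s j) (t j)) ` {1..m})"

text \<open>
  The quotient of the path algebra by the relation ideal, realised on normal forms: the ideal
  is spanned by the paths it contains, so every coset has exactly one representative without such
  paths. The lemma \<open>R_ST_iso_quotient\<close> below identifies \<open>R_ST\<close> with the quotient ring.
\<close>

definition normal_form ::
  "nat \<Rightarrow> nat \<Rightarrow> (nat \<Rightarrow> nat) \<Rightarrow> (nat \<Rightarrow> nat) \<Rightarrow> (nat \<times> nat \<Rightarrow> 'k::field) \<Rightarrow> nat \<times> nat \<Rightarrow> 'k" where
  "normal_form n m s t x =
     (\<lambda>(i, j). if (path i j :: nat \<times> nat \<Rightarrow> 'k) \<in> relation_ideal n m s t then 0 else x (i, j))"

definition R_ST :: "nat \<Rightarrow> nat \<Rightarrow> (nat \<Rightarrow> nat) \<Rightarrow> (nat \<Rightarrow> nat) \<Rightarrow> (nat \<times> nat \<Rightarrow> 'k::field) ring" where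
  "R_ST n m s t =
     \<lparr> carrier = normal_form n m s t ` carrier (path_algebra n),
       mult = (\<lambda>y x. normal_form n m s t (y \<otimes>\<^bsub>path_algebra n\<^esub> x)),
       one = normal_form n m s t \<one>\<^bsub>path_algebra n\<^esub>,
       zero = 0,
       add = (+) \<rparr>"

definition A_ST :: "nat \<Rightarrow> nat \<Rightarrow> (nat \<Rightarrow> nat) \<Rightarrow> (nat \<Rightarrow> nat) \<Rightarrow> (nat, 'k::field, nat \<times> nat \<Rightarrow> 'k) ainf" where
  "A_ST n m s t =
     (let R = R_ST n m s t; e = (\<lambda>i. normal_form n m s t (path i i)) in
      \<lparr> Ob = {0..n},
        Hom = (\<lambda>i j g. if g = 0 then {e j \<otimes>\<^bsub>R\<^esub> x \<otimes>\<^bsub>R\<^esub> e i | x. x \<in> carrier R} else {0}),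
        Mu = (\<lambda>_ as. case as of [a1, a2] \<Rightarrow> a2 \<otimes>\<^bsub>R\<^esub> a1 | _ \<Rightarrow> 0),
        Scl = (\<lambda>c x p. c * x p) \<rparr>)"


section \<open>The category \<open>\<B>\<^sub>S\<^sub>,\<^sub>T\<close>\<close>

text \<open>\<open>None\<close> stands for \<open>-\<infinity>\<close>.\<close>

definition d_fun :: "nat \<Rightarrow> (nat \<Rightarrow> nat) \<Rightarrow> (nat \<Rightarrow> nat) \<Rightarrow> nat \<Rightarrow> nat option" where
  "d_fun m s t p =
     (if \<exists>j\<in>{1..m}. t j \<le> p then Some (Max {s j | j. j \<in> {1..m} \<and> t j \<le> p}) else None)"

text \<open>
  \<open>a_seq m s t p i\<close> is \<open>Some a\<^sup>(\<^sup>p\<^sup>)\<^sub>i\<close> for \<open>i \<le> l\<^sub>p\<close> and \<open>None\<close> for \<open>i > l\<^sub>p\<close>. As \<open>d\<close> is monotone,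
  \<open>d(a\<^sub>i\<^sub>-\<^sub>2) \<noteq> d(a\<^sub>i\<^sub>-\<^sub>1)\<close> implies that \<open>d(a\<^sub>i\<^sub>-\<^sub>2)\<close> is not \<open>-\<infinity>\<close>.
\<close>

fun a_seq :: "nat \<Rightarrow> (nat \<Rightarrow> nat) \<Rightarrow> (nat \<Rightarrow> nat) \<Rightarrow> nat \<Rightarrow> nat \<Rightarrow> nat option" where
  "a_seq m s t p 0 = Some p"
| "a_seq m s t p (Suc 0) = (if p = 0 then None else Some (p - 1))"
| "a_seq m s t p (Suc (Suc i)) =
     (case (a_seq m s t p i, a_seq m s t p (Suc i)) of
        (Some x, Some y) \<Rightarrow> if d_fun m s t x \<noteq> d_fun m s t y then d_fun m s t x else None
      | _ \<Rightarrow> None)"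

definition eta_exists :: "nat \<Rightarrow> (nat \<Rightarrow> nat) \<Rightarrow> (nat \<Rightarrow> nat) \<Rightarrow> nat \<Rightarrow> nat \<Rightarrow> bool" where
  "eta_exists m s t p q \<longleftrightarrow> (\<exists>i. a_seq m s t p i = Some q)"

definition eta_deg :: "nat \<Rightarrow> (nat \<Rightarrow> nat) \<Rightarrow> (nat \<Rightarrow> nat) \<Rightarrow> nat \<Rightarrow> nat \<Rightarrow> int" where
  "eta_deg m s t p q = int (THE i. a_seq m s t p i = Some q)"

text \<open>
  The object \<open>B(p)\<close> is represented by \<open>p\<close>. All nonzero morphism spaces are one-dimensional and are
  realised as \<open>'k\<close>, the scalar \<open>c\<close> standing for \<open>c \<cdot> \<eta>\<close>; so \<open>Mu\<close> on scalars is the multilinear extension of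
  the formula for the \<open>\<eta>\<close>.
\<close>

definition B_ST :: "nat \<Rightarrow> nat \<Rightarrow> (nat \<Rightarrow> nat) \<Rightarrow> (nat \<Rightarrow> nat) \<Rightarrow> (nat, 'k::field, 'k) ainf" where
  "B_ST n m s t =
     \<lparr> Ob = {0..n},
       Hom = (\<lambda>p q g. if g \<ge> 0 \<and> a_seq m s t p (nat g) = Some q then UNIV else {0}),
       Mu = (\<lambda>js cs.
          let d = length cs; deg = eta_deg m s t in
          if d \<ge> 1 \<and> length js = Suc d \<and>
             (\<forall>r<d. eta_exists m s t (js ! r) (js ! Suc r)) \<and>
             eta_exists m s t (hd js) (last js) \<and>
             deg (hd js) (last js) = (\<Sum>r<d. deg (js ! r) (js ! Suc r)) + 2 - int d
          then (-1) powi ((deg (js ! (d - 1)) (js ! d) + 1) * deg (hd js) (last js)) * prod_list cs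
          else 0),
       Scl = (*) \<rparr>"


section \<open>\<open>R_ST\<close> is the quotient of the path algebra by the relation ideal\<close>

lemma path_carrierD:
  "x \<in> carrier (path_algebra n) \<Longrightarrow> x (i, j) \<noteq> 0 \<Longrightarrow> i \<le> j \<and> j \<le> n"
  unfolding path_algebra_def by simp

lemma path_carrierI:
  "(\<And>i j. x (i, j) \<noteq> 0 \<Longrightarrow> i \<le> j \<and> j \<le> n) \<Longrightarrow> x \<in> carrier (path_algebra n)"
  unfolding path_algebra_def by simp

lemma path_algebra_add: "add (path_algebra n) = (+)" "zero (path_algebra n) = 0"
  by (simp_all add: path_algebra_def)

lemma path_mult_eq:
  fixes x y :: "nat \<times> nat \<Rightarrow> 'k::field"
  assumes "x \<in> carrier (path_algebra n)" "y \<in> carrier (path_algebra n)"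
  shows "(y \<otimes>\<^bsub>path_algebra n\<^esub> x) (i, l) = (\<Sum>j\<le>n. y (j, l) * x (i, j))"
proof -
  have *: "y (j, l) * x (i, j) = 0" if "j \<notin> {i..l} \<or> j \<notin> {..n}" for j
    using path_carrierD[OF assms(1), of i j] path_carrierD[OF assms(2), of j l] that
    by (cases "x (i, j) = 0"; cases "y (j, l) = 0") simp_all
  have "(\<Sum>j=i..l. y (j, l) * x (i, j)) = (\<Sum>j\<in>{i..l} \<union> {..n}. y (j, l) * x (i, j))"
    by (rule sum.mono_neutral_left) (use * in blast)+
  also have "\<dots> = (\<Sum>j\<le>n. y (j, l) * x (i, j))"
    by (rule sum.mono_neutral_right) (use * in blast)+
  finally show ?thesis by (simp add: path_algebra_def)
qed

lemma path_mult_closed: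
  fixes x y :: "nat \<times> nat \<Rightarrow> 'k::field"
  assumes "x \<in> carrier (path_algebra n)" "y \<in> carrier (path_algebra n)"
  shows "y \<otimes>\<^bsub>path_algebra n\<^esub> x \<in> carrier (path_algebra n)"
proof -
  have "i \<le> l \<and> l \<le> n" if nz: "(y \<otimes>\<^bsub>path_algebra n\<^esub> x) (i, l) \<noteq> 0" for i l
  proof -
    from nz obtain j where "y (j, l) * x (i, j) \<noteq> 0"
      unfolding path_mult_eq[OF assms] by (meson sum.not_neutral_contains_not_neutral)
    then show ?thesis
      using path_carrierD[OF assms(1), of i j] path_carrierD[OF assms(2), of j l] by simp
  qed
  then show ?thesis by (rule path_carrierI)
qed

lemma path_algebra_ring: "ring (path_algebra n :: (nat \<times> nat \<Rightarrow> 'k::field) ring)"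
proof (rule ringI)
  let ?P = "path_algebra n :: (nat \<times> nat \<Rightarrow> 'k) ring"
  note m = path_mult_closed path_mult_eq
  show "abelian_group ?P"
  proof (rule abelian_groupI)
    fix x assume x: "x \<in> carrier ?P"
    have "- x \<in> carrier ?P" using path_carrierD[OF x] by (intro path_carrierI) simp
    moreover have "(- x) \<oplus>\<^bsub>?P\<^esub> x = \<zero>\<^bsub>?P\<^esub>" by (simp add: path_algebra_add)
    ultimately show "\<exists>y\<in>carrier ?P. y \<oplus>\<^bsub>?P\<^esub> x = \<zero>\<^bsub>?P\<^esub>" by blast
  next
    fix x y assume xy: "x \<in> carrier ?P" "y \<in> carrier ?P"
    show "x \<oplus>\<^bsub>?P\<^esub> y \<in> carrier ?P"
    proof (rule path_carrierI)
      fix i j assume "(x \<oplus>\<^bsub>?P\<^esub> y) (i, j) \<noteq> 0"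
      then have "x (i, j) \<noteq> 0 \<or> y (i, j) \<noteq> 0" by (auto simp: path_algebra_add)
      then show "i \<le> j \<and> j \<le> n" using path_carrierD[OF xy(1)] path_carrierD[OF xy(2)] by blast
    qed
  next
    show "\<zero>\<^bsub>?P\<^esub> \<in> carrier ?P" by (simp add: path_algebra_def)
  qed (simp_all add: path_algebra_add add_ac)
  show "monoid ?P"
  proof (rule monoidI)
    show one: "\<one>\<^bsub>?P\<^esub> \<in> carrier ?P" by (auto simp: path_algebra_def)
    fix x assume x: "x \<in> carrier ?P"
    show "\<one>\<^bsub>?P\<^esub> \<otimes>\<^bsub>?P\<^esub> x = x"
    proof (rule ext, clarify)
      fix i l
      have "(\<one>\<^bsub>?P\<^esub> \<otimes>\<^bsub>?P\<^esub> x) (i, l) = (\<Sum>j\<le>n. if j = l then x (i, j) else 0)"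
        unfolding m(2)[OF x one] by (intro sum.cong) (auto simp: path_algebra_def)
      moreover have "x (i, l) = 0" if "\<not> l \<le> n" using path_carrierD[OF x] that by blast
      ultimately show "(\<one>\<^bsub>?P\<^esub> \<otimes>\<^bsub>?P\<^esub> x) (i, l) = x (i, l)" by auto
    qed
    show "x \<otimes>\<^bsub>?P\<^esub> \<one>\<^bsub>?P\<^esub> = x"
    proof (rule ext, clarify)
      fix i l
      have "(x \<otimes>\<^bsub>?P\<^esub> \<one>\<^bsub>?P\<^esub>) (i, l) = (\<Sum>j\<le>n. if j = i then x (j, l) else 0)"
        unfolding m(2)[OF one x] by (intro sum.cong) (auto simp: path_algebra_def)
      moreover have "x (i, l) = 0" if "\<not> i \<le> n"
        using path_carrierD[OF x, of i l] that by (meson le_trans)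
      ultimately show "(x \<otimes>\<^bsub>?P\<^esub> \<one>\<^bsub>?P\<^esub>) (i, l) = x (i, l)" by auto
    qed
  next
    fix x y assume "x \<in> carrier ?P" "y \<in> carrier ?P"
    then show "x \<otimes>\<^bsub>?P\<^esub> y \<in> carrier ?P" by (rule m(1)[rotated])
  next
    fix x y z assume x: "x \<in> carrier ?P" and y: "y \<in> carrier ?P" and z: "z \<in> carrier ?P"
    show "x \<otimes>\<^bsub>?P\<^esub> y \<otimes>\<^bsub>?P\<^esub> z = x \<otimes>\<^bsub>?P\<^esub> (y \<otimes>\<^bsub>?P\<^esub> z)"
    proof (rule ext, clarify)
      fix i l
      have "(x \<otimes>\<^bsub>?P\<^esub> y \<otimes>\<^bsub>?P\<^esub> z) (i, l) = (\<Sum>j\<le>n. \<Sum>k\<le>n. x (k, l) * y (j, k) * z (i, j))"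
        by (simp add: m x y z sum_distrib_right)
      also have "\<dots> = (\<Sum>k\<le>n. \<Sum>j\<le>n. x (k, l) * y (j, k) * z (i, j))" by (rule sum.swap)
      also have "\<dots> = (x \<otimes>\<^bsub>?P\<^esub> (y \<otimes>\<^bsub>?P\<^esub> z)) (i, l)"
        by (simp add: m x y z sum_distrib_left mult.assoc)
      finally show "(x \<otimes>\<^bsub>?P\<^esub> y \<otimes>\<^bsub>?P\<^esub> z) (i, l) = (x \<otimes>\<^bsub>?P\<^esub> (y \<otimes>\<^bsub>?P\<^esub> z)) (i, l)" .
    qed
  qed
  have "(x \<oplus>\<^bsub>?P\<^esub> y) \<otimes>\<^bsub>?P\<^esub> z = x \<otimes>\<^bsub>?P\<^esub> z \<oplus>\<^bsub>?P\<^esub> y \<otimes>\<^bsub>?P\<^esub> z"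
       "z \<otimes>\<^bsub>?P\<^esub> (x \<oplus>\<^bsub>?P\<^esub> y) = z \<otimes>\<^bsub>?P\<^esub> x \<oplus>\<^bsub>?P\<^esub> z \<otimes>\<^bsub>?P\<^esub> y" for x y z
    by (simp_all add: path_algebra_def fun_eq_iff sum.distrib distrib_left distrib_right)
  then show "(x \<oplus>\<^bsub>?P\<^esub> y) \<otimes>\<^bsub>?P\<^esub> z = x \<otimes>\<^bsub>?P\<^esub> z \<oplus>\<^bsub>?P\<^esub> y \<otimes>\<^bsub>?P\<^esub> z"
       "z \<otimes>\<^bsub>?P\<^esub> (x \<oplus>\<^bsub>?P\<^esub> y) = z \<otimes>\<^bsub>?P\<^esub> x \<oplus>\<^bsub>?P\<^esub> z \<otimes>\<^bsub>?P\<^esub> y" for x y z .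
qed

lemma path_carrier: "path i j \<in> carrier (path_algebra n) \<longleftrightarrow> i \<le> j \<and> j \<le> n"
  by (auto simp: path_algebra_def path_def)

text \<open>Multiplying with scalar multiples of trivial paths isolates a single coefficient.\<close>

lemma path_corner:
  fixes x :: "nat \<times> nat \<Rightarrow> 'k::field"
  assumes x: "x \<in> carrier (path_algebra n)" and ij: "i \<le> n" "j \<le> n"
  shows "(\<lambda>p. c * path j j p) \<otimes>\<^bsub>path_algebra n\<^esub> x \<otimes>\<^bsub>path_algebra n\<^esub> path i i = (\<lambda>p. c * x (i, j) * path i j p)"
proof (rule ext, clarify)
  fix k l
  let ?P = "path_algebra n :: (nat \<times> nat \<Rightarrow> 'k) ring"
  have c: "(\<lambda>p. c * path j j p) \<in> carrier ?P" using ij by (auto simp: path_algebra_def path_def)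
  have e: "path i i \<in> carrier ?P" using ij by (simp add: path_carrier)
  have *: "((\<lambda>p. c * path j j p) \<otimes>\<^bsub>?P\<^esub> x) (r, l) = (if l = j then c * x (r, j) else 0)" for r
  proof -
    have "((\<lambda>p. c * path j j p) \<otimes>\<^bsub>?P\<^esub> x) (r, l)
        = (\<Sum>q\<le>n. if q = j then (if l = j then c * x (r, j) else 0) else 0)"
      unfolding path_mult_eq[OF x c] by (intro sum.cong) (auto simp: path_def)
    then show ?thesis using ij by simp
  qed
  have "((\<lambda>p. c * path j j p) \<otimes>\<^bsub>?P\<^esub> x \<otimes>\<^bsub>?P\<^esub> path i i) (k, l)
      = (\<Sum>q\<le>n. if q = i then (if k = i \<and> l = j then c * x (i, j) else 0) else 0)"
    unfolding path_mult_eq[OF e path_mult_closed[OF x c]] *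
    by (intro sum.cong) (auto simp: path_def)
  then show "((\<lambda>p. c * path j j p) \<otimes>\<^bsub>?P\<^esub> x \<otimes>\<^bsub>?P\<^esub> path i i) (k, l) = c * x (i, j) * path i j (k, l)"
    using ij by (auto simp: path_def)
qed

lemma path_algebra_expand:
  fixes x :: "nat \<times> nat \<Rightarrow> 'k::field"
  assumes "x \<in> carrier (path_algebra n)"
  shows "x = (\<Sum>q\<in>{(i, j). i \<le> j \<and> j \<le> n}. (\<lambda>p. x q * path (fst q) (snd q) p))"
proof -
  have fin: "finite {(i, j). i \<le> j \<and> j \<le> n}"
    by (rule finite_subset[of _ "{..n} \<times> {..n}"]) auto
  have coeff: "x p = (\<Sum>q\<in>{(i, j). i \<le> j \<and> j \<le> n}. x q * path (fst q) (snd q) p)" for p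
  proof -
    have "(\<Sum>q\<in>{(i, j). i \<le> j \<and> j \<le> n}. x q * path (fst q) (snd q) p)
        = (\<Sum>q\<in>{(i, j). i \<le> j \<and> j \<le> n}. if p = q then x q else 0)"
      by (intro sum.cong) (auto simp: path_def)
    also have "\<dots> = (if p \<in> {(i, j). i \<le> j \<and> j \<le> n} then x p else 0)"
      using fin by (rule sum.delta')
    also have "\<dots> = x p"
      using path_carrierD[OF assms, of "fst p" "snd p"] by (cases p) auto
    finally show ?thesis ..
  qed
  have apply_sum: "(\<Sum>q\<in>Q. f q) p = (\<Sum>q\<in>Q. f q p)"
    for Q :: "(nat \<times> nat) set" and f :: "nat \<times> nat \<Rightarrow> nat \<times> nat \<Rightarrow> 'k" and p
    by (induction Q rule: infinite_finite_induct) auto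
  show ?thesis by (rule ext) (unfold apply_sum, rule coeff)
qed

lemma ideal_path_coeff:
  fixes I :: "(nat \<times> nat \<Rightarrow> 'k::field) set"
  assumes I: "ideal I (path_algebra n)" and x: "x \<in> I" and nz: "x (i, j) \<noteq> 0"
  shows "path i j \<in> I"
proof -
  let ?P = "path_algebra n :: (nat \<times> nat \<Rightarrow> 'k) ring"
  interpret ideal I ?P by (fact I)
  have xc: "x \<in> carrier ?P" using x by (rule a_Hcarr)
  have ij: "i \<le> n" "j \<le> n" using path_carrierD[OF xc nz] by auto
  let ?c = "(\<lambda>p. inverse (x (i, j)) * path j j p)"
  have c: "?c \<in> carrier ?P" using ij by (auto simp: path_algebra_def path_def)
  have "?c \<otimes>\<^bsub>?P\<^esub> x \<otimes>\<^bsub>?P\<^esub> path i i \<in> I"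
    using x c ij by (intro I_r_closed I_l_closed) (auto simp: path_carrier)
  then show ?thesis unfolding path_corner[OF xc ij] using nz by simp
qed

lemma ideal_scaled_path:
  fixes I :: "(nat \<times> nat \<Rightarrow> 'k::field) set"
  assumes I: "ideal I (path_algebra n)" and p: "path i j \<in> I"
  shows "(\<lambda>q. c * path i j q) \<in> I"
proof -
  let ?P = "path_algebra n :: (nat \<times> nat \<Rightarrow> 'k) ring"
  interpret ideal I ?P by (fact I)
  have pc: "path i j \<in> carrier ?P" using p by (rule a_Hcarr)
  then have ij: "i \<le> n" "j \<le> n" by (auto simp: path_carrier)
  have c: "(\<lambda>q. c * path j j q) \<in> carrier ?P" using ij by (auto simp: path_algebra_def path_def)
  have "(\<lambda>q. c * path j j q) \<otimes>\<^bsub>?P\<^esub> path i j \<otimes>\<^bsub>?P\<^esub> path i i \<in> I"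
    using p c ij by (intro I_r_closed I_l_closed) (auto simp: path_carrier)
  then show ?thesis unfolding path_corner[OF pc ij] by (simp add: path_def)
qed

context
  fixes n m :: nat and s t :: "nat \<Rightarrow> nat"
  assumes rel: "\<And>j. j \<in> {1..m} \<Longrightarrow> s j \<le> t j \<and> t j \<le> n"
begin

lemma relation_ideal_ideal: "ideal (relation_ideal n m s t) (path_algebra n)"
  unfolding relation_ideal_def using rel
  by (intro ring.genideal_ideal path_algebra_ring) (auto simp: path_carrier)

lemma normal_form_eq_0_iff:
  assumes x: "x \<in> carrier (path_algebra n)"
  shows "normal_form n m s t x = 0 \<longleftrightarrow> x \<in> (relation_ideal n m s t :: (nat \<times> nat \<Rightarrow> 'k::field) set)"
proof
  let ?P = "path_algebra n :: (nat \<times> nat \<Rightarrow> 'k) ring"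
  let ?I = "relation_ideal n m s t :: (nat \<times> nat \<Rightarrow> 'k) set"
  interpret ideal ?I ?P by (rule relation_ideal_ideal)
  assume 0: "normal_form n m s t x = 0"
  have z: "(0 :: nat \<times> nat \<Rightarrow> 'k) \<in> ?I"
    using additive_subgroup.zero_closed[OF is_additive_subgroup] by (simp add: path_algebra_add)
  have *: "(\<lambda>p. x q * path (fst q) (snd q) p) \<in> ?I" for q
  proof (cases "x q = 0")
    case True
    then show ?thesis using z by (simp add: zero_fun_def)
  next
    case False
    with fun_cong[OF 0, of q] have "path (fst q) (snd q) \<in> ?I"
      by (cases q) (auto simp: normal_form_def split: if_splits)
    then show ?thesis by (rule ideal_scaled_path[OF relation_ideal_ideal])
  qed
  have "(\<Sum>q\<in>Q. f q) \<in> ?I" if "\<And>q. f q \<in> ?I" for Q :: "(nat \<times> nat) set" and f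
  proof (induction Q rule: infinite_finite_induct)
    case (insert q Q)
    have "f q + sum f Q \<in> ?I"
      using additive_subgroup.a_closed[OF is_additive_subgroup that[of q] insert.IH]
      by (simp only: path_algebra_add)
    then show ?case by (subst sum.insert[OF insert.hyps])
  qed (use z in \<open>simp_all add: zero_fun_def\<close>)
  from this[OF *] show "x \<in> ?I" by (subst path_algebra_expand[OF x])
next
  assume "x \<in> (relation_ideal n m s t :: (nat \<times> nat \<Rightarrow> 'k) set)"
  then show "normal_form n m s t x = 0"
    using ideal_path_coeff[OF relation_ideal_ideal, of x]
    by (force simp: normal_form_def fun_eq_iff)
qed

lemma normal_form_closed:
  "x \<in> carrier (path_algebra n) \<Longrightarrow> normal_form n m s t x \<in> carrier (path_algebra n)"
  by (rule path_carrierI, erule path_carrierD) (auto simp: normal_form_def split: if_splits)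

lemma normal_form_add: "normal_form n m s t (x + y) = normal_form n m s t x + normal_form n m s t y"
  by (auto simp: normal_form_def fun_eq_iff)

lemma normal_form_diff: "normal_form n m s t (x - y) = normal_form n m s t x - normal_form n m s t y"
  by (auto simp: normal_form_def fun_eq_iff)

lemma normal_form_mult:
  fixes x y :: "nat \<times> nat \<Rightarrow> 'k::field"
  assumes x: "x \<in> carrier (path_algebra n)" and y: "y \<in> carrier (path_algebra n)"
  shows "normal_form n m s t (y \<otimes>\<^bsub>path_algebra n\<^esub> x) =
         normal_form n m s t (normal_form n m s t y \<otimes>\<^bsub>path_algebra n\<^esub> normal_form n m s t x)"
proof -
  let ?P = "path_algebra n :: (nat \<times> nat \<Rightarrow> 'k) ring"
  let ?I = "relation_ideal n m s t :: (nat \<times> nat \<Rightarrow> 'k) set"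
  let ?N = "normal_form n m s t :: (nat \<times> nat \<Rightarrow> 'k) \<Rightarrow> _"
  interpret ideal ?I ?P by (rule relation_ideal_ideal)
  have diff: "z - ?N z \<in> ?I" "z - ?N z \<in> carrier ?P" if z: "z \<in> carrier ?P" for z
  proof -
    show c: "z - ?N z \<in> carrier ?P"
      using path_carrierD[OF z] by (intro path_carrierI) (auto simp: normal_form_def split: if_splits)
    have "?N (z - ?N z) = 0" by (auto simp: normal_form_def fun_eq_iff)
    then show "z - ?N z \<in> ?I" using normal_form_eq_0_iff[OF c] by simp
  qed
  note cl = normal_form_closed path_mult_closed
  have "y \<otimes>\<^bsub>?P\<^esub> x - ?N y \<otimes>\<^bsub>?P\<^esub> ?N x =
      (y - ?N y) \<otimes>\<^bsub>?P\<^esub> x + ?N y \<otimes>\<^bsub>?P\<^esub> (x - ?N x)"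
    by (simp add: path_algebra_def fun_eq_iff left_diff_distrib right_diff_distrib sum_subtractf)
  also have "\<dots> \<in> ?I"
  proof -
    have "(y - ?N y) \<otimes>\<^bsub>?P\<^esub> x \<oplus>\<^bsub>?P\<^esub> ?N y \<otimes>\<^bsub>?P\<^esub> (x - ?N x) \<in> ?I"
      using x y diff
      by (intro additive_subgroup.a_closed[OF is_additive_subgroup] I_l_closed I_r_closed cl)
    then show ?thesis by (simp only: path_algebra_add)
  qed
  finally have mem: "y \<otimes>\<^bsub>?P\<^esub> x - ?N y \<otimes>\<^bsub>?P\<^esub> ?N x \<in> ?I" .
  then have "?N (y \<otimes>\<^bsub>?P\<^esub> x - ?N y \<otimes>\<^bsub>?P\<^esub> ?N x) = 0"
    using normal_form_eq_0_iff[OF a_Hcarr[OF mem]] by simp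
  then show ?thesis by (simp add: normal_form_diff)
qed

text \<open>The canonical map from the quotient ring to \<^const>\<open>R_ST\<close> is an isomorphism.\<close>

theorem R_ST_iso_quotient:
  "(\<lambda>X. the_elem (normal_form n m s t ` X)) \<in>
     ring_iso (path_algebra n Quot relation_ideal n m s t) (R_ST n m s t :: (nat \<times> nat \<Rightarrow> 'k::field) ring)"
proof -
  let ?P = "path_algebra n :: (nat \<times> nat \<Rightarrow> 'k) ring"
  let ?R = "R_ST n m s t :: (nat \<times> nat \<Rightarrow> 'k) ring"
  let ?N = "normal_form n m s t :: (nat \<times> nat \<Rightarrow> 'k) \<Rightarrow> _"
  have N0: "?N 0 = 0" by (auto simp: normal_form_def fun_eq_iff)
  have hom: "?N \<in> ring_hom ?P ?R"
  proof (rule ring_hom_memI)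
    fix x y assume "x \<in> carrier ?P" "y \<in> carrier ?P"
    then show "?N (x \<otimes>\<^bsub>?P\<^esub> y) = ?N x \<otimes>\<^bsub>?R\<^esub> ?N y"
      by (simp add: R_ST_def normal_form_mult[symmetric])
    show "?N (x \<oplus>\<^bsub>?P\<^esub> y) = ?N x \<oplus>\<^bsub>?R\<^esub> ?N y"
      using normal_form_add[of x y] by (simp add: R_ST_def path_algebra_def)
  qed (simp_all add: R_ST_def)
  have img: "?N ` carrier ?P = carrier ?R" by (simp add: R_ST_def)
  have "ring (?R\<lparr>carrier := ?N ` carrier ?P, zero := ?N \<zero>\<^bsub>?P\<^esub>\<rparr>)"
    by (rule ring.ring_hom_imp_img_ring[OF path_algebra_ring hom])
  moreover have "?R\<lparr>carrier := ?N ` carrier ?P, zero := ?N \<zero>\<^bsub>?P\<^esub>\<rparr> = ?R"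
    by (simp add: R_ST_def path_algebra_def N0)
  ultimately have "ring ?R" by simp
  then have rh: "ring_hom_ring ?P ?R ?N"
    by (rule ring_hom_ringI2[OF path_algebra_ring _ hom])
  have "a_kernel ?P ?R ?N = {x \<in> carrier ?P. ?N x = 0}" by (simp add: a_kernel_def' R_ST_def)
  also have "\<dots> = {x \<in> carrier ?P. x \<in> relation_ideal n m s t}"
    by (rule Collect_cong) (metis normal_form_eq_0_iff)
  also have "\<dots> = relation_ideal n m s t"
    using ideal.Icarr[OF relation_ideal_ideal] by blast
  finally have "a_kernel ?P ?R ?N = relation_ideal n m s t" .
  with ring_hom_ring.FactRing_iso_set[OF rh img] show ?thesis by simp
qed

end

end

theory Submission
  imports Defs
begin

text \<open>
  Since \<open>A_ST\<close> is concentrated in degree \<open>0\<close> with at most one path between two vertices, a module morphism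
  between simple modules \<open>S p\<close> and \<open>S q\<close> is a scalar function on the strings of nonzero paths from
  \<open>q\<close> to \<open>p\<close>, written here as descending lists of vertices that start with \<open>p\<close> and end with \<open>q\<close>
  (\<open>mod_hom_cochain_hom\<close>). The dg structure of the category of modules becomes the bar construction: the
  differential deletes entries (\<open>mod_differential_cochain_hom\<close>) and the composition is a cup product
  (\<open>mod_composition_cochain_hom\<close>). What has to be found is an \<open>A\<^sub>\<infinity>\<close>-functor from \<open>B_ST\<close> to this dg category
  that induces isomorphisms on cohomology.

  The cohomology is known from the minimal resolutions. All syzygies of a simple module are
  intervals of vertices, the slots, and the sequences that define \<open>B_ST\<close> list their tops
  (\<open>a_seq_bd\<close>). The list of the tops is the critical chain. Coboundaries vanish on it
  (\<open>bdry_crit\<close>), and a cocycle that vanishes on it is a coboundary (\<open>cocycle_exact\<close>). So the first order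
  part of the functor sends an arrow to the cocycle that is \<open>1\<close> on all lists that run through the
  slots, and any \<open>A\<^sub>\<infinity>\<close>-functor that extends this is a quasi-isomorphism.

  The higher components are given by an explicit recursion, the cochains \<open>tau\<close>. It is found by
  imposing a gauge, namely that the components vanish on lists which begin with tops of syzygies
  and then repeat the slot of the last one (\<open>tau_gauge\<close>); the functor equation on such lists is then solved for
  the remaining value. It is not clear from the recursion that the functor equation holds
  on the other lists, nor that the products are those of \<open>B_ST\<close>. The first point follows from
  rigidity: the defect of the equation is a cocycle, as the standard homological argument shows
  (\<open>bdry_mc\<close>), it satisfies the gauge condition, and such a cocycle is zero as soon as it vanishes on the
  critical chain (\<open>cocycle_rigid\<close>). The second point is the evaluation of the equation on critical chains,
  where it says that the product of a string of arrows is the value of \<open>tau\<close> on the tail of a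
  critical chain. This value is a sign exactly when the degrees match (\<open>tau_tail\<close>), which is the
  formula for the products in \<open>B_ST\<close> up to a rescaling of the arrows (\<open>eprod_mu\<close>). The same induction over the
  length of strings yields the \<open>A\<^sub>\<infinity>\<close>-relations in \<open>B_ST\<close>, as the obstruction to the defect being a
  cocycle (\<open>maurer_cartan\<close>).
\<close>

section \<open>Syzygies of the simple modules\<close>

text \<open>
  \<open>L p\<close> is the least source of a nonzero path with target \<open>p\<close>, so a path from \<open>x\<close> to \<open>y\<close> is nonzero iff
  \<open>L y \<le> x \<le> y\<close>. That \<open>L\<close> is monotone and that arrows are nonzero is all that the combinatorics
  uses of the relations, hence the abstract locale.
\<close>

locale short_paths =
  fixes L :: "nat \<Rightarrow> nat"
  assumes mono_L: "x \<le> y \<Longrightarrow> L x \<le> L y" and L_le: "L x \<le> x - 1"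
begin

text \<open>
  The minimal projective resolution of the simple module at \<open>p\<close> is uniserial: its \<open>t\<close>-th syzygy has
  as composition factors the vertices of \<open>slot p t\<close>, the interval from \<open>bd p (t + 1)\<close> to just below
  \<open>bd p t\<close>. The largest one, \<open>apex p t\<close>, is the top of the syzygy. Covering it by the projective
  module with factors from \<open>L (apex p t)\<close> to \<open>apex p t\<close> leaves the interval from \<open>L (apex p t)\<close> to
  just below \<open>bd p (t + 1)\<close>, which is the recursion. So \<open>arrow p i q\<close> says that the extension
  group of degree \<open>i\<close> of the simple modules at \<open>p\<close> and \<open>q\<close> is nonzero.
\<close>

fun bd :: "nat \<Rightarrow> nat \<Rightarrow> nat" where
  "bd p 0 = Suc p"
| "bd p (Suc 0) = p"
| "bd p (Suc (Suc t)) = L (bd p t - 1)"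

definition slot :: "nat \<Rightarrow> nat \<Rightarrow> nat set" where
  "slot p t = {bd p (Suc t)..<bd p t}"

definition apex :: "nat \<Rightarrow> nat \<Rightarrow> nat" where
  "apex p t = bd p t - 1"

definition arrow :: "nat \<Rightarrow> nat \<Rightarrow> nat \<Rightarrow> bool" where
  "arrow p i q \<longleftrightarrow> (\<forall>t\<le>i. bd p (Suc t) < bd p t) \<and> bd p i = Suc q"

definition conn :: "nat \<Rightarrow> nat \<Rightarrow> bool" where
  "conn p q \<longleftrightarrow> (\<exists>i. arrow p i q)"

definition deg :: "nat \<Rightarrow> nat \<Rightarrow> nat" where
  "deg p q = (THE i. arrow p i q)"

lemma bd_Suc_le: "bd p (Suc t) \<le> bd p t"
proof (induction p t rule: bd.induct)
  case (2 p)
  have "L p \<le> p - 1" by (rule L_le)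
  then show ?case by simp
qed (auto intro!: mono_L diff_le_mono)

lemma bd_antimono: "s \<le> t \<Longrightarrow> bd p t \<le> bd p s"
  by (rule lift_Suc_antimono_le[of "bd p"]) (rule bd_Suc_le)

lemma bd_L: "bd p (Suc (Suc t)) = L (apex p t)"
  by (simp add: apex_def)

lemma slot_0: "slot p 0 = {p}"
  by (auto simp: slot_def)

lemma slot_disjoint: "z \<in> slot p s \<Longrightarrow> z \<in> slot p t \<Longrightarrow> s = t"
proof (induction s t rule: linorder_wlog)
  case (le s t)
  show ?case
  proof (rule ccontr)
    assume "s \<noteq> t"
    with le have "bd p t \<le> bd p (Suc s)" by (intro bd_antimono) auto
    with le show False by (auto simp: slot_def)
  qed
qed auto

lemma apex_in_slot: "bd p (Suc t) < bd p t \<Longrightarrow> apex p t \<in> slot p t"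
  by (auto simp: slot_def apex_def)

lemma slot_le_apex: "z \<in> slot p t \<Longrightarrow> z \<le> apex p t \<and> Suc (apex p t) = bd p t"
  by (auto simp: slot_def apex_def)

text \<open>
  By monotonicity of \<open>L\<close>: \<open>x\<close> is at most the apex of slot \<open>t\<close>, whose image under \<open>L\<close> is the lower
  end of slot \<open>t + 1\<close>. So a list with entries in successive slots consists of nonzero paths.
\<close>

lemma slot_step:
  assumes "x \<in> slot p t" "y \<in> slot p (Suc t)" shows "L x \<le> y" "y < x"
proof -
  have "L x \<le> L (apex p t)" using slot_le_apex[OF assms(1)] by (intro mono_L) auto
  then show "L x \<le> y" using assms(2) by (auto simp: slot_def apex_def)
  show "y < x" using assms by (auto simp: slot_def)
qed

lemma arrow_bd: "arrow p i q \<Longrightarrow> t \<le> i \<Longrightarrow> bd p (Suc t) < bd p t"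
  by (simp add: arrow_def)

lemma arrow_apex: "arrow p i q \<Longrightarrow> q = apex p i"
  by (simp add: arrow_def apex_def)

lemma arrow_slot: "arrow p i q \<Longrightarrow> t \<le> i \<Longrightarrow> apex p t \<in> slot p t"
  by (auto simp: arrow_def intro: apex_in_slot)

lemma arrow_in_slot: "arrow p i q \<Longrightarrow> q \<in> slot p i"
  using arrow_apex arrow_slot by blast

lemma arrow_inj: "arrow p i q \<Longrightarrow> arrow p k q \<Longrightarrow> i = k"
  using arrow_in_slot slot_disjoint by blast

lemma deg_eq: "arrow p i q \<Longrightarrow> deg p q = i"
  unfolding deg_def using arrow_inj by blast

lemma conn_arrow: "conn p q \<Longrightarrow> arrow p (deg p q) q"
  using deg_eq by (auto simp: conn_def)

lemma arrow_le: "arrow p i q \<Longrightarrow> q \<le> p"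
  using bd_antimono[of 0 i p] by (auto simp: arrow_def)

lemma arrow_refl: "arrow p 0 p"
  by (auto simp: arrow_def)

lemma conn_refl: "conn p p" and deg_refl: "deg p p = 0"
  using arrow_refl deg_eq by (auto simp: conn_def)

lemma arrow_0_iff: "arrow p 0 q \<longleftrightarrow> p = q"
  by (auto simp: arrow_def)

lemma conn_le: "conn p q \<Longrightarrow> q \<le> p"
  using arrow_le by (auto simp: conn_def)

text \<open>
  Here \<open>c\<close> is the top of the \<open>i\<close>-th syzygy of \<open>p\<close>. The resolution of \<open>c\<close> runs along that of \<open>p\<close>,
  shifted by \<open>i\<close>: the recursion for \<open>bd\<close> advances in steps of two, so the even bounds, which start
  from \<open>bd c 0 = bd p i\<close>, agree exactly, while the odd ones start one step earlier and are only
  interleaved.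
\<close>

lemma bd_arrow:
  assumes c: "arrow p i c"
  shows "(even u \<longrightarrow> bd c u = bd p (i + u)) \<and>
         (odd u \<longrightarrow> bd p (i + u) \<le> bd c u \<and> bd c u \<le> bd p (i + u - 1))"
    (is "?P u")
proof -
  have "?P u \<and> ?P (Suc u)"
  proof (induction u)
    case 0
    have "bd p i = Suc c" "bd p (Suc i) < bd p i" using c by (auto simp: arrow_def)
    then show ?case by simp
  next
    case (Suc u)
    have "?P (Suc (Suc u))"
    proof (cases "even u")
      case True
      then show ?thesis using Suc by simp
    next
      case False
      then obtain v where v: "u = Suc v" by (cases u) auto
      have "bd p (i + u) \<le> bd c u" "bd c u \<le> bd p (i + v)" using Suc False v by auto
      then show ?thesis using False v by (auto intro!: mono_L diff_le_mono)
    qed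
    then show ?case using Suc by simp
  qed
  then show ?thesis ..
qed

lemma bd_arrow_even: "arrow p i c \<Longrightarrow> even u \<Longrightarrow> bd c u = bd p (i + u)"
  and bd_arrow_odd: "arrow p i c \<Longrightarrow> odd u \<Longrightarrow> bd p (i + u) \<le> bd c u"
    "arrow p i c \<Longrightarrow> odd u \<Longrightarrow> bd c u \<le> bd p (i + u - 1)"
  using bd_arrow by blast+

lemma bd_arrow_le: "arrow p i c \<Longrightarrow> 0 < u \<Longrightarrow> bd c u \<le> bd p (i + u - 1)"
  using bd_arrow[of p i c u] bd_antimono[of "i + u - 1" "i + u" p] by (cases "even u") auto


section \<open>Strings of morphisms\<close>

definition linked :: "nat list \<Rightarrow> bool" where
  "linked j \<longleftrightarrow> successively conn j"

definition strict :: "nat list \<Rightarrow> bool" where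
  "strict j \<longleftrightarrow> successively (\<lambda>p q. conn p q \<and> p \<noteq> q) j"

text \<open>
  The sum of the reduced degrees (degree minus one) of the morphisms of a string. In these degrees
  all \<open>A\<^sub>\<infinity>\<close>-products have degree \<open>1\<close> and the components of an \<open>A\<^sub>\<infinity>\<close>-functor have degree \<open>0\<close>.
\<close>

fun red :: "nat list \<Rightarrow> int" where
  "red (p # q # js) = int (deg p q) - 1 + red (q # js)"
| "red _ = 0"

lemma strict_simps: "strict [p]" "strict (p # q # js) \<longleftrightarrow> conn p q \<and> p \<noteq> q \<and> strict (q # js)"
  by (auto simp: strict_def)

lemma linked_simps: "linked [p]" "linked (p # q # js) \<longleftrightarrow> conn p q \<and> linked (q # js)"
  by (auto simp: linked_def)

lemma conn_neq_deg: "conn p q \<Longrightarrow> p \<noteq> q \<Longrightarrow> 1 \<le> deg p q"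
  using conn_arrow[of p q] arrow_0_iff[of p q] by (cases "deg p q") auto

lemma strict_red: "strict j \<Longrightarrow> 0 \<le> red j"
  using conn_neq_deg by (induction j rule: red.induct) (fastforce simp: strict_simps)+

text \<open>
  The target of a string lies weakly below the top of the syzygy that is reached by the reduced
  degree of the string.
\<close>

lemma string_target_bound:
  "strict (p # q # js) \<Longrightarrow> int h = red (p # q # js) + 1 \<Longrightarrow> last (q # js) < bd p h"
proof (induction js arbitrary: p q h)
  case Nil
  then have "arrow p h q" using conn_arrow[of p q] by (simp add: strict_simps)
  then show ?case by (simp add: arrow_def)
next
  case (Cons r js)
  define k where "k = nat (red (q # r # js) + 1)"
  have k: "int k = red (q # r # js) + 1" "0 < k"
    using strict_red[of "q # r # js"] Cons.prems by (auto simp: k_def strict_simps)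
  have a: "arrow p (deg p q) q" using Cons.prems by (auto simp: strict_simps intro: conn_arrow)
  have h: "h = deg p q + k - 1" using Cons.prems k by simp
  have "last (r # js) < bd q k" using Cons.prems k by (intro Cons.IH) (auto simp: strict_simps)
  also have "bd q k \<le> bd p h" unfolding h using a k by (intro bd_arrow_le)
  finally show ?case by simp
qed

text \<open>
  Complements \<open>string_target_bound\<close> in one degree less. The evaluation of the twisting cochain on
  tails of critical chains needs it to exclude arrows of even degree.
\<close>

lemma string_target_no_tie:
  "strict (p # q # js) \<Longrightarrow> int h = red (p # q # js) \<Longrightarrow>
   \<not> (bd p (Suc h) = bd p h \<and> bd p h = Suc (last (q # js)))"
proof (induction js arbitrary: p q h)
  case Nil
  then have "deg p q = Suc h" using conn_neq_deg[of p q] by (simp add: strict_simps)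
  then have "arrow p (Suc h) q" using conn_arrow[of p q] Nil by (simp add: strict_simps)
  then have "bd p (Suc h) < bd p h" by (rule arrow_bd) simp
  then show ?case by simp
next
  case (Cons r js)
  define s where "s = last (r # js)"
  define k where "k = nat (red (q # r # js))"
  have st: "strict (q # r # js)" using Cons.prems by (simp add: strict_simps)
  have k: "int k = red (q # r # js)" using strict_red[OF st] by (simp add: k_def)
  have a: "arrow p (deg p q) q" using Cons.prems by (auto simp: strict_simps intro: conn_arrow)
  have d: "1 \<le> deg p q" using Cons.prems conn_neq_deg by (simp add: strict_simps)
  have h: "Suc h = deg p q + k" using Cons.prems k by simp
  have s: "s < bd q (Suc k)"
    unfolding s_def using string_target_bound[OF st, of "Suc k"] k by simp
  show ?case
  proof
    assume tie: "bd p (Suc h) = bd p h \<and> bd p h = Suc (last (q # r # js))"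
    then have eq: "bd p (Suc h) = Suc s" "bd p h = Suc s" by (simp_all add: s_def)
    show False
    proof (cases "even k")
      case True
      have "bd q (Suc k) \<le> bd p (deg p q + k)" using bd_arrow_le[OF a, of "Suc k"] by simp
      also have "\<dots> = Suc s" using h eq by simp
      finally have "bd q (Suc k) = Suc s" using s by simp
      moreover have "bd q k = Suc s" using bd_arrow_even[OF a True] h eq by simp
      ultimately show False using Cons.IH[OF st k] by (simp add: s_def)
    next
      case False
      have "bd q (Suc k) = bd p (deg p q + Suc k)" using bd_arrow_even[OF a] False by simp
      also have "\<dots> = L s" using h eq by (metis add_Suc_right bd.simps(3) diff_Suc_1)
      also have "\<dots> \<le> s" using L_le[of s] by simp
      finally show False using s by simp
    qed
  qed
qed

lemma string_target_strict:
  assumes st: "strict (p # q # r # js)" and h: "int h = red (p # q # r # js) + 1"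
    and slot: "bd p (Suc h) < bd p h"
  shows "bd p h \<noteq> Suc (last (r # js))"
proof
  assume eq: "bd p h = Suc (last (r # js))"
  define s where "s = last (r # js)"
  define k where "k = nat (red (q # r # js))"
  have st': "strict (q # r # js)" using st by (simp add: strict_simps)
  have k: "int k = red (q # r # js)" using strict_red[OF st'] by (simp add: k_def)
  have a: "arrow p (deg p q) q" using st by (auto simp: strict_simps intro: conn_arrow)
  have d: "1 \<le> deg p q" using st conn_neq_deg by (simp add: strict_simps)
  have h': "h = deg p q + k" using h k by simp
  have s: "s < bd q (Suc k)"
    unfolding s_def using string_target_bound[OF st', of "Suc k"] k by simp
  show False
  proof (cases "even k")
    case True
    have "bd q (Suc k) \<le> bd p (deg p q + k)" using bd_arrow_le[OF a, of "Suc k"] by simp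
    also have "\<dots> = Suc s" using h' eq s_def by simp
    finally have "bd q (Suc k) = Suc s" using s by simp
    moreover have "bd q k = Suc s" using bd_arrow_even[OF a True] h' eq s_def by simp
    ultimately show False using string_target_no_tie[OF st' k] by (simp add: s_def)
  next
    case False
    have "bd q (Suc k) = bd p (Suc h)" using bd_arrow_even[OF a] False h' by simp
    then show False using s slot eq s_def by simp
  qed
qed

end

context short_paths
begin

section \<open>The twisting cochain\<close>

text \<open>
  Lists of vertices are written in descending order, so consecutive entries are target and source of
  a nonzero path. Equal neighbours are identity morphisms.
\<close>

definition chain :: "nat list \<Rightarrow> bool" where
  "chain z \<longleftrightarrow> (\<forall>i. Suc i < length z \<longrightarrow> L (z ! i) \<le> z ! Suc i \<and> z ! Suc i \<le> z ! i)"

definition fits :: "nat \<Rightarrow> nat list \<Rightarrow> nat \<Rightarrow> bool" where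
  "fits p z K \<longleftrightarrow> (\<forall>t\<le>K. z ! t \<in> slot p t)"

definition lift :: "nat \<Rightarrow> nat \<Rightarrow> nat \<Rightarrow> nat list \<Rightarrow> nat list" where
  "lift p i K z = map (apex p) [i..<Suc K] @ drop K z"

text \<open>
  The components of the twisting cochain, that is of the functor from the combinatorial category to
  the simple modules, up to the signs \<open>eprod\<close>. A single arrow \<open>p \<rightarrow> q\<close> of degree \<open>i\<close> goes to the
  cochain that is \<open>1\<close> on the chains from \<open>p\<close> to \<open>q\<close> that follow the slots of \<open>p\<close>. For a longer
  string, replace the entries of \<open>z\<close> one after the other by the apexes of their slots. The
  Maurer-Cartan equation on \<open>map (apex p) [0..<Suc K] @ drop K z\<close>, where the gauge condition makes
  \<open>tau\<close> vanish, expresses the change of the value in step \<open>K\<close> through shorter strings. The sum of these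
  changes is the value at \<open>z\<close>.
\<close>

fun tau :: "nat list \<Rightarrow> nat list \<Rightarrow> 'k::comm_ring_1" where
  "tau [p, q] z =
     (if conn p q \<and> length z = Suc (deg p q) \<and> fits p z (deg p q) \<and> last z = q then 1 else 0)"
| "tau (p # q # r # js) z =
     (if conn p q
      then \<Sum>K<length z. if deg p q \<le> K \<and> fits p z K \<and> z ! K \<noteq> apex p K
                        then (-1) ^ (K - deg p q) * tau (q # r # js) (lift p (deg p q) K z) else 0
      else 0)"
| "tau _ z = 0"

lemma length_lift: "i \<le> K \<Longrightarrow> K < length z \<Longrightarrow> length (lift p i K z) = length z + 1 - i"
  by (simp add: lift_def)

lemma lift_nth:
  assumes "i \<le> K" "K < length z" "u < length z + 1 - i"
  shows "lift p i K z ! u = (if u \<le> K - i then apex p (i + u) else z ! (u + i - 1))"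
proof (cases "u \<le> K - i")
  case True
  then have "u < Suc K - i" using assms by simp
  then show ?thesis using True by (simp add: lift_def nth_append del: upt_Suc)
next
  case False
  then have "\<not> u < Suc K - i" using assms by simp
  moreover from this have "K + (u - (Suc K - i)) = u + i - 1" using assms by simp
  ultimately show ?thesis using assms False
    by (simp add: lift_def nth_append del: upt_Suc)
qed

lemma last_lift: "i \<le> K \<Longrightarrow> K < length z \<Longrightarrow> last (lift p i K z) = last z"
  by (simp add: lift_def)

lemma fits_0: "z \<noteq> [] \<Longrightarrow> fits p z K \<Longrightarrow> hd z = p"
  by (auto simp: fits_def slot_0 hd_conv_nth)

lemma tau_nonzero_step:
  assumes "tau (p # q # r # js) z \<noteq> (0::'k::comm_ring_1)"
  obtains K where "conn p q" "K < length z" "deg p q \<le> K" "fits p z K" "z ! K \<noteq> apex p K"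
    "tau (q # r # js) (lift p (deg p q) K z) \<noteq> (0::'k)"
proof -
  let ?f = "\<lambda>K. if deg p q \<le> K \<and> fits p z K \<and> z ! K \<noteq> apex p K
       then (-1) ^ (K - deg p q) * tau (q # r # js) (lift p (deg p q) K z) else (0::'k)"
  have c: "conn p q" using assms by (auto split: if_splits)
  then have "sum ?f {..<length z} \<noteq> 0" using assms by simp
  then obtain K where "K \<in> {..<length z}" "?f K \<noteq> 0"
    by (rule sum.not_neutral_contains_not_neutral)
  then show ?thesis using c by (intro that[of K]) (auto split: if_splits)
qed

lemma tau_nonzero_single:
  "tau [p, q] z \<noteq> (0::'k::comm_ring_1) \<Longrightarrow>
   conn p q \<and> length z = Suc (deg p q) \<and> fits p z (deg p q) \<and> last z = q"
  by (simp split: if_splits)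

lemma tau_nonzero_induct [consumes 1, case_names single step]:
  assumes nz: "tau j z \<noteq> (0::'k::comm_ring_1)"
    and single: "\<And>p q z. conn p q \<Longrightarrow> length z = Suc (deg p q) \<Longrightarrow> fits p z (deg p q) \<Longrightarrow> last z = q \<Longrightarrow> P [p, q] z"
    and step: "\<And>p q r js z K. conn p q \<Longrightarrow> K < length z \<Longrightarrow> deg p q \<le> K \<Longrightarrow> fits p z K \<Longrightarrow>
      tau (q # r # js) (lift p (deg p q) K z) \<noteq> (0::'k) \<Longrightarrow>
      P (q # r # js) (lift p (deg p q) K z) \<Longrightarrow> P (p # q # r # js) z"
  shows "P j z"
  using nz
proof (induction j z rule: tau.induct)
  case (1 p q z)
  then show ?case using tau_nonzero_single[OF 1] by (intro single) auto
next
  case (2 p q r js z)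
  from tau_nonzero_step[OF 2(2)] obtain K where
    K: "conn p q" "K < length z" "deg p q \<le> K" "fits p z K" "z ! K \<noteq> apex p K"
      "tau (q # r # js) (lift p (deg p q) K z) \<noteq> (0::'k)" by metis
  then show ?case using 2(1)[of K] by (intro step[of p q K]) auto
qed auto

lemma tau_linked: "tau j z \<noteq> (0::'k::comm_ring_1) \<Longrightarrow> linked j \<and> 2 \<le> length j \<and> z \<noteq> []"
  by (induction j z rule: tau_nonzero_induct) (auto simp: linked_simps)

lemma tau_ends: "tau j z \<noteq> (0::'k::comm_ring_1) \<Longrightarrow> hd z = hd j \<and> last z = last j"
proof (induction j z rule: tau_nonzero_induct)
  case (single p q z)
  then show ?case using fits_0[of z p] by (cases z) auto
next
  case (step p q r js z K)
  have "hd z = p" using step fits_0[of z p K] by (cases z) auto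
  then show ?case using step last_lift[of "deg p q" K z p] by auto
qed

lemma tau_length: "tau j z \<noteq> (0::'k::comm_ring_1) \<Longrightarrow> int (length z) = red j + 2"
proof (induction j z rule: tau_nonzero_induct)
  case (step p q r js z K)
  then have "int (length z + 1 - deg p q) = red (q # r # js) + 2"
    using length_lift[of "deg p q" K z p] by simp
  moreover have "deg p q \<le> length z + 1" using step by simp
  ultimately show ?case by simp
qed auto

text \<open>
  The values of \<open>tau\<close> live on strictly decreasing chains, so \<open>tau\<close> vanishes on lists with identity
  morphisms, as unitality demands.
\<close>

lemma tau_decreasing:
  "tau j z \<noteq> (0::'k::comm_ring_1) \<Longrightarrow> Suc t < length z \<Longrightarrow> L (z ! t) \<le> z ! Suc t \<and> z ! Suc t < z ! t"
proof (induction j z arbitrary: t rule: tau_nonzero_induct)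
  case (single p q z)
  then have "z ! t \<in> slot p t" "z ! Suc t \<in> slot p (Suc t)" by (auto simp: fits_def)
  then show ?case using slot_step by blast
next
  case (step p q r js z K)
  show ?case
  proof (cases "t < K")
    case True
    then have "z ! t \<in> slot p t" "z ! Suc t \<in> slot p (Suc t)" using step by (auto simp: fits_def)
    then show ?thesis using slot_step by blast
  next
    case False
    define u where "u = Suc (t - deg p q)"
    have u: "Suc u < length (lift p (deg p q) K z)" "\<not> u \<le> K - deg p q" "u + deg p q = Suc t"
      using step False by (auto simp: u_def length_lift)
    then have "lift p (deg p q) K z ! u = z ! t" "lift p (deg p q) K z ! Suc u = z ! Suc t"
      using step False by (auto simp: lift_nth length_lift)
    then show ?thesis using step.IH[OF u(1)] by simp
  qed
qed

lemma tau_chain: "tau j z \<noteq> (0::'k::comm_ring_1) \<Longrightarrow> chain z"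
  unfolding chain_def using tau_decreasing[of j z] less_imp_le by blast

lemma tau_below: "tau j z \<noteq> (0::'k::comm_ring_1) \<Longrightarrow> t < length z \<Longrightarrow> z ! t < bd (hd j) t"
proof (induction j z arbitrary: t rule: tau_nonzero_induct)
  case (single p q z)
  then have "z ! t \<in> slot p t" by (auto simp: fits_def)
  then show ?case by (simp add: slot_def)
next
  case (step p q r js z K)
  show ?case
  proof (cases "t \<le> K")
    case True
    then have "z ! t \<in> slot p t" using step by (auto simp: fits_def)
    then show ?thesis by (simp add: slot_def)
  next
    case False
    define u where "u = Suc (t - deg p q)"
    have u: "u < length (lift p (deg p q) K z)" "\<not> u \<le> K - deg p q" "u + deg p q = Suc t" "0 < u"
      using step False by (auto simp: u_def length_lift)
    have "z ! t = lift p (deg p q) K z ! u" using u step False by (auto simp: lift_nth length_lift)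
    also have "\<dots> < bd q u" using step.IH[OF u(1)] by simp
    also have "\<dots> \<le> bd p (deg p q + u - 1)"
      by (rule bd_arrow_le[OF conn_arrow[OF step(1)] u(4)])
    also have "deg p q + u - 1 = t" using u by simp
    finally show ?thesis by simp
  qed
qed

text \<open>
  The lists in the sum for \<open>tau\<close> have to follow the slots of \<open>p\<close> up to an entry that is not an apex.
  After an initial segment of apexes, an entry outside its slot therefore makes every summand zero.
  The gauge condition \<open>tau_gauge\<close> below is a special case, as the slots are disjoint.
\<close>

lemma tau_off_slot:
  assumes x: "x \<notin> slot p m"
  shows "tau (p # q # js) (map (apex p) [0..<m] @ x # zs) = (0::'k::comm_ring_1)"
proof (rule ccontr)
  let ?z = "map (apex p) [0..<m] @ x # zs"
  assume nz: "tau (p # q # js) ?z \<noteq> (0::'k)"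
  have zm: "?z ! m = x" by (simp add: nth_append)
  show False
  proof (cases js)
    case Nil
    then have *: "conn p q \<and> length ?z = Suc (deg p q) \<and> fits p ?z (deg p q)"
      using tau_nonzero_single[of p q ?z] nz by blast
    then have "m \<le> deg p q" by simp
    with * zm x show False unfolding fits_def by metis
  next
    case (Cons r js')
    from tau_nonzero_step[OF nz[unfolded Cons]] obtain K where
      K: "fits p ?z K" "?z ! K \<noteq> apex p K" by metis
    have "m \<le> K"
    proof (rule ccontr)
      assume "\<not> m \<le> K"
      then have "?z ! K = apex p K" by (simp add: nth_append)
      with K show False by simp
    qed
    with K zm x show False unfolding fits_def by metis
  qed
qed

lemma tau_critical: "tau (p # q # r # js) (map (apex p) [0..<m]) = (0::'k::comm_ring_1)"
proof (rule ccontr)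
  assume nz: "tau (p # q # r # js) (map (apex p) [0..<m]) \<noteq> (0::'k)"
  from tau_nonzero_step[OF nz] show False by (metis diff_zero length_map length_upt nth_map_upt add_0)
qed

lemma tau_single_critical:
  "tau [p, q] (map (apex p) [0..<m]) = (if conn p q \<and> m = Suc (deg p q) then 1 else (0::'k::comm_ring_1))"
proof -
  have "fits p (map (apex p) [0..<Suc (deg p q)]) (deg p q)" "apex p (deg p q) = q" if "conn p q"
    using conn_arrow[OF that] arrow_slot arrow_apex by (auto simp: fits_def simp del: upt_Suc)
  then show ?thesis by (auto simp: last_map)
qed

lemma tau_gauge:
  "x \<in> slot p k \<Longrightarrow> tau (p # q # js) (map (apex p) [0..<Suc k] @ x # zs) = (0::'k::comm_ring_1)"
  using slot_disjoint by (intro tau_off_slot) (metis n_not_Suc_n)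

section \<open>The value of the twisting cochain on tails of critical chains\<close>

definition lam :: "nat \<Rightarrow> nat" where
  "lam z = L (z - 1)"

lemma lam_mono: "x \<le> y \<Longrightarrow> (lam ^^ m) x \<le> (lam ^^ m) y"
  by (induction m) (auto simp: lam_def intro!: mono_L diff_le_mono)

lemma bd_add_double: "bd p (t + 2 * m) = (lam ^^ m) (bd p t)"
  by (induction m) (simp_all add: lam_def)

text \<open>
  The shape of the tail \<open>map (apex p) [i..<Suc g]\<close> of a critical chain of \<open>p\<close>, seen from the simple module
  \<open>q\<close> with \<open>arrow p i q\<close>: the entries of even index are the apexes of \<open>q\<close>, those of odd index lie in
  the slots of \<open>q\<close>. The condition on iterates of \<open>lam\<close> remembers that the odd entries come from the
  syzygies of some common simple module; it is what survives the induction over strings.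
\<close>

definition zigzag :: "nat \<Rightarrow> nat list \<Rightarrow> bool" where
  "zigzag q w \<longleftrightarrow>
     (\<forall>t. Suc t < length w \<longrightarrow> L (w ! t) \<le> w ! Suc t \<and> w ! Suc t < w ! t) \<and>
     (\<forall>t<length w. even t \<longrightarrow> Suc (w ! t) = bd q t) \<and>
     (\<forall>t<length w. odd t \<longrightarrow> bd q (Suc t) \<le> w ! t \<and> w ! t < bd q t \<and>
        (\<exists>x. Suc (w ! t) = (lam ^^ (t div 2)) x))"

fun odd_but_last :: "nat list \<Rightarrow> bool" where
  "odd_but_last (p # q # r # js) \<longleftrightarrow> odd (deg p q) \<and> odd_but_last (q # r # js)"
| "odd_but_last _ \<longleftrightarrow> True"

text \<open>The bound below which an entry of odd index stays when the string moves from \<open>q\<close> to \<open>c\<close>.\<close>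

lemma zigzag_odd_bound:
  assumes a: "arrow q i c" and i: "odd i" "i \<le> s" and s: "odd s"
    and x: "Suc y = (lam ^^ (s div 2)) x" and less: "Suc y < bd q s"
  shows "y < bd c (Suc s - i)"
proof -
  obtain a b where ab: "i = 1 + 2 * a" "s = 1 + 2 * (a + b)"
  proof -
    from i s obtain a m where "i = 1 + 2 * a" "s = 1 + 2 * m" by (metis oddE add.commute)
    then show ?thesis using i that[of a "m - a"] by auto
  qed
  have eq: "Suc y = (lam ^^ b) ((lam ^^ a) x)"
    using x ab by (simp add: funpow_add[unfolded o_def, THEN fun_cong, symmetric] add.commute)
  have "bd q s = (lam ^^ b) (bd q i)"
    using bd_add_double[of q i b] ab by (simp add: algebra_simps)
  then have qs: "bd q s = (lam ^^ b) (Suc c)" using a by (simp add: arrow_def)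
  have cs: "bd c (Suc s - i) = (lam ^^ b) c"
    using bd_add_double[of c 1 b] ab by (simp add: algebra_simps)
  have "(lam ^^ a) x < Suc c"
  proof (rule ccontr)
    assume "\<not> ?thesis"
    then have "(lam ^^ b) (Suc c) \<le> (lam ^^ b) ((lam ^^ a) x)" by (intro lam_mono) simp
    then show False using less eq qs by simp
  qed
  then have "(lam ^^ b) ((lam ^^ a) x) \<le> (lam ^^ b) c" by (intro lam_mono) simp
  then show ?thesis using eq cs by simp
qed

text \<open>
  Only one summand of the recursion survives. If the first arrow \<open>q \<rightarrow> c\<close> has degree \<open>i\<close>, then \<open>i\<close> is odd,
  because for even \<open>i\<close> the bounds on the target of a string are violated. The list can leave the
  slots of \<open>q\<close> only at an odd index before the first empty even slot, and \<open>K\<close> is the last index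
  up to there. The lifted list is again a zigzag, for \<open>c\<close>, so induction over the string applies.
\<close>

lemma tau_zigzag:
  "strict (q # c # js) \<Longrightarrow> zigzag q w \<Longrightarrow> last w = last (c # js) \<Longrightarrow> int (length w) = red (q # c # js) + 2 \<Longrightarrow>
   tau (q # c # js) w = (1::'k::comm_ring_1) \<and> odd_but_last (q # c # js)"
proof (induction js arbitrary: q c w)
  case Nil
  have a: "arrow q (deg q c) c" using Nil by (auto simp: strict_simps intro: conn_arrow)
  have "w ! t \<in> slot q t" if "t \<le> deg q c" for t
  proof -
    have "t < length w" using that Nil by simp
    then show ?thesis
      using Nil(2) arrow_bd[OF a that] by (cases "even t") (auto simp: zigzag_def slot_def)
  qed
  then show ?case using Nil by (simp add: fits_def strict_simps)
next
  case (Cons r js)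
  define i where "i = deg q c"
  define s where "s = last (r # js)"
  define k where "k = nat (red (c # r # js) + 1)"
  define h where "h = length w - 1"
  have st: "strict (c # r # js)" using Cons.prems by (simp add: strict_simps)
  have cc: "conn q c" using Cons.prems by (simp add: strict_simps)
  have a: "arrow q i c" unfolding i_def by (rule conn_arrow[OF cc])
  have i: "1 \<le> i" using Cons.prems conn_neq_deg by (simp add: strict_simps i_def)
  have k: "int k = red (c # r # js) + 1" "1 \<le> k"
    using strict_red[OF st] by (auto simp: k_def)
  have lw: "length w = Suc h" and h: "h = i + k - 1"
    using Cons.prems(4) k i by (auto simp: h_def i_def)
  have "w \<noteq> []" using lw by auto
  then have "last w = w ! h" by (simp add: last_conv_nth lw)
  then have s: "w ! h = s" using Cons.prems(3) by (simp add: s_def)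
  note zz = Cons.prems(2)[unfolded zigzag_def lw]
  have step: "L (w ! t) \<le> w ! Suc t" "w ! Suc t < w ! t" if "t < h" for t
    using zz that by auto
  have ev: "Suc (w ! t) = bd q t" if "even t" "t \<le> h" for t using zz that by auto
  have od: "bd q (Suc t) \<le> w ! t" "w ! t < bd q t" "\<exists>x. Suc (w ! t) = (lam ^^ (t div 2)) x"
    if "odd t" "t \<le> h" for t using zz that by auto
  have U: "s < bd c k" unfolding s_def using string_target_bound[OF st, of k] k by simp
  have no_tie: False if "even (i + k - 1)" "odd k" "Suc s = bd q h"
  proof -
    have "bd c (k - 1) = bd q (i + (k - 1))" using bd_arrow_even[OF a] that by simp
    also have "i + (k - 1) = h" using h k by simp
    finally have 1: "bd c (k - 1) = Suc s" using that by simp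
    then have "bd c k = Suc s" using U bd_Suc_le[of c "k - 1"] k by simp
    then show False using 1 string_target_no_tie[OF st, of "k - 1"] k by (simp add: s_def)
  qed
  have oi: "odd i"
  proof
    assume ei: "even i"
    show False
    proof (cases "odd h")
      case True
      then have "even k" using ei h k by auto
      then have "bd c k = bd q (Suc h)" using bd_arrow_even[OF a] h i k by simp
      also have "\<dots> \<le> s" using od(1)[OF True] s by simp
      finally show False using U by simp
    next
      case False
      then have "odd k" using ei h k i by auto
      then show False using no_tie ev[of h] False s h by simp
    qed
  qed
  have tie_add: "bd q (Suc (t + 2 * m)) = bd q (t + 2 * m)" if "bd q (Suc t) = bd q t" for t m
    using bd_add_double[of q "Suc t" m] bd_add_double[of q t m] that by simp
  obtain K where K: "odd K" "i \<le> K" "K \<le> h" "fits q w K" "w ! K \<noteq> apex q K"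
    and tie: "\<And>t. even t \<Longrightarrow> K < t \<Longrightarrow> t \<le> h \<Longrightarrow> bd q (Suc t) = bd q t"
  proof (cases "\<exists>t\<le>h. even t \<and> bd q (Suc t) = bd q t")
    case False
    have nt: "bd q (Suc t) < bd q t" if "even t" "t \<le> h" for t
    proof -
      have "bd q (Suc t) \<noteq> bd q t" using False that by blast
      then show ?thesis using bd_Suc_le[of q t] by simp
    qed
    have f: "fits q w h"
      unfolding fits_def slot_def
    proof (intro allI impI)
      fix t assume "t \<le> h"
      then show "w ! t \<in> {bd q (Suc t)..<bd q t}"
        using ev[of t] od[of t] nt[of t] by (cases "even t") auto
    qed
    have oh: "odd h"
    proof
      assume eh: "even h"
      then have "even k" using oi h k i by auto
      then have "bd c k = bd q (Suc h)" using bd_arrow_even[OF a] h i k by simp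
      then show False using U ev[OF eh] nt[OF eh] s by simp
    qed
    have "w ! h \<noteq> apex q h"
    proof
      assume "w ! h = apex q h"
      then have "bd q h = Suc s" using od(2)[OF oh] s by (simp add: apex_def)
      moreover have "bd q (Suc h) < bd q h" using od(1,2)[OF oh] by simp
      ultimately show False
        using string_target_strict[OF Cons.prems(1), of h] Cons.prems(4) lw by (simp add: s_def)
    qed
    then show ?thesis using that[of h] f oh h k by auto
  next
    case True
    define t0 where "t0 = (LEAST t. t \<le> h \<and> even t \<and> bd q (Suc t) = bd q t)"
    have t0: "t0 \<le> h \<and> even t0 \<and> bd q (Suc t0) = bd q t0"
      unfolding t0_def using True by (rule LeastI_ex)
    have nt: "bd q (Suc t) < bd q t" if "even t" "t < t0" for t
    proof -
      have "t \<le> h" using that t0 by simp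
      then have "bd q (Suc t) \<noteq> bd q t"
        using not_less_Least[OF that(2)[unfolded t0_def]] that(1) by blast
      then show ?thesis using bd_Suc_le[of q t] by simp
    qed
    obtain K where K: "t0 = Suc K" using t0 by (cases t0) auto
    have oK: "odd K" using t0 K by simp
    have "i \<le> K"
    proof (rule ccontr)
      assume "\<not> i \<le> K"
      then show False using arrow_bd[OF a, of t0] t0 K by simp
    qed
    moreover have "fits q w K"
      unfolding fits_def slot_def
    proof (intro allI impI)
      fix t assume "t \<le> K"
      then show "w ! t \<in> {bd q (Suc t)..<bd q t}"
        using ev[of t] od[of t] nt[of t] K t0 by (cases "even t") auto
    qed
    moreover have "w ! K \<noteq> apex q K"
    proof
      assume "w ! K = apex q K"
      then have "bd q (Suc (Suc K)) = L (w ! K)" by (simp add: apex_def)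
      also have "\<dots> \<le> w ! Suc K" using step(1)[of K] K t0 by simp
      finally show False using ev[of "Suc K"] K t0 by simp
    qed
    moreover have "bd q (Suc t) = bd q t" if t: "even t" "K < t" "t \<le> h" for t
    proof -
      have "even (t - t0)" "t0 \<le> t" using t t0 K by auto
      then obtain m where "t = t0 + 2 * m" by (metis evenE le_add_diff_inverse)
      then show ?thesis using tie_add t0 by simp
    qed
    ultimately show ?thesis using that[of K] oK K t0 by simp
  qed
  define x where "x = lift q i K w"
  have Kw: "K < length w" using K lw by simp
  have lx: "length x = Suc k" using h k i K lw by (simp add: x_def length_lift)
  have xn: "x ! u = (if u \<le> K - i then apex q (i + u) else w ! (u + i - 1))" if "u \<le> k" for u
    unfolding x_def using that K lw h by (intro lift_nth) auto
  have ne: "bd q (Suc t) < bd q t" if "t \<le> K" for t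
    using K(4) that unfolding fits_def slot_def by (metis atLeastLessThan_iff le_less_trans)
  have uniq: "K' = K" if K': "K' < length w" "i \<le> K'" "fits q w K'" "w ! K' \<noteq> apex q K'"
    "tau (c # r # js) (lift q i K' w) \<noteq> (0::'k)" for K'
  proof (rule ccontr)
    assume "K' \<noteq> K"
    then consider "K' < K" | "K < K'" by linarith
    then show False
    proof cases
      case 1
      have oK': "odd K'"
      proof
        assume "even K'"
        then show False using ev[of K'] K'(4) K 1 by (simp add: apex_def flip: ev)
      qed
      define u where "u = K' + 2 - i"
      have u: "u < length (lift q i K' w)" "\<not> u \<le> K' - i" "u + i - 1 = Suc K'" "even u"
        using K' 1 K lw oK' oi by (auto simp: u_def length_lift)
      have "w ! Suc K' = lift q i K' w ! u" using u K' by (simp add: lift_nth length_lift)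
      also have "\<dots> < bd c u" using tau_below[OF K'(5) u(1)] by simp
      also have "\<dots> = bd q (i + u)" using bd_arrow_even[OF a u(4)] .
      also have "i + u = Suc (Suc K')" using K' by (simp add: u_def)
      also have "bd q (Suc (Suc K')) \<le> w ! Suc K'"
        using K(4)[unfolded fits_def slot_def, rule_format, of "Suc K'"] 1 by simp
      finally show False by simp
    next
      case 2
      then have "w ! Suc K \<in> slot q (Suc K)" using K'(3) by (simp add: fits_def)
      then show False using tie[of "Suc K"] K 2 K' lw by (simp add: slot_def)
    qed
  qed
  have "zigzag c x"
    unfolding zigzag_def lx
  proof (intro conjI allI impI)
    fix u assume u: "Suc u < Suc k"
    consider "Suc u \<le> K - i" | "u = K - i" | "K - i < u" by linarith
    then have "L (x ! u) \<le> x ! Suc u \<and> x ! Suc u < x ! u"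
    proof cases
      case 1
      then have *: "i + u \<le> K" "Suc (i + u) \<le> K" using K by auto
      then have "apex q (i + u) \<in> slot q (i + u)" "apex q (Suc (i + u)) \<in> slot q (Suc (i + u))"
        using ne[OF *(1)] ne[OF *(2)] by (auto intro: apex_in_slot)
      then show ?thesis using 1 u slot_step by (simp add: xn)
    next
      case 2
      then have "x ! u = apex q K" "x ! Suc u = w ! K" using u K by (auto simp: xn)
      moreover have "w ! K \<in> slot q K" using K by (simp add: fits_def)
      ultimately show ?thesis
        using K(5) slot_le_apex[of "w ! K" q K] bd_L[of q K] bd_Suc_le[of q "Suc K"]
        by (auto simp: slot_def)
    next
      case 3
      then obtain t where t: "u + i - 1 = t" "Suc u + i - 1 = Suc t"
        using i by (intro that[of "u + i - 1"]) auto
      have "x ! u = w ! t" "x ! Suc u = w ! Suc t" using 3 u t by (auto simp: xn)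
      then show ?thesis using step[of t] t u h by simp
    qed
    then show "L (x ! u) \<le> x ! Suc u" "x ! Suc u < x ! u" by auto
  next
    fix u assume u: "u < Suc k" "even u"
    show "Suc (x ! u) = bd c u"
    proof (cases "u \<le> K - i")
      case True
      then have "i + u \<le> K" using K by simp
      then have "bd q (i + u) \<noteq> 0" using ne[of "i + u"] by simp
      then show ?thesis
        using True u bd_arrow_even[OF a u(2)] by (simp add: xn apex_def)
    next
      case False
      define t where "t = u + i - 1"
      have t: "even t" "K \<le> t" "t \<le> h" "Suc t = i + u"
        using False u K oi h i by (auto simp: t_def)
      moreover have "K \<noteq> t" using K(1) t(1) by auto
      ultimately have t: "even t" "K < t" "t \<le> h" "Suc t = i + u" by auto
      have "x ! u = w ! t" using False u by (simp add: xn t_def)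
      then show ?thesis using ev[OF t(1,3)] tie[OF t(1-3)] bd_arrow_even[OF a u(2)] t(4) by simp
    qed
  next
    fix u assume u: "u < Suc k" "odd u"
    have "bd c (Suc u) \<le> x ! u \<and> x ! u < bd c u \<and> (\<exists>y. Suc (x ! u) = (lam ^^ (u div 2)) y)"
    proof (cases "u \<le> K - i")
      case True
      have iu: "i + u \<le> K" using True K by simp
      have A: "bd c (Suc u) = bd q (Suc (i + u))" using bd_arrow_even[OF a, of "Suc u"] u by simp
      have B: "bd q (i + u) \<le> bd c u" using bd_arrow_odd[OF a] u by simp
      have C: "x ! u = apex q (i + u)" using True u by (simp add: xn)
      have D: "Suc (apex q (i + u)) = bd q (i + u)" using ne[OF iu] by (simp add: apex_def)
      have "Suc i + 2 * (u div 2) = i + u" using u by presburger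
      then have E: "bd q (i + u) = (lam ^^ (u div 2)) (bd q (Suc i))"
        using bd_add_double[of q "Suc i" "u div 2"] by metis
      show ?thesis
        unfolding A C
      proof (intro conjI)
        show "bd q (Suc (i + u)) \<le> apex q (i + u)" using ne[OF iu] D by linarith
        show "apex q (i + u) < bd c u" using B D by linarith
        show "\<exists>y. Suc (apex q (i + u)) = (lam ^^ (u div 2)) y" unfolding D E by blast
      qed
    next
      case False
      define t where "t = u + i - 1"
      have t: "odd t" "K \<le> t" "t \<le> h" "Suc t = i + u" "i \<le> t" "Suc t - i = u"
        using False u K oi h i by (auto simp: t_def)
      have xu: "x ! u = w ! t" using False u by (simp add: xn t_def)
      have "bd c (Suc u) = bd q (Suc (Suc t))"
        using bd_arrow_even[OF a, of "Suc u"] u(2) unfolding t(4) by simp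
      also have "\<dots> \<le> bd q (Suc t)" by (rule bd_Suc_le)
      also have "\<dots> \<le> w ! t" by (rule od(1)[OF t(1,3)])
      finally have 1: "bd c (Suc u) \<le> x ! u" using xu by simp
      obtain y where y: "Suc (w ! t) = (lam ^^ (t div 2)) y" using od(3) t by blast
      have "Suc (w ! t) < bd q t"
      proof (cases "t = K")
        case True
        then show ?thesis using K(5) od(2)[OF t(1,3)] by (auto simp: apex_def)
      next
        case False
        obtain v where v: "t = Suc v" using t(1) by (cases t) auto
        then have "even v" using t(1) by simp
        then have "K \<noteq> v" using K(1) by auto
        with v \<open>even v\<close> False t(2) have v: "t = Suc v" "K < v" "even v" by auto
        have "bd q t = Suc (w ! v)" using tie[of v] ev[of v] t v by simp
        then show ?thesis using step(2)[of v] v t by simp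
      qed
      then have 2: "x ! u < bd c u"
        using zigzag_odd_bound[OF a oi t(5) t(1) y] t(6) xu by simp
      have "t div 2 = u div 2 + i div 2" using t(4) oi u(2) by (auto elim!: oddE)
      then have "Suc (x ! u) = (lam ^^ (u div 2)) ((lam ^^ (i div 2)) y)"
        using y xu by (simp add: funpow_add)
      then show ?thesis using 1 2 by blast
    qed
    then show "bd c (Suc u) \<le> x ! u" "x ! u < bd c u" "\<exists>y. Suc (x ! u) = (lam ^^ (u div 2)) y"
      by auto
  qed
  moreover have "last x = last (r # js)"
    using Cons.prems(3) last_lift[OF K(2) Kw] by (simp add: x_def)
  moreover have "int (length x) = red (c # r # js) + 2" using lx k by simp
  ultimately have IH: "tau (c # r # js) x = (1::'k) \<and> odd_but_last (c # r # js)"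
    using Cons.IH[OF st] by simp
  have summand: "(if i \<le> K' \<and> fits q w K' \<and> w ! K' \<noteq> apex q K'
        then (-1) ^ (K' - i) * tau (c # r # js) (lift q i K' w) else 0) =
        (if K' = K then 1 else (0::'k))" if "K' < length w" for K'
  proof (cases "K' = K")
    case True
    have "even (K - i)" using K(1) oi by simp
    then show ?thesis using True IH K unfolding x_def by simp
  next
    case False
    then have "tau (c # r # js) (lift q i K' w) = (0::'k)"
      if "i \<le> K'" "fits q w K'" "w ! K' \<noteq> apex q K'"
      using uniq[OF \<open>K' < length w\<close> that] by blast
    then show ?thesis using False by simp
  qed
  have "tau (q # c # r # js) w = (\<Sum>K'<length w. if K' = K then (1::'k) else 0)"
    unfolding tau.simps i_def[symmetric] if_P[OF cc]
    by (intro sum.cong refl summand) simp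
  also have "\<dots> = 1" using Kw by simp
  finally show ?case using IH oi by (simp add: i_def)
qed

end

context short_paths
begin

section \<open>The products\<close>

text \<open>
  The structure constants of the combinatorial category before the change of sign by \<open>eps\<close>.
\<close>

definition mu :: "nat list \<Rightarrow> 'k::comm_ring_1" where
  "mu j = (if 2 \<le> length j \<and> linked j \<and> conn (hd j) (last j) \<and> int (deg (hd j) (last j)) = red j + 2
           then (-1) ^ deg (j ! 0) (j ! 1) else 0)"

lemma linked_remdups_adj:
  "linked j \<Longrightarrow> strict (remdups_adj j) \<and>
     red j + int (length j) = red (remdups_adj j) + int (length (remdups_adj j))"
proof (induction j rule: remdups_adj.induct)
  case (3 x y xs)
  show ?case
  proof (cases "x = y")
    case True
    then show ?thesis using 3 by (simp add: linked_simps deg_refl)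
  next
    case False
    have "hd (remdups_adj (y # xs)) = y" by simp
    then obtain zs where zs: "remdups_adj (y # xs) = y # zs" by (metis list.collapse remdups_adj_Nil_iff list.distinct(1))
    show ?thesis using 3(2)[OF False] 3(3) False zs by (simp add: linked_simps strict_simps)
  qed
qed (auto simp: linked_def strict_def)

lemma remdups_adj_eq: "length (remdups_adj j) = length j \<Longrightarrow> remdups_adj j = j"
proof (induction j rule: remdups_adj.induct)
  case (3 x y xs)
  then show ?case using remdups_adj_length[of "x # xs"] by (auto split: if_splits)
qed auto

text \<open>
  Identities occur only in products of two morphisms. Removing \<open>u\<close> identities from a string raises
  its reduced degree by \<open>u\<close>, so matching degrees would connect its source and target in a smaller
  degree than the reduced degree allows. For \<open>u > 0\<close> the bounds on the targets of strings without
  identities exclude this, except for the product of an arrow with one identity.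
\<close>

lemma matched_strict:
  assumes ln: "linked j" "4 \<le> length j" and c: "conn (hd j) (last j)"
    and g: "int (deg (hd j) (last j)) = red j + 2"
  shows "strict j"
proof (rule ccontr)
  assume ns: "\<not> strict j"
  define k where "k = remdups_adj j"
  define u where "u = length j - length k"
  have k: "strict k" "red j + int (length j) = red k + int (length k)"
    using linked_remdups_adj[OF ln(1)] by (auto simp: k_def)
  have ends: "hd k = hd j" "last k = last j" by (auto simp: k_def)
  have "k \<noteq> j" using ns k by auto
  then have lt: "length k < length j"
    using remdups_adj_length[of j] remdups_adj_eq[of j] unfolding k_def
    by (metis le_neq_implies_less)
  have u: "int u = int (length j) - int (length k)" "1 \<le> u" using lt by (auto simp: u_def)
  define p where "p = hd j"
  define s where "s = last j"
  define g where "g = deg p s"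
  have a: "arrow p g s" using c by (auto simp: p_def s_def g_def intro: conn_arrow)
  have gg: "int g = red k - int u + 2" using assms(4) k u by (simp add: g_def p_def s_def)
  have "k \<noteq> []" using ln by (auto simp: k_def)
  then consider "k = [p]" | q where "k = [p, q]" | q r js where "k = p # q # r # js"
    using ends(1) unfolding p_def by (metis list.exhaust list.sel(1))
  then show False
  proof cases
    case 1
    then have "p = s" using ends by (simp add: p_def s_def)
    then have "g = 0" by (simp add: g_def deg_refl)
    then show False using gg 1 u ln by simp
  next
    case 2
    then have "q = s" using ends by (simp add: s_def)
    then show False using gg 2 u ln by (simp add: g_def)
  next
    case 3
    have s: "s = last (r # js)" using 3 ends by (simp add: s_def)
    show False
    proof (cases "u = 1")
      case True
      have "bd p g \<noteq> Suc (last (r # js))"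
        using string_target_strict[of p q r js g] k(1) 3 gg True arrow_bd[OF a, of g] by simp
      then show False using a s by (simp add: arrow_def)
    next
      case False
      define h where "h = nat (red k + 1)"
      have h: "int h = red k + 1" "Suc g \<le> h"
        using gg u False strict_red[OF k(1)] by (auto simp: h_def)
      have "s < bd p h" using string_target_bound[of p q "r # js" h] k(1) 3 h s by simp
      moreover have "bd p h \<le> bd p (Suc g)" using h by (intro bd_antimono)
      moreover have "bd p (Suc g) < bd p g" using arrow_bd[OF a] by simp
      moreover have "bd p g = Suc s" using a by (simp add: arrow_def)
      ultimately show False by linarith
    qed
  qed
qed

lemma linked_last_le: "linked j \<Longrightarrow> j \<noteq> [] \<Longrightarrow> last j \<le> hd j"
proof (induction j rule: induct_list012)
  case (3 x y zs)
  then show ?case using conn_le[of x y] by (auto simp: linked_simps)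
qed auto

lemma zigzag_tail:
  assumes a: "arrow p i q" and ag: "arrow p g s" and i: "i \<le> g"
  shows "zigzag q (map (apex p) [i..<Suc g])"
proof -
  have n: "map (apex p) [i..<Suc g] ! t = apex p (i + t)" if "t < Suc g - i" for t
    using that by (simp del: upt_Suc)
  have sl: "apex p (i + t) \<in> slot p (i + t)" "Suc (apex p (i + t)) = bd p (i + t)" if "t < Suc g - i" for t
  proof -
    show "apex p (i + t) \<in> slot p (i + t)" using arrow_slot[OF ag, of "i + t"] that by simp
    then show "Suc (apex p (i + t)) = bd p (i + t)" using slot_le_apex by blast
  qed
  show ?thesis
    unfolding zigzag_def length_map length_upt
  proof (intro conjI allI impI)
    fix t assume "Suc t < Suc g - i"
    then show "L (map (apex p) [i..<Suc g] ! t) \<le> map (apex p) [i..<Suc g] ! Suc t"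
      "map (apex p) [i..<Suc g] ! Suc t < map (apex p) [i..<Suc g] ! t"
      using n[of t] n[of "Suc t"] slot_step[of "apex p (i + t)" p "i + t" "apex p (i + Suc t)"]
        sl(1)[of t] sl(1)[of "Suc t"] by (auto simp del: upt_Suc)
  next
    fix t assume "t < Suc g - i" "even t"
    then show "Suc (map (apex p) [i..<Suc g] ! t) = bd q t"
      using n sl bd_arrow_even[OF a] by (simp del: upt_Suc)
  next
    fix t assume t: "t < Suc g - i" "odd t"
    have "bd q (Suc t) = bd p (Suc (i + t))" using bd_arrow_even[OF a, of "Suc t"] t by simp
    then show "bd q (Suc t) \<le> map (apex p) [i..<Suc g] ! t"
      using n[OF t(1)] sl(1)[OF t(1)] by (simp add: slot_def del: upt_Suc)
    show "map (apex p) [i..<Suc g] ! t < bd q t"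
      using n[OF t(1)] sl(1)[OF t(1)] bd_arrow_odd(1)[OF a t(2)] by (simp add: slot_def del: upt_Suc)
    have "Suc i + 2 * (t div 2) = i + t" using t(2) by (auto elim!: oddE)
    then have "bd p (i + t) = (lam ^^ (t div 2)) (bd p (Suc i))"
      using bd_add_double[of p "Suc i" "t div 2"] by metis
    then show "\<exists>x. Suc (map (apex p) [i..<Suc g] ! t) = (lam ^^ (t div 2)) x"
      using n[OF t(1)] sl(2)[OF t(1)] by metis
  qed
qed

lemma arrow_index_mono:
  assumes "arrow p i q" "arrow p g s" "s \<le> q" shows "i \<le> g"
proof (rule ccontr)
  assume "\<not> i \<le> g"
  then have "bd p i \<le> bd p (Suc g)" by (intro bd_antimono) simp
  also have "\<dots> < bd p g" using arrow_bd[OF assms(2)] by simp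
  finally show False using assms by (simp add: arrow_def)
qed

text \<open>
  The value of the twisting cochain on the tail of the critical chain from \<open>p\<close> to the target of the
  string is the structure constant: this is how the products \<open>mu\<close> arise when the Maurer-Cartan
  equation is evaluated on critical chains.
\<close>

theorem tau_tail:
  assumes c: "conn p (last (r # js))" and pq: "conn p q"
  shows "(-1) ^ deg p q * tau (q # r # js) (map (apex p) [deg p q..<Suc (deg p (last (r # js)))]) =
         (mu (p # q # r # js) :: 'k::comm_ring_1)"
    and "mu (p # q # r # js) \<noteq> (0::'k) \<Longrightarrow> odd_but_last (q # r # js) \<and> (js = [] \<or> strict (q # r # js))"
proof -
  define s where "s = last (r # js)"
  define g where "g = deg p s"
  define i where "i = deg p q"
  define w where "w = map (apex p) [i..<Suc g]"
  have a: "arrow p i q" using pq by (simp add: i_def conn_arrow)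
  have ag: "arrow p g s" using c by (simp add: s_def g_def conn_arrow)
  have *: "tau (q # r # js) w = (1::'k) \<and> odd_but_last (q # r # js) \<and> (js = [] \<or> strict (q # r # js))"
    if ln: "linked (q # r # js)" and gd: "int g = red (p # q # r # js) + 2"
  proof -
    have sq: "s \<le> q" using linked_last_le[OF ln] by (simp add: s_def)
    have ig: "i \<le> g" by (rule arrow_index_mono[OF a ag sq])
    have zz: "zigzag q w" unfolding w_def by (rule zigzag_tail[OF a ag ig])
    have lw: "length w = Suc g - i" by (simp add: w_def del: upt_Suc)
    have la: "last w = last (r # js)"
      using ig arrow_apex[OF ag] by (simp add: w_def s_def)
    show ?thesis
    proof (cases "strict (q # r # js)")
      case True
      then show ?thesis using tau_zigzag[OF True zz la] lw gd ig by (simp add: i_def)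
    next
      case False
      show ?thesis
      proof (cases js)
        case Nil
        then have "q = r" using False ln by (auto simp: strict_simps linked_simps)
        then have "g = i" using Nil by (simp add: g_def i_def s_def)
        then have "w = [q]" using arrow_apex[OF a] by (simp add: w_def)
        then show ?thesis
          using Nil \<open>q = r\<close> by (simp add: conn_refl deg_refl fits_def slot_0)
      next
        case (Cons x xs)
        have "strict (p # q # r # js)"
          using ln gd pq c Cons by (intro matched_strict) (auto simp: linked_simps g_def s_def)
        then show ?thesis using False by (simp add: strict_simps)
      qed
    qed
  qed
  have mu_eq: "mu (p # q # r # js) =
      (if linked (q # r # js) \<and> int g = red (p # q # r # js) + 2 then (-1) ^ i else (0::'k))"
    using c pq by (auto simp: mu_def linked_simps g_def s_def i_def)
  show "mu (p # q # r # js) \<noteq> (0::'k) \<Longrightarrow> odd_but_last (q # r # js) \<and> (js = [] \<or> strict (q # r # js))"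
    using * mu_eq by (auto split: if_splits)
  have "(-1) ^ i * tau (q # r # js) w = (mu (p # q # r # js) :: 'k)"
  proof (cases "linked (q # r # js) \<and> int g = red (p # q # r # js) + 2")
    case True
    then show ?thesis using * mu_eq by simp
  next
    case False
    have "tau (q # r # js) w = (0::'k)"
    proof (rule ccontr)
      assume nz: "tau (q # r # js) w \<noteq> (0::'k)"
      have ln: "linked (q # r # js)" using tau_linked[OF nz] by simp
      have "s \<le> q" using linked_last_le[OF ln] by (simp add: s_def)
      then have "i \<le> g" by (rule arrow_index_mono[OF a ag])
      then have "int g = red (p # q # r # js) + 2"
        using tau_length[OF nz] by (simp add: w_def i_def del: upt_Suc)
      then show False using False ln by simp
    qed
    then show ?thesis unfolding mu_eq if_not_P[OF False] by simp
  qed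
  then show "(-1) ^ deg p q * tau (q # r # js) (map (apex p) [deg p q..<Suc (deg p (last (r # js)))]) =
      (mu (p # q # r # js) :: 'k)"
    by (simp add: i_def w_def g_def s_def del: upt_Suc)
qed


section \<open>Signs\<close>

text \<open>
  The sign of the reversal of \<open>i\<close> letters. Rescaling each arrow by \<open>eps\<close> of its degree turns the
  structure constants \<open>mu\<close>, whose sign depends on the first morphism of the string, into those of the
  combinatorial category, whose sign depends on the last one and on the product.
\<close>

definition eps :: "nat \<Rightarrow> 'k::comm_ring_1" where
  "eps i = (-1) ^ (i * (i - 1) div 2)"

fun eprod :: "nat list \<Rightarrow> 'k::comm_ring_1" where
  "eprod (p # q # js) = eps (deg p q) * eprod (q # js)"
| "eprod _ = 1"

lemma eps_square: "eps i * eps i = (1::'k::comm_ring_1)"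
  by (simp add: eps_def flip: power_mult_distrib)

lemma eps_0: "eps 0 = (1::'k::comm_ring_1)"
  by (simp add: eps_def)

lemma eps_Suc: "eps (Suc i) = eps i * ((-1) ^ i :: 'k::comm_ring_1)"
proof -
  have "Suc i * i = i * (i - 1) + i * 2" by (cases i) auto
  then have "Suc i * (Suc i - 1) div 2 = i * (i - 1) div 2 + i" by simp
  then show ?thesis by (simp add: eps_def power_add)
qed

lemma eps_add: "eps (a + b) = eps a * eps b * ((-1) ^ (a * b) :: 'k::comm_ring_1)"
  by (induction b) (auto simp: eps_Suc eps_0 power_add algebra_simps)

lemma eprod_odd:
  "odd_but_last (q # c # js) \<Longrightarrow> js = [] \<or> strict (q # c # js) \<Longrightarrow> int h = red (q # c # js) + 1 \<Longrightarrow>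
   eprod (q # c # js) = (eps h :: 'k::comm_ring_1) \<and>
   even h = even (deg ((q # c # js) ! length js) ((c # js) ! length js))"
proof (induction js arbitrary: q c h)
  case (Cons r js)
  define k where "k = nat (red (c # r # js) + 1)"
  have st: "strict (c # r # js)" using Cons.prems by (auto simp: strict_simps)
  have k: "int k = red (c # r # js) + 1" using strict_red[OF st] by (simp add: k_def)
  obtain a where a: "deg q c = Suc a" "even a" using Cons.prems by (cases "deg q c") auto
  have h: "h = a + k" using Cons.prems k a by simp
  have "eps (deg q c) = (eps a :: 'k)" using a by (simp add: eps_Suc)
  moreover have "eps h = (eps a * eps k :: 'k)" using h a by (simp add: eps_add)
  ultimately show ?case using Cons.IH[of c r k] Cons.prems st k h a by simp
qed simp

text \<open>
  In a string with nonzero \<open>mu\<close> all arrows but the first and the last have odd degree. For odd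
  degrees \<open>eps\<close> is multiplicative up to signs that cancel, so the product of all \<open>eps\<close> can be read off
  from the outer arrows.
\<close>

theorem eprod_mu:
  assumes nz: "mu j \<noteq> (0::'k::comm_ring_1)"
  shows "eps (deg (hd j) (last j)) * eprod j * mu j =
         ((-1) ^ ((deg (j ! (length j - 2)) (last j) + 1) * deg (hd j) (last j)) :: 'k)"
proof -
  have m: "2 \<le> length j" "linked j" "conn (hd j) (last j)" "int (deg (hd j) (last j)) = red j + 2"
    "mu j = ((-1) ^ deg (j ! 0) (j ! 1) :: 'k)"
    using nz by (auto simp: mu_def split: if_splits)
  have "length j \<noteq> 2"
  proof
    assume "length j = 2"
    then obtain p q where "j = [p, q]" by (auto simp: length_Suc_conv numeral_2_eq_2)
    then show False using m(4) by simp
  qed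
  with m(1) have "3 \<le> length j" by simp
  then obtain p q r js where j: "j = p # q # r # js"
    by (metis Suc_le_length_iff numeral_3_eq_3)
  define i where "i = deg p q"
  define g where "g = deg (hd j) (last j)"
  define e where "e = deg (j ! (length j - 2)) (last j)"
  have pq: "conn p q" using m(2) j by (simp add: linked_simps)
  have o: "odd_but_last (q # r # js)" "js = [] \<or> strict (q # r # js)"
    using tau_tail(2)[of p r js q] m(3) pq nz j by auto
  have "0 \<le> red (q # r # js) + 1" using o strict_red[of "q # r # js"] by auto
  then obtain h where h: "int h = red (q # r # js) + 1" by (metis nat_0_le)
  have g: "g = i + h" using m(4) h j by (simp add: g_def i_def)
  have e: "even h = even e" and ep: "eprod (q # r # js) = (eps h :: 'k)"
    using eprod_odd[OF o h, where ?'k = 'k] by (auto simp: e_def j last_conv_nth)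
  have "eps g * eprod j * mu j = (eps i * eps i) * (eps h * eps h) * ((-1) ^ (i * h + i) :: 'k)"
    unfolding g eps_add using m(5) ep by (simp add: j i_def power_add mult_ac)
  also have "\<dots> = (-1) ^ (i * h + i)" by (simp add: eps_square)
  also have "\<dots> = (-1) ^ ((e + 1) * g)"
    using e g by (cases "even i"; cases "even e") (auto simp: minus_one_power_iff)
  finally show ?thesis by (simp add: g_def e_def)
qed

end

section \<open>Cochains on lists\<close>

definition del :: "nat \<Rightarrow> 'a list \<Rightarrow> 'a list" where
  "del m z = take m z @ drop (Suc m) z"

text \<open>
  Cochains on lists form a differential graded algebra under \<open>bdry\<close> and \<open>cup\<close>: deleting an entry is
  composing two neighbouring morphisms, and in the product the two factors share an entry. Up to
  sign these are the differential and the composition of the dg category of modules.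
\<close>

definition bdry :: "('a list \<Rightarrow> 'k::comm_ring_1) \<Rightarrow> 'a list \<Rightarrow> 'k" where
  "bdry f z = (\<Sum>m<length z. (-1) ^ m * f (del m z))"

definition cup :: "('a list \<Rightarrow> 'k::comm_ring_1) \<Rightarrow> ('a list \<Rightarrow> 'k) \<Rightarrow> 'a list \<Rightarrow> 'k" where
  "cup f g z = (\<Sum>m<length z. (-1) ^ m * f (take (Suc m) z) * g (drop m z))"

lemma length_del: "m < length z \<Longrightarrow> length (del m z) = length z - 1"
  by (simp add: del_def)

lemma del_del: "m \<le> m' \<Longrightarrow> Suc m' < length z \<Longrightarrow> del m' (del m z) = del m (del (Suc m') z)"
  by (simp add: del_def min_def take_drop drop_drop)

lemma bdry_bdry: "bdry (bdry f) z = (0::'k::comm_ring_1)"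
proof -
  define n where "n = length z - 1"
  let ?F = "\<lambda>m m'. (-1) ^ (m + m') * f (del m' (del m z))"
  have "bdry (bdry f) z = (\<Sum>m<length z. \<Sum>m'<n. ?F m m')"
    by (simp add: bdry_def length_del n_def sum_distrib_left power_add mult.assoc)
  also have "\<dots> = (\<Sum>(m, m')\<in>{..<length z} \<times> {..<n}. ?F m m')"
    by (simp add: sum.cartesian_product)
  also have "{..<length z} \<times> {..<n} =
      {(m, m'). m < length z \<and> m' < n \<and> m \<le> m'} \<union> {(m, m'). m < length z \<and> m' < n \<and> m' < m}" by auto
  also have "(\<Sum>(m, m')\<in>\<dots>. ?F m m') =
      (\<Sum>(m, m')\<in>{(m, m'). m < length z \<and> m' < n \<and> m \<le> m'}. ?F m m') +
      (\<Sum>(m, m')\<in>{(m, m'). m < length z \<and> m' < n \<and> m' < m}. ?F m m')"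
    by (rule sum.union_disjoint)
      (auto intro: finite_subset[of _ "{..<length z} \<times> {..<n}"])
  also have "(\<Sum>(m, m')\<in>{(m, m'). m < length z \<and> m' < n \<and> m \<le> m'}. ?F m m') =
      (\<Sum>(m, m')\<in>{(m, m'). m < length z \<and> m' < n \<and> m' < m}. - ?F m m')"
    by (rule sum.reindex_bij_witness[of _ "\<lambda>(m, m'). (m', m - 1)" "\<lambda>(m, m'). (Suc m', m)"])
      (auto simp: n_def del_del add.commute)
  finally show ?thesis by (simp add: sum_negf split_def)
qed

lemma bdry_cup:
  fixes f g :: "'a list \<Rightarrow> 'k::comm_ring_1"
  assumes f: "f [] = 0" and g: "g [] = 0"
  shows "bdry (cup f g) z = - cup (bdry f) g z + (\<Sum>m<length z. f (take (Suc m) z) * bdry g (drop m z))"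
proof -
  define n where "n = length z"
  let ?F = "\<lambda>m' m. (-1) ^ (m' + m) * f (take (Suc m) (del m' z)) * g (drop m (del m' z))"
  have "bdry (cup f g) z = (\<Sum>m'<n. \<Sum>m<n - 1. ?F m' m)"
    by (simp add: bdry_def cup_def length_del n_def sum_distrib_left power_add mult.assoc)
  also have "\<dots> = (\<Sum>(m', m)\<in>{..<n} \<times> {..<n - 1}. ?F m' m)"
    by (simp add: sum.cartesian_product)
  also have "{..<n} \<times> {..<n - 1} =
      {(m', m). m' \<le> m \<and> m < n - 1} \<union> {(m', m). m < m' \<and> m' < n}" by auto
  also have "(\<Sum>(m', m)\<in>\<dots>. ?F m' m) =
      (\<Sum>(m', m)\<in>{(m', m). m' \<le> m \<and> m < n - 1}. ?F m' m) + (\<Sum>(m', m)\<in>{(m', m). m < m' \<and> m' < n}. ?F m' m)"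
    by (rule sum.union_disjoint)
      (auto intro: finite_subset[of _ "{..<n} \<times> {..<n}"])
  also have "(\<Sum>(m', m)\<in>{(m', m). m' \<le> m \<and> m < n - 1}. ?F m' m) =
      (\<Sum>(m', m)\<in>{(m', m). m' < m \<and> m < n}.
         - ((-1) ^ (m' + m) * f (del m' (take (Suc m) z)) * g (drop m z)))"
    by (rule sum.reindex_bij_witness[of _ "\<lambda>(m', m). (m', m - 1)" "\<lambda>(m', m). (m', Suc m)"])
      (auto simp: n_def del_def min_def take_drop)
  also have "\<dots> = (\<Sum>m<n. \<Sum>m'<m. - ((-1) ^ (m' + m) * f (del m' (take (Suc m) z)) * g (drop m z)))"
    by (subst sum.Sigma)
      (auto intro!: sum.reindex_bij_witness[of _ "\<lambda>(m, m'). (m', m)" "\<lambda>(m', m). (m, m')"])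
  also have "\<dots> = - cup (bdry f) g z + (\<Sum>m<n. f (take m z) * g (drop m z))"
  proof -
    have "(-1) ^ m * bdry f (take (Suc m) z) =
        (\<Sum>m'<m. (-1) ^ (m' + m) * f (del m' (take (Suc m) z))) + f (take m z)" if "m < n" for m
    proof -
      have "length (take (Suc m) z) = Suc m" using that by (simp add: n_def)
      moreover have "del m (take (Suc m) z) = take m z" by (simp add: del_def min_def)
      ultimately have "(-1) ^ m * bdry f (take (Suc m) z) =
          (\<Sum>m'<m. (-1) ^ (m' + m) * f (del m' (take (Suc m) z))) + (-1) ^ m * ((-1) ^ m * f (take m z))"
        by (simp add: bdry_def distrib_left sum_distrib_left power_add mult_ac)
      then show ?thesis by (simp flip: mult.assoc power_add)
    qed
    then have "cup (bdry f) g z = (\<Sum>m<n. ((\<Sum>m'<m. (-1) ^ (m' + m) * f (del m' (take (Suc m) z))) + f (take m z)) * g (drop m z))"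
      unfolding cup_def n_def[symmetric] by (intro sum.cong) auto
    then show ?thesis
      by (simp add: distrib_right sum.distrib sum_distrib_right sum_negf)
  qed
  also have "(\<Sum>(m', m)\<in>{(m', m). m < m' \<and> m' < n}. ?F m' m) =
      (\<Sum>m<n. \<Sum>l<n - Suc m. (-1) ^ Suc l * f (take (Suc m) z) * g (del (Suc l) (drop m z)))"
  proof -
    have *: "?F m' m = (-1) ^ Suc (m' - Suc m) * f (take (Suc m) z) * g (del (Suc (m' - Suc m)) (drop m z))"
      if "m < m'" "m' < n" for m m'
    proof -
      have "take (Suc m) (del m' z) = take (Suc m) z"
        "drop m (del m' z) = del (Suc (m' - Suc m)) (drop m z)"
        using that by (auto simp: del_def n_def drop_take Suc_diff_Suc)
      moreover have "(-1) ^ (m' + m) = ((-1) ^ Suc (m' - Suc m) :: 'k)"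
        using that by (simp add: minus_one_power_iff)
      ultimately show ?thesis by simp
    qed
    have "(\<Sum>(m', m)\<in>{(m', m). m < m' \<and> m' < n}. ?F m' m) =
        (\<Sum>(m, l)\<in>Sigma {..<n} (\<lambda>m. {..<n - Suc m}).
          (-1) ^ Suc l * f (take (Suc m) z) * g (del (Suc l) (drop m z)))"
      by (rule sum.reindex_bij_witness[of _ "\<lambda>(m, l). (m + Suc l, m)" "\<lambda>(m', m). (m, m' - Suc m)"])
        (auto simp: * simp del: power_Suc)
    then show ?thesis by (simp add: sum.Sigma del: power_Suc)
  qed
  also have "\<dots> = (\<Sum>m<n. f (take (Suc m) z) * bdry g (drop m z)) - (\<Sum>m<n. f (take (Suc m) z) * g (drop (Suc m) z))"
  proof -
    have "bdry g (drop m z) = g (drop (Suc m) z) + (\<Sum>l<n - Suc m. (-1) ^ Suc l * g (del (Suc l) (drop m z)))"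
      if "m < n" for m
    proof -
      have "length (drop m z) = Suc (n - Suc m)" using that by (simp add: n_def)
      moreover have "del 0 (drop m z) = drop (Suc m) z" by (simp add: del_def)
      ultimately show ?thesis unfolding bdry_def by (simp add: sum.lessThan_Suc_shift del: sum.lessThan_Suc)
    qed
    then have "(\<Sum>m<n. f (take (Suc m) z) * bdry g (drop m z)) =
        (\<Sum>m<n. f (take (Suc m) z) * (g (drop (Suc m) z) + (\<Sum>l<n - Suc m. (-1) ^ Suc l * g (del (Suc l) (drop m z)))))"
      by (intro sum.cong) auto
    then show ?thesis by (simp add: distrib_left sum.distrib sum_distrib_left mult_ac)
  qed
  finally have "bdry (cup f g) z = - cup (bdry f) g z +
      (\<Sum>m<n. f (take (Suc m) z) * bdry g (drop m z)) +
      ((\<Sum>m<n. f (take m z) * g (drop m z)) - (\<Sum>m<n. f (take (Suc m) z) * g (drop (Suc m) z)))"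
    by simp
  also have "(\<Sum>m<n. f (take m z) * g (drop m z)) - (\<Sum>m<n. f (take (Suc m) z) * g (drop (Suc m) z)) = 0"
    using sum_lessThan_telescope'[of "\<lambda>m. f (take m z) * g (drop m z)" n] f g
    by (simp add: sum_subtractf n_def)
  finally show ?thesis by (simp add: n_def)
qed

context short_paths
begin

text \<open>
  The nonzero strings of paths with source \<open>q\<close> and target \<open>p\<close>.
\<close>

definition V :: "nat \<Rightarrow> nat \<Rightarrow> nat list \<Rightarrow> bool" where
  "V p q z \<longleftrightarrow> z \<noteq> [] \<and> hd z = p \<and> last z = q \<and> chain z"

lemma L_le_self: "L x \<le> x"
  using L_le[of x] by simp

lemma chain_alt:
  "chain z \<longleftrightarrow> sorted_wrt (\<ge>) z \<and> (\<forall>a\<in>set z. a = last z \<or> (\<exists>c\<in>set z. L a \<le> c \<and> c < a))"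
proof
  assume c: "chain z"
  then have "successively (\<ge>) z" by (auto simp: chain_def successively_conv_nth)
  then have s: "sorted_wrt (\<ge>) z" by (simp add: successively_conv_sorted_wrt transp_on_ge)
  moreover have "a = last z \<or> (\<exists>c\<in>set z. L a \<le> c \<and> c < a)" if a: "a \<in> set z" for a
  proof (rule ccontr)
    assume n: "\<not> ?thesis"
    have same: "z ! k = a" if "i \<le> k" "z ! i = a" "k < length z" for i k
      using that
    proof (induction k rule: dec_induct)
      case (step k)
      then have "L a \<le> z ! Suc k" "z ! Suc k \<le> a" "z ! Suc k \<in> set z" using c by (auto simp: chain_def)
      then show ?case using n le_neq_implies_less by blast
    qed
    obtain i where "i < length z" "z ! i = a" using a by (metis in_set_conv_nth)
    then have "z ! (length z - 1) = a" "z \<noteq> []" using same[of i "length z - 1"] by auto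
    then have "last z = a" by (simp add: last_conv_nth)
    with n show False by simp
  qed
  ultimately show "sorted_wrt (\<ge>) z \<and> (\<forall>a\<in>set z. a = last z \<or> (\<exists>c\<in>set z. L a \<le> c \<and> c < a))"
    by blast
next
  assume s: "sorted_wrt (\<ge>) z \<and> (\<forall>a\<in>set z. a = last z \<or> (\<exists>c\<in>set z. L a \<le> c \<and> c < a))"
  show "chain z"
    unfolding chain_def
  proof (intro allI impI conjI)
    fix i assume i: "Suc i < length z"
    show le: "z ! Suc i \<le> z ! i" using s i by (auto simp: sorted_wrt_iff_nth_less)
    from s i have "z ! i = last z \<or> (\<exists>c\<in>set z. L (z ! i) \<le> c \<and> c < z ! i)" by auto
    then show "L (z ! i) \<le> z ! Suc i"
    proof
      assume e: "z ! i = last z"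
      have "last z = z ! (length z - 1)" using i by (intro last_conv_nth) auto
      then have "last z \<le> z ! Suc i"
        using s i by (cases "Suc i = length z - 1") (auto simp: sorted_wrt_iff_nth_less)
      then show ?thesis using e L_le_self[of "z ! i"] by simp
    next
      assume "\<exists>c\<in>set z. L (z ! i) \<le> c \<and> c < z ! i"
      then obtain k where k: "k < length z" "L (z ! i) \<le> z ! k" "z ! k < z ! i"
        by (auto simp: in_set_conv_nth)
      have "\<not> k \<le> i"
      proof
        assume "k \<le> i"
        then have "z ! i \<le> z ! k" using s i by (cases "k = i") (auto simp: sorted_wrt_iff_nth_less)
        with k show False by simp
      qed
      then have "z ! k \<le> z ! Suc i"
        using s k by (cases "k = Suc i") (auto simp: sorted_wrt_iff_nth_less)
      with k show ?thesis by simp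
    qed
  qed
qed

lemma set_del_subset: "set (del m z) \<subseteq> set z"
  using set_take_subset[of m z] set_drop_subset[of "Suc m" z] by (auto simp: del_def)

lemma sorted_del: "sorted_wrt R z \<Longrightarrow> sorted_wrt R (del m z)"
proof (cases "m < length z")
  case True
  assume "sorted_wrt R z"
  then have "sorted_wrt R (take m z @ z ! m # drop (Suc m) z)" by (simp flip: id_take_nth_drop[OF True])
  then show ?thesis by (simp add: del_def sorted_wrt_append)
qed (simp add: del_def)

text \<open>
  Being a chain between its end points is a property of a list that can only get lost, not
  regained, when entries are deleted.
\<close>

lemma V_del_del:
  assumes x: "V p q x" and y: "V p q (del m' (del m x))" shows "V p q (del m x)"
proof -
  define z where "z = del m x"
  define y where "y = del m' z"
  have sx: "sorted_wrt (\<ge>) x" using x by (simp add: V_def chain_alt)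
  have sz: "sorted_wrt (\<ge>) z" unfolding z_def by (rule sorted_del[OF sx])
  have yz: "set y \<subseteq> set z" and zx: "set z \<subseteq> set x"
    unfolding y_def z_def by (rule set_del_subset)+
  have vy: "V p q y" using assms(2) by (simp add: y_def z_def)
  then have py: "p \<in> set y" "q \<in> set y" by (auto simp: V_def)
  have bx: "q \<le> a \<and> a \<le> p" if ax: "a \<in> set x" for a
  proof -
    have "x \<noteq> []" "hd x = p" "last x = q" using x by (auto simp: V_def)
    moreover obtain i where "i < length x" "a = x ! i" using ax by (metis in_set_conv_nth)
    moreover from this have "x ! i \<le> x ! 0"
      using sx by (cases "i = 0") (auto simp: sorted_wrt_iff_nth_less)
    moreover from calculation have "x ! (length x - 1) \<le> x ! i"
      using sx by (cases "i = length x - 1") (auto simp: sorted_wrt_iff_nth_less)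
    ultimately show ?thesis by (simp add: hd_conv_nth last_conv_nth)
  qed
  have nz: "z \<noteq> []" using py yz by auto
  have hz: "hd z = p"
  proof -
    from py yz obtain i where i: "i < length z" "z ! i = p" by (metis in_set_conv_nth subsetD)
    then have "p \<le> z ! 0" using sz by (cases "i = 0") (auto simp: sorted_wrt_iff_nth_less)
    moreover have "z ! 0 \<le> p" using bx zx nz by (metis length_greater_0_conv nth_mem subsetD)
    ultimately show ?thesis using nz by (simp add: hd_conv_nth)
  qed
  have lz: "last z = q"
  proof -
    from py yz obtain i where i: "i < length z" "z ! i = q" by (metis in_set_conv_nth subsetD)
    then have "z ! (length z - 1) \<le> q"
      using sz by (cases "i = length z - 1") (auto simp: sorted_wrt_iff_nth_less)
    moreover have "q \<le> last z" using bx zx nz by (metis last_in_set subsetD)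
    ultimately show ?thesis using nz by (simp add: last_conv_nth)
  qed
  have "a = q \<or> (\<exists>c\<in>set z. L a \<le> c \<and> c < a)" if a: "a \<in> set z" for a
  proof -
    define a' where "a' = Min {b \<in> set y. a \<le> b}"
    have "p \<in> {b \<in> set y. a \<le> b}" using py bx zx a by auto
    then have "a' \<in> {b \<in> set y. a \<le> b}" unfolding a'_def by (intro Min_in) auto
    then have a': "a' \<in> set y" "a \<le> a'" by auto
    have mn: "a' \<le> b" if "b \<in> set y" "a \<le> b" for b
      unfolding a'_def using that by (intro Min_le) auto
    show ?thesis
    proof (cases "a' = q")
      case True
      then show ?thesis using a' bx[of a] zx a by auto
    next
      case False
      then obtain c where c: "c \<in> set y" "L a' \<le> c" "c < a'"
        using vy a' by (auto simp: V_def chain_alt)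
      then have "c < a" using mn by force
      moreover have "L a \<le> c" using mono_L[OF a'(2)] c by simp
      ultimately show ?thesis using c yz by auto
    qed
  qed
  then have "chain z" unfolding chain_alt using sz lz by blast
  then show ?thesis using nz hz lz by (simp add: V_def z_def)
qed

text \<open>
  Deletion may produce lists that are not chains. Restricting the coboundary to the chains is still a
  differential: by \<open>V_del_del\<close>, whenever a double deletion is a chain, so is the list in between.
\<close>

lemma bdry_V_bdry:
  assumes x: "V p q x" and supp: "\<And>z. f z \<noteq> (0::'k::comm_ring_1) \<Longrightarrow> V p q z"
  shows "bdry (\<lambda>z. if V p q z then bdry f z else 0) x = 0"
proof -
  have "(if V p q (del m x) then bdry f (del m x) else 0) = bdry f (del m x)" for m
  proof (cases "V p q (del m x)")
    case False
    then have "f (del m' (del m x)) = 0" for m' using V_del_del[OF x] supp by blast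
    then have "bdry f (del m x) = 0" by (simp add: bdry_def)
    then show ?thesis by simp
  qed simp
  then have "bdry (\<lambda>z. if V p q z then bdry f z else 0) x = bdry (bdry f) x"
    by (simp add: bdry_def[of _ x])
  then show ?thesis by (simp add: bdry_bdry)
qed

lemma V_take:
  assumes v: "V p q x" and m: "m < length x" shows "V p (x ! m) (take (Suc m) x)"
proof -
  have "take (Suc m) x = take m x @ [x ! m]" using m by (rule take_Suc_conv_app_nth)
  then have "last (take (Suc m) x) = x ! m" by simp
  then show ?thesis using v m by (simp add: V_def chain_def)
qed

lemma V_drop:
  assumes v: "V p q x" and m: "m < length x" shows "V (x ! m) q (drop m x)"
  using v m by (simp add: V_def chain_def hd_drop_conv_nth)

lemma tau_V: "tau j z \<noteq> (0::'k::comm_ring_1) \<Longrightarrow> V (hd j) (last j) z"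
  using tau_linked[of j z] tau_ends[of j z] tau_chain[of j z] by (auto simp: V_def)

end

section \<open>Blocks and contractions of strings\<close>

text \<open>
  The parts of a string of morphisms, given by its objects: adjacent parts share an object. In \<open>ctr u v\<close>
  the block from \<open>u\<close> to \<open>v\<close> is replaced by a single morphism between its end points.
\<close>

definition pre :: "nat \<Rightarrow> 'a list \<Rightarrow> 'a list" where "pre c j = take (Suc c) j"
definition suf :: "nat \<Rightarrow> 'a list \<Rightarrow> 'a list" where "suf c j = drop c j"
definition blk :: "nat \<Rightarrow> nat \<Rightarrow> 'a list \<Rightarrow> 'a list" where "blk u v j = take (Suc (v - u)) (drop u j)"
definition ctr :: "nat \<Rightarrow> nat \<Rightarrow> 'a list \<Rightarrow> 'a list" where "ctr u v j = take (Suc u) j @ drop v j"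
definition pairs :: "'a list \<Rightarrow> (nat \<times> nat) set" where "pairs j = {(u, v). u < v \<and> v < length j}"

lemmas part_defs = pre_def suf_def blk_def ctr_def

lemma finite_pairs: "finite (pairs j)"
  by (rule finite_subset[of _ "{..<length j} \<times> {..<length j}"]) (auto simp: pairs_def)

lemma length_part:
  "c < length j \<Longrightarrow> length (pre c j) = Suc c"
  "length (suf c j) = length j - c"
  "u \<le> v \<Longrightarrow> v < length j \<Longrightarrow> length (blk u v j) = Suc (v - u)"
  "u < v \<Longrightarrow> v < length j \<Longrightarrow> length (ctr u v j) = Suc u + (length j - v)"
  by (auto simp: part_defs)

lemma part_nth:
  "i \<le> c \<Longrightarrow> c < length j \<Longrightarrow> pre c j ! i = j ! i"
  "c + i < length j \<Longrightarrow> suf c j ! i = j ! (c + i)"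
  "u + i \<le> v \<Longrightarrow> v < length j \<Longrightarrow> blk u v j ! i = j ! (u + i)"
  "u < v \<Longrightarrow> v < length j \<Longrightarrow> i < Suc u + (length j - v) \<Longrightarrow>
     ctr u v j ! i = (if i \<le> u then j ! i else j ! (i - Suc u + v))"
  by (auto simp: part_defs nth_append min_def add.commute)

lemma part_hd_last:
  "c < length j \<Longrightarrow> hd (pre c j) = hd j" "c < length j \<Longrightarrow> last (pre c j) = j ! c"
  "c < length j \<Longrightarrow> hd (suf c j) = j ! c" "c < length j \<Longrightarrow> last (suf c j) = last j"
  "u \<le> v \<Longrightarrow> v < length j \<Longrightarrow> hd (blk u v j) = j ! u" "u \<le> v \<Longrightarrow> v < length j \<Longrightarrow> last (blk u v j) = j ! v"
  "u < v \<Longrightarrow> v < length j \<Longrightarrow> hd (ctr u v j) = hd j" "u < v \<Longrightarrow> v < length j \<Longrightarrow> last (ctr u v j) = last j"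
proof -
  show "c < length j \<Longrightarrow> hd (pre c j) = hd j" by (simp add: pre_def)
  show "c < length j \<Longrightarrow> last (pre c j) = j ! c" by (simp add: pre_def take_Suc_conv_app_nth)
  show "c < length j \<Longrightarrow> hd (suf c j) = j ! c" by (simp add: suf_def hd_drop_conv_nth)
  show "c < length j \<Longrightarrow> last (suf c j) = last j" by (simp add: suf_def)
  show "u \<le> v \<Longrightarrow> v < length j \<Longrightarrow> hd (blk u v j) = j ! u" by (simp add: blk_def hd_drop_conv_nth)
  show "u \<le> v \<Longrightarrow> v < length j \<Longrightarrow> last (blk u v j) = j ! v"
    by (simp add: blk_def take_Suc_conv_app_nth)
  show "u < v \<Longrightarrow> v < length j \<Longrightarrow> hd (ctr u v j) = hd j" by (cases j) (auto simp: ctr_def)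
  show "u < v \<Longrightarrow> v < length j \<Longrightarrow> last (ctr u v j) = last j" by (simp add: ctr_def)
qed

lemma pre_pre: "b \<le> c \<Longrightarrow> c < length j \<Longrightarrow> pre b (pre c j) = pre b j"
  by (simp add: pre_def min_def)

lemma suf_suf: "suf b (suf c j) = suf (c + b) j"
  by (simp add: suf_def add.commute)

lemma suf_pre: "b \<le> c \<Longrightarrow> c < length j \<Longrightarrow> suf b (pre c j) = blk b c j"
  by (simp add: part_defs drop_take Suc_diff_le)

lemma pre_suf: "pre b (suf c j) = blk c (c + b) j"
  by (simp add: part_defs)

lemma blk_pre: "v \<le> c \<Longrightarrow> c < length j \<Longrightarrow> u \<le> v \<Longrightarrow> blk u v (pre c j) = blk u v j"
  by (simp add: part_defs drop_take min_def)

lemma blk_suf: "c \<le> u \<Longrightarrow> u \<le> v \<Longrightarrow> blk (u - c) (v - c) (suf c j) = blk u v j"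
  by (simp add: part_defs)

lemma blk_blk: "a \<le> u \<Longrightarrow> u \<le> v \<Longrightarrow> v \<le> b \<Longrightarrow> blk (u - a) (v - a) (blk a b j) = blk u v j"
  by (simp add: part_defs drop_take min_def)

lemma pre_blk: "a \<le> u \<Longrightarrow> u \<le> b \<Longrightarrow> pre (u - a) (blk a b j) = blk a u j"
  by (simp add: part_defs min_def)

lemma blk_full: "j \<noteq> [] \<Longrightarrow> blk 0 (length j - 1) j = j"
  by (simp add: blk_def)

lemma ctr_full: "2 \<le> length j \<Longrightarrow> ctr 0 (length j - 1) j = [hd j, last j]"
proof -
  assume j: "2 \<le> length j"
  then have "j \<noteq> []" by auto
  then have "drop (length j - 1) j = [last j]"
    by (metis append_butlast_last_id append_eq_conv_conj length_butlast)
  moreover have "take (Suc 0) j = [hd j]" using \<open>j \<noteq> []\<close> by (cases j) auto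
  ultimately show ?thesis by (simp add: ctr_def)
qed

lemma ctr_pre: "u < v \<Longrightarrow> v \<le> c \<Longrightarrow> c < length j \<Longrightarrow> ctr u v (pre c j) = pre (c + Suc u - v) (ctr u v j)"
  by (simp add: part_defs min_def drop_take)

lemma suf_ctr_right: "u < v \<Longrightarrow> v \<le> c \<Longrightarrow> c < length j \<Longrightarrow> suf (c + Suc u - v) (ctr u v j) = suf c j"
  by (simp add: part_defs)

lemma pre_ctr_left: "c \<le> u \<Longrightarrow> u < v \<Longrightarrow> v < length j \<Longrightarrow> pre c (ctr u v j) = pre c j"
  by (simp add: part_defs min_def)

lemma suf_ctr_left: "c \<le> u \<Longrightarrow> u < v \<Longrightarrow> v < length j \<Longrightarrow> suf c (ctr u v j) = ctr (u - c) (v - c) (suf c j)"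
  by (simp add: part_defs take_drop Suc_diff_le)

lemma blk_ctr_left: "a < b \<Longrightarrow> b \<le> u \<Longrightarrow> u < v \<Longrightarrow> v < length j \<Longrightarrow> blk a b (ctr u v j) = blk a b j"
  by (simp add: part_defs take_drop min_def)

lemma blk_ctr_right:
  "u < v \<Longrightarrow> v \<le> a \<Longrightarrow> a < b \<Longrightarrow> b < length j \<Longrightarrow> blk (a + Suc u - v) (b + Suc u - v) (ctr u v j) = blk a b j"
  by (simp add: part_defs)

lemma blk_ctr_mid:
  "a \<le> u \<Longrightarrow> u < v \<Longrightarrow> v \<le> b \<Longrightarrow> b < length j \<Longrightarrow>
   blk a (b + Suc u - v) (ctr u v j) = ctr (u - a) (v - a) (blk a b j)"
  by (simp add: part_defs drop_take Suc_diff_le min_def)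

lemma ctr_ctr_mid:
  "a \<le> u \<Longrightarrow> u < v \<Longrightarrow> v \<le> b \<Longrightarrow> b < length j \<Longrightarrow> ctr a (b + Suc u - v) (ctr u v j) = ctr a b j"
  by (simp add: part_defs min_def)

lemma ctr_ctr_disjoint:
  "a < b \<Longrightarrow> b \<le> u \<Longrightarrow> u < v \<Longrightarrow> v < length j \<Longrightarrow>
   ctr (u + Suc a - b) (v + Suc a - b) (ctr a b j) = ctr a b (ctr u v j)"
  by (simp add: part_defs min_def drop_take)

context short_paths
begin

lemma red_append: "red (xs @ y # ys) = red (xs @ [y]) + red (y # ys)"
proof (induction xs rule: induct_list012)
  case (2 x)
  then show ?case by (cases ys) auto
qed auto

lemma red_pre_suf: "c < length j \<Longrightarrow> red j = red (pre c j) + red (suf c j)"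
proof -
  assume c: "c < length j"
  have "red (take c j @ j ! c # drop (Suc c) j) = red (take c j @ [j ! c]) + red (j ! c # drop (Suc c) j)"
    by (rule red_append)
  also have "take c j @ j ! c # drop (Suc c) j = j" by (rule id_take_nth_drop[OF c, symmetric])
  also have "take c j @ [j ! c] = pre c j" using c by (simp add: pre_def take_Suc_conv_app_nth)
  also have "j ! c # drop (Suc c) j = suf c j" using c by (simp add: suf_def Cons_nth_drop_Suc)
  finally show ?thesis .
qed

lemma red_pre_blk: "u \<le> v \<Longrightarrow> v < length j \<Longrightarrow> red (pre v j) = red (pre u j) + red (blk u v j)"
  using red_pre_suf[of u "pre v j"] by (simp add: length_part pre_pre suf_pre)

lemma red_ctr:
  assumes uv: "u < v" "v < length j" and nz: "mu (blk u v j) \<noteq> (0::'k::comm_ring_1)"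
  shows "red (ctr u v j) = red j + 1"
proof -
  have "int (deg (j ! u) (j ! v)) = red (blk u v j) + 2"
    using nz uv part_hd_last(5,6)[of u v j] by (auto simp: mu_def split: if_splits)
  moreover have "red (ctr u v j) = red (pre u j) + (int (deg (j ! u) (j ! v)) - 1) + red (suf v j)"
  proof -
    have "ctr u v j = take u j @ j ! u # j ! v # drop (Suc v) j"
      using uv by (simp add: ctr_def take_Suc_conv_app_nth Cons_nth_drop_Suc)
    then have "red (ctr u v j) = red (take u j @ [j ! u]) + red (j ! u # j ! v # drop (Suc v) j)"
      by (simp only: red_append[of "take u j" "j ! u" "j ! v # drop (Suc v) j"])
    also have "take u j @ [j ! u] = pre u j" using uv by (simp add: pre_def take_Suc_conv_app_nth)
    also have "red (j ! u # j ! v # drop (Suc v) j) = int (deg (j ! u) (j ! v)) - 1 + red (j ! v # drop (Suc v) j)"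
      by simp
    also have "j ! v # drop (Suc v) j = suf v j" using uv by (simp add: suf_def Cons_nth_drop_Suc)
    finally show ?thesis by simp
  qed
  moreover have "red j = red (pre u j) + red (blk u v j) + red (suf v j)"
    using red_pre_suf[of v j] red_pre_blk[of u v j] uv by simp
  ultimately show ?thesis by simp
qed

lemma mu_short: "length j \<le> 2 \<Longrightarrow> mu j = (0::'k::comm_ring_1)"
proof -
  assume "length j \<le> 2"
  then have "j = [] \<or> (\<exists>p. j = [p]) \<or> (\<exists>p q. j = [p, q])"
    by (cases j; cases "tl j") auto
  then show ?thesis by (auto simp: mu_def)
qed

definition sg :: "int \<Rightarrow> 'k::comm_ring_1" where
  "sg r = (if even r then 1 else -1)"

lemma sg_add: "sg (a + b) = (sg a * sg b :: 'k::comm_ring_1)"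
  by (auto simp: sg_def)

lemma sg_1: "sg 1 = (-1 :: 'k::comm_ring_1)"
  by (simp add: sg_def)

lemma sg_square: "sg a * sg a = (1 :: 'k::comm_ring_1)"
  by (auto simp: sg_def)

lemma sg_int: "sg (int m) = ((-1) ^ m :: 'k::comm_ring_1)"
  by (simp add: sg_def)

end

lemma cup_sum_left: "cup (\<lambda>z. \<Sum>i\<in>A. F i z) g x = (\<Sum>i\<in>A. cup (F i) g x)"
  unfolding cup_def by (subst sum.swap) (simp add: sum_distrib_left sum_distrib_right)

lemma cup_scale_left: "cup (\<lambda>z. c * f z) g x = c * cup f g x"
  by (simp add: cup_def sum_distrib_left mult_ac)

lemma cup_diff_left: "cup (\<lambda>z. f z - g z) h x = cup f h x - cup g h x"
  by (simp add: cup_def sum_subtractf algebra_simps)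

lemma bdry_sum: "bdry (\<lambda>z. \<Sum>i\<in>A. F i z) x = (\<Sum>i\<in>A. bdry (F i) x)"
  unfolding bdry_def by (subst sum.swap) (simp add: sum_distrib_left)

lemma bdry_scale: "bdry (\<lambda>z. c * f z) x = c * bdry f x"
  by (simp add: bdry_def sum_distrib_left mult_ac)

lemma bdry_diff: "bdry (\<lambda>z. f z - g z) x = bdry f x - bdry g x"
  by (simp add: bdry_def sum_subtractf algebra_simps)

lemma sum_Sigma_pair:
  assumes "finite P" "\<And>u v. finite (S u v)"
  shows "(\<Sum>((u, v), c)\<in>Sigma P (\<lambda>(u, v). S u v). F u v c) = (\<Sum>(u, v)\<in>P. \<Sum>c\<in>S u v. F u v c)"
  using assms unfolding split_def by (subst sum.Sigma) (auto simp: split_def)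

definition cup3 :: "('a list \<Rightarrow> 'k::comm_ring_1) \<Rightarrow> ('a list \<Rightarrow> 'k) \<Rightarrow> ('a list \<Rightarrow> 'k) \<Rightarrow> 'a list \<Rightarrow> 'k" where
  "cup3 f g h x = (\<Sum>(l, m)\<in>{(l, m). l \<le> m \<and> m < length x}.
     (-1) ^ (l + m) * f (take (Suc l) x) * g (drop l (take (Suc m) x)) * h (drop m x))"

lemma cup_cup_left: "cup (cup f g) h x = cup3 f g h x"
proof -
  have "cup (cup f g) h x = (\<Sum>(m, l)\<in>Sigma {..<length x} (\<lambda>m. {..<Suc m}).
      (-1) ^ (l + m) * f (take (Suc l) x) * g (drop l (take (Suc m) x)) * h (drop m x))"
  proof -
    have *: "(-1) ^ m * cup f g (take (Suc m) x) * h (drop m x) =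
        (\<Sum>l<Suc m. (-1) ^ (l + m) * f (take (Suc l) x) * g (drop l (take (Suc m) x)) * h (drop m x))"
      if "m < length x" for m
    proof -
      have "length (take (Suc m) x) = Suc m" using that by simp
      then have "cup f g (take (Suc m) x) =
          (\<Sum>l<Suc m. (-1) ^ l * f (take (Suc l) x) * g (drop l (take (Suc m) x)))"
        unfolding cup_def by (intro sum.cong) (auto simp: min_def)
      then show ?thesis
        by (simp add: sum_distrib_left sum_distrib_right power_add mult_ac del: sum.lessThan_Suc)
    qed
    show ?thesis
      unfolding cup_def[of "cup f g"]
      by (subst sum.Sigma[symmetric]) (auto intro!: sum.cong simp: * simp del: sum.lessThan_Suc)
  qed
  also have "\<dots> = cup3 f g h x"
    unfolding cup3_def
    by (rule sum.reindex_bij_witness[of _ "\<lambda>(l, m). (m, l)" "\<lambda>(m, l). (l, m)"]) auto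
  finally show ?thesis .
qed

lemma cup_cup_right: "(\<Sum>l<length x. f (take (Suc l) x) * cup g h (drop l x)) = cup3 f g h x"
proof -
  have "(\<Sum>l<length x. f (take (Suc l) x) * cup g h (drop l x)) =
      (\<Sum>(l, m)\<in>Sigma {..<length x} (\<lambda>l. {..<length x - l}).
        (-1) ^ m * f (take (Suc l) x) * g (take (Suc m) (drop l x)) * h (drop (m + l) x))"
    by (simp add: cup_def sum_distrib_left mult_ac flip: sum.Sigma)
  also have "\<dots> = cup3 f g h x"
    unfolding cup3_def
    by (rule sum.reindex_bij_witness[of _ "\<lambda>(l, m). (l, m - l)" "\<lambda>(l, m). (l, m + l)"])
      (auto simp: drop_take minus_one_power_iff Suc_diff_le)
  finally show ?thesis .
qed

context short_paths
begin

section \<open>The Maurer-Cartan equation\<close>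

text \<open>
  The three parts of the equation for an \<open>A\<^sub>\<infinity>\<close>-functor to a dg category on a string \<open>j\<close>: \<open>contr\<close>
  multiplies a block of the string before \<open>tau\<close> is applied, \<open>cups\<close> composes the values of \<open>tau\<close> on the
  two parts of a cut string, and the third is the differential of \<open>tau\<close>. Their defect is
  \<open>mc_defect\<close>, and \<open>ainf_defect\<close> is the defect of the \<open>A\<^sub>\<infinity>\<close>-relation for \<open>mu\<close>.
\<close>

definition contr :: "nat list \<Rightarrow> nat list \<Rightarrow> 'k::comm_ring_1" where
  "contr j z = (\<Sum>(u, v)\<in>pairs j. sg (red (pre u j)) * mu (blk u v j) * tau (ctr u v j) z)"

definition cups :: "nat list \<Rightarrow> nat list \<Rightarrow> 'k::comm_ring_1" where
  "cups j z = (\<Sum>c<length j. cup (tau (pre c j)) (tau (suf c j)) z)"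

definition mc_defect :: "nat list \<Rightarrow> nat list \<Rightarrow> 'k::comm_ring_1" where
  "mc_defect j z = cups j z - bdry (tau j) z - contr j z"

definition ainf_defect :: "nat list \<Rightarrow> 'k::comm_ring_1" where
  "ainf_defect j = (\<Sum>(u, v)\<in>pairs j. sg (red (pre u j)) * mu (blk u v j) * mu (ctr u v j))"

lemma V_join:
  assumes "V p r (take (Suc m) z)" "V r q (drop m z)" "m < length z" shows "V p q z"
proof -
  have "L (z ! i) \<le> z ! Suc i \<and> z ! Suc i \<le> z ! i" if "Suc i < length z" for i
  proof (cases "i < m")
    case True
    then have "Suc i < length (take (Suc m) z)" using assms(3) by simp
    then show ?thesis using assms(1) True by (auto simp: V_def chain_def)
  next
    case False
    have "Suc (i - m) < length (drop m z)" using that False by simp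
    then show ?thesis using assms(2) False by (auto simp: V_def chain_def)
  qed
  then show ?thesis using assms by (auto simp: V_def chain_def)
qed

lemma cups_V: "cups j z \<noteq> (0::'k::comm_ring_1) \<Longrightarrow> V (hd j) (last j) z"
proof -
  assume "cups j z \<noteq> (0::'k)"
  then obtain c where c: "c < length j" "cup (tau (pre c j)) (tau (suf c j)) z \<noteq> (0::'k)"
    unfolding cups_def by (meson lessThan_iff sum.not_neutral_contains_not_neutral)
  then obtain m where m: "m < length z"
      "(-1) ^ m * tau (pre c j) (take (Suc m) z) * tau (suf c j) (drop m z) \<noteq> (0::'k)"
    unfolding cup_def by (meson lessThan_iff sum.not_neutral_contains_not_neutral)
  have 1: "tau (pre c j) (take (Suc m) z) \<noteq> (0::'k)" "tau (suf c j) (drop m z) \<noteq> (0::'k)"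
    using m(2) by auto
  have "V (hd j) (j ! c) (take (Suc m) z)" "V (j ! c) (last j) (drop m z)"
    using tau_V[OF 1(1)] tau_V[OF 1(2)] c(1) by (simp_all add: part_hd_last)
  then show ?thesis using m(1) by (rule V_join)
qed

lemma contr_V: "contr j z \<noteq> (0::'k::comm_ring_1) \<Longrightarrow> V (hd j) (last j) z"
proof -
  assume "contr j z \<noteq> (0::'k)"
  then obtain u v where "(u, v) \<in> pairs j" "tau (ctr u v j) z \<noteq> (0::'k)"
    unfolding contr_def by (smt (verit) case_prod_beta mult_not_zero prod.collapse sum.not_neutral_contains_not_neutral)
  then show ?thesis using tau_V[of "ctr u v j" z] by (auto simp: pairs_def part_hd_last)
qed

lemma cups_assoc:
  "(\<Sum>c<length j. cup (cups (pre c j)) (tau (suf c j)) x) =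
   (\<Sum>c<length j. \<Sum>m<length x. tau (pre c j) (take (Suc m) x) * (cups (suf c j) (drop m x) :: 'k::comm_ring_1))"
proof -
  let ?T = "\<lambda>b c. cup3 (tau (pre b j)) (tau (blk b c j)) (tau (suf c j)) x :: 'k"
  have "(\<Sum>c<length j. cup (cups (pre c j)) (tau (suf c j)) x) = (\<Sum>c<length j. \<Sum>b<Suc c. ?T b c)"
  proof (rule sum.cong[OF refl])
    fix c assume c: "c \<in> {..<length j}"
    have "cup (cups (pre c j)) (tau (suf c j)) x =
        (\<Sum>b<Suc c. cup (cup (tau (pre b (pre c j))) (tau (suf b (pre c j)))) (tau (suf c j)) x :: 'k)"
      using c unfolding cups_def[abs_def] cup_sum_left by (simp add: length_part)
    also have "\<dots> = (\<Sum>b<Suc c. ?T b c)"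
      using c by (intro sum.cong refl) (simp add: cup_cup_left pre_pre suf_pre)
    finally show "cup (cups (pre c j)) (tau (suf c j)) x = (\<Sum>b<Suc c. ?T b c)" .
  qed
  also have "\<dots> = (\<Sum>b<length j. \<Sum>c<length j - b. ?T b (b + c))"
    unfolding sum.Sigma[OF finite_lessThan ballI[OF finite_lessThan]]
    by (rule sum.reindex_bij_witness[of _ "\<lambda>(b, c). (b + c, b)" "\<lambda>(c, b). (b, c - b)"]) auto
  also have "\<dots> = (\<Sum>b<length j. \<Sum>m<length x. tau (pre b j) (take (Suc m) x) * cups (suf b j) (drop m x))"
  proof (rule sum.cong[OF refl])
    fix b assume b: "b \<in> {..<length j}"
    have "(\<Sum>m<length x. tau (pre b j) (take (Suc m) x) * (cups (suf b j) (drop m x) :: 'k)) =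
      (\<Sum>c<length j - b. \<Sum>m<length x. tau (pre b j) (take (Suc m) x) *
         cup (tau (pre c (suf b j))) (tau (suf c (suf b j))) (drop m x))"
      unfolding cups_def sum_distrib_left by (subst sum.swap) (use b in \<open>simp add: length_part\<close>)
    then show "(\<Sum>c<length j - b. ?T b (b + c)) =
       (\<Sum>m<length x. tau (pre b j) (take (Suc m) x) * cups (suf b j) (drop m x))"
      using b by (simp add: cup_cup_right pre_suf suf_suf)
  qed
  finally show ?thesis .
qed

lemma tau_sg:
  assumes "m < length x"
  shows "tau j (take (Suc m) x) * sg (red j) = - ((-1) ^ m * (tau j (take (Suc m) x) :: 'k::comm_ring_1))"
proof (cases "tau j (take (Suc m) x) = (0::'k)")
  case False
  then have "red j = int m - 1" using tau_length[OF False] assms by simp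
  then have "sg (red j) = (- ((-1) ^ m) :: 'k)" by (auto simp: sg_def)
  then show ?thesis by (simp add: mult.commute)
qed simp

lemma cups_contr:
  "(\<Sum>c<length j. cup (contr (pre c j)) (tau (suf c j)) x) -
   (\<Sum>c<length j. \<Sum>m<length x. tau (pre c j) (take (Suc m) x) * contr (suf c j) (drop m x)) =
   (\<Sum>(u, v)\<in>pairs j. sg (red (pre u j)) * mu (blk u v j) * (cups (ctr u v j) x :: 'k::comm_ring_1))"
proof -
  let ?n = "length j"
  let ?K = "\<lambda>u v. sg (red (pre u j)) * mu (blk u v j) :: 'k"
  let ?C = "\<lambda>u v c. cup (tau (pre c (ctr u v j))) (tau (suf c (ctr u v j))) x :: 'k"
  have "(\<Sum>c<?n. cup (contr (pre c j)) (tau (suf c j)) x) =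
      (\<Sum>c<?n. \<Sum>(u, v)\<in>pairs (pre c j). ?K u v * ?C u v (c + Suc u - v))"
  proof (rule sum.cong[OF refl])
    fix c assume c: "c \<in> {..<?n}"
    have "cup (contr (pre c j)) (tau (suf c j)) x = (\<Sum>(u, v)\<in>pairs (pre c j).
        sg (red (pre u (pre c j))) * mu (blk u v (pre c j)) * (cup (tau (ctr u v (pre c j))) (tau (suf c j)) x :: 'k))"
      unfolding contr_def[abs_def] cup_sum_left by (simp add: cup_scale_left split_def)
    also have "\<dots> = (\<Sum>(u, v)\<in>pairs (pre c j). ?K u v * ?C u v (c + Suc u - v))"
      using c by (intro sum.cong refl)
        (auto simp: pairs_def length_part pre_pre blk_pre ctr_pre suf_ctr_right simp del: add_Suc_right)
    finally show "cup (contr (pre c j)) (tau (suf c j)) x = (\<Sum>(u, v)\<in>pairs (pre c j). ?K u v * ?C u v (c + Suc u - v))" .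
  qed
  also have "\<dots> = (\<Sum>(c, u, v)\<in>Sigma {..<?n} (\<lambda>c. pairs (pre c j)). ?K u v * ?C u v (c + Suc u - v))"
    by (subst sum.Sigma) (auto simp: finite_pairs split_def)
  also have "\<dots> = (\<Sum>((u, v), c)\<in>Sigma (pairs j) (\<lambda>(u, v). {Suc u..<Suc u + (?n - v)}). ?K u v * ?C u v c)"
    by (rule sum.reindex_bij_witness[of _ "\<lambda>((u, v), c). (c + v - Suc u, u, v)" "\<lambda>(c, u, v). ((u, v), c + Suc u - v)"])
      (auto simp: pairs_def length_part)
  also have "\<dots> = (\<Sum>(u, v)\<in>pairs j. \<Sum>c=Suc u..<Suc u + (?n - v). ?K u v * ?C u v c)"
    by (rule sum_Sigma_pair) (auto simp: finite_pairs)
  finally have 1: "(\<Sum>c<?n. cup (contr (pre c j)) (tau (suf c j)) x) = \<dots>" .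
  have "(\<Sum>c<?n. \<Sum>m<length x. tau (pre c j) (take (Suc m) x) * contr (suf c j) (drop m x)) =
      (\<Sum>c<?n. \<Sum>(u, v)\<in>pairs (suf c j). - (?K (u + c) (v + c) * ?C (u + c) (v + c) c))"
  proof (rule sum.cong[OF refl])
    fix c assume c: "c \<in> {..<?n}"
    have "(\<Sum>m<length x. tau (pre c j) (take (Suc m) x) * contr (suf c j) (drop m x)) =
      (\<Sum>(u, v)\<in>pairs (suf c j). \<Sum>m<length x. tau (pre c j) (take (Suc m) x) *
        (sg (red (pre u (suf c j))) * mu (blk u v (suf c j)) * (tau (ctr u v (suf c j)) (drop m x) :: 'k)))"
      unfolding contr_def sum_distrib_left by (subst sum.swap) (simp add: split_def)
    also have "\<dots> = (\<Sum>(u, v)\<in>pairs (suf c j). - (?K (u + c) (v + c) * ?C (u + c) (v + c) c))"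
    proof (intro sum.cong refl, clarify)
      fix u v assume "(u, v) \<in> pairs (suf c j)"
      then have uv: "u < v" "c + v < ?n" using c by (auto simp: pairs_def length_part)
      have r: "red (pre (u + c) j) = red (pre c j) + red (pre u (suf c j))"
        using red_pre_blk[of c "u + c" j] uv by (simp add: pre_suf add.commute)
      have sgu: "sg (red (pre u (suf c j))) = (sg (red (pre c j)) * sg (red (pre (u + c) j)) :: 'k)"
        unfolding r sg_add by (simp add: mult.assoc[symmetric] sg_square)
      have "?C (u + c) (v + c) c = (\<Sum>m<length x. (-1) ^ m * tau (pre c j) (take (Suc m) x) * tau (ctr u v (suf c j)) (drop m x))"
        using uv by (simp add: cup_def pre_ctr_left suf_ctr_left)
      moreover have "blk u v (suf c j) = blk (u + c) (v + c) j"
        using blk_suf[of c "u + c" "v + c" j] uv by simp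
      moreover have "tau (pre c j) (take (Suc m) x) * (sg (red (pre u (suf c j))) * M * t) =
          - (sg (red (pre (u + c) j)) * M * ((-1) ^ m * tau (pre c j) (take (Suc m) x) * t))"
        if "m < length x" for m and M t :: 'k
      proof -
        have "tau (pre c j) (take (Suc m) x) * (sg (red (pre u (suf c j))) * M * t) =
          (tau (pre c j) (take (Suc m) x) * sg (red (pre c j))) * (sg (red (pre (u + c) j)) * M * t)"
          by (simp add: sgu mult_ac)
        then show ?thesis unfolding tau_sg[OF that] by (simp add: mult_ac)
      qed
      ultimately show "(\<Sum>m<length x. tau (pre c j) (take (Suc m) x) *
          (sg (red (pre u (suf c j))) * mu (blk u v (suf c j)) * tau (ctr u v (suf c j)) (drop m x))) =
          - (?K (u + c) (v + c) * ?C (u + c) (v + c) c)"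
        by (simp add: sum_distrib_left sum_negf)
    qed
    finally show "(\<Sum>m<length x. tau (pre c j) (take (Suc m) x) * contr (suf c j) (drop m x)) =
      (\<Sum>(u, v)\<in>pairs (suf c j). - (?K (u + c) (v + c) * ?C (u + c) (v + c) c))" .
  qed
  also have "\<dots> = (\<Sum>(c, u, v)\<in>Sigma {..<?n} (\<lambda>c. pairs (suf c j)). - (?K (u + c) (v + c) * ?C (u + c) (v + c) c))"
    by (subst sum.Sigma) (auto simp: finite_pairs split_def)
  also have "\<dots> = (\<Sum>((u, v), c)\<in>Sigma (pairs j) (\<lambda>(u, v). {..<Suc u}). - (?K u v * ?C u v c))"
    by (rule sum.reindex_bij_witness[of _ "\<lambda>((u, v), c). (c, u - c, v - c)" "\<lambda>(c, u, v). ((u + c, v + c), c)"])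
      (auto simp: pairs_def length_part)
  also have "\<dots> = (\<Sum>(u, v)\<in>pairs j. \<Sum>c<Suc u. - (?K u v * ?C u v c))"
    by (rule sum_Sigma_pair) (auto simp: finite_pairs)
  finally have 2: "(\<Sum>c<?n. \<Sum>m<length x. tau (pre c j) (take (Suc m) x) * contr (suf c j) (drop m x)) = \<dots>" .
  have "(\<Sum>c<Suc u. ?K u v * ?C u v c) + (\<Sum>c=Suc u..<Suc u + (?n - v). ?K u v * ?C u v c) =
      ?K u v * cups (ctr u v j) x" if "(u, v) \<in> pairs j" for u v
  proof -
    have "length (ctr u v j) = Suc u + (?n - v)" using that by (simp add: pairs_def length_part)
    then have "?K u v * cups (ctr u v j) x = (\<Sum>c<Suc u + (?n - v). ?K u v * ?C u v c)"
      by (simp only: cups_def sum_distrib_left)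
    also have "\<dots> = (\<Sum>c<Suc u. ?K u v * ?C u v c) + (\<Sum>c=Suc u..<Suc u + (?n - v). ?K u v * ?C u v c)"
      using sum.atLeastLessThan_concat[of 0 "Suc u" "Suc u + (?n - v)" "\<lambda>c. ?K u v * ?C u v c"]
      by (simp only: atLeast0LessThan zero_le le_add1)
    finally show ?thesis ..
  qed
  then have "(\<Sum>(u, v)\<in>pairs j. ?K u v * cups (ctr u v j) x) =
     (\<Sum>(u, v)\<in>pairs j. (\<Sum>c<Suc u. ?K u v * ?C u v c) + (\<Sum>c=Suc u..<Suc u + (?n - v). ?K u v * ?C u v c))"
    by (intro sum.cong) auto
  then show ?thesis
    unfolding 1 2 by (simp add: split_def sum.distrib sum_negf del: sum.lessThan_Suc sum.op_ivl_Suc)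
qed

lemma contr_contr:
  "(\<Sum>(u, v)\<in>pairs j. sg (red (pre u j)) * mu (blk u v j) * contr (ctr u v j) x) =
   (\<Sum>(a, b)\<in>pairs j. ainf_defect (blk a b j) * (tau (ctr a b j) x :: 'k::comm_ring_1))"
proof -
  let ?n = "length j"
  let ?K = "\<lambda>u v. sg (red (pre u j)) * mu (blk u v j) :: 'k"
  let ?F = "\<lambda>((u, v), a, b). ?K u v *
     (sg (red (pre a (ctr u v j))) * mu (blk a b (ctr u v j)) * tau (ctr a b (ctr u v j)) x)"
  let ?G = "\<lambda>((u, v), a, b). ?K u v * (?K a b * tau (ctr a b (ctr u v j)) x)"
  define A where "A = {((u, v), a, b). a < b \<and> b \<le> u \<and> u < v \<and> v < ?n}"
  define B where "B = {((u, v), a, b). u < v \<and> v < ?n \<and> u < a \<and> a < b \<and> b < Suc u + (?n - v)}"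
  define C where "C = {((u, v), a, b). u < v \<and> v < ?n \<and> a \<le> u \<and> u < b \<and> b < Suc u + (?n - v)}"
  define S where "S = Sigma (pairs j) (\<lambda>(u, v). pairs (ctr u v j))"
  have "finite S" unfolding S_def by (auto simp: finite_pairs)
  have S: "S = (A \<union> B) \<union> C"
    unfolding S_def A_def B_def C_def by (auto simp: pairs_def length_part)
  then have fin: "finite A" "finite B" "finite C" using \<open>finite S\<close> by auto
  have disj: "A \<inter> B = {}" "(A \<union> B) \<inter> C = {}" by (auto simp: A_def B_def C_def)
  have "(\<Sum>(u, v)\<in>pairs j. ?K u v * contr (ctr u v j) x) = sum ?F S"
    unfolding S_def contr_def sum_distrib_left split_def
    by (subst sum.Sigma) (auto simp: finite_pairs split_def)
  also have "\<dots> = sum ?F A + sum ?F B + sum ?F C"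
    unfolding S using fin disj by (simp add: sum.union_disjoint)
  also have "sum ?F A = sum ?G A"
    by (rule sum.cong[OF refl]) (auto simp: A_def pre_ctr_left blk_ctr_left)
  also have "sum ?F B = (\<Sum>y\<in>A. - ?G y)"
  proof (rule sum.reindex_bij_witness[of _ "\<lambda>((u, v), a, b). ((a, b), (u + Suc a - b, v + Suc a - b))"
        "\<lambda>((u, v), a, b). ((a + v - Suc u, b + v - Suc u), (u, v))"])
    fix y assume "y \<in> B"
    then obtain u v a b where y: "y = ((u, v), a, b)" and b: "u < v" "v < ?n" "u < a" "a < b" "b < Suc u + (?n - v)"
      by (auto simp: B_def)
    define a' where "a' = a + v - Suc u"
    define b' where "b' = b + v - Suc u"
    have ab: "a = a' + Suc u - v" "b = b' + Suc u - v" "v \<le> a'" "a' < b'" "b' < ?n"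
      using b by (auto simp: a'_def b'_def)
    have "?F ((u, v), a, b) = - ?G ((a', b'), u, v)"
    proof (cases "mu (blk u v j) = (0::'k)")
      case False
      have "red (pre a (ctr u v j)) = red (pre a' j) + 1"
        using red_ctr[of u v "pre a' j"] False b ab by (simp add: ctr_pre blk_pre length_part)
      then have "sg (red (pre a (ctr u v j))) = - (sg (red (pre a' j)) :: 'k)" by (simp add: sg_add sg_1)
      moreover have "blk a b (ctr u v j) = blk a' b' j"
        unfolding ab using b ab by (intro blk_ctr_right) auto
      moreover have "ctr a b (ctr u v j) = ctr u v (ctr a' b' j)"
        unfolding ab using b ab by (intro ctr_ctr_disjoint) auto
      ultimately show ?thesis by (simp add: mult_ac)
    qed simp
    then show "- ?G ((\<lambda>((u, v), a, b). ((a + v - Suc u, b + v - Suc u), u, v)) y) = ?F y"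
      unfolding y a'_def b'_def by simp
  qed (auto simp: A_def B_def)
  also have "sum ?F C = (\<Sum>((a, b), u, v)\<in>Sigma (pairs j) (\<lambda>(a, b). pairs (blk a b j)).
      (sg (red (pre u (blk a b j))) * mu (blk u v (blk a b j)) * mu (ctr u v (blk a b j))) * tau (ctr a b j) x)"
  proof (rule sum.reindex_bij_witness[of _ "\<lambda>((a, b), u, v). ((a + u, a + v), a, b + Suc u - v)"
        "\<lambda>((u, v), a, b). ((a, b + v - Suc u), u - a, v - a)"])
    fix y assume "y \<in> C"
    then obtain u v a b where y: "y = ((u, v), a, b)" and b: "u < v" "v < ?n" "a \<le> u" "u < b" "b < Suc u + (?n - v)"
      by (auto simp: C_def)
    define b' where "b' = b + v - Suc u"
    have ab: "b = b' + Suc u - v" "v \<le> b'" "b' < ?n" using b by (auto simp: b'_def)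
    have "red (pre u j) = red (pre a j) + red (pre (u - a) (blk a b' j))"
      using red_pre_blk[of a u j] b ab by (simp add: pre_blk)
    then have sgu: "sg (red (pre u j)) * sg (red (pre a j)) = (sg (red (pre (u - a) (blk a b' j))) :: 'k)"
      by (simp add: sg_add mult_ac) (simp add: sg_square flip: mult.assoc)
    have eqs: "blk a b (ctr u v j) = ctr (u - a) (v - a) (blk a b' j)" "ctr a b (ctr u v j) = ctr a b' j"
      "blk u v j = blk (u - a) (v - a) (blk a b' j)" "pre a (ctr u v j) = pre a j"
      unfolding ab(1) using b ab(2,3)
      by (auto simp: blk_ctr_mid ctr_ctr_mid blk_blk pre_ctr_left simp del: add_Suc_right)
    show "(\<lambda>((a, b), u, v). sg (red (pre u (blk a b j))) * mu (blk u v (blk a b j)) *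
        mu (ctr u v (blk a b j)) * tau (ctr a b j) x) ((\<lambda>((u, v), a, b). ((a, b + v - Suc u), u - a, v - a)) y) = ?F y"
      unfolding y prod.case b'_def[symmetric] eqs sgu[symmetric] by (simp add: mult_ac)
  qed (auto simp: C_def pairs_def length_part)
  also have "\<dots> = (\<Sum>(a, b)\<in>pairs j. \<Sum>(u, v)\<in>pairs (blk a b j).
      (sg (red (pre u (blk a b j))) * mu (blk u v (blk a b j)) * mu (ctr u v (blk a b j))) * tau (ctr a b j) x)"
    unfolding split_def
    by (subst sum.Sigma) (auto simp: finite_pairs split_def)
  also have "\<dots> = (\<Sum>(a, b)\<in>pairs j. ainf_defect (blk a b j) * tau (ctr a b j) x)"
    by (simp add: ainf_defect_def sum_distrib_right split_def)
  finally show ?thesis by (simp add: sum_negf)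
qed

text \<open>
  Apply the differential to the equation for \<open>j\<close>. The terms with \<open>cups\<close> give triple products, which
  cancel by associativity, and terms with the differentials of shorter components, which are
  replaced through the equation for shorter strings. The terms with \<open>contr\<close> give double
  contractions: disjoint blocks cancel in pairs, and nested blocks sum up to defects of
  \<open>A\<^sub>\<infinity>\<close>-relations, of which only the one for the full string \<open>j\<close> is left.
\<close>

theorem bdry_mc:
  fixes j :: "nat list"
  assumes x: "V (hd j) (last j) x" and len: "2 \<le> length j"
    and mc_defect: "\<And>i z. length i < length j \<Longrightarrow> V (hd i) (last i) z \<Longrightarrow> mc_defect i z = (0::'k::comm_ring_1)"
    and ainf_defect: "\<And>i. length i < length j \<Longrightarrow> ainf_defect i = (0::'k)"
  shows "bdry (\<lambda>z. if V (hd j) (last j) z then mc_defect j z else 0) x = ainf_defect j * (tau [hd j, last j] x :: 'k)"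
proof -
  let ?V = "V (hd j) (last j)"
  have tau_Nil: "tau i [] = (0::'k)" for i using tau_linked[of i "[]"] by auto
  have "(\<lambda>z. if ?V z then mc_defect j z else 0) = (\<lambda>z. cups j z - (if ?V z then bdry (tau j) z else 0) - (contr j z :: 'k))"
  proof
    fix z
    show "(if ?V z then mc_defect j z else 0) = cups j z - (if ?V z then bdry (tau j) z else 0) - (contr j z :: 'k)"
    proof (cases "?V z")
      case False
      then have "cups j z = (0::'k)" "contr j z = (0::'k)" using cups_V[of j z] contr_V[of j z] by blast+
      then show ?thesis using False by simp
    qed (simp add: mc_defect_def)
  qed
  then have "bdry (\<lambda>z. if ?V z then mc_defect j z else (0::'k)) x =
      bdry (cups j) x - bdry (\<lambda>z. if ?V z then bdry (tau j) z else 0) x - bdry (contr j) x"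
    by (simp add: bdry_diff)
  also have "bdry (\<lambda>z. if ?V z then bdry (tau j) z else (0::'k)) x = 0"
    using x tau_V[of j] by (rule bdry_V_bdry)
  also have "bdry (contr j) x = (\<Sum>(u, v)\<in>pairs j. sg (red (pre u j)) * mu (blk u v j) * (bdry (tau (ctr u v j)) x :: 'k))"
    unfolding contr_def[abs_def] bdry_sum by (simp add: bdry_scale split_def)
  also have "\<dots> = (\<Sum>(u, v)\<in>pairs j. sg (red (pre u j)) * mu (blk u v j) * (cups (ctr u v j) x - contr (ctr u v j) x))"
  proof (intro sum.cong refl, clarify)
    fix u v assume uv: "(u, v) \<in> pairs j"
    show "sg (red (pre u j)) * mu (blk u v j) * bdry (tau (ctr u v j)) x =
        sg (red (pre u j)) * mu (blk u v j) * (cups (ctr u v j) x - contr (ctr u v j) x :: 'k)"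
    proof (cases "mu (blk u v j) = (0::'k)")
      case False
      then have "\<not> length (blk u v j) \<le> 2" using mu_short by blast
      then have "length (ctr u v j) < length j" using uv by (auto simp: pairs_def length_part)
      moreover have "V (hd (ctr u v j)) (last (ctr u v j)) x" using x uv by (simp add: pairs_def part_hd_last)
      ultimately have "mc_defect (ctr u v j) x = (0::'k)" by (rule mc_defect)
      then show ?thesis by (simp add: mc_defect_def algebra_simps)
    qed simp
  qed
  also have "\<dots> = (\<Sum>(u, v)\<in>pairs j. sg (red (pre u j)) * mu (blk u v j) * cups (ctr u v j) x) -
      (\<Sum>(u, v)\<in>pairs j. sg (red (pre u j)) * mu (blk u v j) * contr (ctr u v j) x)"
    by (simp add: split_def right_diff_distrib sum_subtractf)
  also have "bdry (cups j) x = (\<Sum>c<length j. - cup (bdry (tau (pre c j))) (tau (suf c j)) x +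
      (\<Sum>m<length x. tau (pre c j) (take (Suc m) x) * (bdry (tau (suf c j)) (drop m x) :: 'k)))"
    unfolding cups_def[abs_def] bdry_sum by (simp add: bdry_cup tau_Nil)
  also have "\<dots> = (\<Sum>c<length j. - cup (\<lambda>z. cups (pre c j) z - contr (pre c j) z) (tau (suf c j)) x +
      (\<Sum>m<length x. tau (pre c j) (take (Suc m) x) * (cups (suf c j) (drop m x) - contr (suf c j) (drop m x) :: 'k)))"
  proof (rule sum.cong[OF refl])
    fix c assume "c \<in> {..<length j}"
    then have c: "c < length j" by simp
    have 1: "bdry (tau (pre c j)) (take (Suc m) x) * tau (suf c j) (drop m x) =
        (cups (pre c j) (take (Suc m) x) - contr (pre c j) (take (Suc m) x)) * (tau (suf c j) (drop m x) :: 'k)"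
      if m: "m < length x" for m
    proof (cases "tau (suf c j) (drop m x) = (0::'k)")
      case False
      then have "x ! m = j ! c" "2 \<le> length (suf c j)"
        using tau_ends[OF False] tau_linked[OF False] m c by (auto simp: part_hd_last hd_drop_conv_nth)
      then have "V (hd (pre c j)) (last (pre c j)) (take (Suc m) x)" "length (pre c j) < length j"
        using V_take[OF x m] c by (auto simp: part_hd_last length_part)
      then have "mc_defect (pre c j) (take (Suc m) x) = (0::'k)" by (intro mc_defect)
      then show ?thesis by (simp add: mc_defect_def algebra_simps)
    qed simp
    have 2: "tau (pre c j) (take (Suc m) x) * bdry (tau (suf c j)) (drop m x) =
        tau (pre c j) (take (Suc m) x) * (cups (suf c j) (drop m x) - contr (suf c j) (drop m x) :: 'k)"
      if m: "m < length x" for m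
    proof (cases "tau (pre c j) (take (Suc m) x) = (0::'k)")
      case False
      have "last (take (Suc m) x) = x ! m" using V_take[OF x m] by (simp add: V_def)
      then have "x ! m = j ! c" "2 \<le> length (pre c j)"
        using tau_ends[OF False] tau_linked[OF False] c by (auto simp: part_hd_last)
      then have "V (hd (suf c j)) (last (suf c j)) (drop m x)" "length (suf c j) < length j"
        using V_drop[OF x m] c by (auto simp: part_hd_last length_part)
      then have "mc_defect (suf c j) (drop m x) = (0::'k)" by (intro mc_defect)
      then show ?thesis by (simp add: mc_defect_def algebra_simps)
    qed simp
    show "- cup (bdry (tau (pre c j))) (tau (suf c j)) x +
        (\<Sum>m<length x. tau (pre c j) (take (Suc m) x) * bdry (tau (suf c j)) (drop m x)) =
        - cup (\<lambda>z. cups (pre c j) z - contr (pre c j) z) (tau (suf c j)) x +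
        (\<Sum>m<length x. tau (pre c j) (take (Suc m) x) * (cups (suf c j) (drop m x) - contr (suf c j) (drop m x) :: 'k))"
      unfolding cup_def using 1 2 by (simp add: mult.assoc)
  qed
  also have "\<dots> =
      (\<Sum>c<length j. \<Sum>m<length x. tau (pre c j) (take (Suc m) x) * cups (suf c j) (drop m x)) -
      (\<Sum>c<length j. cup (cups (pre c j)) (tau (suf c j)) x) +
      ((\<Sum>c<length j. cup (contr (pre c j)) (tau (suf c j)) x) -
      (\<Sum>c<length j. \<Sum>m<length x. tau (pre c j) (take (Suc m) x) * contr (suf c j) (drop m x)))"
    by (simp add: cup_diff_left right_diff_distrib sum_subtractf sum.distrib sum_negf)
  finally have "bdry (\<lambda>z. if ?V z then mc_defect j z else (0::'k)) x =
      (\<Sum>(u, v)\<in>pairs j. sg (red (pre u j)) * mu (blk u v j) * contr (ctr u v j) x)"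
    unfolding cups_assoc cups_contr by simp
  also have "\<dots> = (\<Sum>(a, b)\<in>pairs j. ainf_defect (blk a b j) * (tau (ctr a b j) x :: 'k))"
    by (rule contr_contr)
  also have "\<dots> = (\<Sum>(a, b)\<in>{(0, length j - 1)}. ainf_defect (blk a b j) * tau (ctr a b j) x)"
  proof (rule sum.mono_neutral_right[OF finite_pairs])
    show "{(0, length j - 1)} \<subseteq> pairs j" using len by (auto simp: pairs_def)
    show "\<forall>i\<in>pairs j - {(0, length j - 1)}. (case i of (a, b) \<Rightarrow> ainf_defect (blk a b j) * (tau (ctr a b j) x :: 'k)) = 0"
    proof
      fix i assume i: "i \<in> pairs j - {(0, length j - 1)}"
      obtain a b where ab: "i = (a, b)" by (cases i)
      then have "length (blk a b j) < length j" using i by (auto simp: pairs_def length_part)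
      then show "(case i of (a, b) \<Rightarrow> ainf_defect (blk a b j) * (tau (ctr a b j) x :: 'k)) = 0"
        using ab by (simp add: ainf_defect)
    qed
  qed
  also have "\<dots> = ainf_defect j * tau [hd j, last j] x"
    using len blk_full[of j] ctr_full[of j] by (cases j) auto
  finally show ?thesis .
qed

end

context short_paths
begin

text \<open>
  The critical chain of length \<open>k + 1\<close> consists of the tops of the syzygies. Each extension group
  is at most one-dimensional and detected by the value of a cocycle on the critical chain.
\<close>

definition crit :: "nat \<Rightarrow> nat \<Rightarrow> nat list" where
  "crit p k = map (apex p) [0..<Suc k]"

definition full :: "nat \<Rightarrow> nat \<Rightarrow> bool" where
  "full p k \<longleftrightarrow> (\<forall>t\<le>k. bd p (Suc t) < bd p t)"

lemma del_Cons: "del 0 (x # z) = z" "del (Suc m) (x # z) = x # del m z"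
  by (simp_all add: del_def)

lemma length_crit: "length (crit p k) = Suc k"
  by (simp add: crit_def)

lemma crit_nth: "t \<le> k \<Longrightarrow> crit p k ! t = apex p t"
  by (simp add: crit_def del: upt_Suc)

lemma crit_Suc: "crit p (Suc k) = crit p k @ [apex p (Suc k)]"
  by (simp add: crit_def)

lemma crit_0: "crit p 0 = [p]"
  by (simp add: crit_def apex_def)

lemma crit_neq: "crit p k \<noteq> []"
  by (simp add: crit_def)

lemma hd_crit: "hd (crit p k) = p"
  by (simp add: hd_conv_nth crit_neq crit_nth apex_def)

lemma last_crit: "last (crit p k) = apex p k"
  by (simp add: crit_def)

lemma take_crit: "m \<le> k \<Longrightarrow> take (Suc m) (crit p k) = crit p m"
  by (simp add: crit_def take_map del: upt_Suc)

lemma full_arrow: "full p k \<Longrightarrow> arrow p k (apex p k)"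
  by (auto simp: full_def arrow_def apex_def)

lemma arrow_full: "arrow p k q \<Longrightarrow> full p k \<and> q = apex p k"
  using arrow_apex by (auto simp: full_def arrow_def)

lemma full_apex: "full p k \<Longrightarrow> t \<le> k \<Longrightarrow> apex p t \<in> slot p t \<and> Suc (apex p t) = bd p t"
  using apex_in_slot[of p t] slot_le_apex by (auto simp: full_def)

lemma del_append_left: "m < length u \<Longrightarrow> del m (u @ w) = del m u @ w"
  by (simp add: del_def)

lemma del_append_right: "length u \<le> m \<Longrightarrow> del m (u @ w) = u @ del (m - length u) w"
  by (simp add: del_def Suc_diff_le)

lemma del_crit:
  assumes "m < k"
  shows "\<exists>zs. del m (crit p k) = map (apex p) [0..<m] @ apex p (Suc m) # zs"
proof -
  have "drop (Suc m) (crit p k) = apex p (Suc m) # drop (Suc (Suc m)) (crit p k)"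
    using assms Cons_nth_drop_Suc[of "Suc m" "crit p k"] by (simp add: length_crit crit_nth)
  moreover have "take m (crit p k) = map (apex p) [0..<m]"
    using assms by (simp add: crit_def take_map del: upt_Suc)
  ultimately show ?thesis by (auto simp: del_def)
qed

lemma del_crit_tau:
  assumes f: "full p k" and m: "m < k"
  shows "tau (p # q # js) (del m (crit p k) @ w) = (0::'k::comm_ring_1)"
proof -
  obtain zs where "del m (crit p k) = map (apex p) [0..<m] @ apex p (Suc m) # zs"
    using del_crit[OF m] by blast
  moreover have "apex p (Suc m) \<notin> slot p m"
    using full_apex[OF f, of "Suc m"] m slot_disjoint[of "apex p (Suc m)" p m "Suc m"] by auto
  ultimately show ?thesis using tau_off_slot[of "apex p (Suc m)" p m q js "zs @ w"] by simp
qed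

lemma del_crit_V:
  assumes f: "full p k" and m: "m < k"
  shows "\<not> V p q (del m (crit p k) @ w)"
proof
  assume v: "V p q (del m (crit p k) @ w)"
  obtain zs where e: "del m (crit p k) = map (apex p) [0..<m] @ apex p (Suc m) # zs"
    using del_crit[OF m] by blast
  have b: "Suc (apex p (Suc m)) = bd p (Suc m)" using full_apex[OF f, of "Suc m"] m by simp
  show False
  proof (cases m)
    case 0
    then have "apex p 1 = p" using v e by (simp add: V_def)
    then show False using b 0 by simp
  next
    case (Suc t)
    let ?l = "del m (crit p k) @ w"
    have "?l ! t = apex p t" "?l ! Suc t = apex p (Suc m)" "Suc t < length ?l"
      unfolding e using Suc by (auto simp: nth_append)
    then have "L (apex p t) \<le> apex p (Suc m)" using v unfolding V_def chain_def by metis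
    then show False using b Suc by (simp flip: bd_L)
  qed
qed

lemma V_crit: assumes "arrow p g q" shows "V p q (crit p g)"
proof -
  have f: "full p g" "q = apex p g" using arrow_full[OF assms] by auto
  have "chain (crit p g)"
    unfolding chain_def length_crit
  proof (intro allI impI)
    fix i assume i: "Suc i < Suc g"
    have "apex p i \<in> slot p i" "apex p (Suc i) \<in> slot p (Suc i)" using full_apex[OF f(1)] i by auto
    from slot_step[OF this] i
    show "L (crit p g ! i) \<le> crit p g ! Suc i \<and> crit p g ! Suc i \<le> crit p g ! i"
      by (simp add: crit_nth)
  qed
  then show ?thesis by (simp add: V_def crit_neq hd_crit last_crit f)
qed

text \<open>
  Take a chain that agrees with the apexes up to index \<open>k\<close> and continues with \<open>z\<close>. The gauge condition
  applies if \<open>z\<close> lies in slot \<open>k\<close>. Otherwise it lies in slot \<open>k + 1\<close>; insert the apex of this slot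
  before \<open>z\<close> and apply the cocycle condition to the longer list. All deletions but two leave lists
  that are no chains or that are covered by the gauge condition, and the remaining two relate the
  given chain to one that follows the apexes further. Iteration ends at the critical chain.
\<close>

lemma cocycle_rigid:
  fixes f :: "nat list \<Rightarrow> 'k::comm_ring_1"
  assumes supp: "\<And>z. f z \<noteq> 0 \<Longrightarrow> V p q z"
    and gauge: "\<And>k z zs. full p k \<Longrightarrow> z \<in> slot p k \<Longrightarrow> V p q (crit p k @ z # zs) \<Longrightarrow> f (crit p k @ z # zs) = 0"
    and crit: "\<And>g. arrow p g q \<Longrightarrow> f (crit p g) = 0"
    and cocycle: "\<And>x. V p q x \<Longrightarrow> bdry f x = 0"
  shows "f x = 0"
proof -
  have "f (crit p k @ zs) = 0" if "full p k" "V p q (crit p k @ zs)" for k zs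
    using that
  proof (induction zs arbitrary: k)
    case Nil
    then have "apex p k = q" by (simp add: V_def last_crit)
    then have "arrow p k q" using full_arrow[OF Nil(1)] by simp
    then show ?case using crit by simp
  next
    case (Cons z zs)
    show ?case
    proof (cases "z \<in> slot p k")
      case True
      then show ?thesis using gauge Cons.prems by blast
    next
      case False
      have "L ((crit p k @ z # zs) ! k) \<le> (crit p k @ z # zs) ! Suc k \<and>
          (crit p k @ z # zs) ! Suc k \<le> (crit p k @ z # zs) ! k"
        using Cons.prems(2) by (auto simp: V_def chain_def length_crit)
      then have z: "L (apex p k) \<le> z" "z \<le> apex p k"
        by (auto simp: nth_append length_crit crit_nth)
      have zs1: "z \<in> slot p (Suc k)"
        using z False full_apex[OF Cons.prems(1), of k] by (auto simp: slot_def simp flip: bd_L)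
      then have f1: "full p (Suc k)" using Cons.prems(1) by (auto simp: full_def slot_def le_Suc_eq)
      let ?y = "crit p (Suc k) @ z # zs"
      have vy: "V p q ?y"
      proof -
        have "chain ?y"
          unfolding chain_def
        proof (intro allI impI)
          fix i assume i: "Suc i < length ?y"
          consider "i < Suc k" | "i = Suc k" | "Suc k < i" by linarith
          then show "L (?y ! i) \<le> ?y ! Suc i \<and> ?y ! Suc i \<le> ?y ! i"
          proof cases
            case 1
            then show ?thesis
              using slot_step[of "apex p i" p i "apex p (Suc i)"] full_apex[OF f1, of i] full_apex[OF f1, of "Suc i"]
              by (simp add: nth_append length_crit crit_nth)
          next
            case 2
            have "bd p (Suc (Suc (Suc k))) \<le> bd p (Suc (Suc k))" by (rule bd_Suc_le)
            then show ?thesis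
              using 2 zs1 slot_le_apex[OF zs1] bd_L[of p "Suc k"]
              by (simp add: nth_append length_crit crit_nth slot_def del: bd.simps)
          next
            case 3
            then obtain i' where i': "i = Suc i'" "k < i'" by (cases i) auto
            have "?y ! i = (crit p k @ z # zs) ! i'" "?y ! Suc i = (crit p k @ z # zs) ! Suc i'"
              using i' by (auto simp: nth_append length_crit)
            moreover have "Suc i' < length (crit p k @ z # zs)" using i i' by (simp add: length_crit)
            ultimately show ?thesis using Cons.prems(2) by (simp add: V_def chain_def)
          qed
        qed
        then show ?thesis using Cons.prems(2) by (auto simp: V_def hd_crit crit_neq hd_append)
      qed
      have terms: "(-1) ^ m * f (del m ?y) = (if m = Suc k then (-1) ^ m * f (crit p k @ z # zs) else 0)"
        if "m < length ?y" for m
      proof -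
        consider "m < Suc k" | "m = Suc k" | "m = Suc (Suc k)" | "Suc (Suc k) < m" by linarith
        then show ?thesis
        proof cases
          case 1
          then have "\<not> V p q (del m ?y)"
            using del_crit_V[OF f1] by (simp add: del_append_left length_crit)
          then have "f (del m ?y) = 0" using supp by blast
          then show ?thesis using 1 by simp
        next
          case 2
          have "del (Suc k) (crit p (Suc k)) = crit p k"
            by (simp add: del_def crit_Suc length_crit)
          then show ?thesis using 2 by (simp add: del_append_left length_crit)
        next
          case 3
          then have e: "del m ?y = crit p (Suc k) @ zs"
            by (simp add: del_append_right length_crit) (simp add: del_def)
          have "f (crit p (Suc k) @ zs) = 0"
            using Cons.IH[OF f1] supp[of "crit p (Suc k) @ zs"] by blast
          then show ?thesis using 3 e by simp
        next
          case 4
          then obtain l where "m = Suc (Suc (Suc l)) + k" by (metis add.commute less_iff_Suc_add add_Suc_right)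
          then have e: "del m ?y = crit p (Suc k) @ z # del l zs"
            by (simp add: del_append_right length_crit) (simp add: del_def)
          have "f (crit p (Suc k) @ z # del l zs) = 0"
            using gauge[OF f1 zs1, of "del l zs"] supp[of "crit p (Suc k) @ z # del l zs"] by blast
          then show ?thesis using 4 e by simp
        qed
      qed
      have "0 = bdry f ?y" using cocycle[OF vy] by simp
      also have "\<dots> = (\<Sum>m<length ?y. if m = Suc k then (-1) ^ m * f (crit p k @ z # zs) else 0)"
        unfolding bdry_def using terms by (intro sum.cong) auto
      also have "\<dots> = (-1) ^ Suc k * f (crit p k @ z # zs)"
        by (subst sum.delta) (auto simp: length_crit)
      finally have "(-1) ^ k * ((-1) ^ k * f (crit p k @ z # zs)) = 0" by simp
      then show ?thesis by (simp flip: mult.assoc power_mult_distrib)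
    qed
  qed
  from this[of 0 "tl x"] have "V p q x \<Longrightarrow> f x = 0"
    by (cases x) (auto simp: crit_0 full_def V_def bd.simps(2))
  then show ?thesis using supp by blast
qed

section \<open>Exactness\<close>

text \<open>
  The contracting homotopy: prepend the top of the current interval \<open>{lo..<hi}\<close> of composition factors,
  then pass to the next syzygy. The recursion alternates between the interval and its successor.
\<close>

fun theta :: "nat \<Rightarrow> nat \<Rightarrow> (nat list \<Rightarrow> 'k::comm_ring_1) \<Rightarrow> nat list \<Rightarrow> 'k" where
  "theta lo hi f [] = 0"
| "theta lo hi f (x # xs) =
     (if lo \<le> x \<and> x < hi then f ((hi - 1) # x # xs) - theta (lam hi) lo (\<lambda>w. f ((hi - 1) # w)) xs else 0)"

text \<open>
  The lists of tops of the syzygies of the interval \<open>{lo..<hi}\<close> that end in \<open>q\<close>, that is the critical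
  chains for intervals.
\<close>

inductive top_chain :: "nat \<Rightarrow> nat \<Rightarrow> nat \<Rightarrow> nat list \<Rightarrow> bool" where
  "lo < Suc q \<Longrightarrow> top_chain lo (Suc q) q [q]"
| "lo < Suc y \<Longrightarrow> top_chain (lam (Suc y)) lo q w \<Longrightarrow> top_chain lo (Suc y) q (y # w)"

text \<open>
  Chains that start in the interval \<open>{lo..<hi}\<close> and end in \<open>q\<close> compute the extensions of the module
  with these composition factors by the simple module at \<open>q\<close>. Admitting all intervals is what makes
  the induction over syzygies possible.
\<close>

definition W :: "nat \<Rightarrow> nat \<Rightarrow> nat \<Rightarrow> nat list \<Rightarrow> bool" where
  "W lo hi q z \<longleftrightarrow> z \<noteq> [] \<and> lo \<le> hd z \<and> hd z < hi \<and> last z = q \<and> chain z"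

lemma chain_Cons: "chain (x # y # zs) \<longleftrightarrow> L x \<le> y \<and> y \<le> x \<and> chain (y # zs)"
proof
  assume c: "chain (x # y # zs)"
  have "L ((y # zs) ! i) \<le> (y # zs) ! Suc i \<and> (y # zs) ! Suc i \<le> (y # zs) ! i" if "Suc i < length (y # zs)" for i
    using c[unfolded chain_def, rule_format, of "Suc i"] that by simp
  moreover have "L x \<le> y \<and> y \<le> x" using c[unfolded chain_def, rule_format, of 0] by simp
  ultimately show "L x \<le> y \<and> y \<le> x \<and> chain (y # zs)" unfolding chain_def by blast
next
  assume c: "L x \<le> y \<and> y \<le> x \<and> chain (y # zs)"
  show "chain (x # y # zs)"
    unfolding chain_def
  proof (intro allI impI)
    fix i assume "Suc i < length (x # y # zs)"
    then show "L ((x # y # zs) ! i) \<le> (x # y # zs) ! Suc i \<and> (x # y # zs) ! Suc i \<le> (x # y # zs) ! i"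
      using c by (cases i) (auto simp: chain_def)
  qed
qed

lemma theta_degree: "theta lo hi f z \<noteq> 0 \<Longrightarrow> \<exists>u. length u = Suc (length z) \<and> f u \<noteq> 0"
proof (induction z arbitrary: lo hi f)
  case (Cons x xs)
  then consider "f ((hi - 1) # x # xs) \<noteq> 0" | "theta (lam hi) lo (\<lambda>w. f ((hi - 1) # w)) xs \<noteq> 0"
    by (cases "f ((hi - 1) # x # xs) = 0") (auto split: if_splits)
  then show ?case
  proof cases
    case 2
    from Cons.IH[OF 2] obtain u where "length u = Suc (length xs)" "f ((hi - 1) # u) \<noteq> 0" by blast
    then show ?thesis by (intro exI[of _ "(hi - 1) # u"]) simp
  qed (intro exI[of _ "(hi - 1) # x # xs"], simp)
qed simp

lemma theta_W:
  "(\<And>z. z \<noteq> [] \<Longrightarrow> f z \<noteq> 0 \<Longrightarrow> last z = q \<and> chain z) \<Longrightarrow> lam hi \<le> lo \<Longrightarrow> theta lo hi f z \<noteq> 0 \<Longrightarrow> W lo hi q z"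
proof (induction z arbitrary: lo hi f)
  case (Cons x xs)
  then have x: "lo \<le> x" "x < hi" by (auto split: if_splits)
  from Cons.prems(3) consider "f ((hi - 1) # x # xs) \<noteq> 0" | "theta (lam hi) lo (\<lambda>w. f ((hi - 1) # w)) xs \<noteq> 0"
    by (cases "f ((hi - 1) # x # xs) = 0") (auto split: if_splits)
  then show ?case
  proof cases
    case 1
    then have "last (x # xs) = q" "chain (x # xs)"
      using Cons.prems(1)[of "(hi - 1) # x # xs"] by (auto simp: chain_Cons)
    then show ?thesis using x by (simp add: W_def)
  next
    case 2
    have "lam lo \<le> lam hi" using x by (auto simp: lam_def intro!: mono_L)
    then have w: "W (lam hi) lo q xs"
    proof (intro Cons.IH[OF _ _ 2])
      fix z assume z: "z \<noteq> []" "f ((hi - 1) # z) \<noteq> 0"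
      then show "last z = q \<and> chain z"
        using Cons.prems(1)[of "(hi - 1) # z"] by (cases z) (auto simp: chain_Cons)
    qed
    then obtain b ys where xs: "xs = b # ys" by (cases xs) (auto simp: W_def)
    have "L x \<le> lam hi" using x by (auto simp: lam_def intro!: mono_L)
    then show ?thesis using w x xs by (auto simp: W_def chain_Cons)
  qed
qed simp

lemma chain_hd_del: "chain z \<Longrightarrow> del m z \<noteq> [] \<Longrightarrow> hd (del m z) \<le> hd z"
proof -
  assume c: "chain z" and ne: "del m z \<noteq> []"
  then have "z \<noteq> []" by (auto simp: del_def)
  have "hd (del m z) \<in> set z" using set_del_subset ne by (metis hd_in_set subsetD)
  then obtain i where "i < length z" "hd (del m z) = z ! i" by (metis in_set_conv_nth)
  then show ?thesis using c \<open>z \<noteq> []\<close>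
    by (cases "i = 0") (auto simp: chain_alt sorted_wrt_iff_nth_less hd_conv_nth)
qed

text \<open>
  With \<open>y\<close> the top of the interval, the cocycle condition for \<open>f\<close> on the chain \<open>y # x\<close> expresses \<open>f x\<close>
  through values of \<open>f\<close> on chains that begin with \<open>y\<close>. These form the coboundary of the first summand
  of \<open>theta\<close>, except when the deletion of the first entry of \<open>x\<close> leaves the interval. There the cochain
  \<open>\<lambda>w. f (y # w)\<close> is, up to this coboundary, a cocycle on the chains of the next syzygy, and the
  induction hypothesis supplies the second summand.
\<close>

lemma theta_exact:
  fixes f :: "nat list \<Rightarrow> 'k::comm_ring_1"
  assumes "\<And>z. z \<noteq> [] \<Longrightarrow> f z \<noteq> 0 \<Longrightarrow> last z = q \<and> chain z" and "lam hi \<le> lo"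
    and "\<And>w. top_chain lo hi q w \<Longrightarrow> f w = 0"
    and "\<And>y. W lo hi q y \<Longrightarrow> bdry (\<lambda>z. if W lo hi q z then f z else 0) y = 0"
    and "W lo hi q x"
  shows "bdry (theta lo hi f) x = f x"
  using assms
proof (induction x arbitrary: lo hi f)
  case Nil
  then show ?case by (simp add: W_def)
next
  case (Cons z w)
  note supp = Cons.prems(1) and lam = Cons.prems(2) and top = Cons.prems(3) and cocycle = Cons.prems(4)
  define y where "y = hi - 1"
  define g where "g = (\<lambda>u. f (y # u))"
  let ?R = "\<lambda>u. if W lo hi q u then f u else 0"
  have z: "lo \<le> z" "z < hi" and lq: "last (z # w) = q" and ch: "chain (z # w)"
    using Cons.prems(5) by (auto simp: W_def)
  have y: "hi = Suc y" "lo \<le> y" "z \<le> y" using z by (auto simp: y_def)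
  have Ly: "L y = lam hi" "L y \<le> z" using lam y z by (auto simp: lam_def)
  have Wy: "W lo hi q (y # z # w)" using lq ch y Ly by (auto simp: W_def chain_Cons)
  show ?case
  proof (cases w)
    case Nil
    have "f [z] = 0"
    proof (cases "z = y")
      case True
      then show ?thesis using top[of "[z]"] top_chain.intros(1)[of lo z] lq Nil y by auto
    next
      case False
      have "0 = bdry ?R [y, z]" using cocycle Wy Nil by simp
      also have "\<dots> = ?R [z] - ?R [y]" by (simp add: bdry_def del_def)
      also have "\<dots> = f [z]" using False Cons.prems(5) Nil by (auto simp: W_def)
      finally show ?thesis by simp
    qed
    then show ?thesis using Nil by (simp add: bdry_def del_def)
  next
    case (Cons b ws)
    have b: "L z \<le> b" "b \<le> z" "chain w" using ch Cons by (auto simp: chain_Cons)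
    let ?slot = "lo \<le> b"
    let ?T = "theta (lam hi) lo g"
    have th: "theta lo hi f (u # us) = f (y # u # us) - ?T us" if "lo \<le> u" "u < hi" for u us
      using that by (simp add: g_def y_def)
    have gs: "last u = q \<and> chain u" if "u \<noteq> []" "g u \<noteq> 0" for u
      using that supp[of "y # u"] by (cases u) (auto simp: g_def chain_Cons)
    have lam2: "lam lo \<le> lam hi" using z by (auto simp: lam_def intro!: mono_L)
    have R: "?R (y # u) = f (y # u)" if "u \<noteq> []" for u
      using supp[of "y # u"] that y by (auto simp: W_def)
    have delz: "del (Suc m) (z # w) = z # del m w" for m by (simp add: del_def)
    \<comment> \<open>the cocycle condition for \<open>f\<close>\<close>
    have "0 = bdry ?R (y # z # w)" using cocycle Wy by simp
    also have "\<dots> = ?R (z # w) - (?R (y # w) - (\<Sum>m<length w. (-1) ^ m * ?R (y # z # del m w)))"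
      by (simp add: bdry_def sum.lessThan_Suc_shift del_Cons sum_negf del: sum.lessThan_Suc cong: if_cong)
    also have "\<dots> = f (z # w) - f (y # w) + (\<Sum>m<length w. (-1) ^ m * f (y # z # del m w))"
    proof -
      have "?R (z # w) = f (z # w)" using Cons.prems(5) by simp
      moreover have "?R (y # w) = f (y # w)" by (rule R) (simp add: Cons)
      moreover have "?R (y # z # del m w) = f (y # z # del m w)" for m by (rule R) simp
      ultimately show ?thesis by (simp add: algebra_simps)
    qed
    finally have 1: "(\<Sum>m<length w. (-1) ^ m * f (y # z # del m w)) = f (y # w) - f (z # w)"
      by (simp add: algebra_simps)
    \<comment> \<open>the boundary of the contraction\<close>
    have "bdry (theta lo hi f) (z # w) =
        theta lo hi f w - (\<Sum>m<length w. (-1) ^ m * theta lo hi f (z # del m w))"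
      by (simp add: bdry_def sum.lessThan_Suc_shift del_Cons sum_negf del: sum.lessThan_Suc theta.simps)
    also have "(\<Sum>m<length w. (-1) ^ m * theta lo hi f (z # del m w)) =
        (\<Sum>m<length w. (-1) ^ m * f (y # z # del m w)) - bdry ?T w"
      unfolding th[OF z] by (simp add: bdry_def right_diff_distrib sum_subtractf)
    finally have 2: "bdry (theta lo hi f) (z # w) = theta lo hi f w - (f (y # w) - f (z # w)) + bdry ?T w"
      using 1 by simp
    have 3: "theta lo hi f w + bdry ?T w = f (y # w)"
    proof (cases ?slot)
      case True
      have T0: "?T (del (Suc m) w) = 0" for m
        using True Cons by (simp add: del_def)
      have "bdry ?T w = ?T ws"
        using Cons T0 by (simp add: bdry_def sum.lessThan_Suc_shift del: sum.lessThan_Suc theta.simps) (simp add: del_def)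
      then show ?thesis using th[of b ws] True b z Cons by simp
    next
      case False
      have 4: "theta lo hi f w = 0" using False Cons by simp
      show ?thesis
      proof (cases "lam hi \<le> b")
        case True
        have Ww: "W (lam hi) lo q w" using True False Cons b lq by (auto simp: W_def)
        have "bdry ?T w = g w"
        proof (rule Cons.IH[OF gs lam2 _ _ Ww])
          fix u assume "top_chain (lam hi) lo q u"
          then show "g u = 0" using top[of "y # u"] y top_chain.intros(2)[of lo y q u] by (simp add: g_def)
        next
          fix u assume u: "W (lam hi) lo q u"
          then obtain c us where us: "u = c # us" by (cases u) (auto simp: W_def)
          have Wyu: "W lo hi q (y # u)" using u us y Ly by (auto simp: W_def chain_Cons)
          have nu: "\<not> W lo hi q u" using u by (auto simp: W_def)
          have "(if W lo hi q (y # del m u) then f (y # del m u) else 0) =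
              (if W (lam hi) lo q (del m u) then g (del m u) else 0)" for m
          proof (cases "del m u")
            case Nil
            have "us = []" using Nil us by (cases m) (auto simp: del_def)
            then have "q < y" using u us y by (auto simp: W_def)
            then show ?thesis using Nil by (simp add: W_def)
          next
            case (Cons c' us')
            have "c' \<le> c" using chain_hd_del[of u m] u us Cons by (auto simp: W_def)
            then show ?thesis
              using supp[of "y # del m u"] Cons u us y Ly by (auto simp: W_def g_def chain_Cons)
          qed
          then have "bdry (\<lambda>v. if W (lam hi) lo q v then g v else 0) u =
              (\<Sum>m<length u. (-1) ^ m * ?R (y # del m u))"
            by (simp add: bdry_def)
          also have "\<dots> = ?R u - bdry ?R (y # u)"
            by (simp add: bdry_def sum.lessThan_Suc_shift del_Cons sum_negf del: sum.lessThan_Suc cong: if_cong)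
          also have "\<dots> = 0" using cocycle[OF Wyu] nu by simp
          finally show "bdry (\<lambda>v. if W (lam hi) lo q v then g v else 0) u = 0" .
        qed auto
        then show ?thesis using 4 by (simp add: g_def)
      next
        case False
        have "?T (del m w) = 0" for m
        proof (cases "del m w")
          case (Cons c us)
          then have "c \<le> b" using chain_hd_del[OF b(3), of m] \<open>w = b # ws\<close> by simp
          then show ?thesis using Cons False by simp
        qed simp
        then have "bdry ?T w = 0" by (simp add: bdry_def)
        moreover have "f (y # w) = 0" using supp[of "y # w"] False Cons Ly by (auto simp: chain_Cons)
        ultimately show ?thesis using 4 by simp
      qed
    qed
    show ?thesis using 2 3 by (simp add: algebra_simps)
  qed
qed

lemma top_chain_crit:
  "top_chain lo hi q w \<Longrightarrow> lo = bd p (Suc t) \<Longrightarrow> hi = bd p t \<Longrightarrow>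
   \<exists>g\<ge>t. (\<forall>s. t \<le> s \<and> s \<le> g \<longrightarrow> bd p (Suc s) < bd p s) \<and> bd p g = Suc q \<and> w = map (apex p) [t..<Suc g]"
proof (induction arbitrary: t rule: top_chain.induct)
  case (1 lo q)
  then show ?case by (intro exI[of _ t]) (auto simp: apex_def dest: le_antisym)
next
  case (2 lo y q w)
  have "lam (Suc y) = bd p (Suc (Suc t))" using 2 by (simp add: lam_def)
  then obtain g where g: "Suc t \<le> g" "\<forall>s. Suc t \<le> s \<and> s \<le> g \<longrightarrow> bd p (Suc s) < bd p s"
    "bd p g = Suc q" "w = map (apex p) [Suc t..<Suc g]"
    using 2(3)[of "Suc t"] 2 by blast
  have "y # w = map (apex p) [t..<Suc g]"
    using g 2 by (simp add: upt_conv_Cons[of t "Suc g"] del: upt_Suc) (simp add: apex_def)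
  moreover have "bd p (Suc s) < bd p s" if "t \<le> s" "s \<le> g" for s
    using that g(2) 2 by (cases "s = t") auto
  ultimately show ?case using g by (intro exI[of _ g]) auto
qed

text \<open>
  The case of \<open>theta_exact\<close> with interval \<open>{p..p}\<close>; the obstruction left by the induction over
  syzygies is the value on the critical chain.
\<close>

theorem cocycle_exact:
  fixes f :: "nat list \<Rightarrow> 'k::comm_ring_1"
  assumes supp: "\<And>z. f z \<noteq> 0 \<Longrightarrow> V p q z"
    and cocycle: "\<And>x. V p q x \<Longrightarrow> bdry f x = 0"
    and crit: "\<And>g. arrow p g q \<Longrightarrow> f (crit p g) = 0"
  obtains h where "\<And>z. h z \<noteq> 0 \<Longrightarrow> V p q z"
    "\<And>z. h z \<noteq> 0 \<Longrightarrow> \<exists>u. length u = Suc (length z) \<and> f u \<noteq> 0"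
    "\<And>x. V p q x \<Longrightarrow> bdry h x = f x"
proof
  let ?h = "theta p (Suc p) f"
  have WV: "W p (Suc p) q z \<longleftrightarrow> V p q z" for z by (auto simp: W_def V_def)
  have lam: "lam (Suc p) \<le> p" using L_le_self by (simp add: lam_def)
  have s: "last z = q \<and> chain z" if "f z \<noteq> 0" for z using supp[OF that] by (simp add: V_def)
  show "V p q z" if "?h z \<noteq> 0" for z
    using theta_W[of f q "Suc p" p z] s lam that WV by blast
  show "\<exists>u. length u = Suc (length z) \<and> f u \<noteq> 0" if "?h z \<noteq> 0" for z
    using that by (rule theta_degree)
  show "bdry ?h x = f x" if x: "V p q x" for x
  proof (rule theta_exact[of f q])
    fix w assume "top_chain p (Suc p) q w"
    then have "\<exists>g\<ge>0. (\<forall>s. 0 \<le> s \<and> s \<le> g \<longrightarrow> bd p (Suc s) < bd p s) \<and> bd p g = Suc q \<and>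
        w = map (apex p) [0..<Suc g]"
      by (rule top_chain_crit) simp_all
    then obtain g where "arrow p g q" "w = crit p g" unfolding arrow_def crit_def by blast
    then show "f w = 0" using crit[of g] by simp
  next
    fix y assume y: "W p (Suc p) q y"
    have "(\<lambda>z. if W p (Suc p) q z then f z else 0) = f" using supp WV by (intro ext) auto
    then show "bdry (\<lambda>z. if W p (Suc p) q z then f z else 0) y = 0" using cocycle y WV by simp
  qed (use s lam x WV in auto)
qed

end

context short_paths
begin

section \<open>Proof of the Maurer-Cartan equation\<close>

text \<open>
  On a list that starts with apexes only the cut after the first arrow can contribute: longer
  initial strings vanish on critical chains by \<open>tau_critical\<close>, and a single arrow of degree \<open>i\<close>
  takes exactly \<open>i\<close> steps.
\<close>

lemma cups_crit:
  assumes lk: "\<And>m. m \<le> k \<Longrightarrow> take (Suc m) y = crit p m" and len: "k < length y"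
    and gauge: "\<And>c m. c < length (p # q # js) \<Longrightarrow> k < m \<Longrightarrow> m < length y \<Longrightarrow>
      tau (pre c (p # q # js)) (take (Suc m) y) = (0::'k::comm_ring_1)"
  shows "cups (p # q # js) y =
    (if conn p q \<and> deg p q \<le> k then (-1) ^ deg p q * tau (q # js) (drop (deg p q) y) else (0::'k))"
proof -
  let ?j = "p # q # js"
  have t: "tau (pre c ?j) (crit p m) = (if c = 1 \<and> conn p q \<and> m = deg p q then 1 else (0::'k))"
    if "c < length ?j" for c m
  proof -
    consider "c = 0" | "c = 1" | r ks where "pre c ?j = p # q # r # ks" "c \<noteq> 1"
    proof (cases c)
      case (Suc c')
      show ?thesis
      proof (cases c')
        case 0
        then show ?thesis using that(2) Suc by simp
      next
        case (Suc c'')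
        then show ?thesis
          using \<open>c < length ?j\<close> \<open>c = Suc c'\<close> that(3)[of "hd js" "take c'' (tl js)"]
          by (cases js) (auto simp: pre_def)
      qed
    qed (use that(1) in simp)
    then show ?thesis
    proof cases
      case 1
      then show ?thesis by (simp add: pre_def)
    next
      case 2
      then show ?thesis
        by (simp add: pre_def crit_def tau_single_critical del: upt_Suc tau.simps)
    next
      case 3
      then show ?thesis by (simp add: crit_def tau_critical del: upt_Suc)
    qed
  qed
  have inner: "cup (tau (pre c ?j)) (tau (suf c ?j)) y =
      (if c = 1 then if conn p q \<and> deg p q \<le> k then (-1) ^ deg p q * tau (q # js) (drop (deg p q) y) else 0 else (0::'k))"
    if c: "c < length ?j" for c
  proof -
    have "cup (tau (pre c ?j)) (tau (suf c ?j)) y =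
        (\<Sum>m<length y. if m = deg p q then if c = 1 \<and> conn p q \<and> deg p q \<le> k
          then (-1) ^ deg p q * tau (q # js) (drop (deg p q) y) else 0 else (0::'k))"
      unfolding cup_def
    proof (rule sum.cong[OF refl])
      fix m assume m: "m \<in> {..<length y}"
      show "(-1) ^ m * tau (pre c ?j) (take (Suc m) y) * tau (suf c ?j) (drop m y) =
          (if m = deg p q then if c = 1 \<and> conn p q \<and> deg p q \<le> k
          then (-1) ^ deg p q * tau (q # js) (drop (deg p q) y) else 0 else (0::'k))"
      proof (cases "m \<le> k")
        case True
        then show ?thesis using t[OF c, of m] lk[OF True] by (auto simp: suf_def)
      next
        case False
        then show ?thesis using gauge[OF c, of m] m by auto
      qed
    qed
    also have "\<dots> = (if c = 1 then if conn p q \<and> deg p q \<le> k then (-1) ^ deg p q * tau (q # js) (drop (deg p q) y) else 0 else 0)"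
      using len by (subst sum.delta) auto
    finally show ?thesis .
  qed
  have "cups ?j y = (\<Sum>c<length ?j. if c = 1 then if conn p q \<and> deg p q \<le> k
      then (-1) ^ deg p q * tau (q # js) (drop (deg p q) y) else 0 else (0::'k))"
    unfolding cups_def using inner by (intro sum.cong) auto
  also have "\<dots> = (if conn p q \<and> deg p q \<le> k then (-1) ^ deg p q * tau (q # js) (drop (deg p q) y) else 0)"
    by (subst sum.delta) auto
  finally show ?thesis .
qed

lemma ctr_Cons2: "u < v \<Longrightarrow> v < length (p # q # js) \<Longrightarrow> \<exists>r rs. ctr u v (p # q # js) = p # r # rs"
proof -
  assume uv: "u < v" "v < length (p # q # js)"
  then have "2 \<le> length (ctr u v (p # q # js))" by (simp add: length_part)
  moreover have "hd (ctr u v (p # q # js)) = p" using uv by (simp add: part_hd_last)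
  ultimately show ?thesis
    by (metis Suc_le_length_iff numeral_2_eq_2 list.sel(1))
qed

lemma contr_gauge:
  assumes "z \<in> slot p k" shows "contr (p # q # js) (crit p k @ z # zs) = (0::'k::comm_ring_1)"
  unfolding contr_def
proof (rule sum.neutral, clarify)
  fix u v assume "(u, v) \<in> pairs (p # q # js)"
  then obtain r rs where "ctr u v (p # q # js) = p # r # rs"
    using ctr_Cons2[of u v p q js] by (auto simp: pairs_def)
  then show "sg (red (pre u (p # q # js))) * mu (blk u v (p # q # js)) *
      tau (ctr u v (p # q # js)) (crit p k @ z # zs) = (0::'k)"
    using tau_gauge[OF assms, of r rs zs, where ?'k = 'k] by (simp add: crit_def del: upt_Suc)
qed

lemma bdry_gauge:
  assumes f: "full p k" and z: "z \<in> slot p k"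
  shows "bdry (tau (p # q # js)) (crit p k @ z # zs) =
    (-1) ^ k * (tau (p # q # js) (map (apex p) [0..<k] @ z # zs) - (tau (p # q # js) (crit p k @ zs) :: 'k::comm_ring_1))"
proof -
  let ?j = "p # q # js" and ?y = "crit p k @ z # zs"
  let ?a = "tau ?j (map (apex p) [0..<k] @ z # zs) :: 'k" and ?b = "tau ?j (crit p k @ zs) :: 'k"
  have "bdry (tau ?j) ?y =
      (\<Sum>m<length ?y. (if m = k then (-1) ^ k * ?a else 0) + (if m = Suc k then (-1) ^ Suc k * ?b else 0))"
    unfolding bdry_def
  proof (rule sum.cong[OF refl])
    fix m assume "m \<in> {..<length ?y}"
    consider "m < k" | "m = k" | "m = Suc k" | "Suc k < m" by linarith
    then show "(-1) ^ m * tau ?j (del m ?y) =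
        (if m = k then (-1) ^ k * ?a else 0) + (if m = Suc k then (-1) ^ Suc k * ?b else 0)"
    proof cases
      case 1
      then have "tau ?j (del m ?y) = (0::'k)"
        using del_crit_tau[OF f 1] by (simp add: del_append_left length_crit)
      then show ?thesis using 1 by simp
    next
      case 2
      have "del k (crit p k) = map (apex p) [0..<k]" by (simp add: del_def crit_def)
      then show ?thesis using 2 by (simp add: del_append_left length_crit)
    next
      case 3
      then have "del m ?y = crit p k @ zs" by (simp add: del_append_right length_crit del_Cons)
      then show ?thesis using 3 by simp
    next
      case 4
      then obtain l where "m = Suc (Suc k) + l" using less_iff_Suc_add by auto
      then have "del m ?y = crit p k @ z # del l zs" by (simp add: del_append_right length_crit del_Cons)
      then show ?thesis using 4 tau_gauge[OF z, of q js "del l zs", where ?'k = 'k] by (simp add: crit_def del: upt_Suc)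
    qed
  qed
  also have "\<dots> = (-1) ^ k * ?a + (-1) ^ Suc k * ?b"
  proof -
    have "(\<Sum>m<length ?y. if m = k then X else 0) = X" "(\<Sum>m<length ?y. if m = Suc k then X else 0) = X"
      for X :: 'k
      by (subst sum.delta; simp add: length_crit)+
    then show ?thesis by (simp only: sum.distrib)
  qed
  finally show ?thesis by (simp add: algebra_simps)
qed

text \<open>
  On these lists the recursion that defines \<open>tau\<close> is the Maurer-Cartan equation: by the gauge
  condition only the deletions of the last apex and of \<open>z\<close> survive in the differential.
\<close>

lemma mc_gauge:
  assumes f: "full p k" and z: "z \<in> slot p k" and v: "V p (last (q # js)) (crit p k @ z # zs)"
  shows "mc_defect (p # q # js) (crit p k @ z # zs) = (0::'k::comm_ring_1)"
proof -
  let ?j = "p # q # js" and ?y = "crit p k @ z # zs" and ?i = "deg p q"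
  let ?A = "map (apex p) [0..<k] @ z # zs" and ?B = "crit p k @ zs"
  have tk: "take (Suc m) ?y = crit p m" if "m \<le> k" for m
    using take_crit[OF that] that by (simp add: length_crit)
  have A: "?A ! t = (if t < k then apex p t else if t = k then z else zs ! (t - Suc k))" for t
    by (auto simp: nth_append nth_Cons')
  have B: "?B ! t = (if t < k then apex p t else if t = k then apex p k else zs ! (t - Suc k))" for t
    by (auto simp: nth_append length_crit crit_nth)
  have len: "length ?A = Suc k + length zs" "length ?B = Suc k + length zs" by (auto simp: length_crit)
  have fits: "fits p ?A K = fits p ?B K" for K
    unfolding fits_def A B using z full_apex[OF f, of k] by auto
  have cups: "cups ?j ?y = (if conn p q \<and> ?i \<le> k then (-1) ^ ?i * tau (q # js) (drop ?i ?y) else (0::'k))"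
  proof (rule cups_crit)
    fix c m assume "c < length ?j" "k < m"
    then obtain ws where w: "take (Suc m) ?y = crit p k @ z # ws" by (auto simp: length_crit take_Cons')
    show "tau (pre c ?j) (take (Suc m) ?y) = (0::'k)"
    proof (cases c)
      case (Suc c')
      then obtain r rs where "pre c ?j = p # q # rs" by (auto simp: pre_def)
      then show ?thesis unfolding w using tau_gauge[OF z, of q rs ws, where ?'k = 'k] by (simp add: crit_def del: upt_Suc)
    qed (simp add: pre_def)
  qed (use tk length_crit in auto)
  have "(-1) ^ k * (tau ?j ?A - tau ?j ?B) = (cups ?j ?y :: 'k)"
  proof (cases "conn p q")
    case False
    then have "tau ?j ?A = (0::'k)" "tau ?j ?B = (0::'k)" by (cases js; simp)+
    then show ?thesis using cups False by simp
  next
    case pq: True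
    show ?thesis
    proof (cases js)
      case Nil
      have "last ?A = q" using v Nil by (cases zs) (auto simp: V_def)
      moreover have "last ?B = q" if "zs \<noteq> [] \<or> k = ?i"
      proof (cases zs)
        case Nil
        then show ?thesis using that arrow_apex[OF conn_arrow[OF pq]] by (simp add: last_crit)
      next
        case Cons
        then show ?thesis using v \<open>js = []\<close> by (auto simp: V_def)
      qed
      ultimately have "tau ?j ?A = (tau ?j ?B :: 'k)"
        using fits len Nil by (cases zs) auto
      then show ?thesis using cups Nil by simp
    next
      case (Cons r rs)
      let ?t = "\<lambda>w. tau (q # r # rs) w :: 'k"
      let ?S = "\<lambda>X K. if ?i \<le> K \<and> fits p X K \<and> X ! K \<noteq> apex p K then (-1) ^ (K - ?i) * ?t (lift p ?i K X) else 0"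
      have "tau ?j X = (\<Sum>K<length X. ?S X K)" for X using pq Cons by simp
      then have "tau ?j ?A - tau ?j ?B = (\<Sum>K<Suc k + length zs. ?S ?A K - ?S ?B K)"
        using len by (simp only: sum_subtractf)
      also have "\<dots> = (\<Sum>K<Suc k + length zs. if K = k then ?S ?A k else 0)"
      proof (rule sum.cong[OF refl])
        fix K
        consider "K < k" | "K = k" | "k < K" by linarith
        then show "?S ?A K - ?S ?B K = (if K = k then ?S ?A k else 0)"
        proof cases
          case 1
          then show ?thesis by (simp add: A B)
        next
          case 2
          then show ?thesis by (simp add: B)
        next
          case 3
          then have "?A ! K = ?B ! K" "drop K ?A = drop K ?B" by (auto simp: A B length_crit drop_Cons')
          then show ?thesis using 3 fits by (simp add: lift_def)
        qed
      qed
      also have "\<dots> = ?S ?A k" by (subst sum.delta) auto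
      also have "\<dots> = (if ?i \<le> k then (-1) ^ (k - ?i) * ?t (drop ?i ?y) else 0)"
      proof (cases "?i \<le> k \<and> z \<noteq> apex p k")
        case True
        have "fits p ?A k" unfolding fits_def A using z full_apex[OF f] by auto
        moreover have "lift p ?i k ?A = drop ?i ?y"
          using True by (simp add: lift_def crit_def drop_map del: upt_Suc)
        ultimately show ?thesis using True by (simp add: A)
      next
        case False
        have "?t (drop ?i ?y) = 0" if i: "?i \<le> k" "z = apex p k"
        proof (rule ccontr)
          assume nz: "?t (drop ?i ?y) \<noteq> 0"
          have lt: "Suc (k - ?i) < length (drop ?i ?y)" using i by (simp add: length_crit)
          have "drop ?i ?y ! (k - ?i) = ?y ! k" "drop ?i ?y ! Suc (k - ?i) = ?y ! Suc k"
            using i by (subst nth_drop; simp add: length_crit)+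
          moreover have "?y ! k = z" "?y ! Suc k = z" using i by (auto simp: nth_append length_crit crit_nth)
          ultimately have e: "drop ?i ?y ! (k - ?i) = z" "drop ?i ?y ! Suc (k - ?i) = z" by argo+
          from tau_decreasing[OF nz lt] show False unfolding e by simp
        qed
        then show ?thesis using False by (auto simp: A)
      qed
      finally have "(-1) ^ k * (tau ?j ?A - tau ?j ?B) = (if ?i \<le> k then (-1) ^ k * (-1) ^ (k - ?i) * ?t (drop ?i ?y) else 0)"
        by (simp add: mult.assoc)
      moreover have "(-1) ^ k * (-1) ^ (k - ?i) = ((-1) ^ ?i :: 'k)" if "?i \<le> k"
        using that by (simp add: minus_one_power_iff)
      ultimately show ?thesis using cups pq Cons by (simp del: tau.simps)
    qed
  qed
  then show ?thesis
    unfolding mc_defect_def contr_gauge[OF z] bdry_gauge[OF f z] by simp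
qed

text \<open>
  Every deletion leaves the slots or shortens the critical chain, so the differential contributes
  nothing. The product term is evaluated by \<open>tau_tail\<close>, and the only contraction that is left is that
  of the whole string. Both give \<open>mu\<close>.
\<close>

lemma mc_crit:
  assumes a: "arrow p g (last (q # js))"
  shows "mc_defect (p # q # js) (crit p g) = (0::'k::comm_ring_1)"
proof -
  let ?j = "p # q # js" and ?i = "deg p q" and ?s = "last (q # js)"
  have f: "full p g" "?s = apex p g" using arrow_full[OF a] by auto
  have dg: "deg p ?s = g" and cs: "conn p ?s" using a deg_eq conn_def by auto
  have b: "bdry (tau ?j) (crit p g) = (0::'k)"
    unfolding bdry_def
  proof (rule sum.neutral, clarify)
    fix m assume "m < length (crit p g)"
    then consider "m < g" | "m = g" by (auto simp: length_crit less_Suc_eq)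
    then have "tau ?j (del m (crit p g)) = (0::'k)"
    proof cases
      case 1
      then show ?thesis using del_crit_tau[OF f(1) 1, of q js "[]"] by simp
    next
      case 2
      have "del m (crit p g) = map (apex p) [0..<g]" using 2 by (simp add: del_def crit_def)
      then show ?thesis
        using tau_single_critical[of p q g, where ?'k = 'k] tau_critical[of p q "hd js" "tl js" g, where ?'k = 'k] dg
        by (cases js) auto
    qed
    then show "(-1) ^ m * tau ?j (del m (crit p g)) = (0::'k)" by simp
  qed
  have "contr ?j (crit p g) = (\<Sum>(u, v)\<in>{(0, Suc (length js))}. sg (red (pre u ?j)) * mu (blk u v ?j) * (tau (ctr u v ?j) (crit p g) :: 'k))"
    unfolding contr_def
  proof (rule sum.mono_neutral_right[OF finite_pairs])
    show "{(0, Suc (length js))} \<subseteq> pairs ?j" by (auto simp: pairs_def)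
    show "\<forall>i\<in>pairs ?j - {(0, Suc (length js))}.
        (case i of (u, v) \<Rightarrow> sg (red (pre u ?j)) * mu (blk u v ?j) * (tau (ctr u v ?j) (crit p g) :: 'k)) = 0"
    proof
      fix i assume i: "i \<in> pairs ?j - {(0, Suc (length js))}"
      obtain u v where uv: "i = (u, v)" by (cases i)
      then have *: "u < v" "v < length ?j" "\<not> (u = 0 \<and> v = Suc (length js))" using i by (auto simp: pairs_def)
      then have "3 \<le> length (ctr u v ?j)" by (auto simp: length_part)
      moreover obtain r rs where "ctr u v ?j = p # r # rs" using ctr_Cons2[OF *(1,2)] by blast
      ultimately obtain r' rs' where "ctr u v ?j = p # r # r' # rs'" by (cases rs) auto
      then have "tau (ctr u v ?j) (crit p g) = (0::'k)" by (simp add: crit_def tau_critical del: upt_Suc tau.simps)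
      then show "(case i of (u, v) \<Rightarrow> sg (red (pre u ?j)) * mu (blk u v ?j) * (tau (ctr u v ?j) (crit p g) :: 'k)) = 0"
        using uv by simp
    qed
  qed
  also have "\<dots> = mu ?j"
    using blk_full[of ?j] ctr_full[of ?j] tau_single_critical[of p ?s "Suc g", where ?'k = 'k] cs dg
    by (simp add: pre_def sg_def crit_def del: upt_Suc tau.simps)
  finally have c: "contr ?j (crit p g) = (mu ?j :: 'k)" .
  have cu: "cups ?j (crit p g) = (if conn p q \<and> ?i \<le> g then (-1) ^ ?i * tau (q # js) (drop ?i (crit p g)) else (0::'k))"
    by (rule cups_crit) (auto simp: take_crit length_crit)
  have "cups ?j (crit p g) = (mu ?j :: 'k)"
  proof (cases js)
    case Nil
    then show ?thesis unfolding cu by (simp add: mu_short)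
  next
    case (Cons r rs)
    show ?thesis
    proof (cases "conn p q")
      case True
      have "mu ?j = (-1) ^ ?i * (tau (q # r # rs) (map (apex p) [?i..<Suc g]) :: 'k)"
        using tau_tail(1)[of p r rs q, where ?'k = 'k] cs dg True Cons by (simp del: upt_Suc tau.simps)
      also have "map (apex p) [?i..<Suc g] = drop ?i (crit p g)" by (simp add: crit_def drop_map del: upt_Suc)
      finally have m: "mu ?j = (-1) ^ ?i * (tau (q # r # rs) (drop ?i (crit p g)) :: 'k)" .
      show ?thesis
      proof (cases "?i \<le> g")
        case False
        then have "tau (q # r # rs) (drop ?i (crit p g)) = (0::'k)"
          using tau_linked[of "q # r # rs" "drop ?i (crit p g)"] by (auto simp: length_crit)
        then show ?thesis using cu m False by simp
      qed (use cu m True Cons in \<open>simp del: tau.simps\<close>)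
    next
      case False
      then show ?thesis using cu by (simp add: mu_def linked_simps)
    qed
  qed
  then show ?thesis using b c by (simp add: mc_defect_def)
qed

lemma bdry_crit:
  assumes a: "arrow p g q" and supp: "\<And>z. f z \<noteq> (0::'k::comm_ring_1) \<Longrightarrow> V p q z"
  shows "bdry f (crit p g) = 0"
  unfolding bdry_def
proof (rule sum.neutral, clarify)
  have f: "full p g" "q = apex p g" using arrow_full[OF a] by auto
  fix m assume "m < length (crit p g)"
  then consider "m < g" | "m = g" by (auto simp: length_crit less_Suc_eq)
  then have "\<not> V p q (del m (crit p g))"
  proof cases
    case 1
    then show ?thesis using del_crit_V[OF f(1) 1, of q "[]"] by simp
  next
    case 2
    show ?thesis
    proof (cases g)
      case 0
      then show ?thesis using 2 by (simp add: crit_0 V_def del_Cons)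
    next
      case (Suc g')
      have "del m (crit p g) = crit p g'" using 2 Suc by (simp add: del_def crit_Suc length_crit)
      moreover have "apex p g' \<noteq> apex p g"
        using full_apex[OF f(1), of g'] full_apex[OF f(1), of g] Suc slot_disjoint[of "apex p g" p g' g] by auto
      ultimately show ?thesis using f by (simp add: V_def last_crit)
    qed
  qed
  then show "(-1) ^ m * f (del m (crit p g)) = 0" using supp by force
qed

text \<open>
  Induction on the length of the string. By \<open>bdry_mc\<close> the differential of the defect is
  \<open>ainf_defect j\<close> times the component of a single arrow. Evaluation on the critical chain, where no
  coboundary can be nonzero, shows that \<open>ainf_defect j = 0\<close>. So the defect is a cocycle, which
  vanishes on the gauge chains and on the critical chain, and hence everywhere by \<open>cocycle_rigid\<close>.
\<close>

theorem maurer_cartan: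
  "(\<forall>z. V (hd j) (last j) z \<longrightarrow> mc_defect j z = (0::'k::comm_ring_1)) \<and> ainf_defect j = (0::'k)"
proof (induction j rule: length_induct)
  case (1 j)
  show ?case
  proof (cases "2 \<le> length j")
    case False
    then have "j = [] \<or> (\<exists>p. j = [p])" by (cases j; cases "tl j") auto
    then have "pairs j = {}" "cups j z = (0::'k)" "tau j z = (0::'k)" for z
      by (auto simp: pairs_def cups_def cup_def pre_def)
    then show ?thesis by (simp add: mc_defect_def ainf_defect_def contr_def bdry_def)
  next
    case True
    then obtain p q js where j: "j = p # q # js" by (metis Suc_le_length_iff numeral_2_eq_2)
    define s where "s = last j"
    have s: "s = last (q # js)" by (simp add: s_def j)
    define f where "f = (\<lambda>z. if V p s z then mc_defect j z else (0::'k))"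
    have cocycle: "bdry f x = ainf_defect j * tau [p, s] x" if "V p s x" for x
      using bdry_mc[of j x, where ?'k = 'k] 1 True that by (simp add: f_def j s_def)
    have supp: "V p s z" if "f z \<noteq> 0" for z using that by (auto simp: f_def split: if_splits)
    have ainf_defect: "ainf_defect j = (0::'k)"
    proof (cases "conn p s")
      case True
      then have a: "arrow p (deg p s) s" by (rule conn_arrow)
      have "0 = bdry f (crit p (deg p s))" using bdry_crit[OF a supp] by simp
      also have "\<dots> = ainf_defect j * tau [p, s] (crit p (deg p s))" by (rule cocycle[OF V_crit[OF a]])
      also have "\<dots> = ainf_defect j"
        using tau_single_critical[of p s "Suc (deg p s)", where ?'k = 'k] True by (simp add: crit_def del: tau.simps upt_Suc)
      finally show ?thesis ..
    next
      case False
      then have "mu (ctr u v j) = (0::'k)" if "(u, v) \<in> pairs j" for u v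
        using that part_hd_last(7,8)[of u v j] by (simp add: mu_def pairs_def s_def j)
      then show ?thesis unfolding ainf_defect_def by (intro sum.neutral) auto
    qed
    have "f z = 0" for z
    proof (rule cocycle_rigid[OF supp])
      fix k z zs assume "full p k" "z \<in> slot p k" "V p s (crit p k @ z # zs)"
      then have "mc_defect j (crit p k @ z # zs) = (0::'k)" unfolding j s by (rule mc_gauge)
      then show "f (crit p k @ z # zs) = 0" by (simp add: f_def)
    next
      fix g assume "arrow p g s"
      then have "mc_defect j (crit p g) = (0::'k)" unfolding j s by (rule mc_crit)
      then show "f (crit p g) = 0" by (simp add: f_def)
    next
      fix x assume "V p s x"
      then show "bdry f x = 0" using cocycle ainf_defect by simp
    qed
    then have "mc_defect j z = (0::'k)" if "V p s z" for z using that by (metis f_def)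
    then show ?thesis using ainf_defect by (simp add: j s_def)
  qed
qed

end

section \<open>The category of the path algebra\<close>

lemma in_listset: "as \<in> listset Vs \<longleftrightarrow> length as = length Vs \<and> (\<forall>i<length Vs. as ! i \<in> Vs ! i)"
proof (induction Vs arbitrary: as)
  case (Cons V Vs)
  have "as \<in> listset (V # Vs) \<longleftrightarrow> (\<exists>x xs. as = x # xs \<and> x \<in> V \<and> xs \<in> listset Vs)"
    by (auto simp: set_Cons_def)
  also have "\<dots> \<longleftrightarrow> length as = length (V # Vs) \<and> (\<forall>i<length (V # Vs). as ! i \<in> (V # Vs) ! i)"
    by (cases as) (auto simp: Cons.IH less_Suc_eq_0_disj)
  finally show ?case .
qed auto

lemma graded_space_single:
  assumes vs: "vector_space scl" and sub: "module.subspace scl (V g0)" and z: "\<And>g. g \<noteq> g0 \<Longrightarrow> V g = {0}"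
  shows "graded_space scl V"
proof -
  interpret vector_space scl by fact
  have "subspace (V g)" for g using sub z by (cases "g = g0") auto
  moreover have "x g = 0"
    if x: "\<forall>g. x g \<in> V g" "(\<Sum>g | x g \<noteq> 0. x g) = 0" for x g
  proof -
    have *: "x g = 0" if "g \<noteq> g0" for g using x(1) z[OF that] by auto
    have "x g0 = 0"
    proof (rule ccontr)
      assume "x g0 \<noteq> 0"
      then have "{g. x g \<noteq> 0} = {g0}" using * by auto
      then show False using x(2) \<open>x g0 \<noteq> 0\<close> by simp
    qed
    then show ?thesis using * by (cases "g = g0") auto
  qed
  ultimately show ?thesis unfolding graded_space_def by blast
qed

text \<open>
  Shifting \<open>d_fun\<close> by one turns the value \<open>-\<infinity>\<close> into \<open>0\<close>: a nonzero path to \<open>p\<close> has to start after the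
  largest start of a relation that ends at or before \<open>p\<close>.
\<close>

definition least_start :: "nat \<Rightarrow> (nat \<Rightarrow> nat) \<Rightarrow> (nat \<Rightarrow> nat) \<Rightarrow> nat \<Rightarrow> nat" where
  "least_start m s t p = (case d_fun m s t p of None \<Rightarrow> 0 | Some x \<Rightarrow> Suc x)"

locale path_relations =
  fixes n m :: nat and s t :: "nat \<Rightarrow> nat"
  assumes gap: "j \<in> {1..m} \<Longrightarrow> s j + 2 \<le> t j" and t_le: "j \<in> {1..m} \<Longrightarrow> t j \<le> n"
begin

lemma least_start_le_iff: "least_start m s t p \<le> i \<longleftrightarrow> (\<forall>j\<in>{1..m}. t j \<le> p \<longrightarrow> s j < i)"
proof (cases "\<exists>j\<in>{1..m}. t j \<le> p")
  case True
  let ?S = "{s j | j. j \<in> {1..m} \<and> t j \<le> p}"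
  have fin: "finite ?S" by simp
  have "?S \<noteq> {}" using True by blast
  then have "Suc (Max ?S) \<le> i \<longleftrightarrow> (\<forall>x\<in>?S. x < i)" using fin by (simp add: Suc_le_eq del: ex_in_conv)
  moreover have "(\<forall>x\<in>?S. x < i) \<longleftrightarrow> (\<forall>j\<in>{1..m}. t j \<le> p \<longrightarrow> s j < i)" by blast
  moreover have "least_start m s t p = Suc (Max ?S)" using True by (simp add: least_start_def d_fun_def)
  ultimately show ?thesis by (simp only:)
next
  case False
  then show ?thesis by (auto simp: least_start_def d_fun_def)
qed

sublocale short_paths "least_start m s t"
proof
  show "x \<le> y \<Longrightarrow> least_start m s t x \<le> least_start m s t y" for x y
    unfolding least_start_le_iff using least_start_le_iff[of y "least_start m s t y"] by (meson le_trans order_refl)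
  show "least_start m s t x \<le> x - 1" for x
    unfolding least_start_le_iff using gap by fastforce
qed

abbreviation "P \<equiv> path_algebra n :: (nat \<times> nat \<Rightarrow> 'k::field) ring"
abbreviation "A \<equiv> A_ST n m s t :: (nat, 'k::field, nat \<times> nat \<Rightarrow> 'k) ainf"
abbreviation "nf \<equiv> normal_form n m s t :: (nat \<times> nat \<Rightarrow> 'k::field) \<Rightarrow> _"

definition short :: "nat \<Rightarrow> nat \<Rightarrow> bool" where
  "short i j \<longleftrightarrow> least_start m s t j \<le> i \<and> i \<le> j"

text \<open>
  Every morphism space of \<open>A_ST\<close> is spanned by one path, so its elements are of this form.
\<close>

definition scaled_path :: "'k::field \<Rightarrow> nat \<Rightarrow> nat \<Rightarrow> nat \<times> nat \<Rightarrow> 'k" where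
  "scaled_path c i j = (\<lambda>p. c * path i j p)"

lemma scaled_path_apply: "scaled_path c i j (i, j) = c"
  by (simp add: scaled_path_def path_def)

lemma scaled_path_0: "scaled_path 0 i j = 0"
  by (simp add: scaled_path_def fun_eq_iff)

lemma scaled_path_1: "scaled_path 1 i j = path i j"
  by (simp add: scaled_path_def)

lemma scaled_path_add: "scaled_path c i j + scaled_path d i j = scaled_path (c + d) i j"
  by (simp add: scaled_path_def fun_eq_iff distrib_right)

lemma scaled_path_carrier: "i \<le> j \<Longrightarrow> j \<le> n \<Longrightarrow> scaled_path c i j \<in> carrier P"
  by (rule path_carrierI) (auto simp: scaled_path_def path_def split: if_splits)

lemma rel: "j \<in> {1..m} \<Longrightarrow> s j \<le> t j \<and> t j \<le> n"
  using gap t_le by fastforce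

lemma scaled_path_mult:
  assumes "i \<le> j" "j \<le> k" "k \<le> n"
  shows "scaled_path d j k \<otimes>\<^bsub>P\<^esub> scaled_path c i j = (scaled_path (c * d) i k :: nat \<times> nat \<Rightarrow> 'k::field)"
proof (rule ext, clarify)
  fix r l
  have cc: "scaled_path c i j \<in> carrier P" "scaled_path d j k \<in> carrier P" using assms by (auto intro!: scaled_path_carrier)
  have "(scaled_path d j k \<otimes>\<^bsub>P\<^esub> scaled_path c i j) (r, l) = (\<Sum>q\<le>n. if q = j then (if r = i \<and> l = k then c * d else 0) else 0)"
    unfolding path_mult_eq[OF cc] by (intro sum.cong) (auto simp: scaled_path_def path_def)
  also have "\<dots> = scaled_path (c * d) i k (r, l)" using assms by (auto simp: scaled_path_def path_def)
  finally show "(scaled_path d j k \<otimes>\<^bsub>P\<^esub> scaled_path c i j) (r, l) = scaled_path (c * d) i k (r, l)" .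
qed

text \<open>
  The paths that contain a relation span a two-sided ideal, which bounds the relation ideal from above.
\<close>

lemma long_ideal:
  "ideal {x \<in> carrier P. \<forall>i j. least_start m s t j \<le> i \<longrightarrow> x (i, j) = (0::'k::field)} P"
    (is "ideal ?J P")
proof (rule idealI[OF path_algebra_ring])
  interpret ring P by (rule path_algebra_ring)
  show "subgroup ?J (add_monoid P)"
  proof (rule group.subgroupI)
    show "Group.group (add_monoid P)" by (rule a_group)
    show "?J \<subseteq> carrier (add_monoid P)" by auto
    have "(0 :: nat \<times> nat \<Rightarrow> 'k) \<in> ?J" by (simp add: path_algebra_def)
    then show "?J \<noteq> {}" by blast
  next
    fix x assume x: "x \<in> ?J"
    have "- x \<in> carrier P" using x path_carrierD[of x n] by (intro path_carrierI) auto
    moreover have "- x \<oplus>\<^bsub>P\<^esub> x = \<zero>\<^bsub>P\<^esub>" by (simp add: path_algebra_add)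
    ultimately have "\<ominus>\<^bsub>P\<^esub> x = - x" using x by (intro minus_equality) auto
    then have "inv\<^bsub>add_monoid P\<^esub> x = - x" by (simp add: a_inv_def)
    then show "inv\<^bsub>add_monoid P\<^esub> x \<in> ?J" using x \<open>- x \<in> carrier P\<close> by simp
  next
    fix x y assume x: "x \<in> ?J" and y: "y \<in> ?J"
    then have "x \<oplus>\<^bsub>P\<^esub> y \<in> carrier P" by (intro a_closed) auto
    then show "x \<otimes>\<^bsub>add_monoid P\<^esub> y \<in> ?J" using x y by (simp add: path_algebra_add)
  qed
next
  fix a x :: "nat \<times> nat \<Rightarrow> 'k" assume a: "a \<in> ?J" and x: "x \<in> carrier P"
  have ac: "a \<in> carrier P" using a by simp
  have "(x \<otimes>\<^bsub>P\<^esub> a) (i, l) = 0" if "least_start m s t l \<le> i" for i l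
    unfolding path_mult_eq[OF ac x]
  proof (rule sum.neutral, rule ballI)
    fix q
    show "x (q, l) * a (i, q) = 0"
    proof (cases "x (q, l) = 0")
      case False
      then have "q \<le> l" using path_carrierD[OF x] by blast
      then have "least_start m s t q \<le> i" using mono_L[of q l] that by simp
      then show ?thesis using a by simp
    qed simp
  qed
  then show "x \<otimes>\<^bsub>P\<^esub> a \<in> ?J" using path_mult_closed[OF ac x] by simp
  have "(a \<otimes>\<^bsub>P\<^esub> x) (i, l) = 0" if "least_start m s t l \<le> i" for i l
    unfolding path_mult_eq[OF x ac]
  proof (rule sum.neutral, rule ballI)
    fix q
    show "a (q, l) * x (i, q) = 0"
    proof (cases "x (i, q) = 0")
      case False
      then have "i \<le> q" using path_carrierD[OF x] by blast
      then show ?thesis using a that by simp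
    qed simp
  qed
  then show "a \<otimes>\<^bsub>P\<^esub> x \<in> ?J" using path_mult_closed[OF x ac] by simp
qed

lemma path_in_relation_ideal:
  assumes ij: "i \<le> j" "j \<le> n"
  shows "(path i j :: nat \<times> nat \<Rightarrow> 'k::field) \<in> relation_ideal n m s t \<longleftrightarrow> \<not> least_start m s t j \<le> i"
proof
  interpret ring "P :: (nat \<times> nat \<Rightarrow> 'k) ring" by (rule path_algebra_ring)
  let ?J = "{x \<in> carrier P. \<forall>i j. least_start m s t j \<le> i \<longrightarrow> x (i, j) = (0::'k)}"
  assume p: "(path i j :: nat \<times> nat \<Rightarrow> 'k) \<in> relation_ideal n m s t"
  have "(\<lambda>j. path (s j) (t j)) ` {1..m} \<subseteq> ?J"
  proof
    fix x :: "nat \<times> nat \<Rightarrow> 'k" assume "x \<in> (\<lambda>j. path (s j) (t j)) ` {1..m}"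
    then obtain k where k: "k \<in> {1..m}" "x = path (s k) (t k)" by blast
    have "\<not> least_start m s t (t k) \<le> s k" using k(1) unfolding least_start_le_iff by blast
    moreover have "x \<in> carrier P" using k rel[OF k(1)] by (simp add: path_carrier)
    ultimately show "x \<in> ?J" using k by (auto simp: path_def)
  qed
  then have "relation_ideal n m s t \<subseteq> ?J"
    unfolding relation_ideal_def by (rule genideal_minimal[OF long_ideal])
  with p have "least_start m s t j \<le> i \<longrightarrow> (path i j :: nat \<times> nat \<Rightarrow> 'k) (i, j) = 0" by blast
  then show "\<not> least_start m s t j \<le> i" by (simp add: path_def)
next
  assume "\<not> least_start m s t j \<le> i"
  then obtain k where k: "k \<in> {1..m}" "t k \<le> j" "i \<le> s k" unfolding least_start_le_iff by auto
  interpret ideal "relation_ideal n m s t" "P :: (nat \<times> nat \<Rightarrow> 'k) ring"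
    by (rule relation_ideal_ideal[OF rel])
  have st: "s k \<le> t k" "t k \<le> n" using rel[OF k(1)] by auto
  have "(path (s k) (t k) :: nat \<times> nat \<Rightarrow> 'k) \<in> relation_ideal n m s t"
    unfolding relation_ideal_def using k(1) rel
    by (intro subsetD[OF genideal_self]) (auto simp: path_carrier)
  then have "path (t k) j \<otimes>\<^bsub>P\<^esub> (path (s k) (t k) \<otimes>\<^bsub>P\<^esub> path i (s k)) \<in> (relation_ideal n m s t :: (nat \<times> nat \<Rightarrow> 'k) set)"
    using k st ij by (intro I_l_closed I_r_closed) (auto simp: path_carrier)
  moreover have "path (t k) j \<otimes>\<^bsub>P\<^esub> (path (s k) (t k) \<otimes>\<^bsub>P\<^esub> path i (s k)) = (path i j :: nat \<times> nat \<Rightarrow> 'k)"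
    using k st ij by (simp add: scaled_path_mult flip: scaled_path_1)
  ultimately show "(path i j :: nat \<times> nat \<Rightarrow> 'k) \<in> relation_ideal n m s t" by simp
qed

lemma nf_apply:
  assumes "x \<in> carrier P" shows "nf x (i, j) = (if least_start m s t j \<le> i then x (i, j) else (0::'k::field))"
proof (cases "x (i, j) = 0")
  case False
  then have "i \<le> j" "j \<le> n" using path_carrierD[OF assms] by auto
  then show ?thesis by (simp add: normal_form_def path_in_relation_ideal)
qed (simp add: normal_form_def)

lemma nf_scaled_path: "i \<le> j \<Longrightarrow> j \<le> n \<Longrightarrow> nf (scaled_path c i j) = scaled_path (if short i j then c else 0) i j"
proof (rule ext, clarify)
  fix a b assume ij: "i \<le> j" "j \<le> n"
  show "nf (scaled_path c i j) (a, b) = scaled_path (if short i j then c else 0) i j (a, b)"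
    unfolding nf_apply[OF scaled_path_carrier[OF ij]] using ij by (auto simp: scaled_path_def path_def short_def)
qed

lemma short_refl: "short i i"
  using L_le_self by (simp add: short_def)

lemma A_Ob: "Ob A = {0..n}" and A_Scl: "Scl A = (\<lambda>c x p. c * x p)"
  by (simp_all add: A_ST_def Let_def)

lemma Scl_scaled_path: "Scl A c (scaled_path d i j) = scaled_path (c * d) i j"
  by (simp add: A_Scl scaled_path_def mult.assoc)

lemma A_Mu: "Mu A Xs as = (if length as = 2 then nf (as ! 1 \<otimes>\<^bsub>P\<^esub> as ! 0) else (0 :: nat \<times> nat \<Rightarrow> 'k::field))"
proof -
  have "length as = 2 \<longleftrightarrow> (\<exists>a b. as = [a, b])" by (auto simp: length_Suc_conv numeral_2_eq_2)
  then show ?thesis by (auto simp: A_ST_def Let_def R_ST_def split: list.splits)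
qed

lemma A_Hom:
  assumes ij: "i \<le> n" "j \<le> n"
  shows "Hom A i j g = {scaled_path c i j | c. c \<noteq> (0::'k::field) \<longrightarrow> g = 0 \<and> short i j}"
proof (cases "g = 0")
  case False
  then show ?thesis by (auto simp: A_ST_def Let_def scaled_path_0)
next
  case True
  have pc: "path q q \<in> carrier (P :: (nat \<times> nat \<Rightarrow> 'k) ring)" if "q \<le> n" for q
    using that by (simp add: path_carrier)
  have e: "nf (path q q) = (path q q :: nat \<times> nat \<Rightarrow> 'k)" if "q \<le> n" for q
    using nf_scaled_path[of q q 1] that short_refl by (simp add: scaled_path_1)
  have *: "nf (nf (nf (path j j) \<otimes>\<^bsub>P\<^esub> x) \<otimes>\<^bsub>P\<^esub> nf (path i i)) = scaled_path (if short i j then x (i, j) else 0) i (j::nat)"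
    if x: "x \<in> carrier (P :: (nat \<times> nat \<Rightarrow> 'k) ring)" for x
  proof -
    have "nf (nf (nf (path j j) \<otimes>\<^bsub>P\<^esub> x) \<otimes>\<^bsub>P\<^esub> nf (path i i)) = nf ((path j j \<otimes>\<^bsub>P\<^esub> x) \<otimes>\<^bsub>P\<^esub> path i i)"
      using normal_form_mult[OF rel pc[OF ij(1)] path_mult_closed[OF x pc[OF ij(2)]]] by (simp add: e ij)
    also have "path j j \<otimes>\<^bsub>P\<^esub> x \<otimes>\<^bsub>P\<^esub> path i i = scaled_path (x (i, j)) i j"
      using path_corner[OF x ij, of 1] by (simp add: scaled_path_def)
    also have "nf \<dots> = scaled_path (if short i j then x (i, j) else 0) i j"
    proof (cases "i \<le> j")
      case True
      then show ?thesis using ij by (simp add: nf_scaled_path)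
    next
      case False
      then have "x (i, j) = 0" using path_carrierD[OF x, of i j] by blast
      then show ?thesis by (auto simp: scaled_path_0 normal_form_def)
    qed
    finally show ?thesis .
  qed
  have "Hom A i j g = {nf (nf (nf (path j j) \<otimes>\<^bsub>P\<^esub> x) \<otimes>\<^bsub>P\<^esub> nf (path i i)) | x. x \<in> nf ` carrier (P :: (nat \<times> nat \<Rightarrow> 'k) ring)}"
    using True by (simp add: A_ST_def Let_def R_ST_def)
  also have "\<dots> = {scaled_path c i j | c. c \<noteq> 0 \<longrightarrow> g = 0 \<and> short i j}"
  proof (intro equalityI subsetI)
    fix a assume "a \<in> {nf (nf (nf (path j j) \<otimes>\<^bsub>P\<^esub> x) \<otimes>\<^bsub>P\<^esub> nf (path i i)) | x. x \<in> nf ` carrier (P :: (nat \<times> nat \<Rightarrow> 'k) ring)}"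
    then obtain y where y: "y \<in> carrier (P :: (nat \<times> nat \<Rightarrow> 'k) ring)"
      "a = nf (nf (nf (path j j) \<otimes>\<^bsub>P\<^esub> nf y) \<otimes>\<^bsub>P\<^esub> nf (path i i))" by blast
    then have "a = scaled_path (if short i j then nf y (i, j) else 0) i j"
      using *[OF normal_form_closed[OF rel y(1)]] by simp
    then show "a \<in> {scaled_path c i j | c. c \<noteq> 0 \<longrightarrow> g = 0 \<and> short i j}" using True by auto
  next
    fix a :: "nat \<times> nat \<Rightarrow> 'k" assume "a \<in> {scaled_path c i j | c. c \<noteq> 0 \<longrightarrow> g = 0 \<and> short i j}"
    then obtain c where c: "a = scaled_path c i j" "c \<noteq> 0 \<longrightarrow> short i j" by blast
    show "a \<in> {nf (nf (nf (path j j) \<otimes>\<^bsub>P\<^esub> x) \<otimes>\<^bsub>P\<^esub> nf (path i i)) | x. x \<in> nf ` carrier (P :: (nat \<times> nat \<Rightarrow> 'k) ring)}"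
    proof (cases "short i j")
      case True
      then have cc: "scaled_path c i j \<in> carrier P" using ij by (intro scaled_path_carrier) (auto simp: short_def)
      have "nf (scaled_path c i j) = scaled_path c i j" using True ij by (subst nf_scaled_path) (auto simp: short_def)
      then have "scaled_path c i j \<in> nf ` carrier P" using cc by (metis imageI)
      moreover have "nf (nf (nf (path j j) \<otimes>\<^bsub>P\<^esub> scaled_path c i j) \<otimes>\<^bsub>P\<^esub> nf (path i i)) = a"
        using *[OF cc] True c by (simp add: scaled_path_apply)
      ultimately show ?thesis by blast
    next
      case False
      have z: "(0 :: nat \<times> nat \<Rightarrow> 'k) \<in> carrier P" by (simp add: path_algebra_def)
      have "nf (0 :: nat \<times> nat \<Rightarrow> 'k) = 0" by (auto simp: normal_form_def fun_eq_iff)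
      then have "0 \<in> nf ` carrier (P :: (nat \<times> nat \<Rightarrow> 'k) ring)" using z by (metis imageI)
      moreover have "nf (nf (nf (path j j) \<otimes>\<^bsub>P\<^esub> 0) \<otimes>\<^bsub>P\<^esub> nf (path i i)) = a"
        using *[OF z] False c by (auto simp: scaled_path_0)
      ultimately show ?thesis by blast
    qed
  qed
  finally show ?thesis .
qed

lemma A_Mu_scaled_path:
  assumes "i \<le> n" "j \<le> n" "k \<le> n" "c \<noteq> 0 \<longrightarrow> short i j" "d \<noteq> 0 \<longrightarrow> short j k"
  shows "Mu A Xs [scaled_path c i j, scaled_path d j k] = (scaled_path (if short i k then c * d else 0) i k :: nat \<times> nat \<Rightarrow> 'k::field)"
proof (cases "c = 0 \<or> d = 0")
  case True
  have "(y \<otimes>\<^bsub>P\<^esub> 0) = 0" "(0 \<otimes>\<^bsub>P\<^esub> y) = (0 :: nat \<times> nat \<Rightarrow> 'k)" for y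
    by (auto simp: path_algebra_def fun_eq_iff)
  moreover have "nf (0 :: nat \<times> nat \<Rightarrow> 'k) = 0" by (auto simp: normal_form_def fun_eq_iff)
  ultimately show ?thesis using True by (auto simp: A_Mu scaled_path_0)
next
  case False
  then have "short i j" "short j k" using assms by auto
  then have "i \<le> j" "j \<le> k" by (auto simp: short_def)
  then show ?thesis using assms by (simp add: A_Mu scaled_path_mult nf_scaled_path)
qed

lemma short_trans_left: "short i k \<Longrightarrow> i \<le> j \<Longrightarrow> j \<le> k \<Longrightarrow> short i j \<and> short j k"
  using mono_L[of j k] by (auto simp: short_def)

lemma composable_iff:
  "composable C Xs gs as \<longleftrightarrow> set Xs \<subseteq> Ob C \<and> length Xs = Suc (length gs) \<and> length as = length gs \<and>
     (\<forall>r<length gs. as ! r \<in> Hom C (Xs ! r) (Xs ! Suc r) (gs ! r))"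
  by (auto simp: composable_def hom_spaces_def in_listset)

lemma A_Hom_scaled_path: "i \<le> n \<Longrightarrow> j \<le> n \<Longrightarrow> a \<in> Hom A i j g \<Longrightarrow>
    a = scaled_path (a (i, j)) i j \<and> (a (i, j) \<noteq> (0::'k::field) \<longrightarrow> g = 0 \<and> short i j)"
  by (auto simp: A_Hom scaled_path_apply)

lemma scaled_path_Hom: "i \<le> n \<Longrightarrow> j \<le> n \<Longrightarrow> c \<noteq> 0 \<longrightarrow> g = 0 \<and> short i j \<Longrightarrow> scaled_path c i j \<in> Hom A i j g"
  by (auto simp: A_Hom)

lemma vs_A: "vector_space (Scl A :: 'k::field \<Rightarrow> _)"
  by unfold_locales (auto simp: A_Scl fun_eq_iff algebra_simps)

lemma nf_0: "nf 0 = 0"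
  by (auto simp: normal_form_def fun_eq_iff)

lemma nf_add: "nf (x + y) = nf x + nf y"
  by (auto simp: normal_form_def fun_eq_iff)

lemma nf_scale: "nf (\<lambda>p. c * x p) = (\<lambda>p. c * nf x p)"
  by (auto simp: normal_form_def fun_eq_iff)

lemma P_mult_bilinear:
  "(y + y') \<otimes>\<^bsub>P\<^esub> x = y \<otimes>\<^bsub>P\<^esub> x + y' \<otimes>\<^bsub>P\<^esub> x" "y \<otimes>\<^bsub>P\<^esub> (x + x') = y \<otimes>\<^bsub>P\<^esub> x + y \<otimes>\<^bsub>P\<^esub> x'"
  "(\<lambda>p. c * y p) \<otimes>\<^bsub>P\<^esub> x = (\<lambda>p. c * (y \<otimes>\<^bsub>P\<^esub> x) p)" "y \<otimes>\<^bsub>P\<^esub> (\<lambda>p. c * x p) = (\<lambda>p. c * (y \<otimes>\<^bsub>P\<^esub> x) p)"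
  "0 \<otimes>\<^bsub>P\<^esub> x = 0" "y \<otimes>\<^bsub>P\<^esub> 0 = (0 :: nat \<times> nat \<Rightarrow> 'k::field)"
  by (auto simp: path_algebra_def fun_eq_iff sum.distrib sum_distrib_left algebra_simps)

lemma length_2: "length as = 2 \<longleftrightarrow> (\<exists>a b. as = [a, b])"
  by (auto simp: length_Suc_conv numeral_2_eq_2)

lemma A_Mu_zero: "0 \<in> set as \<Longrightarrow> Mu A Xs as = (0 :: nat \<times> nat \<Rightarrow> 'k::field)"
proof (cases "length as = 2")
  case True
  assume z: "0 \<in> set as"
  obtain a b where as: "as = [a, b]" using True by (auto simp: length_2)
  then show ?thesis using z by (auto simp: A_Mu P_mult_bilinear nf_0)
qed (simp add: A_Mu)

lemma length_3: "length as = 3 \<longleftrightarrow> (\<exists>a b c. as = [a, b, c])"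
  by (auto simp: length_Suc_conv numeral_3_eq_3)

lemma A_multilinear: "multilinear_on (Scl A) (Scl A) Vs (Mu A Xs :: _ \<Rightarrow> nat \<times> nat \<Rightarrow> 'k::field)"
  unfolding multilinear_on_def
proof (intro ballI allI impI conjI)
  fix as i x y and c :: 'k assume "as \<in> listset Vs" "i < length Vs"
  then have i: "i < length as" by (simp add: in_listset)
  show "Mu A Xs (as[i := x + y]) = Mu A Xs (as[i := x]) + (Mu A Xs (as[i := y]) :: nat \<times> nat \<Rightarrow> 'k)"
    using i by (cases "length as = 2")
      (auto simp: A_Mu length_2 less_Suc_eq numeral_2_eq_2 P_mult_bilinear nf_add)
  show "Mu A Xs (as[i := Scl A c x]) = Scl A c (Mu A Xs (as[i := x]) :: nat \<times> nat \<Rightarrow> 'k)"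
    using i by (cases "length as = 2")
      (auto simp: A_Mu length_2 less_Suc_eq numeral_2_eq_2 A_Scl P_mult_bilinear nf_scale fun_eq_iff)
qed

lemma Scl_A_1: "Scl A 1 x = (x :: nat \<times> nat \<Rightarrow> 'k::field)"
  by (simp add: A_Scl)

lemma Scl_A_0: "Scl A c 0 = (0 :: nat \<times> nat \<Rightarrow> 'k::field)"
  by (simp add: A_Scl fun_eq_iff)

lemma A_relations: "ainf_relations (A :: (nat, 'k::field, nat \<times> nat \<Rightarrow> 'k) ainf)"
  unfolding ainf_relations_def
proof (intro allI impI)
  fix Xs gs and as :: "(nat \<times> nat \<Rightarrow> 'k) list"
  assume "composable A Xs gs as \<and> as \<noteq> []"
  then have comp: "set Xs \<subseteq> {0..n}" "length Xs = Suc (length as)" "length as = length gs"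
    "\<And>r. r < length as \<Longrightarrow> as ! r \<in> Hom A (Xs ! r) (Xs ! Suc r) (gs ! r)"
    by (auto simp: composable_iff A_Ob)
  let ?T = "\<lambda>i j. Scl A ((-1) powi star gs i)
             (Mu A (take (Suc i) Xs @ drop (i + j) Xs)
                   (take i as @ Mu A (take (Suc j) (drop i Xs)) (take j (drop i as)) # drop (i + j) as)) :: nat \<times> nat \<Rightarrow> 'k"
  have z: "?T i j = 0" if "\<not> (length as = 3 \<and> j = 2)" "i < length as" "j \<in> {1..length as - i}" for i j
  proof (cases "j = 2")
    case True
    then have "length (take i as @ Mu A (take (Suc j) (drop i Xs)) (take j (drop i as)) # drop (i + j) as) \<noteq> 2"
      using that by auto
    then show ?thesis by (simp add: A_Mu[of _ "_ @ _"] Scl_A_0)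
  next
    case False
    then have "Mu A (take (Suc j) (drop i Xs)) (take j (drop i as)) = (0 :: nat \<times> nat \<Rightarrow> 'k)"
      using that by (simp add: A_Mu)
    then show ?thesis by (simp add: A_Mu_zero Scl_A_0)
  qed
  show "(\<Sum>i<length as. \<Sum>j=1..length as - i. ?T i j) = 0"
  proof (cases "length as = 3")
    case False
    then show ?thesis using z by (intro sum.neutral ballI) auto
  next
    case True
    then obtain a b c where as: "as = [a, b, c]" by (auto simp: length_3)
    have "length Xs = 4" using comp as by simp
    then obtain w x y v where Xs: "Xs = [w, x, y, v]" by (auto simp: length_Suc_conv eval_nat_numeral)
    obtain ga gb gc where gs: "gs = [ga, gb, gc]" using comp(3) True by (auto simp: length_3)
    have le: "w \<le> n" "x \<le> n" "y \<le> n" "v \<le> n" using comp(1) Xs by auto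
    have hom: "a \<in> Hom A w x ga" "b \<in> Hom A x y gb" "c \<in> Hom A y v gc"
      using comp(4)[of 0] comp(4)[of 1] comp(4)[of 2] by (auto simp: as Xs gs)
    obtain ka where a: "a = scaled_path ka w x" "ka \<noteq> 0 \<longrightarrow> ga = 0 \<and> short w x" using A_Hom_scaled_path[OF _ _ hom(1)] le by blast
    obtain kb where b: "b = scaled_path kb x y" "kb \<noteq> 0 \<longrightarrow> gb = 0 \<and> short x y" using A_Hom_scaled_path[OF _ _ hom(2)] le by blast
    obtain kc where c: "c = scaled_path kc y v" "kc \<noteq> 0 \<longrightarrow> gc = 0 \<and> short y v" using A_Hom_scaled_path[OF _ _ hom(3)] le by blast
    have "(\<Sum>i<length as. \<Sum>j=1..length as - i. ?T i j) = ?T 0 2 + ?T 1 2"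
    proof -
      have "(\<Sum>j=1..length as - i. ?T i j) = (if i = 0 then ?T 0 2 else if i = 1 then ?T 1 2 else 0)" if "i < length as" for i
      proof -
        have "(\<Sum>j=1..length as - i. ?T i j) = (\<Sum>j=1..length as - i. if j = 2 then ?T i 2 else 0)"
          using z[of _ i] that by (intro sum.cong) auto
        also have "\<dots> = (if 2 \<in> {1..length as - i} then ?T i 2 else 0)" by (rule sum.delta) simp
        finally show ?thesis using that True by auto
      qed
      then have "(\<Sum>i<length as. \<Sum>j=1..length as - i. ?T i j) = (\<Sum>i<(3::nat). if i = 0 then ?T 0 2 else if i = 1 then ?T 1 2 else 0)"
        using True by (intro sum.cong) auto
      then show ?thesis by (simp add: eval_nat_numeral)
    qed
    also have "?T 0 2 = Mu A [w, y, v] [Mu A [w, x, y] [a, b], c]"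
      by (simp add: as Xs star_def A_Scl eval_nat_numeral)
    also have "\<dots> = scaled_path (if short w v then ka * kb * kc else 0) w v"
    proof -
      have "Mu A [w, x, y] [a, b] = (scaled_path (if short w y then ka * kb else 0) w y :: nat \<times> nat \<Rightarrow> 'k)"
        unfolding a(1) b(1) using a(2) b(2) le by (intro A_Mu_scaled_path) auto
      moreover have "Mu A [w, y, v] [scaled_path (if short w y then ka * kb else 0) w y, c] =
          (scaled_path (if short w v then (if short w y then ka * kb else 0) * kc else 0) w v :: nat \<times> nat \<Rightarrow> 'k)"
        unfolding c(1) using c(2) le by (intro A_Mu_scaled_path) auto
      moreover have "(if short w v then (if short w y then ka * kb else 0) * kc else 0) = (if short w v then ka * kb * kc else 0)"
      proof (cases "short w v \<and> ka * kb * kc \<noteq> 0")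
        case True
        then have "w \<le> x" "x \<le> y" "y \<le> v" using a(2) b(2) c(2) by (auto simp: short_def)
        then show ?thesis using short_trans_left[of w v y] True by simp
      qed auto
      ultimately show ?thesis by simp
    qed
    also have "?T 1 2 = scaled_path (if short w v then - (ka * kb * kc) else 0) w v"
    proof -
      have "Mu A [x, y, v] [b, c] = (scaled_path (if short x v then kb * kc else 0) x v :: nat \<times> nat \<Rightarrow> 'k)"
        unfolding b(1) c(1) using b(2) c(2) le by (intro A_Mu_scaled_path) auto
      moreover have "Mu A [w, x, v] [a, scaled_path (if short x v then kb * kc else 0) x v] =
          (scaled_path (if short w v then ka * (if short x v then kb * kc else 0) else 0) w v :: nat \<times> nat \<Rightarrow> 'k)"
        unfolding a(1) using a(2) le by (intro A_Mu_scaled_path) auto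
      moreover have "(if short w v then ka * (if short x v then kb * kc else 0) else 0) = (if short w v then ka * (kb * kc) else 0)"
      proof (cases "short w v \<and> ka * (kb * kc) \<noteq> 0")
        case True
        then have "w \<le> x" "x \<le> y" "y \<le> v" using a(2) b(2) c(2) by (auto simp: short_def)
        then show ?thesis using short_trans_left[of w v x] True by simp
      qed auto
      ultimately have "Mu A [w, x, v] [a, Mu A [x, y, v] [b, c]] = (scaled_path (if short w v then ka * (kb * kc) else 0) w v :: nat \<times> nat \<Rightarrow> 'k)"
        by simp
      moreover have "?T 1 2 = Scl A ((-1) powi (ga - 1)) (Mu A [w, x, v] [a, Mu A [x, y, v] [b, c]])"
        by (simp add: as Xs gs star_def eval_nat_numeral)
      ultimately have "?T 1 2 = scaled_path ((-1) powi (ga - 1) * (if short w v then ka * (kb * kc) else 0)) w v"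
        by (simp add: Scl_scaled_path)
      then show ?thesis using a(2) by (cases "ka = 0") (auto simp: mult.assoc)
    qed
    finally show ?thesis unfolding scaled_path_add by (cases "short w v") (simp_all add: scaled_path_0 zero_fun_def)
  qed
qed

lemma A_unit_left:
  assumes "i \<le> n" "Y \<le> n" "a \<in> Hom A i Y g"
  shows "Mu A [i, i, Y] [path i i, a] = (a :: nat \<times> nat \<Rightarrow> 'k::field)"
proof -
  obtain c where c: "a = scaled_path c i Y" "c \<noteq> 0 \<longrightarrow> short i Y" using A_Hom_scaled_path[OF assms] by blast
  have "Mu A [i, i, Y] [scaled_path 1 i i, scaled_path c i Y] = (scaled_path (if short i Y then 1 * c else 0) i Y :: nat \<times> nat \<Rightarrow> 'k)"
    using c assms short_refl by (intro A_Mu_scaled_path) auto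
  then show ?thesis using c by (auto simp: scaled_path_1)
qed

lemma A_unit_right:
  assumes "Y \<le> n" "i \<le> n" "a \<in> Hom A Y i g"
  shows "Mu A [Y, i, i] [a, path i i] = (a :: nat \<times> nat \<Rightarrow> 'k::field)"
    and "Scl A ((-1) powi g) a = a"
proof -
  obtain c where c: "a = scaled_path c Y i" "c \<noteq> 0 \<longrightarrow> g = 0 \<and> short Y i" using A_Hom_scaled_path[OF assms] by blast
  have "Mu A [Y, i, i] [scaled_path c Y i, scaled_path 1 i i] = (scaled_path (if short Y i then c * 1 else 0) Y i :: nat \<times> nat \<Rightarrow> 'k)"
    using c assms short_refl by (intro A_Mu_scaled_path) auto
  then show "Mu A [Y, i, i] [a, path i i] = a" using c by (auto simp: scaled_path_1)
  show "Scl A ((-1) powi g) a = a" using c by (cases "c = 0") (auto simp: scaled_path_0 Scl_A_0 Scl_A_1)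
qed

lemma path_Hom: "i \<le> n \<Longrightarrow> (path i i :: nat \<times> nat \<Rightarrow> 'k::field) \<in> Hom A i i 0"
  using scaled_path_Hom[of i i 1 0] short_refl by (simp add: scaled_path_1)

lemma A_unit:
  assumes "i \<le> n" shows "strict_unit A i (path i i :: nat \<times> nat \<Rightarrow> 'k::field)"
  unfolding strict_unit_def
proof (intro conjI ballI allI impI)
  fix Y g and a :: "nat \<times> nat \<Rightarrow> 'k" assume "Y \<in> Ob A"
  then have Y: "Y \<le> n" by (simp add: A_Ob)
  show "Mu A [i, i, Y] [path i i, a] = a" if "a \<in> Hom A i Y g" by (rule A_unit_left[OF assms Y that])
  show "Scl A ((-1) powi g) (Mu A [Y, i, i] [a, path i i]) = a" if "a \<in> Hom A Y i g"
    using A_unit_right[OF Y assms that] by simp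
next
  show "path i i \<in> Hom A i i 0" by (rule path_Hom[OF assms])
  show "Mu A [i, i] [path i i] = (0 :: nat \<times> nat \<Rightarrow> 'k)" by (simp add: A_Mu)
  fix Xs gs k and as :: "(nat \<times> nat \<Rightarrow> 'k) list"
  assume "composable A Xs gs as \<and> 3 \<le> length as \<and> k < length as \<and> Xs ! k = i \<and> Xs ! Suc k = i \<and> as ! k = path i i"
  then have "length as \<noteq> 2" by linarith
  then show "Mu A Xs as = 0" by (simp add: A_Mu)
qed

lemma A_category: "ainf_category (A :: (nat, 'k::field, nat \<times> nat \<Rightarrow> 'k) ainf)"
  unfolding ainf_category_def
proof (intro conjI ballI allI impI)
  show "vector_space (Scl (A :: (nat, 'k, nat \<times> nat \<Rightarrow> 'k) ainf) :: 'k \<Rightarrow> _)" by (rule vs_A)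
  interpret vector_space "Scl (A :: (nat, 'k, nat \<times> nat \<Rightarrow> 'k) ainf) :: 'k \<Rightarrow> _" by (rule vs_A)
  fix i j assume "i \<in> Ob (A :: (nat, 'k, nat \<times> nat \<Rightarrow> 'k) ainf)" "j \<in> Ob (A :: (nat, 'k, nat \<times> nat \<Rightarrow> 'k) ainf)"
  then have ij: "i \<le> n" "j \<le> n" by (auto simp: A_Ob)
  show "graded_space (Scl (A :: (nat, 'k, nat \<times> nat \<Rightarrow> 'k) ainf) :: 'k \<Rightarrow> _) (Hom (A :: (nat, 'k, nat \<times> nat \<Rightarrow> 'k) ainf) i j)"
  proof (rule graded_space_single[OF vs_A, of _ 0])
    show "subspace (Hom (A :: (nat, 'k, nat \<times> nat \<Rightarrow> 'k) ainf) i j 0)"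
    proof (rule subspaceI)
      show "0 \<in> Hom (A :: (nat, 'k, nat \<times> nat \<Rightarrow> 'k) ainf) i j 0" using scaled_path_Hom[OF ij, of 0 0] by (simp add: scaled_path_0)
      fix x y :: "nat \<times> nat \<Rightarrow> 'k" and c :: 'k
      assume x: "x \<in> Hom (A :: (nat, 'k, nat \<times> nat \<Rightarrow> 'k) ainf) i j 0" and y: "y \<in> Hom (A :: (nat, 'k, nat \<times> nat \<Rightarrow> 'k) ainf) i j 0"
      then obtain a b where "x = scaled_path a i j" "y = scaled_path b i j" "a \<noteq> 0 \<longrightarrow> short i j" "b \<noteq> 0 \<longrightarrow> short i j"
        using A_Hom_scaled_path[OF ij x] A_Hom_scaled_path[OF ij y] by blast
      then show "x + y \<in> Hom (A :: (nat, 'k, nat \<times> nat \<Rightarrow> 'k) ainf) i j 0" "Scl (A :: (nat, 'k, nat \<times> nat \<Rightarrow> 'k) ainf) c x \<in> Hom (A :: (nat, 'k, nat \<times> nat \<Rightarrow> 'k) ainf) i j 0"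
        using scaled_path_Hom[OF ij, of "a + b" 0] scaled_path_Hom[OF ij, of "c * a" 0] by (auto simp: scaled_path_add Scl_scaled_path)
    qed
  qed (use ij in \<open>auto simp: A_Hom scaled_path_0\<close>)
next
  fix Xs :: "nat list" and gs :: "int list"
  assume *: "set Xs \<subseteq> Ob (A :: (nat, 'k, nat \<times> nat \<Rightarrow> 'k) ainf) \<and> length Xs = Suc (length gs) \<and> gs \<noteq> []"
  show "multilinear_on (Scl (A :: (nat, 'k, nat \<times> nat \<Rightarrow> 'k) ainf)) (Scl (A :: (nat, 'k, nat \<times> nat \<Rightarrow> 'k) ainf)) (hom_spaces A Xs gs) (Mu A Xs :: _ \<Rightarrow> nat \<times> nat \<Rightarrow> 'k)"
    by (rule A_multilinear)
  fix as :: "(nat \<times> nat \<Rightarrow> 'k) list" assume "as \<in> listset (hom_spaces A Xs gs)"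
  then have as: "length as = length gs" "\<And>r. r < length gs \<Longrightarrow> as ! r \<in> Hom (A :: (nat, 'k, nat \<times> nat \<Rightarrow> 'k) ainf) (Xs ! r) (Xs ! Suc r) (gs ! r)"
    by (auto simp: in_listset hom_spaces_def)
  have "hd Xs \<in> set Xs" "last Xs \<in> set Xs" using * by (cases Xs; auto)+
  then have hl: "hd Xs \<le> n" "last Xs \<le> n" using * by (auto simp: A_Ob)
  show "Mu A Xs as \<in> Hom (A :: (nat, 'k, nat \<times> nat \<Rightarrow> 'k) ainf) (hd Xs) (last Xs) (sum_list gs + 2 - int (length gs))"
  proof (cases "length as = 2")
    case False
    then show ?thesis using hl scaled_path_Hom[of "hd Xs" "last Xs" 0] by (simp add: A_Mu scaled_path_0)
  next
    case True
    then obtain a b where ab: "as = [a, b]" by (auto simp: length_2)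
    obtain ga gb where gs: "gs = [ga, gb]" using True as(1) by (auto simp: length_2)
    have "length Xs = 3" using * gs by simp
    then obtain x y z where Xs: "Xs = [x, y, z]" by (auto simp: length_3)
    have le: "x \<le> n" "y \<le> n" "z \<le> n" using * Xs by (auto simp: A_Ob)
    obtain ka kb where "a = scaled_path ka x y" "ka \<noteq> 0 \<longrightarrow> ga = 0 \<and> short x y" "b = scaled_path kb y z" "kb \<noteq> 0 \<longrightarrow> gb = 0 \<and> short y z"
      using A_Hom_scaled_path[of x y a ga] A_Hom_scaled_path[of y z b gb] as(2)[of 0] as(2)[of 1] le by (auto simp: ab gs Xs)
    then have "Mu A Xs as = scaled_path (if short x z then ka * kb else 0) x z"
      "(if short x z then ka * kb else 0) \<noteq> 0 \<longrightarrow> ga + gb = 0 \<and> short x z"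
      using le A_Mu_scaled_path[of x y z ka kb Xs] by (auto simp: ab)
    then show ?thesis
      using scaled_path_Hom[OF le(1,3), of "if short x z then ka * kb else 0" "ga + gb"] by (simp only: Xs gs) simp
  qed
next
  show "ainf_relations (A :: (nat, 'k, nat \<times> nat \<Rightarrow> 'k) ainf)" by (rule A_relations)
next
  fix i assume "i \<in> Ob (A :: (nat, 'k, nat \<times> nat \<Rightarrow> 'k) ainf)"
  then have i: "i \<le> n" by (simp add: A_Ob)
  have z: "0 \<in> Hom (A :: (nat, 'k, nat \<times> nat \<Rightarrow> 'k) ainf) X Y g" if "X \<in> Ob (A :: (nat, 'k, nat \<times> nat \<Rightarrow> 'k) ainf)" "Y \<in> Ob (A :: (nat, 'k, nat \<times> nat \<Rightarrow> 'k) ainf)" for X Y g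
    using that scaled_path_Hom[of X Y 0 g] by (auto simp: A_Ob scaled_path_0)
  have coh: "(a, a) \<in> cohomologous A X Y g" if "X \<in> Ob (A :: (nat, 'k, nat \<times> nat \<Rightarrow> 'k) ainf)" "Y \<in> Ob (A :: (nat, 'k, nat \<times> nat \<Rightarrow> 'k) ainf)" "a \<in> cocycles A X Y g"
    for X Y g and a :: "nat \<times> nat \<Rightarrow> 'k"
    using that z[OF that(1,2), of "g - 1"] by (auto simp: cohomologous_def A_Mu)
  have "cohomology_unit A i (path i i :: nat \<times> nat \<Rightarrow> 'k)"
    unfolding cohomology_unit_def
  proof (intro conjI ballI allI)
    show "(path i i :: nat \<times> nat \<Rightarrow> 'k) \<in> cocycles A i i 0"
      using path_Hom[OF i] by (simp add: cocycles_def A_Mu)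
    fix Y g and a :: "nat \<times> nat \<Rightarrow> 'k" assume Y: "Y \<in> Ob (A :: (nat, 'k, nat \<times> nat \<Rightarrow> 'k) ainf)"
    then have Yn: "Y \<le> n" by (simp add: A_Ob)
    show "(Mu A [i, i, Y] [path i i, a], a) \<in> cohomologous A i Y g" if "a \<in> cocycles A i Y g"
      using coh[OF \<open>i \<in> Ob (A :: (nat, 'k, nat \<times> nat \<Rightarrow> 'k) ainf)\<close> Y that] A_unit_left[OF i Yn, of a g] that by (simp add: cocycles_def)
    show "(Scl (A :: (nat, 'k, nat \<times> nat \<Rightarrow> 'k) ainf) ((-1) powi g) (Mu A [Y, i, i] [a, path i i]), a) \<in> cohomologous A Y i g"
      if "a \<in> cocycles A Y i g"
      using coh[OF Y \<open>i \<in> Ob (A :: (nat, 'k, nat \<times> nat \<Rightarrow> 'k) ainf)\<close> that] A_unit_right[OF Yn i, of a g] that by (simp add: cocycles_def)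
  qed
  then show "\<exists>e :: nat \<times> nat \<Rightarrow> 'k. cohomology_unit A i e" by blast
qed

lemma A_cohomology_unit:
  assumes i: "i \<le> n" and e: "cohomology_unit A i (e :: nat \<times> nat \<Rightarrow> 'k::field)"
  shows "e = path i i"
proof -
  have "(path i i :: nat \<times> nat \<Rightarrow> 'k) \<in> cocycles A i i 0" using path_Hom[OF i] by (simp add: cocycles_def A_Mu)
  then have "(Mu A [i, i, i] [e, path i i], path i i) \<in> cohomologous A i i 0"
    using e i by (auto simp: cohomology_unit_def A_Ob)
  then have "Mu A [i, i, i] [e, path i i] = path i i" by (auto simp: cohomologous_def A_Mu)
  moreover have "e \<in> Hom A i i 0" using e by (simp add: cohomology_unit_def cocycles_def)
  ultimately show ?thesis using A_unit_right(1)[OF i i] by metis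
qed

lemma A_unit_of: "i \<le> n \<Longrightarrow> unit_of A i = (path i i :: nat \<times> nat \<Rightarrow> 'k::field)"
proof -
  assume i: "i \<le> n"
  have "e = path i i" if "strict_unit A i e" for e :: "nat \<times> nat \<Rightarrow> 'k"
  proof -
    have "e \<in> Hom A i i 0" "Mu A [i, i, i] [e, path i i] = path i i"
      using that path_Hom[OF i, where ?'k = 'k] i by (auto simp: strict_unit_def A_Ob)
    then show ?thesis using A_unit_right(1)[OF i i] by metis
  qed
  then show ?thesis unfolding unit_of_def using A_unit[OF i] by blast
qed

lemma A_directed: "directed (A :: (nat, 'k::field, nat \<times> nat \<Rightarrow> 'k) ainf)"
  unfolding directed_def
proof (intro conjI ballI)
  interpret vector_space "Scl (A :: (nat, 'k, nat \<times> nat \<Rightarrow> 'k) ainf) :: 'k \<Rightarrow> _" by (rule vs_A)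
  show "ainf_category (A :: (nat, 'k, nat \<times> nat \<Rightarrow> 'k) ainf)" by (rule A_category)
  show "finite (Ob (A :: (nat, 'k, nat \<times> nat \<Rightarrow> 'k) ainf))" by (simp add: A_Ob)
next
  interpret vector_space "Scl (A :: (nat, 'k, nat \<times> nat \<Rightarrow> 'k) ainf) :: 'k \<Rightarrow> _" by (rule vs_A)
  fix i j assume "i \<in> Ob (A :: (nat, 'k, nat \<times> nat \<Rightarrow> 'k) ainf)" "j \<in> Ob (A :: (nat, 'k, nat \<times> nat \<Rightarrow> 'k) ainf)"
  then have ij: "i \<le> n" "j \<le> n" by (auto simp: A_Ob)
  have "(\<Union>g. Hom (A :: (nat, 'k, nat \<times> nat \<Rightarrow> 'k) ainf) i j g) \<subseteq> span {path i j :: nat \<times> nat \<Rightarrow> 'k}"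
  proof clarify
    fix g and x :: "nat \<times> nat \<Rightarrow> 'k" assume "x \<in> Hom (A :: (nat, 'k, nat \<times> nat \<Rightarrow> 'k) ainf) i j g"
    then have "x = Scl (A :: (nat, 'k, nat \<times> nat \<Rightarrow> 'k) ainf) (x (i, j)) (path i j)" using A_Hom_scaled_path[OF ij] by (metis Scl_scaled_path mult_1_right scaled_path_1)
    then show "x \<in> span {path i j}" by (metis span_base span_scale singletonI)
  qed
  then show "finite_total_dim (Scl (A :: (nat, 'k, nat \<times> nat \<Rightarrow> 'k) ainf) :: 'k \<Rightarrow> _) (Hom (A :: (nat, 'k, nat \<times> nat \<Rightarrow> 'k) ainf) i j)"
    unfolding finite_total_dim_def by blast
next
  fix i assume "i \<in> Ob (A :: (nat, 'k, nat \<times> nat \<Rightarrow> 'k) ainf)"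
  then have i: "i \<le> n" by (simp add: A_Ob)
  have "Hom (A :: (nat, 'k, nat \<times> nat \<Rightarrow> 'k) ainf) i i 0 = range (\<lambda>c. Scl (A :: (nat, 'k, nat \<times> nat \<Rightarrow> 'k) ainf) c (path i i :: nat \<times> nat \<Rightarrow> 'k))"
    using i short_refl by (auto simp: A_Hom Scl_scaled_path simp flip: scaled_path_1)
  moreover have "Hom (A :: (nat, 'k, nat \<times> nat \<Rightarrow> 'k) ainf) i i g = {0 :: nat \<times> nat \<Rightarrow> 'k}" if "g \<noteq> 0" for g
    using i that by (auto simp: A_Hom scaled_path_0)
  moreover have "(path i i :: nat \<times> nat \<Rightarrow> 'k) \<noteq> 0" by (auto simp: path_def fun_eq_iff)
  ultimately show "\<exists>e :: nat \<times> nat \<Rightarrow> 'k. strict_unit A i e \<and> e \<noteq> 0 \<and> Hom (A :: (nat, 'k, nat \<times> nat \<Rightarrow> 'k) ainf) i i 0 = range (\<lambda>c. Scl (A :: (nat, 'k, nat \<times> nat \<Rightarrow> 'k) ainf) c e) \<and>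
      (\<forall>g. g \<noteq> 0 \<longrightarrow> Hom (A :: (nat, 'k, nat \<times> nat \<Rightarrow> 'k) ainf) i i g = {0})"
    using A_unit[OF i] by blast
next
  let ?r = "{(i, j). i \<le> j \<and> j \<le> n}"
  have lin: "linear_order_on {0..n} ?r"
    by (auto simp: linear_order_on_def partial_order_on_def preorder_on_def refl_on_def trans_def
        antisym_def total_on_def)
  have ord: "(i, j) \<in> ?r" if ij: "i \<le> n" "j \<le> n" and g: "Hom (A :: (nat, 'k, nat \<times> nat \<Rightarrow> 'k) ainf) i j g \<noteq> {0 :: nat \<times> nat \<Rightarrow> 'k}" for i j g
  proof -
    have "short i j"
    proof (rule ccontr)
      assume "\<not> short i j"
      then have "Hom (A :: (nat, 'k, nat \<times> nat \<Rightarrow> 'k) ainf) i j g = {0 :: nat \<times> nat \<Rightarrow> 'k}" using ij by (auto simp: A_Hom scaled_path_0)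
      then show False using g by simp
    qed
    then show ?thesis using ij by (simp add: short_def)
  qed
  show "\<exists>r. linear_order_on (Ob (A :: (nat, 'k, nat \<times> nat \<Rightarrow> 'k) ainf)) r \<and>
      (\<forall>X\<in>Ob (A :: (nat, 'k, nat \<times> nat \<Rightarrow> 'k) ainf). \<forall>Y\<in>Ob (A :: (nat, 'k, nat \<times> nat \<Rightarrow> 'k) ainf).
        (\<exists>g. Hom (A :: (nat, 'k, nat \<times> nat \<Rightarrow> 'k) ainf) X Y g \<noteq> {0 :: nat \<times> nat \<Rightarrow> 'k}) \<longrightarrow> (X, Y) \<in> r)"
    by (intro exI[of _ ?r] conjI ballI impI) (use lin ord in \<open>auto simp only: A_Ob atLeastAtMost_iff\<close>)
qed

end

section \<open>Morphisms of simple modules as cochains\<close>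

text \<open>
  The parameter \<open>ground\<close> fixes the ground field, so that the constants below are not polymorphic in it.
\<close>

locale koszul = path_relations n m s t for n m :: nat and s t :: "nat \<Rightarrow> nat" +
  fixes ground :: "'k::field itself"
begin

abbreviation AA :: "(nat, 'k, nat \<times> nat \<Rightarrow> 'k) ainf" where
  "AA \<equiv> A_ST n m s t"

abbreviation S :: "nat \<Rightarrow> (nat, nat \<times> nat \<Rightarrow> 'k, 'k vec) amod" where
  "S \<equiv> simple_module AA"

definition line :: "nat \<Rightarrow> nat \<Rightarrow> (nat \<times> nat \<Rightarrow> 'k) set" where
  "line i j = {scaled_path c i j | c. c \<noteq> 0 \<longrightarrow> short i j}"

definition vec :: "'k \<Rightarrow> 'k vec" where
  "vec c = (\<lambda>i. if i = 0 then c else 0)"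

definition dom :: "nat list \<Rightarrow> (nat \<times> nat \<Rightarrow> 'k) list \<Rightarrow> bool" where
  "dom Xs as \<longleftrightarrow> set Xs \<subseteq> {0..n} \<and> length Xs = Suc (length as) \<and> (\<forall>r<length as. as ! r \<in> line (Xs ! r) (Xs ! Suc r))"

definition wt :: "nat list \<Rightarrow> (nat \<times> nat \<Rightarrow> 'k) list \<Rightarrow> 'k" where
  "wt Xs as = (\<Prod>r<length as. (as ! r) (Xs ! r, Xs ! Suc r))"

text \<open>
  The morphism of modules given by a cochain. Between simple modules the arguments are spanned by
  \<open>vec 1\<close> and by paths, so a multilinear family is the product of its values on these basis elements,
  a function of the list of objects, with the coefficients of the arguments. The list is reversed,
  since strings of morphisms are listed from source to target and chains in descending order.
\<close>

definition cochain_hom :: "(nat list \<Rightarrow> 'k) \<Rightarrow> nat list \<Rightarrow> 'k vec \<Rightarrow> (nat \<times> nat \<Rightarrow> 'k) list \<Rightarrow> 'k vec" where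
  "cochain_hom f Xs b as = (if dom Xs as \<and> b \<in> range vec then vec (f (rev Xs) * (b 0 * wt Xs as)) else 0)"

lemma vec_simps: "vec c 0 = c" "vec 0 = 0" "vec c + vec d = vec (c + d)" "vscale c (vec d) = vec (c * d)"
  "- vec c = vec (- c)" "vec c - vec d = vec (c - d)"
  by (auto simp: vec_def vscale_def fun_eq_iff)

lemma vec_inj: "vec c = vec d \<longleftrightarrow> c = d"
  by (metis vec_simps(1))

lemma vec_sum: "(\<Sum>i\<in>I. vec (c i)) = vec (\<Sum>i\<in>I. c i)"
  by (induction I rule: infinite_finite_induct) (auto simp: vec_simps)

lemma vec_eq_0: "vec c = 0 \<longleftrightarrow> c = 0"
  using vec_inj[of c 0] by (simp add: vec_simps)

lemma range_vec: "b \<in> range vec \<longleftrightarrow> (\<forall>i>0. b i = 0)"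
proof
  assume "\<forall>i>0. b i = 0"
  then have "b = vec (b 0)" by (auto simp: vec_def fun_eq_iff)
  then show "b \<in> range vec" by blast
qed (auto simp: vec_def)

lemma vscale_0: "vscale c 0 = (0 :: 'k vec)" "vscale 0 b = (0 :: 'k vec)"
  by (auto simp: vscale_def fun_eq_iff)

lemma vscale_apply: "vscale c b i = c * b i"
  by (simp add: vscale_def)

lemma vs_vscale: "vector_space (vscale :: 'k \<Rightarrow> _)"
  by unfold_locales (auto simp: vscale_def fun_eq_iff algebra_simps)

lemma line_0: "0 \<in> line i j"
  unfolding line_def by (rule CollectI, rule exI[of _ 0]) (simp add: scaled_path_0)

lemma line_eq: "a \<in> line i j \<Longrightarrow> a = scaled_path (a (i, j)) i j"
  by (auto simp: line_def scaled_path_apply)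

lemma line_short: "a \<in> line i j \<Longrightarrow> a (i, j) \<noteq> 0 \<Longrightarrow> short i j"
  by (auto simp: line_def scaled_path_apply)

lemma line_add: "a \<in> line i j \<Longrightarrow> a' \<in> line i j \<Longrightarrow> a + a' \<in> line i j"
  unfolding line_def by (clarsimp simp: scaled_path_add) (metis add_0)

lemma line_scale: "a \<in> line i j \<Longrightarrow> Scl AA c a \<in> line i j"
  unfolding line_def by (clarsimp simp: Scl_scaled_path) (metis mult_zero_right)

lemma path_line: "path i i \<in> line i i"
  unfolding line_def using short_refl[of i] scaled_path_1[where ?'a = 'k, of i i] by (metis (mono_tags, lifting) mem_Collect_eq)

lemma A_Hom_line: "i \<le> n \<Longrightarrow> j \<le> n \<Longrightarrow> Hom AA i j g = (if g = 0 then line i j else {0})"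
  by (auto simp: A_Hom line_def scaled_path_0)

lemma S_MSp: "MSp (S p) X g = (if X = p \<and> g = 0 then range vec else {0})"
proof -
  have "{v. \<forall>i>0. v i = 0} = range vec" using range_vec by auto
  then show ?thesis by (simp add: simple_module_def)
qed

lemma S_MMu_pair: "p \<le> n \<Longrightarrow> a \<in> line p p \<Longrightarrow> MMu (S p) [p, p] b [a] = vscale (a (p, p)) b"
proof -
  assume p: "p \<le> n" and a: "a \<in> line p p"
  have "Scl AA c (path p p) = scaled_path c p p" for c
    using Scl_scaled_path[of c 1 p p] by (simp add: scaled_path_1)
  then have "(THE c. a = Scl AA c (unit_of AA p)) = a (p, p)"
    using line_eq[OF a] by (intro the_equality) (auto simp: A_unit_of[OF p] scaled_path_apply)
  then show ?thesis by (simp add: simple_module_def)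
qed

lemma S_MMu_off: "Xs \<noteq> [p, p] \<or> length as \<noteq> 1 \<Longrightarrow> MMu (S p) Xs b as = 0"
  by (auto simp: simple_module_def split: list.splits)

lemma wt_split: "i \<le> length as \<Longrightarrow> length Xs = Suc (length as) \<Longrightarrow>
    wt Xs as = wt (take (Suc i) Xs) (take i as) * wt (drop i Xs) (drop i as)"
proof -
  assume i: "i \<le> length as" "length Xs = Suc (length as)"
  have "(\<Prod>r<length as. (as ! r) (Xs ! r, Xs ! Suc r)) =
      (\<Prod>r<i. (as ! r) (Xs ! r, Xs ! Suc r)) * (\<Prod>r\<in>{i..<length as}. (as ! r) (Xs ! r, Xs ! Suc r))"
    using i by (simp add: prod.atLeastLessThan_concat flip: atLeast0LessThan)
  also have "(\<Prod>r\<in>{i..<length as}. (as ! r) (Xs ! r, Xs ! Suc r)) =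
      (\<Prod>r<length as - i. (as ! (i + r)) (Xs ! (i + r), Xs ! Suc (i + r)))"
    by (rule prod.reindex_bij_witness[of _ "\<lambda>r. i + r" "\<lambda>r. r - i"]) auto
  finally show ?thesis using i by (simp add: wt_def)
qed

lemma dom_split: "dom Xs as \<Longrightarrow> i \<le> length as \<Longrightarrow> dom (take (Suc i) Xs) (take i as) \<and> dom (drop i Xs) (drop i as)"
  by (auto simp: dom_def dest: in_set_takeD in_set_dropD)

lemma wt_update:
  assumes "i < length as"
  shows "wt Xs (as[i := x]) = x (Xs ! i, Xs ! Suc i) * (\<Prod>r\<in>{..<length as} - {i}. (as ! r) (Xs ! r, Xs ! Suc r))"
proof -
  have "wt Xs (as[i := x]) = (\<Prod>r<length as. (as[i := x] ! r) (Xs ! r, Xs ! Suc r))" by (simp add: wt_def)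
  also have "\<dots> = (as[i := x] ! i) (Xs ! i, Xs ! Suc i) * (\<Prod>r\<in>{..<length as} - {i}. (as[i := x] ! r) (Xs ! r, Xs ! Suc r))"
    using assms by (intro prod.remove) auto
  also have "(\<Prod>r\<in>{..<length as} - {i}. (as[i := x] ! r) (Xs ! r, Xs ! Suc r)) =
      (\<Prod>r\<in>{..<length as} - {i}. (as ! r) (Xs ! r, Xs ! Suc r))"
    by (rule prod.cong) auto
  finally show ?thesis using assms by simp
qed

lemma wt_nonzero: "wt Xs as \<noteq> 0 \<Longrightarrow> r < length as \<Longrightarrow> (as ! r) (Xs ! r, Xs ! Suc r) \<noteq> 0"
  by (auto simp: wt_def)

lemma wt_chain: "dom Xs as \<Longrightarrow> wt Xs as \<noteq> 0 \<Longrightarrow> chain (rev Xs)"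
proof -
  assume d: "dom Xs as" and w: "wt Xs as \<noteq> 0"
  have sh: "short (Xs ! r) (Xs ! Suc r)" if "r < length as" for r
    using d wt_nonzero[OF w that] line_short that by (auto simp: dom_def)
  show "chain (rev Xs)"
    unfolding chain_def
  proof (intro allI impI)
    fix i assume i: "Suc i < length (rev Xs)"
    then have "Suc (length Xs - Suc (Suc i)) = length Xs - Suc i" by simp
    then show "least_start m s t (rev Xs ! i) \<le> rev Xs ! Suc i \<and> rev Xs ! Suc i \<le> rev Xs ! i"
      using sh[of "length Xs - Suc (Suc i)"] i d by (simp add: rev_nth dom_def short_def)
  qed
qed

lemma mod_argD:
  assumes "mod_arg AA (S p) Xs h b gs as"
  shows "dom Xs as" "b \<in> range vec" "length gs = length as" "b \<noteq> 0 \<Longrightarrow> last Xs = p \<and> h = 0"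
    "r < length as \<Longrightarrow> as ! r \<noteq> 0 \<Longrightarrow> gs ! r = 0"
proof -
  have a: "set Xs \<subseteq> {0..n}" "length Xs = Suc (length as)" "length gs = length as" "b \<in> MSp (S p) (last Xs) h"
    "\<And>r. r < length as \<Longrightarrow> as ! r \<in> Hom AA (Xs ! r) (Xs ! Suc r) (gs ! r)"
    using assms by (auto simp: mod_arg_def composable_iff A_Ob)
  have X: "Xs ! r \<le> n" if "r < Suc (length as)" for r
    using a(1,2) that by (metis atLeastAtMost_iff nth_mem subsetD)
  have h: "as ! r \<in> (if gs ! r = 0 then line (Xs ! r) (Xs ! Suc r) else {0})" if "r < length as" for r
    using a(5)[OF that] X that by (simp add: A_Hom_line)
  show "dom Xs as" using a h line_0 by (auto simp: dom_def split: if_splits) (metis singletonD)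
  show "b \<in> range vec" "b \<noteq> 0 \<Longrightarrow> last Xs = p \<and> h = 0"
    using a(4) by (auto simp: S_MSp range_vec split: if_splits)
  show "length gs = length as" by fact
  show "r < length as \<Longrightarrow> as ! r \<noteq> 0 \<Longrightarrow> gs ! r = 0" using h[of r] by (auto split: if_splits)
qed

lemma mod_arg_iff:
  "(\<exists>h gs. mod_arg AA (S p) Xs h b gs as) \<longleftrightarrow> dom Xs as \<and> b \<in> range vec \<and> (last Xs = p \<or> b = 0)"
proof
  assume d: "dom Xs as \<and> b \<in> range vec \<and> (last Xs = p \<or> b = 0)"
  then have "Xs ! r \<le> n" if "r < Suc (length as)" for r
    using that by (metis atLeastAtMost_iff dom_def nth_mem subsetD)
  then have "mod_arg AA (S p) Xs 0 b (replicate (length as) 0) as"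
    using d by (auto simp: mod_arg_def composable_iff A_Ob dom_def S_MSp A_Hom_line)
  then show "\<exists>h gs. mod_arg AA (S p) Xs h b gs as" by blast
qed (use mod_argD(1,2,4) in blast)

text \<open>
  All morphisms of \<open>A_ST\<close> have degree \<open>0\<close>, so the sign only depends on lengths as soon as no argument
  is zero.
\<close>

lemma mod_sign_S:
  assumes a: "mod_arg AA (S p) Xs h b gs as" and nz: "b 0 * wt Xs as \<noteq> 0"
  shows "mod_sign AA (S p) Xs b as i = (-1) powi (int i + 1 - int (length Xs))"
proof -
  define P where "P = (\<lambda>(h, gs). mod_arg AA (S p) Xs h b gs as)"
  obtain h' gs' where hg: "(SOME x. P x) = (h', gs')" by (cases "SOME x. P x")
  have "P (h, gs)" using a by (simp add: P_def)
  then have "P (SOME x. P x)" by (rule someI)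
  then have a': "mod_arg AA (S p) Xs h' b gs' as" by (simp add: hg) (simp add: P_def)
  have "b \<noteq> 0" using nz by auto
  then have h': "h' = 0" using mod_argD(4)[OF a'] by simp
  have "gs' ! r = 0" if "r < length as" for r
    using mod_argD(5)[OF a' that] wt_nonzero[of Xs as r] nz that by fastforce
  then have "gs' = replicate (length as) 0"
    using mod_argD(3)[OF a'] by (intro nth_equalityI) auto
  then have "sum_list (drop i gs') = 0" by (simp add: sum_list_replicate)
  then show ?thesis using hg by (simp add: mod_sign_def P_def h' algebra_simps)
qed

subsection \<open>Composition and deletion under the correspondence\<close>

lemma cochain_hom_cut:
  assumes d: "dom Xs as" "b \<in> range vec" and i: "i < length Xs"
  shows "cochain_hom f2 (take (Suc i) Xs) (cochain_hom f1 (drop i Xs) b (drop i as)) (take i as) =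
    vec (f1 (rev (drop i Xs)) * f2 (rev (take (Suc i) Xs)) * (b 0 * wt Xs as))"
proof -
  have i': "i \<le> length as" "length Xs = Suc (length as)" using d i by (auto simp: dom_def)
  show ?thesis
    using dom_split[OF d(1) i'(1)] d(2) wt_split[OF i'] by (simp add: cochain_hom_def vec_simps mult_ac)
qed

text \<open>
  If the composite of the two contracted paths is zero, both sides vanish: the left one because the
  composite is an argument, the right one because \<open>f\<close> is supported on chains.
\<close>

lemma cochain_hom_contract:
  assumes d: "dom Xs as" "b \<in> range vec" and i: "Suc i < length as"
    and f: "\<And>z. f z \<noteq> 0 \<Longrightarrow> chain z"
  shows "dom (take (Suc i) Xs @ drop (i + 2) Xs)
      (take i as @ Mu AA (take 3 (drop i Xs)) (take 2 (drop i as)) # drop (i + 2) as)"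
    and "cochain_hom f (take (Suc i) Xs @ drop (i + 2) Xs) b
      (take i as @ Mu AA (take 3 (drop i Xs)) (take 2 (drop i as)) # drop (i + 2) as) =
    vec (f (rev (del (Suc i) Xs)) * (b 0 * wt Xs as))"
proof -
  have len: "length Xs = Suc (length as)" using d by (simp add: dom_def)
  define x y w where "x = Xs ! i" and "y = Xs ! Suc i" and "w = Xs ! Suc (Suc i)"
  define a a' where "a = as ! i" and "a' = as ! Suc i"
  have le: "Xs ! r \<le> n" if "r < length Xs" for r
    using that d by (metis atLeastAtMost_iff dom_def nth_mem subsetD)
  have l: "a \<in> line x y" "a' \<in> line y w" using d i by (auto simp: dom_def a_def a'_def x_def y_def w_def)
  have dX: "drop i Xs = x # y # w # drop (i + 3) Xs"
    using i len by (simp add: Cons_nth_drop_Suc x_def y_def w_def eval_nat_numeral)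
  have da: "drop i as = a # a' # drop (i + 2) as"
    using i by (simp add: Cons_nth_drop_Suc a_def a'_def eval_nat_numeral)
  define c where "c = (if short x w then a (x, y) * a' (y, w) else 0)"
  have "Mu AA [x, y, w] [scaled_path (a (x, y)) x y, scaled_path (a' (y, w)) y w] = scaled_path c x w"
    unfolding c_def using i len line_short[OF l(1)] line_short[OF l(2)]
    by (intro A_Mu_scaled_path) (auto simp: x_def y_def w_def intro!: le)
  then have M: "Mu AA (take 3 (drop i Xs)) (take 2 (drop i as)) = scaled_path c x w"
    using line_eq[OF l(1)] line_eq[OF l(2)] by (simp add: dX da eval_nat_numeral)
  let ?X = "take (Suc i) Xs @ drop (i + 2) Xs" and ?a = "take i as @ scaled_path c x w # drop (i + 2) as"
  have X: "?X = del (Suc i) Xs" by (simp add: del_def)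
  have nX: "?X ! r = (if r \<le> i then Xs ! r else Xs ! Suc r)" if "r < length as" for r
    using that len i by (auto simp: nth_append min_def)
  have na: "?a ! r = (if r < i then as ! r else if r = i then scaled_path c x w else as ! Suc r)" if "r < length as - 1" for r
  proof -
    have "(scaled_path c x w # drop (i + 2) as) ! (r - i) = as ! Suc r" if "r > i"
      using that \<open>r < length as - 1\<close> i by (auto simp: nth_Cons' )
    then show ?thesis using that i by (auto simp: nth_append min_def)
  qed
  have la: "length ?a = length as - 1" using i by simp
  have scl: "scaled_path c x w \<in> line x w" by (auto simp: line_def c_def)
  have domX: "dom ?X ?a"
    unfolding dom_def
  proof (intro conjI allI impI)
    show "set ?X \<subseteq> {0..n}" using d by (auto simp: dom_def dest: in_set_takeD in_set_dropD)
    show "length ?X = Suc (length ?a)" using i len by simp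
    fix r assume "r < length ?a"
    then have r: "r < length as - 1" by (simp only: la)
    consider "r < i" | "r = i" | "r > i" by linarith
    then show "?a ! r \<in> line (?X ! r) (?X ! Suc r)"
    proof cases
      case 1
      then show ?thesis using r d i unfolding na[OF r] by (simp only: nX) (simp add: dom_def)
    next
      case 2
      then have "?X ! r = x" "?X ! Suc r = w" using r i nX[of i] nX[of "Suc i"] by (simp_all only: x_def w_def) auto
      then show ?thesis using 2 scl unfolding na[OF r] by simp
    next
      case 3
      then have "?X ! r = Xs ! Suc r" "?X ! Suc r = Xs ! Suc (Suc r)" using r i nX[of r] nX[of "Suc r"] by (simp_all only:) auto
      then show ?thesis using 3 r d unfolding na[OF r] by (simp add: dom_def)
    qed
  qed
  then show "dom (take (Suc i) Xs @ drop (i + 2) Xs)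
      (take i as @ Mu AA (take 3 (drop i Xs)) (take 2 (drop i as)) # drop (i + 2) as)"
    unfolding M .
  have "wt ?X ?a = (if short x w then wt Xs as else 0)"
  proof -
    let ?F = "\<lambda>r. (as ! r) (Xs ! r, Xs ! Suc r)"
    have "wt ?X ?a = (\<Prod>r<length as - 1. if r < i then ?F r else if r = i then c else ?F (Suc r))"
      unfolding wt_def la
    proof (rule prod.cong[OF refl])
      fix r assume "r \<in> {..<length as - 1}"
      then have r: "r < length as - 1" by simp
      consider "r < i" | "r = i" | "r > i" by linarith
      moreover have "?X ! r = (if r \<le> i then Xs ! r else Xs ! Suc r)"
        "?X ! Suc r = (if Suc r \<le> i then Xs ! Suc r else Xs ! Suc (Suc r))" using r by (intro nX; linarith)+
      ultimately show "(?a ! r) (?X ! r, ?X ! Suc r) = (if r < i then ?F r else if r = i then c else ?F (Suc r))"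
        unfolding na[OF r] by cases (simp_all add: x_def w_def scaled_path_apply)
    qed
    also have "\<dots> = (\<Prod>r<i. ?F r) * (c * (\<Prod>r\<in>{Suc (Suc i)..<length as}. ?F r))"
    proof -
      let ?G = "\<lambda>r. if r < i then ?F r else if r = i then c else ?F (Suc r)"
      have "prod ?G {..<length as - 1} = prod ?G {..<i} * prod ?G {i..<length as - 1}"
        unfolding lessThan_atLeast0 using i by (intro prod.atLeastLessThan_concat[symmetric]) auto
      also have "prod ?G {i..<length as - 1} = ?G i * prod ?G {Suc i..<length as - 1}"
        using i by (intro prod.atLeast_Suc_lessThan) auto
      also have "prod ?G {Suc i..<length as - 1} = (\<Prod>r\<in>{Suc (Suc i)..<length as}. ?F r)"
        by (rule prod.reindex_bij_witness[of _ "\<lambda>r. r - 1" Suc]) auto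
      finally show ?thesis by simp
    qed
    also have "\<dots> = (if short x w then wt Xs as else 0)"
    proof -
      have "prod ?F {..<length as} = prod ?F {..<i} * prod ?F {i..<length as}"
        unfolding lessThan_atLeast0 using i by (intro prod.atLeastLessThan_concat[symmetric]) auto
      also have "prod ?F {i..<length as} = ?F i * prod ?F {Suc i..<length as}"
        using i by (intro prod.atLeast_Suc_lessThan) auto
      also have "prod ?F {Suc i..<length as} = ?F (Suc i) * prod ?F {Suc (Suc i)..<length as}"
        using i by (intro prod.atLeast_Suc_lessThan) auto
      finally show ?thesis by (simp add: wt_def c_def a_def a'_def x_def y_def w_def mult_ac)
    qed
    finally show ?thesis .
  qed
  moreover have "f (rev (del (Suc i) Xs)) * (b 0 * (if short x w then wt Xs as else 0)) = f (rev (del (Suc i) Xs)) * (b 0 * wt Xs as)"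
  proof (cases "f (rev (del (Suc i) Xs)) = 0")
    case False
    then have "chain (rev ?X)" using f unfolding X by blast
    moreover have "Suc (length as - Suc (Suc i)) < length (rev ?X)" using i len by simp
    ultimately have "least_start m s t (rev ?X ! (length as - Suc (Suc i))) \<le> rev ?X ! Suc (length as - Suc (Suc i)) \<and>
        rev ?X ! Suc (length as - Suc (Suc i)) \<le> rev ?X ! (length as - Suc (Suc i))"
      unfolding chain_def by blast
    moreover have "rev ?X ! (length as - Suc (Suc i)) = w"
    proof -
      have l: "length ?X - Suc (length as - Suc (Suc i)) = Suc i" using i len by simp
      have "rev ?X ! (length as - Suc (Suc i)) = ?X ! (length ?X - Suc (length as - Suc (Suc i)))"
        by (rule rev_nth) (use i len in simp)
      then show ?thesis using nX[OF i] unfolding l by (simp only: w_def) simp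
    qed
    moreover have "rev ?X ! Suc (length as - Suc (Suc i)) = x"
    proof -
      have l: "length ?X - Suc (Suc (length as - Suc (Suc i))) = i" using i len by simp
      have "rev ?X ! Suc (length as - Suc (Suc i)) = ?X ! (length ?X - Suc (Suc (length as - Suc (Suc i))))"
        by (rule rev_nth) (use i len in simp)
      then show ?thesis using nX[of i] i unfolding l by (simp only: x_def) simp
    qed
    ultimately show ?thesis by (simp add: short_def)
  qed simp
  ultimately show "cochain_hom f (take (Suc i) Xs @ drop (i + 2) Xs) b
      (take i as @ Mu AA (take 3 (drop i Xs)) (take 2 (drop i as)) # drop (i + 2) as) =
    vec (f (rev (del (Suc i) Xs)) * (b 0 * wt Xs as))"
    using domX d(2) unfolding M cochain_hom_def X by (auto split: if_splits)
qed


subsection \<open>Morphism spaces between simple modules\<close>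

text \<open>
  A module morphism of degree \<open>g\<close> between simple modules of degree \<open>0\<close> has \<open>g\<close> path arguments, which
  connect \<open>g + 1\<close> objects.
\<close>

definition cochains :: "nat \<Rightarrow> nat \<Rightarrow> int \<Rightarrow> (nat list \<Rightarrow> 'k) set" where
  "cochains p q g = {f. \<forall>z. f z \<noteq> 0 \<longrightarrow> V p q z \<and> int (length z) = g + 1}"

lemma cochainsD: "f \<in> cochains p q g \<Longrightarrow> f z \<noteq> 0 \<Longrightarrow> V p q z" "f \<in> cochains p q g \<Longrightarrow> f z \<noteq> 0 \<Longrightarrow> int (length z) = g + 1"
  by (auto simp: cochains_def)

lemma cochain_hom_nonzero:
  "cochain_hom f Xs b as \<noteq> 0 \<Longrightarrow> dom Xs as \<and> b \<in> range vec \<and> f (rev Xs) \<noteq> 0 \<and> b 0 \<noteq> 0 \<and> wt Xs as \<noteq> 0"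
  by (auto simp: cochain_hom_def vec_simps split: if_splits)

lemma rev_hd_last: "Xs \<noteq> [] \<Longrightarrow> hd (rev Xs) = last Xs \<and> last (rev Xs) = hd Xs"
  by (simp add: hd_rev last_rev)

lemma composable_mod_arg: "composable AA Xs gs as \<Longrightarrow> mod_arg AA (S p) Xs 0 0 gs as"
  by (auto simp: mod_arg_def composable_iff S_MSp vec_simps(2)[symmetric])

lemma MSp_S_range: "b \<in> MSp (S p) X h \<Longrightarrow> b \<in> range vec"
  by (auto simp: S_MSp vec_simps(2)[symmetric] split: if_splits simp del: vec_simps)

lemma range_vec_closed: "b \<in> range vec \<Longrightarrow> b' \<in> range vec \<Longrightarrow> b + b' \<in> range vec"
    "b \<in> range vec \<Longrightarrow> vscale c b \<in> range vec"
  by (auto simp: vec_simps)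

lemma zero_MSp: "0 \<in> MSp (S q) X h"
  using vec_simps(2) by (metis S_MSp rangeI singletonI)

lemma cochain_hom_multilinear:
  assumes d: "dom Xs as" and b: "b \<in> range vec" and i: "i < length as"
    and x: "x \<in> line (Xs ! i) (Xs ! Suc i)" and y: "y \<in> line (Xs ! i) (Xs ! Suc i)"
  shows "cochain_hom f Xs b (as[i := x + y]) = cochain_hom f Xs b (as[i := x]) + cochain_hom f Xs b (as[i := y])"
    "cochain_hom f Xs b (as[i := Scl AA c x]) = vscale c (cochain_hom f Xs b (as[i := x]))"
proof -
  have u: "dom Xs (as[i := z])" if "z \<in> line (Xs ! i) (Xs ! Suc i)" for z
    using d that i by (auto simp: dom_def nth_list_update)
  show "cochain_hom f Xs b (as[i := x + y]) = cochain_hom f Xs b (as[i := x]) + cochain_hom f Xs b (as[i := y])"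
    using u[OF x] u[OF y] u[OF line_add[OF x y]] b i by (simp add: cochain_hom_def wt_update vec_simps algebra_simps)
  show "cochain_hom f Xs b (as[i := Scl AA c x]) = vscale c (cochain_hom f Xs b (as[i := x]))"
    using u[OF x] u[OF line_scale[OF x]] b i by (simp add: cochain_hom_def wt_update vec_simps A_Scl mult_ac)
qed

lemma cochain_hom_family:
  assumes f: "f \<in> cochains p q g"
    and T: "\<And>Xs as b. dom Xs as \<Longrightarrow> b \<in> range vec \<Longrightarrow> T Xs b as = cochain_hom f Xs b as"
  shows "multilinear_family AA (S p) (S q) g T"
  unfolding multilinear_family_def
proof (intro allI impI)
  fix Xs :: "nat list" and gs :: "int list" and h :: int
  assume "set Xs \<subseteq> Ob AA \<and> length Xs = Suc (length gs)"
  then have X: "set Xs \<subseteq> {0..n}" "length Xs = Suc (length gs)" "Xs \<noteq> []" by (auto simp: A_Ob)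
  have as: "dom Xs as \<and> length as = length gs \<and> (\<forall>r<length as. as ! r \<noteq> 0 \<longrightarrow> gs ! r = 0)"
    if "as \<in> listset (hom_spaces AA Xs gs)" for as
  proof -
    have "composable AA Xs gs as" using that X by (simp add: composable_def A_Ob)
    from mod_argD[OF composable_mod_arg[OF this]] show ?thesis by metis
  qed
  have le: "Xs ! r \<le> n" if "r < length Xs" for r using X that by (metis atLeastAtMost_iff nth_mem subsetD)
  have hs: "hom_spaces AA Xs gs ! i = (if gs ! i = 0 then line (Xs ! i) (Xs ! Suc i) else {0})" if "i < length gs" for i
    using that X le by (simp add: hom_spaces_def A_Hom_line)
  have hl: "x \<in> line (Xs ! i) (Xs ! Suc i)" if "x \<in> hom_spaces AA Xs gs ! i" "i < length gs" for x i
    using that hs line_0 by (auto split: if_splits)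
  show "(\<forall>b\<in>MSp (S p) (last Xs) h. multilinear_on (Scl AA) vscale (hom_spaces AA Xs gs) (T Xs b)) \<and>
      (\<forall>as\<in>listset (hom_spaces AA Xs gs). \<forall>b\<in>MSp (S p) (last Xs) h.
         T Xs b as \<in> MSp (S q) (hd Xs) (h + sum_list gs + g - int (length Xs) + 1) \<and>
         (\<forall>b'\<in>MSp (S p) (last Xs) h. T Xs (b + b') as = T Xs b as + T Xs b' as) \<and>
         (\<forall>c. T Xs (vscale c b) as = vscale c (T Xs b as)))"
  proof (intro conjI ballI allI)
    fix b assume "b \<in> MSp (S p) (last Xs) h"
    then have b: "b \<in> range vec" by (rule MSp_S_range)
    show "multilinear_on (Scl AA) vscale (hom_spaces AA Xs gs) (T Xs b)"
      unfolding multilinear_on_def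
    proof (intro ballI allI impI)
      fix as i x y c
      assume a: "as \<in> listset (hom_spaces AA Xs gs)" and i: "i < length (hom_spaces AA Xs gs)"
        and x: "x \<in> hom_spaces AA Xs gs ! i" and y: "y \<in> hom_spaces AA Xs gs ! i"
      have i': "i < length gs" "i < length as" using i as[OF a] by (auto simp: hom_spaces_def)
      note x' = hl[OF x i'(1)] and y' = hl[OF y i'(1)]
      have "dom Xs (as[i := z])" if "z \<in> line (Xs ! i) (Xs ! Suc i)" for z
        using as[OF a] that i' by (auto simp: dom_def nth_list_update)
      then show "T Xs b (as[i := x + y]) = T Xs b (as[i := x]) + T Xs b (as[i := y]) \<and>
          T Xs b (as[i := Scl AA c x]) = vscale c (T Xs b (as[i := x]))"
        using cochain_hom_multilinear[OF conjunct1[OF as[OF a]] b i'(2) x' y'] T b x' y' line_add line_scale by simp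
    qed
  next
    fix as b assume a: "as \<in> listset (hom_spaces AA Xs gs)" and b: "b \<in> MSp (S p) (last Xs) h"
    note b' = MSp_S_range[OF b]
    have tb: "T Xs b'' as = cochain_hom f Xs b'' as" if "b'' \<in> range vec" for b'' using T as[OF a] that by blast
    show "T Xs b as \<in> MSp (S q) (hd Xs) (h + sum_list gs + g - int (length Xs) + 1)"
    proof (cases "cochain_hom f Xs b as = 0")
      case True
      then show ?thesis by (simp add: tb[OF b'] zero_MSp)
    next
      case False
      then have nz: "f (rev Xs) \<noteq> 0" "b 0 \<noteq> 0" "wt Xs as \<noteq> 0" by (auto dest: cochain_hom_nonzero)
      have "gs ! r = 0" if "r < length gs" for r
        using as[OF a] wt_nonzero[OF nz(3), of r] that by fastforce
      then have "gs = replicate (length gs) 0" by (intro nth_equalityI) auto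
      then have "sum_list gs = 0" by (metis mult_zero_right sum_list_replicate)
      moreover have "h = 0" using b nz(2) by (auto simp: S_MSp split: if_splits)
      moreover have "hd Xs = q" using cochainsD(1)[OF f nz(1)] X(3) by (simp add: V_def rev_hd_last)
      moreover have "int (length Xs) = g + 1" using cochainsD(2)[OF f nz(1)] by simp
      moreover have "cochain_hom f Xs b as \<in> range vec" using as[OF a] b' by (auto simp: cochain_hom_def)
      ultimately show ?thesis by (simp add: tb[OF b'] S_MSp)
    qed
    show "T Xs (b + b'') as = T Xs b as + T Xs b'' as" if "b'' \<in> MSp (S p) (last Xs) h" for b''
      using as[OF a] b' MSp_S_range[OF that] range_vec_closed(1)[OF b' MSp_S_range[OF that]]
      by (simp add: tb) (simp add: cochain_hom_def vec_simps algebra_simps)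
    show "T Xs (vscale c b) as = vscale c (T Xs b as)" for c
      using as[OF a] b' range_vec_closed(2)[OF b', of c]
      by (simp add: tb) (simp add: cochain_hom_def vec_simps vscale_apply mult_ac)
  qed
qed

lemma multilinear_scale:
  fixes F :: "'v::ab_group_add list \<Rightarrow> 'w::ab_group_add" and sv :: "'k \<Rightarrow> 'v \<Rightarrow> 'v" and sw :: "'k \<Rightarrow> 'w \<Rightarrow> 'w"
  assumes F: "multilinear_on sv sw Vs F" and vs: "vector_space sw"
    and us: "us \<in> listset Vs" "\<And>i c. i < length Vs \<Longrightarrow> sv c (us ! i) \<in> Vs ! i"
    and as: "length as = length us" "\<And>i. i < length us \<Longrightarrow> as ! i = sv (c i) (us ! i)"
  shows "F as = sw (\<Prod>i<length us. c i) (F us)"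
proof -
  interpret vector_space sw by fact
  have l: "length us = length Vs" "\<And>i. i < length Vs \<Longrightarrow> us ! i \<in> Vs ! i" using us(1) by (auto simp: in_listset)
  have "k \<le> length us \<Longrightarrow> F (take k as @ drop k us) = sw (\<Prod>i<k. c i) (F us)" for k
  proof (induction k)
    case (Suc k)
    let ?B = "take k as @ drop k us"
    have B: "?B \<in> listset Vs"
      unfolding in_listset using Suc.prems as l us(2) by (auto simp: nth_append min_def)
    have s: "take (Suc k) as @ drop (Suc k) us = ?B[k := sv (c k) (us ! k)]"
      using Suc.prems as by (simp add: take_Suc_conv_app_nth list_update_append Cons_nth_drop_Suc[symmetric])
    have e: "?B[k := us ! k] = ?B"
      using Suc.prems as by (intro list_update_same_conv[THEN iffD2]) (auto simp: nth_append)
    have "F (?B[k := sv (c k) (us ! k)]) = sw (c k) (F (?B[k := us ! k]))"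
      using F[unfolded multilinear_on_def, rule_format, OF B, of k "us ! k" "us ! k" "c k"] Suc.prems l by simp
    then show ?case using Suc by (simp add: s e mult.commute)
  qed simp
  from this[of "length us"] show ?thesis using as(1) by simp
qed

definition paths :: "nat list \<Rightarrow> (nat \<times> nat \<Rightarrow> 'k) list" where
  "paths Xs = map (\<lambda>r. path (Xs ! r) (Xs ! Suc r)) [0..<length Xs - 1]"

lemma V_short:
  assumes "V p q (rev Xs)" "Suc r < length Xs" shows "short (Xs ! r) (Xs ! Suc r)"
proof -
  have "Suc (length Xs - Suc (Suc r)) < length (rev Xs)" using assms(2) by simp
  moreover have "length Xs - Suc (Suc (length Xs - Suc (Suc r))) = r" "length Xs - Suc (length Xs - Suc (Suc r)) = Suc r"
    using assms(2) by auto
  ultimately show ?thesis using assms by (auto simp: V_def chain_def short_def rev_nth)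
qed

lemma V_bound: "V p q z \<Longrightarrow> x \<in> set z \<Longrightarrow> x \<le> p"
proof -
  assume v: "V p q z" and x: "x \<in> set z"
  then have "sorted_wrt (\<ge>) z" by (simp add: V_def chain_alt)
  then show "x \<le> p" using v x by (cases z) (auto simp: V_def)
qed

lemma dom_paths: "p \<le> n \<Longrightarrow> V p q (rev Xs) \<Longrightarrow> dom Xs (paths Xs)"
proof -
  assume p: "p \<le> n" and v: "V p q (rev Xs)"
  have "set Xs \<subseteq> {0..n}" using V_bound[OF v] p by fastforce
  moreover have "length Xs = Suc (length (paths Xs))" using v by (cases Xs) (auto simp: paths_def V_def)
  moreover have "paths Xs ! r \<in> line (Xs ! r) (Xs ! Suc r)" if "r < length (paths Xs)" for r
    unfolding line_def
    by (intro CollectI exI[of _ 1]) (use V_short[OF v, of r] that in \<open>auto simp: paths_def scaled_path_1\<close>)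
  ultimately show ?thesis by (simp add: dom_def)
qed

lemma wt_paths: "wt Xs (paths Xs) = 1"
  by (simp add: wt_def paths_def path_def)

lemma cochain_hom_eval: "p \<le> n \<Longrightarrow> V p q z \<Longrightarrow> cochain_hom f (rev z) (vec 1) (paths (rev z)) = vec (f z)"
  using dom_paths[of p q "rev z"] by (simp add: cochain_hom_def wt_paths vec_simps)

lemma cochain_hom_mod_hom:
  assumes f: "f \<in> cochains p q g"
  shows "cochain_hom f \<in> mod_hom AA (S p) (S q) g"
proof -
  have "cochain_hom f Xs b as = 0" if "\<nexists>h gs. mod_arg AA (S p) Xs h b gs as" for Xs b as
  proof (rule ccontr)
    assume "cochain_hom f Xs b as \<noteq> 0"
    then have nz: "dom Xs as" "b \<in> range vec" "f (rev Xs) \<noteq> 0" by (auto dest: cochain_hom_nonzero)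
    then have "last Xs = p" using cochainsD(1)[OF f nz(3)] by (auto simp: V_def hd_rev)
    then show False using that nz mod_arg_iff by blast
  qed
  then show ?thesis using cochain_hom_family[OF f] by (simp add: mod_hom_def)
qed

text \<open>
  Read off the cochain on the basis elements. Conversely the family is recovered by multilinearity
  on its domain of homogeneous arguments; elsewhere both sides are normalised to be zero.
\<close>

lemma mod_hom_cochain_hom:
  assumes p: "p \<le> n" and T: "T \<in> mod_hom AA (S p) (S q) g"
  obtains f where "f \<in> cochains p q g" "T = cochain_hom f"
proof -
  have fm: "multilinear_family AA (S p) (S q) g T"
    and off: "(\<nexists>h gs. mod_arg AA (S p) Xs h b gs as) \<Longrightarrow> T Xs b as = 0" for Xs b as
    using T by (auto simp: mod_hom_def)
  define f where "f z = (if V p q z \<and> int (length z) = g + 1 then T (rev z) (vec 1) (paths (rev z)) 0 else 0)" for z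
  have f: "f \<in> cochains p q g" by (auto simp: cochains_def f_def)
  have "T Xs b as = cochain_hom f Xs b as" for Xs b as
  proof (cases "\<exists>h gs. mod_arg AA (S p) Xs h b gs as")
    case False
    then have "cochain_hom f Xs b as = 0" using cochain_hom_mod_hom[OF f] by (auto simp: mod_hom_def)
    then show ?thesis using off[OF False] by simp
  next
    case True
    then have d: "dom Xs as" "b \<in> range vec" "last Xs = p \<or> b = 0" using mod_arg_iff by auto
    have len: "length Xs = Suc (length as)" "Xs \<noteq> []" and sub: "set Xs \<subseteq> Ob AA"
      using d(1) by (auto simp: dom_def A_Ob)
    have le: "Xs ! r \<le> n" if "r < length Xs" for r
      using that d(1) by (metis atLeastAtMost_iff dom_def nth_mem subsetD)
    let ?gs = "replicate (length as) (0::int)"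
    have hs: "hom_spaces AA Xs ?gs = map (\<lambda>r. line (Xs ! r) (Xs ! Suc r)) [0..<length as]"
      using le len by (simp add: hom_spaces_def A_Hom_line)
    have asl: "as \<in> listset (hom_spaces AA Xs ?gs)" using d(1) by (simp add: hs in_listset dom_def)
    have bM: "b \<in> MSp (S p) (last Xs) 0" using d by (auto simp: S_MSp)
    have FM: "multilinear_on (Scl AA) vscale (hom_spaces AA Xs ?gs) (T Xs b)"
      and tM: "T Xs b as \<in> MSp (S q) (hd Xs) (g - int (length Xs) + 1)"
      and sb: "T Xs (vscale c b) as = vscale c (T Xs b as)" for c
    proof -
      have *: "length Xs = Suc (length ?gs)" using len by simp
      have s0: "sum_list ?gs = 0" by (simp add: sum_list_replicate)
      show "multilinear_on (Scl AA) vscale (hom_spaces AA Xs ?gs) (T Xs b)"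
        using fm[unfolded multilinear_family_def] sub * bM by blast
      have "T Xs b as \<in> MSp (S q) (hd Xs) (0 + sum_list ?gs + g - int (length Xs) + 1)"
        using fm[unfolded multilinear_family_def] sub * bM asl by blast
      then show "T Xs b as \<in> MSp (S q) (hd Xs) (g - int (length Xs) + 1)" by (simp only: s0 add_0)
      show "T Xs (vscale c b) as = vscale c (T Xs b as)"
        using fm[unfolded multilinear_family_def] sub * bM asl by blast
    qed
    show ?thesis
    proof (cases "b 0 * wt Xs as = 0")
      case True
      have "T Xs b as = 0"
      proof (cases "b 0 = 0")
        case True
        then have "b = 0" using d(2) by (auto simp: vec_simps)
        then show ?thesis using sb[of 0] by (simp add: vscale_0)
      next
        case False
        then have "wt Xs as = 0" using True by simp
        then obtain i where i: "i < length as" "(as ! i) (Xs ! i, Xs ! Suc i) = 0"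
          by (auto simp: wt_def prod_zero_iff)
        then have ai: "as ! i \<in> line (Xs ! i) (Xs ! Suc i)" "as ! i = 0"
          using d(1) line_eq[of "as ! i" "Xs ! i" "Xs ! Suc i"] by (auto simp: dom_def scaled_path_0)
        have "T Xs b (as[i := Scl AA 0 (as ! i)]) = vscale 0 (T Xs b (as[i := as ! i]))"
          using FM asl i ai unfolding multilinear_on_def by (simp add: hs)
        moreover have "as[i := 0] = as" using ai(2) by (metis list_update_id)
        ultimately show ?thesis using ai by (simp add: Scl_A_0 vscale_0)
      qed
      then show ?thesis using True by (auto simp: cochain_hom_def vec_simps)
    next
      case False
      have bv: "b = vscale (b 0) (vec 1)" using d(2) by (auto simp: vec_simps)
      have p': "last Xs = p" using False d(3) by auto
      have ch: "chain (rev Xs)" using wt_chain[OF d(1)] False by simp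
      show ?thesis
      proof (cases "hd Xs = q \<and> int (length Xs) = g + 1")
        case False
        then have "T Xs b as = 0" using tM by (auto simp: S_MSp split: if_splits)
        moreover have "f (rev Xs) = 0" using False len(2) by (auto simp: f_def V_def rev_hd_last)
        ultimately show ?thesis by (simp add: cochain_hom_def vec_simps)
      next
        case True
        then have v: "V p q (rev Xs)" using p' ch len by (simp add: V_def rev_hd_last)
        have pd: "dom Xs (paths Xs)" by (rule dom_paths[OF p v])
        have lp: "length (paths Xs) = length as" using len by (simp add: paths_def)
        have ps: "paths Xs \<in> listset (hom_spaces AA Xs ?gs)" using pd lp by (simp add: hs in_listset dom_def)
        have u: "T Xs b as = vscale (\<Prod>i<length (paths Xs). (as ! i) (Xs ! i, Xs ! Suc i)) (T Xs b (paths Xs))"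
        proof (rule multilinear_scale[OF FM vs_vscale ps])
          show "Scl AA c (paths Xs ! i) \<in> hom_spaces AA Xs ?gs ! i" if "i < length (hom_spaces AA Xs ?gs)" for i c
            using that pd lp line_scale[of "paths Xs ! i" "Xs ! i" "Xs ! Suc i"] by (simp add: hs dom_def)
          show "as ! i = Scl AA ((as ! i) (Xs ! i, Xs ! Suc i)) (paths Xs ! i)" if "i < length (paths Xs)" for i
          proof -
            have "as ! i \<in> line (Xs ! i) (Xs ! Suc i)" using d(1) that lp by (simp add: dom_def)
            from line_eq[OF this] show ?thesis
              using that by (simp add: paths_def scaled_path_1[symmetric] Scl_scaled_path)
          qed
        qed (simp add: lp)
        have "T Xs b (paths Xs) = vscale (b 0) (T Xs (vec 1) (paths Xs))"
        proof -
          have "vec 1 \<in> MSp (S p) (last Xs) 0" using p' by (simp add: S_MSp)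
          moreover have *: "length Xs = Suc (length ?gs)" using len by simp
          ultimately have "T Xs (vscale (b 0) (vec 1)) (paths Xs) = vscale (b 0) (T Xs (vec 1) (paths Xs))"
            using fm[unfolded multilinear_family_def] sub ps by blast
          then show ?thesis using bv by simp
        qed
        moreover have "T Xs (vec 1) (paths Xs) = vec (f (rev Xs))"
        proof -
          have "vec 1 \<in> MSp (S p) (last Xs) 0" using p' by (simp add: S_MSp)
          moreover have *: "length Xs = Suc (length ?gs)" using len by simp
          ultimately have "T Xs (vec 1) (paths Xs) \<in> MSp (S q) (hd Xs) (0 + sum_list ?gs + g - int (length Xs) + 1)"
            using fm[unfolded multilinear_family_def] sub ps by blast
          from MSp_S_range[OF this] obtain c where "T Xs (vec 1) (paths Xs) = vec c" by auto
          then show ?thesis using v True by (simp add: f_def vec_simps)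
        qed
        ultimately show ?thesis
          using u d by (simp add: cochain_hom_def lp vec_simps wt_def mult_ac)
      qed
    qed
  qed
  then have "T = cochain_hom f" by blast
  with f that show thesis by blast
qed

end

section \<open>The category of simple modules\<close>

context koszul
begin

lemma powi_sg: "(-1 :: 'k) powi k = sg k"
  by (simp add: sg_def power_int_minus_left)

definition supp :: "nat \<Rightarrow> nat \<Rightarrow> (nat list \<Rightarrow> 'k) \<Rightarrow> bool" where
  "supp p q f \<longleftrightarrow> (\<forall>z. f z \<noteq> 0 \<longrightarrow> V p q z)"

text \<open>
  The differential on cochains that corresponds to the one on module morphisms.
\<close>

definition dd :: "nat \<Rightarrow> nat \<Rightarrow> (nat list \<Rightarrow> 'k) \<Rightarrow> nat list \<Rightarrow> 'k" where
  "dd p q f z = (if V p q z then - bdry f z else 0)"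

text \<open>
  The structure map of a simple module, the action of the identity, as a cochain.
\<close>

definition action_cochain :: "nat \<Rightarrow> nat list \<Rightarrow> 'k" where
  "action_cochain p z = (if z = [p, p] then 1 else 0)"

lemma suppD: "supp p q f \<Longrightarrow> f z \<noteq> 0 \<Longrightarrow> V p q z"
  by (simp add: supp_def)

lemma supp_Nil: "supp p q f \<Longrightarrow> f [] = 0"
  using suppD[of p q f "[]"] by (auto simp: V_def)

lemma cochains_supp: "f \<in> cochains p q g \<Longrightarrow> supp p q f"
  by (simp add: cochains_def supp_def)

lemma V_unit: "V p p [p, p]"
  using L_le_self[of p] by (simp add: V_def chain_def)

lemma action_cochain_cochains: "action_cochain p \<in> cochains p p 1"
  using V_unit by (simp add: cochains_def action_cochain_def)

lemma S_MMu:
  assumes p: "p \<le> n" and d: "dom Xs as" and b: "b \<in> range vec"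
  shows "MMu (S p) Xs b as = cochain_hom (action_cochain p) Xs b as"
proof (cases "Xs = [p, p]")
  case True
  then have "length as = 1" using d by (simp add: dom_def)
  then obtain a where as: "as = [a]" by (auto simp: length_Suc_conv)
  then have "a \<in> line p p" using d True by (simp add: dom_def)
  moreover obtain c where "b = vec c" using b by blast
  ultimately show ?thesis
    using d S_MMu_pair[OF p, of a b] True as by (simp add: cochain_hom_def action_cochain_def wt_def vec_simps mult_ac)
next
  case False
  then have "rev Xs \<noteq> [p, p]" by (metis rev.simps rev_rev_ident append_Nil append_Cons)
  then show ?thesis using False by (simp add: S_MMu_off cochain_hom_def action_cochain_def vec_simps)
qed

lemma cochain_hom_zero_arg: "0 \<in> set as \<Longrightarrow> cochain_hom f Xs b as = 0"
proof -
  assume "0 \<in> set as"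
  then obtain r where "r < length as" "as ! r = 0" by (metis in_set_conv_nth)
  then have "wt Xs as = 0" unfolding wt_def by (intro prod_zero bexI[of _ r]) auto
  then show ?thesis by (simp add: cochain_hom_def vec_simps)
qed

lemma cup_rev:
  "cup f1 f2 (rev Xs) = (\<Sum>i<length Xs. (-1) ^ (length Xs - Suc i) * f1 (rev (drop i Xs)) * f2 (rev (take (Suc i) Xs)) :: 'k)"
proof -
  let ?G = "\<lambda>m. (-1) ^ m * f1 (take (Suc m) (rev Xs)) * f2 (drop m (rev Xs))"
  have "cup f1 f2 (rev Xs) = (\<Sum>i<length Xs. ?G (length Xs - Suc i))"
    using sum.nat_diff_reindex[of ?G "length Xs"] by (simp only: cup_def length_rev)
  also have "\<dots> = (\<Sum>i<length Xs. (-1) ^ (length Xs - Suc i) * f1 (rev (drop i Xs)) * f2 (rev (take (Suc i) Xs)))"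
  proof (rule sum.cong[OF refl])
    fix i assume "i \<in> {..<length Xs}"
    then have i: "i < length Xs" by simp
    have "take (Suc (length Xs - Suc i)) (rev Xs) = rev (drop i Xs)" using i by (simp add: take_rev Suc_diff_Suc)
    moreover have "drop (length Xs - Suc i) (rev Xs) = rev (take (Suc i) Xs)" using i by (simp add: drop_rev)
    ultimately show "?G (length Xs - Suc i) = (-1) ^ (length Xs - Suc i) * f1 (rev (drop i Xs)) * f2 (rev (take (Suc i) Xs))"
      by simp
  qed
  finally show ?thesis .
qed

lemma cup_V: "supp p r f1 \<Longrightarrow> supp r q f2 \<Longrightarrow> cup f1 f2 z \<noteq> 0 \<Longrightarrow>
    \<exists>m<length z. V p r (take (Suc m) z) \<and> f1 (take (Suc m) z) \<noteq> 0 \<and> f2 (drop m z) \<noteq> 0 \<and> V p q z"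
proof -
  assume f: "supp p r f1" "supp r q f2" and "cup f1 f2 z \<noteq> 0"
  then obtain m where m: "m < length z" "(-1) ^ m * f1 (take (Suc m) z) * f2 (drop m z) \<noteq> 0"
    unfolding cup_def by (meson lessThan_iff sum.not_neutral_contains_not_neutral)
  then have "V p r (take (Suc m) z)" "V r q (drop m z)" using suppD[OF f(1)] suppD[OF f(2)] by auto
  then show ?thesis using V_join[OF _ _ m(1)] m by (intro exI[of _ m]) auto
qed

lemma cup_supp: "supp p r f1 \<Longrightarrow> supp r q f2 \<Longrightarrow> supp p q (cup f1 f2)"
  unfolding supp_def[of p q] using cup_V by blast

lemma cup_cochains: "f1 \<in> cochains p r g1 \<Longrightarrow> f2 \<in> cochains r q g2 \<Longrightarrow> cup f1 f2 \<in> cochains p q (g1 + g2)"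
proof -
  assume f: "f1 \<in> cochains p r g1" "f2 \<in> cochains r q g2"
  have "V p q z \<and> int (length z) = g1 + g2 + 1" if nz: "cup f1 f2 z \<noteq> 0" for z
  proof -
    obtain m where "m < length z" "f1 (take (Suc m) z) \<noteq> 0" "f2 (drop m z) \<noteq> 0" "V p q z"
      using cup_V[OF cochains_supp[OF f(1)] cochains_supp[OF f(2)] nz] by blast
    then show ?thesis using cochainsD(2)[OF f(1), of "take (Suc m) z"] cochainsD(2)[OF f(2), of "drop m z"] by auto
  qed
  then show ?thesis by (simp add: cochains_def)
qed

lemma dd_cochains: "f \<in> cochains p q g \<Longrightarrow> dd p q f \<in> cochains p q (g + 1)"
proof -
  assume f: "f \<in> cochains p q g"
  have "int (length z) = g + 2" if nz: "bdry f z \<noteq> 0" for z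
  proof -
    obtain m where "m < length z" "f (del m z) \<noteq> 0"
      using nz unfolding bdry_def by (metis (no_types, lifting) lessThan_iff mult_zero_right sum.neutral)
    then show ?thesis using cochainsD(2)[OF f, of "del m z"] by (simp add: length_del)
  qed
  then show ?thesis by (auto simp: cochains_def dd_def split: if_splits)
qed

lemma dd_supp: "supp p q (dd p q f)"
  by (simp add: supp_def dd_def)

lemma mod_composition_cochain_hom:
  assumes f: "supp p r f1" "supp r q f2"
  shows "mod_composition AA (S p) (cochain_hom f2) (cochain_hom f1) = cochain_hom (cup f1 f2)"
proof (intro ext)
  fix Xs b as
  let ?C = "mod_composition AA (S p) (cochain_hom f2) (cochain_hom f1) Xs b as"
  have "?C = cochain_hom (cup f1 f2) Xs b as"
  proof (cases "\<exists>h gs. mod_arg AA (S p) Xs h b gs as")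
    case False
    have "cochain_hom (cup f1 f2) Xs b as = 0"
    proof (rule ccontr)
      assume "cochain_hom (cup f1 f2) Xs b as \<noteq> 0"
      then have nz: "dom Xs as" "b \<in> range vec" "cup f1 f2 (rev Xs) \<noteq> 0" by (auto dest: cochain_hom_nonzero)
      then have "last Xs = p" using suppD[OF cup_supp[OF f] nz(3)] by (auto simp: V_def hd_rev)
      then show False using False nz mod_arg_iff by blast
    qed
    then show ?thesis using False by (simp add: mod_composition_def)
  next
    case True
    then obtain h gs where arg: "mod_arg AA (S p) Xs h b gs as" by blast
    have d: "dom Xs as" "b \<in> range vec" using mod_argD[OF arg] by auto
    let ?K = "b 0 * wt Xs as"
    have sgn: "mod_sign AA (S p) Xs b as i * ?K = (-1) ^ (length Xs - Suc i) * ?K" if "i < length Xs" for i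
    proof (cases "?K = 0")
      case False
      have "int i + 1 - int (length Xs) = - int (length Xs - Suc i)" using that by simp
      then have "(-1 :: 'k) powi (int i + 1 - int (length Xs)) = (-1) ^ (length Xs - Suc i)"
        by (simp only: powi_sg flip: sg_int) (simp add: sg_def)
      then show ?thesis using mod_sign_S[OF arg False] by simp
    qed simp
    have "?C = (\<Sum>i<length Xs. vec (mod_sign AA (S p) Xs b as i * ?K *
        (f1 (rev (drop i Xs)) * f2 (rev (take (Suc i) Xs)))))"
      using True d by (simp add: mod_composition_def cochain_hom_cut vec_simps mult_ac)
    also have "\<dots> = vec (cup f1 f2 (rev Xs) * ?K)"
      unfolding vec_sum cup_rev sum_distrib_right
      by (rule arg_cong[of _ _ vec], rule sum.cong[OF refl]) (use sgn in \<open>auto simp: mult_ac\<close>)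
    finally show ?thesis using d by (simp add: cochain_hom_def)
  qed
  then show "mod_composition AA (S p) (cochain_hom f2) (cochain_hom f1) Xs b as i = cochain_hom (cup f1 f2) Xs b as i" for i by simp
qed

lemma cup_action_cochain_right:
  assumes f: "supp p q f" and z: "z \<noteq> []" "last z = q"
  shows "cup f (action_cochain q) z = - ((-1) ^ (length z - 1) * f (del (length z - 1) z))"
proof (cases "length z = 1")
  case True
  then obtain x where "z = [x]" by (auto simp: length_Suc_conv)
  then show ?thesis using supp_Nil[OF f] by (simp add: cup_def action_cochain_def del_def)
next
  case False
  obtain v y where v: "z = v @ [y]" using z(1) by (metis append_butlast_last_id)
  then have "v \<noteq> []" using False by auto
  then obtain w x where "v = w @ [x]" by (metis append_butlast_last_id)
  then have zz: "z = w @ [x, q]" using v z(2) by simp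
  have dr: "drop m z = [q, q] \<longleftrightarrow> m = length w \<and> x = q" if "m < length z" for m
  proof
    assume a: "drop m z = [q, q]"
    then have "length z - m = 2" by (metis length_drop length_Cons list.size(3) numeral_2_eq_2)
    then have "m = length w" using zz by simp
    then show "m = length w \<and> x = q" using a zz by simp
  qed (simp add: zz)
  have "cup f (action_cochain q) z = (\<Sum>m<length z. if m = length w then (if x = q then (-1) ^ m * f (take (Suc m) z) else 0) else 0)"
    unfolding cup_def action_cochain_def by (rule sum.cong[OF refl]) (use dr in auto)
  also have "\<dots> = (if x = q then (-1) ^ length w * f (w @ [x]) else 0)" using zz by simp
  also have "\<dots> = (-1) ^ length w * f (w @ [x])"
    using suppD[OF f, of "w @ [x]"] by (auto simp: V_def)
  finally show ?thesis by (simp add: zz del_def)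
qed

lemma cup_action_cochain_left:
  assumes f: "supp p q f" and z: "z \<noteq> []" "hd z = p"
  shows "cup (action_cochain p) f z = - f (del 0 z)"
proof (cases z)
  case (Cons y w)
  show ?thesis
  proof (cases w)
    case Nil
    then show ?thesis using supp_Nil[OF f] Cons by (simp add: cup_def action_cochain_def del_def)
  next
    case (Cons x v)
    then have zz: "z = p # x # v" using z \<open>z = y # w\<close> by simp
    have "take (Suc m) z = [p, p] \<longleftrightarrow> m = 1 \<and> x = p" if "m < length z" for m
      using that zz by (cases m; cases "m - 1") auto
    then have "cup (action_cochain p) f z = (\<Sum>m<length z. if m = 1 then (if x = p then (-1) ^ m * f (drop m z) else 0) else 0)"
      unfolding cup_def action_cochain_def by (intro sum.cong[OF refl]) auto
    also have "\<dots> = (if x = p then - f (x # v) else 0)" by (subst sum.delta) (auto simp: zz)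
    also have "\<dots> = - f (x # v)" using suppD[OF f, of "x # v"] by (auto simp: V_def)
    finally show ?thesis by (simp add: zz del_def)
  qed
qed (use z in simp)

text \<open>
  The differential of module morphisms has inner terms, where two paths are composed, and outer terms
  with the actions on the two simple modules. The outer terms are the deletions of the first and the
  last entry, which are only possible next to an identity morphism.
\<close>

lemma bdry_units:
  assumes f: "supp p q f" and z: "chain z" "z \<noteq> []" "hd z = p"
  shows "dd p q f z = cup f (action_cochain q) z + cup (action_cochain p) f z - (\<Sum>m=1..<length z - 1. (-1) ^ m * f (del m z))"
proof (cases "last z = q")
  case False
  have fz: "f w = 0" if "last w = last z" for w using suppD[OF f, of w] that False by (auto simp: V_def)
  have "cup f (action_cochain q) z = 0"
    unfolding cup_def action_cochain_def by (rule sum.neutral) (use False in \<open>auto dest!: arg_cong[where f = last] simp: last_drop\<close>)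
  moreover have "cup (action_cochain p) f z = 0"
    unfolding cup_def by (rule sum.neutral) (auto simp: fz last_drop)
  moreover have "(\<Sum>m=1..<length z - 1. (-1) ^ m * f (del m z)) = 0"
  proof (rule sum.neutral, rule ballI)
    fix m assume "m \<in> {1..<length z - 1}"
    then have "Suc m < length z" by auto
    then have "last (del m z) = last z" by (simp add: del_def last_append last_drop)
    then show "(-1) ^ m * f (del m z) = 0" by (simp add: fz)
  qed
  ultimately show ?thesis using False by (simp add: dd_def V_def)
next
  case True
  then have "V p q z" using z by (simp add: V_def)
  then have "dd p q f z = - bdry f z" by (simp add: dd_def)
  also have "bdry f z = f (del 0 z) + (\<Sum>m=1..<length z - 1. (-1) ^ m * f (del m z)) + (-1) ^ (length z - 1) * f (del (length z - 1) z)"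
  proof (cases "length z = 1")
    case True
    then obtain x where "z = [x]" by (auto simp: length_Suc_conv)
    then show ?thesis using supp_Nil[OF f] by (simp add: bdry_def del_def)
  next
    case False
    let ?g = "\<lambda>m. (-1) ^ m * f (del m z)"
    have l: "length z = Suc (Suc (length z - 2))" using False z(2) by (cases z; cases "tl z") auto
    have "bdry f z = sum ?g {0..<Suc (length z - 1)}" using z(2) by (simp add: bdry_def atLeast0LessThan)
    also have "\<dots> = sum ?g {0..<length z - 1} + ?g (length z - 1)" by simp
    also have "sum ?g {0..<length z - 1} = ?g 0 + sum ?g {Suc 0..<length z - 1}"
      using l by (intro sum.atLeast_Suc_lessThan) auto
    finally show ?thesis by simp
  qed
  finally show ?thesis
    using cup_action_cochain_right[OF f z(2) True] cup_action_cochain_left[OF f z(2,3)] by simp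
qed

text \<open>
  Reversal of lists turns the sign of module theory into the one of \<open>bdry\<close>, up to a global \<open>-1\<close>, which is
  part of \<open>dd\<close>.
\<close>

lemma mod_differential_cochain_hom:
  assumes f: "supp p q f" and p: "p \<le> n" and q: "q \<le> n"
  shows "mod_differential AA (S p) (S q) (cochain_hom f) = cochain_hom (dd p q f)"
proof (intro ext)
  fix Xs b as
  let ?C = "mod_differential AA (S p) (S q) (cochain_hom f) Xs b as"
  have "?C = cochain_hom (dd p q f) Xs b as"
  proof (cases "\<exists>h gs. mod_arg AA (S p) Xs h b gs as")
    case False
    have "cochain_hom (dd p q f) Xs b as = 0"
    proof (rule ccontr)
      assume "cochain_hom (dd p q f) Xs b as \<noteq> 0"
      then have nz: "dom Xs as" "b \<in> range vec" "dd p q f (rev Xs) \<noteq> 0" by (auto dest: cochain_hom_nonzero)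
      then have "last Xs = p" using suppD[OF dd_supp nz(3)] by (auto simp: V_def hd_rev)
      then show False using False nz mod_arg_iff by blast
    qed
    then show ?thesis using False by (simp add: mod_differential_def)
  next
    case True
    then obtain h gs where arg: "mod_arg AA (S p) Xs h b gs as" by blast
    have d: "dom Xs as" "b \<in> range vec" using mod_argD[OF arg] by auto
    have len: "length Xs = Suc (length as)" using d by (simp add: dom_def)
    let ?K = "b 0 * wt Xs as" and ?e = "\<lambda>i. mod_sign AA (S p) Xs b as i" and ?N = "length Xs"
    have cut: "dom (take (Suc i) Xs) (take i as)" "dom (drop i Xs) (drop i as)" if "i < ?N" for i
      using dom_split[OF d(1), of i] that len by auto
    have rng: "cochain_hom g Xs' b' as' \<in> range vec" if "b' \<in> range vec" for g Xs' b' as'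
      using vec_simps(2) by (auto simp: cochain_hom_def)
    have m1: "MMu (S q) (take (Suc i) Xs) (cochain_hom f (drop i Xs) b (drop i as)) (take i as) =
        vec (f (rev (drop i Xs)) * action_cochain q (rev (take (Suc i) Xs)) * ?K)" if "i < ?N" for i
      using S_MMu[OF q cut(1)[OF that] rng[OF d(2)]] cochain_hom_cut[OF d that] by simp
    have m2: "cochain_hom f (take (Suc i) Xs) (MMu (S p) (drop i Xs) b (drop i as)) (take i as) =
        vec (action_cochain p (rev (drop i Xs)) * f (rev (take (Suc i) Xs)) * ?K)" if "i < ?N" for i
      using S_MMu[OF p cut(2)[OF that] d(2)] cochain_hom_cut[OF d that] by simp
    have m3: "cochain_hom f (take (Suc i) Xs @ drop (i + j) Xs) b
        (take i as @ Mu AA (take (Suc j) (drop i Xs)) (take j (drop i as)) # drop (i + j) as) =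
        (if j = 2 then vec (f (rev (del (Suc i) Xs)) * ?K) else 0)" if "i < length as" "j \<in> {1..length as - i}" for i j
    proof (cases "j = 2")
      case True
      then have "Suc i < length as" using that by auto
      moreover have "chain z" if "f z \<noteq> 0" for z using suppD[OF f that] by (simp add: V_def)
      ultimately show ?thesis
        using cochain_hom_contract(2)[OF d, of i f] True by (simp add: eval_nat_numeral)
    next
      case False
      then have "Mu AA (take (Suc j) (drop i Xs)) (take j (drop i as)) = 0" using that by (simp add: A_Mu)
      then show ?thesis using False by (simp add: cochain_hom_zero_arg)
    qed
    have "?C = vec ((\<Sum>i<?N. ?e i * (f (rev (drop i Xs)) * action_cochain q (rev (take (Suc i) Xs)) * ?K)) +
        (\<Sum>i<?N. ?e i * (action_cochain p (rev (drop i Xs)) * f (rev (take (Suc i) Xs)) * ?K)) +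
        (\<Sum>i<length as - 1. ?e i * (f (rev (del (Suc i) Xs)) * ?K)))"
    proof -
      have "(\<Sum>j=1..length as - i. vscale (?e i) (cochain_hom f (take (Suc i) Xs @ drop (i + j) Xs) b
          (take i as @ Mu AA (take (Suc j) (drop i Xs)) (take j (drop i as)) # drop (i + j) as))) =
          (if i < length as - 1 then vec (?e i * (f (rev (del (Suc i) Xs)) * ?K)) else 0)" (is "?L = _")
        if "i < length as" for i
      proof -
        have "?L = (\<Sum>j=1..length as - i. if j = 2 then vec (?e i * (f (rev (del (Suc i) Xs)) * ?K)) else 0)"
          by (rule sum.cong[OF refl]) (simp add: m3[OF that] vscale_0 vec_simps)
        also have "\<dots> = (if 2 \<in> {1..length as - i} then vec (?e i * (f (rev (del (Suc i) Xs)) * ?K)) else 0)"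
          by (rule sum.delta) simp
        finally show ?thesis using that by (auto simp: less_diff_conv)
      qed
      then have "(\<Sum>i<length as. \<Sum>j=1..length as - i. vscale (?e i) (cochain_hom f (take (Suc i) Xs @ drop (i + j) Xs) b
          (take i as @ Mu AA (take (Suc j) (drop i Xs)) (take j (drop i as)) # drop (i + j) as))) =
          (\<Sum>i<length as. if i < length as - 1 then vec (?e i * (f (rev (del (Suc i) Xs)) * ?K)) else 0)"
        by (intro sum.cong[OF refl]) auto
      also have "\<dots> = (\<Sum>i<length as - 1. vec (?e i * (f (rev (del (Suc i) Xs)) * ?K)))"
        by (rule sum.mono_neutral_cong_right) auto
      finally show ?thesis
        using True by (simp add: mod_differential_def m1 m2 vec_simps vec_sum del: append_assoc)
    qed
    also have "\<dots> = vec (dd p q f (rev Xs) * ?K)"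
    proof (cases "?K = 0")
      case True
      show ?thesis unfolding True by simp
    next
      case False
      have sgn: "?e i = (-1) ^ (?N - Suc i)" if "i < ?N" for i
      proof -
        have "int i + 1 - int (length Xs) = - int (length Xs - Suc i)" using that by simp
        then have "(-1 :: 'k) powi (int i + 1 - int (length Xs)) = (-1) ^ (length Xs - Suc i)"
          by (simp only: powi_sg flip: sg_int) (simp add: sg_def)
        then show ?thesis using mod_sign_S[OF arg False] by simp
      qed
      have ch: "chain (rev Xs)" "rev Xs \<noteq> []" "hd (rev Xs) = p"
      proof -
        have "b \<noteq> 0" using False by auto
        then show "chain (rev Xs)" "rev Xs \<noteq> []" "hd (rev Xs) = p"
          using wt_chain[OF d(1)] False mod_argD(4)[OF arg] len by (auto simp: hd_rev)
      qed
      have "(\<Sum>i<?N. ?e i * (f (rev (drop i Xs)) * action_cochain q (rev (take (Suc i) Xs)) * ?K)) = cup f (action_cochain q) (rev Xs) * ?K"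
        unfolding cup_rev sum_distrib_right by (rule sum.cong[OF refl]) (simp add: sgn mult_ac)
      moreover have "(\<Sum>i<?N. ?e i * (action_cochain p (rev (drop i Xs)) * f (rev (take (Suc i) Xs)) * ?K)) = cup (action_cochain p) f (rev Xs) * ?K"
        unfolding cup_rev sum_distrib_right by (rule sum.cong[OF refl]) (simp add: sgn mult_ac)
      moreover have "(\<Sum>i<length as - 1. ?e i * (f (rev (del (Suc i) Xs)) * ?K)) =
          - (\<Sum>m=1..<length (rev Xs) - 1. (-1) ^ m * f (del m (rev Xs))) * ?K"
      proof -
        have "(\<Sum>i<length as - 1. ?e i * (f (rev (del (Suc i) Xs)) * ?K)) =
            (\<Sum>m=1..<length (rev Xs) - 1. - ((-1) ^ m * f (del m (rev Xs)) * ?K))"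
        proof (rule sum.reindex_bij_witness[of _ "\<lambda>m. length as - 1 - m" "\<lambda>i. length as - 1 - i"])
          fix i assume "i \<in> {..<length as - 1}"
          then have i: "Suc i < length as" by auto
          then have "?N - Suc i = Suc (length as - 1 - i)" using len by simp
          moreover have "rev (del (Suc i) Xs) = del (length as - 1 - i) (rev Xs)"
          proof -
            have "drop (Suc (length as - 1 - i)) (rev Xs) = rev (take (Suc i) Xs)" using i len by (simp add: drop_rev)
            moreover have "take (length as - 1 - i) (rev Xs) = rev (drop (Suc (Suc i)) Xs)" using i len by (simp add: take_rev)
            ultimately show ?thesis by (simp add: del_def)
          qed
          ultimately show "- ((-1) ^ (length as - 1 - i) * f (del (length as - 1 - i) (rev Xs)) * ?K) =
              ?e i * (f (rev (del (Suc i) Xs)) * ?K)"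
            using i len by (simp add: sgn mult_ac)
        qed (use len in auto)
        then show ?thesis by (simp add: sum_negf sum_distrib_right)
      qed
      ultimately show ?thesis
        unfolding bdry_units[OF f ch] by (simp add: algebra_simps)
    qed
    finally show ?thesis using d by (simp add: cochain_hom_def)
  qed
  then show "mod_differential AA (S p) (S q) (cochain_hom f) Xs b as i = cochain_hom (dd p q f) Xs b as i" for i by simp
qed

end

context koszul
begin

lemma S_MMu_zero_arg: "p \<le> n \<Longrightarrow> 0 \<in> set as \<Longrightarrow> MMu (S p) Xs b as = 0"
proof (cases "Xs = [p, p] \<and> length as = 1")
  case True
  assume "p \<le> n" "0 \<in> set as"
  moreover have "as = [0]" using True \<open>0 \<in> set as\<close> by (auto simp: length_Suc_conv)
  ultimately show ?thesis using S_MMu_pair[of p 0 b] line_0 True by (simp add: vscale_0)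
qed (use S_MMu_off in blast)

lemma S_relations:
  assumes p: "p \<le> n"
  shows "module_relations AA (S p)"
  unfolding module_relations_def
proof (intro allI impI)
  fix Xs h b gs as
  assume arg: "mod_arg AA (S p) Xs h b gs as"
  have d: "dom Xs as" "b \<in> range vec" using mod_argD[OF arg] by auto
  have len: "length Xs = Suc (length as)" using d by (simp add: dom_def)
  let ?K = "b 0 * wt Xs as" and ?e = "\<lambda>i. (-1 :: 'k) powi star gs i" and ?N = "length Xs"
  have cut: "dom (take (Suc i) Xs) (take i as)" "dom (drop i Xs) (drop i as)" if "i < ?N" for i
    using dom_split[OF d(1), of i] that len by auto
  have rng: "cochain_hom g Xs' b' as' \<in> range vec" for g Xs' b' as'
    using vec_simps(2) by (auto simp: cochain_hom_def)
  have m1: "MMu (S p) (take (Suc i) Xs) (MMu (S p) (drop i Xs) b (drop i as)) (take i as) =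
      vec (action_cochain p (rev (drop i Xs)) * action_cochain p (rev (take (Suc i) Xs)) * ?K)" if "i < ?N" for i
    using S_MMu[OF p cut(2)[OF that] d(2)] S_MMu[OF p cut(1)[OF that] rng] cochain_hom_cut[OF d that] by simp
  have m3: "MMu (S p) (take (Suc i) Xs @ drop (i + j) Xs) b
      (take i as @ Mu AA (take (Suc j) (drop i Xs)) (take j (drop i as)) # drop (i + j) as) =
      (if j = 2 then vec (action_cochain p (rev (del (Suc i) Xs)) * ?K) else 0)" if "i < length as" "j \<in> {1..length as - i}" for i j
  proof (cases "j = 2")
    case True
    then have i: "Suc i < length as" using that by auto
    have ch: "chain z" if "action_cochain p z \<noteq> 0" for z using suppD[OF cochains_supp[OF action_cochain_cochains] that] by (simp add: V_def)
    show ?thesis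
      using S_MMu[OF p cochain_hom_contract(1)[OF d i ch] d(2)] cochain_hom_contract(2)[OF d i ch] True by (simp add: eval_nat_numeral)
  next
    case False
    then have "Mu AA (take (Suc j) (drop i Xs)) (take j (drop i as)) = 0" using that by (simp add: A_Mu)
    then show ?thesis using False by (simp add: S_MMu_zero_arg[OF p])
  qed
  have inner: "(\<Sum>j=1..length as - i. vscale (?e i) (MMu (S p) (take (Suc i) Xs @ drop (i + j) Xs) b
      (take i as @ Mu AA (take (Suc j) (drop i Xs)) (take j (drop i as)) # drop (i + j) as))) =
      (if Suc i < length as then vec (?e i * (action_cochain p (rev (del (Suc i) Xs)) * ?K)) else 0)" (is "?L = _")
    if "i < length as" for i
  proof -
    have "?L = (\<Sum>j=1..length as - i. if j = 2 then vec (?e i * (action_cochain p (rev (del (Suc i) Xs)) * ?K)) else 0)"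
      by (rule sum.cong[OF refl]) (simp add: m3[OF that] vscale_0 vec_simps)
    also have "\<dots> = (if 2 \<in> {1..length as - i} then vec (?e i * (action_cochain p (rev (del (Suc i) Xs)) * ?K)) else 0)"
      by (rule sum.delta) simp
    finally show ?thesis using that by auto
  qed
  have two: "i = 1 \<and> Xs = [p, p, p]" if "drop i Xs = [p, p]" "take (Suc i) Xs = [p, p]" "i < ?N" for i
  proof -
    have "length (take (Suc i) Xs) = 2" using that(2) by simp
    then have i: "i = 1" using that(3) by simp
    have "Xs = take 1 Xs @ drop 1 Xs" by simp
    moreover have "take 1 Xs = take 1 (take (Suc i) Xs)" by (simp add: i)
    ultimately show ?thesis using that i by (metis append_Cons append_Nil take_Suc_Cons take_0 One_nat_def)
  qed
  have rev2: "action_cochain p (rev w) = (if w = [p, p] then 1 else 0)" for w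
    by (auto simp: action_cochain_def rev_swap)
  have three: "i = 0 \<and> Xs = [p, p, p]" if dl: "del (Suc i) Xs = [p, p]" "Suc i < length as" and ch: "chain (rev Xs)" for i
  proof -
    have "length (del (Suc i) Xs) = 2" using dl by simp
    then have "length Xs = 3" using dl(2) len by (simp add: length_del)
    then obtain x y w where X: "Xs = [x, y, w]" by (auto simp: length_Suc_conv eval_nat_numeral)
    then have i: "i = 0" using dl(2) len by simp
    then have "x = p" "w = p" using dl X by (auto simp: del_def)
    moreover have "rev Xs ! 1 \<le> rev Xs ! 0" "rev Xs ! 2 \<le> rev Xs ! 1"
      using ch X unfolding chain_def by (force simp: eval_nat_numeral)+
    ultimately show ?thesis using X i by (simp add: eval_nat_numeral)
  qed
  have "(\<Sum>i<?N. vscale (?e i) (MMu (S p) (take (Suc i) Xs) (MMu (S p) (drop i Xs) b (drop i as)) (take i as))) +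
      (\<Sum>i<length as. \<Sum>j=1..length as - i. vscale (?e i) (MMu (S p) (take (Suc i) Xs @ drop (i + j) Xs) b
         (take i as @ Mu AA (take (Suc j) (drop i Xs)) (take j (drop i as)) # drop (i + j) as))) =
      (\<Sum>i<?N. vec (?e i * (action_cochain p (rev (drop i Xs)) * action_cochain p (rev (take (Suc i) Xs)) * ?K))) +
      (\<Sum>i<length as. if Suc i < length as then vec (?e i * (action_cochain p (rev (del (Suc i) Xs)) * ?K)) else 0)"
    by (intro arg_cong2[of _ _ _ _ "(+)"] sum.cong refl) (simp_all only: lessThan_iff m1 inner vec_simps)
  also have "\<dots> = 0"
  proof (cases "?K = 0")
    case True
    show ?thesis unfolding True by (simp add: vec_simps cong: if_cong)
  next
    case False
    note ch = wt_chain[OF d(1)]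
    show ?thesis
    proof (cases "Xs = [p, p, p]")
      case True
      have l0: "0 < length as" using len True by (simp flip: length_greater_0_conv)
      have "wt Xs as \<noteq> 0" using False by auto
      from wt_nonzero[OF this l0] have "as ! 0 \<noteq> 0" by (metis zero_fun_apply)
      then have "gs ! 0 = 0" by (rule mod_argD(5)[OF arg l0])
      then have "star gs 1 = -1" "star gs 0 = 0" by (simp_all add: star_def)
      moreover have l: "length Xs = 3" "length as = 2" using True len by auto
      ultimately show ?thesis
        unfolding l by (simp add: True eval_nat_numeral action_cochain_def del_def vec_simps)
    next
      case no: False
      have "action_cochain p (rev (drop i Xs)) * action_cochain p (rev (take (Suc i) Xs)) = 0" if "i < ?N" for i
        using two[OF _ _ that] no by (auto simp: rev2)
      moreover have "action_cochain p (rev (del (Suc i) Xs)) = 0" if "Suc i < length as" for i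
        using three[OF _ that] no ch False by (auto simp: rev2)
      ultimately have "(\<Sum>i<?N. vec (?e i * (action_cochain p (rev (drop i Xs)) * action_cochain p (rev (take (Suc i) Xs)) * ?K))) = 0"
        "(\<Sum>i<length as. if Suc i < length as then vec (?e i * (action_cochain p (rev (del (Suc i) Xs)) * ?K)) else 0) = 0"
        by (intro sum.neutral ballI; simp only: lessThan_iff mult_zero_left mult_zero_right vec_simps if_cancel cong: if_cong)+
      then show ?thesis by (simp only: add_0_left)
    qed
  qed
  finally show "(\<Sum>i<?N. vscale (?e i) (MMu (S p) (take (Suc i) Xs) (MMu (S p) (drop i Xs) b (drop i as)) (take i as))) +
      (\<Sum>i<length as. \<Sum>j=1..length as - i. vscale (?e i) (MMu (S p) (take (Suc i) Xs @ drop (i + j) Xs) b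
         (take i as @ Mu AA (take (Suc j) (drop i Xs)) (take j (drop i as)) # drop (i + j) as))) = 0" .
qed

lemma S_module:
  assumes p: "p \<le> n"
  shows "ainf_module AA (S p)"
  unfolding ainf_module_def
proof (intro conjI ballI allI impI)
  interpret v: vector_space "vscale :: 'k \<Rightarrow> _" by (rule vs_vscale)
  show "graded_space vscale (MSp (S p) X)" for X
  proof (rule graded_space_single[OF vs_vscale, of _ 0])
    show "v.subspace (MSp (S p) X 0)"
    proof (cases "X = p")
      case True
      have "v.subspace (range vec)"
        by (rule v.subspaceI) (auto simp: range_vec vscale_apply)
      then show ?thesis using True by (simp add: S_MSp)
    qed (simp add: S_MSp)
  qed (simp add: S_MSp)
  have "(\<Union>g. MSp (S p) X g) \<subseteq> v.span {vec 1}" for X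
  proof -
    have "vec c \<in> v.span {vec 1}" for c
      using v.span_scale[OF v.span_base, of "vec 1" "{vec 1}" c] by (simp add: vec_simps)
    moreover have "0 \<in> v.span {vec 1}" by (rule v.span_zero)
    ultimately show ?thesis by (auto simp: S_MSp split: if_splits)
  qed
  then show "finite_total_dim vscale (MSp (S p) X)" for X
    unfolding finite_total_dim_def by (intro exI[of _ "{vec 1}"]) auto
  show "multilinear_family AA (S p) (S p) 1 (MMu (S p))"
    using cochain_hom_family[OF action_cochain_cochains] S_MMu[OF p] by blast
  show "module_relations AA (S p)" by (rule S_relations[OF p])
  fix X e g b
  assume "X \<in> Ob AA" and b: "b \<in> MSp (S p) X g" and e: "cohomology_unit AA X e \<and> MMu (S p) [X] b [] = 0"
  have "MMu (S p) [X, X] b [e] - b = 0"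
  proof (cases "X = p")
    case True
    then have "e = path p p" using A_cohomology_unit[OF p] e by blast
    then show ?thesis using S_MMu_pair[OF p path_line] True by (simp add: path_def vscale_def)
  next
    case False
    then show ?thesis using b by (simp add: S_MSp S_MMu_off)
  qed
  then show "\<exists>c\<in>MSp (S p) X (g - 1). MMu (S p) [X, X] b [e] - b = MMu (S p) [X] c []"
    by (intro bexI[of _ 0]) (simp_all add: S_MMu_off zero_MSp)
qed

lemma S_inj: "inj S"
proof (rule injI)
  fix p q assume eq: "S p = S q"
  have "vec 1 \<in> MSp (S p) p 0" by (simp add: S_MSp)
  then have "vec 1 \<in> MSp (S q) p 0" by (simp add: eq)
  then show "p = q" by (auto simp: S_MSp vec_eq_0 split: if_splits)
qed

section \<open>The \<open>A\<^sub>\<infinity>\<close>-structure on cochains\<close>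

abbreviation KK where "KK \<equiv> koszul_category AA"

lemma K_Ob: "Ob KK = S ` {0..n}"
  using S_module by (auto simp: koszul_category_def full_subcategory_def mod_category_def A_Ob)

lemma K_Scl: "Scl KK c T = (\<lambda>Xs b as. vscale c (T Xs b as))"
  by (simp add: koszul_category_def full_subcategory_def mod_category_def)

lemma K_Hom: "p \<le> n \<Longrightarrow> Hom KK (S p) (S q) g = cochain_hom ` cochains p q g"
  using mod_hom_cochain_hom[of p _ q g] cochain_hom_mod_hom[of _ p q g]
  by (auto simp: koszul_category_def full_subcategory_def mod_category_def)

lemma cochain_hom_add: "cochain_hom f + cochain_hom g = cochain_hom (f + g)"
  by (auto simp: fun_eq_iff cochain_hom_def vec_def algebra_simps)

lemma cochain_hom_scale: "Scl KK c (cochain_hom f) = cochain_hom (\<lambda>z. c * f z)"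
  by (auto simp: fun_eq_iff K_Scl cochain_hom_def vec_def vscale_def)

lemma cochain_hom_0: "cochain_hom 0 = 0"
  by (auto simp: fun_eq_iff cochain_hom_def vec_def)

lemma cochain_hom_sum: "(\<Sum>i\<in>I. cochain_hom (f i)) = cochain_hom (\<Sum>i\<in>I. f i)"
  by (induction I rule: infinite_finite_induct)
    (simp_all only: sum.infinite sum.empty sum.insert cochain_hom_0 cochain_hom_add not_False_eq_True)

lemma cochain_hom_inj: "p \<le> n \<Longrightarrow> supp p q f \<Longrightarrow> supp p q g \<Longrightarrow> cochain_hom f = cochain_hom g \<Longrightarrow> f = g"
proof
  fix z assume a: "p \<le> n" "supp p q f" "supp p q g" "cochain_hom f = cochain_hom g"
  show "f z = g z"
  proof (cases "V p q z")
    case True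
    then have "vec (f z) = vec (g z)" using cochain_hom_eval[OF a(1) True] a(4) by metis
    then show ?thesis by (simp add: vec_inj)
  next
    case False
    then show ?thesis using a(2,3) unfolding supp_def by metis
  qed
qed

text \<open>
  The operations of the full subcategory of simple modules, transported to cochains.
\<close>

definition dgmu :: "nat list \<Rightarrow> (nat list \<Rightarrow> 'k) list \<Rightarrow> nat list \<Rightarrow> 'k" where
  "dgmu ps fs = (case (ps, fs) of
     ([p, q], [f]) \<Rightarrow> dd p q f
   | ([p, r, q], [f1, f2]) \<Rightarrow> cup f1 f2
   | _ \<Rightarrow> 0)"

lemma dgmu_simps: "dgmu [p, q] [f] = dd p q f" "dgmu [p, r, q] [f1, f2] = cup f1 f2"
  by (simp_all add: dgmu_def)

lemma dgmu_long: "fs = [] \<or> length fs \<ge> 3 \<Longrightarrow> dgmu ps fs = 0"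
  by (auto simp: dgmu_def split: list.splits)

lemma list_cases2:
  assumes "length ps = Suc (length fs)"
  obtains "fs = [] \<or> length fs \<ge> 3" | p q f where "ps = [p, q]" "fs = [f]"
    | p r q f1 f2 where "ps = [p, r, q]" "fs = [f1, f2]"
proof -
  consider "fs = [] \<or> length fs \<ge> 3" | "length fs = 1" | "length fs = 2" by (cases fs; cases "tl fs"; cases "tl (tl fs)") auto
  then show thesis
  proof cases
    case 1
    then show thesis by (rule that(1))
  next
    case 2
    then show thesis using assms that(2) by (auto simp: length_Suc_conv)
  next
    case 3
    then show thesis using assms that(3) by (auto simp: length_Suc_conv eval_nat_numeral)
  qed
qed

lemma cup_zero: "cup 0 f = (0 :: nat list \<Rightarrow> 'k)" "cup f 0 = (0 :: nat list \<Rightarrow> 'k)"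
  by (auto simp: cup_def fun_eq_iff)

lemma dd_zero: "dd p q 0 = 0"
  by (auto simp: dd_def bdry_def fun_eq_iff)

lemma dgmu_zero_arg:
  assumes "length ps = Suc (length fs)" "0 \<in> set fs"
  shows "dgmu ps fs = 0"
  using assms(1) by (rule list_cases2) (use assms(2) in \<open>auto simp: dgmu_long dgmu_simps cup_zero dd_zero\<close>)

text \<open>
  Composable strings of homogeneous cochains, parallel to \<open>composable\<close>.
\<close>

definition cochain_string :: "nat list \<Rightarrow> int list \<Rightarrow> (nat list \<Rightarrow> 'k) list \<Rightarrow> bool" where
  "cochain_string ps gs fs \<longleftrightarrow> set ps \<subseteq> {0..n} \<and> length ps = Suc (length fs) \<and> length gs = length fs \<and>
     (\<forall>i<length fs. fs ! i \<in> cochains (ps ! i) (ps ! Suc i) (gs ! i))"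

lemma zero_cochains: "0 \<in> cochains p q g"
  by (simp add: cochains_def)

lemma cochain_string_take: "cochain_string ps gs fs \<Longrightarrow> cochain_string (take (Suc i) ps) (take i gs) (take i fs)"
  by (auto simp: cochain_string_def dest: in_set_takeD)

lemma cochain_string_drop: "cochain_string ps gs fs \<Longrightarrow> i \<le> length fs \<Longrightarrow> cochain_string (drop i ps) (drop i gs) (drop i fs)"
  by (auto simp: cochain_string_def dest: in_set_dropD)

lemma dgmu_cochains:
  assumes "cochain_string ps gs fs"
  shows "dgmu ps fs \<in> cochains (hd ps) (last ps) (sum_list gs + 2 - int (length gs))"
proof -
  have l: "length ps = Suc (length fs)" "length gs = length fs" using assms by (auto simp: cochain_string_def)
  from l(1) show ?thesis
  proof (cases rule: list_cases2)
    case 1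
    then show ?thesis by (simp add: dgmu_long zero_cochains)
  next
    case (2 p q f)
    then obtain g where "gs = [g]" using l by (auto simp: length_Suc_conv)
    then show ?thesis using 2 assms dd_cochains[of f p q g] by (simp add: cochain_string_def dgmu_simps add.commute)
  next
    case (3 p r q f1 f2)
    then obtain g1 g2 where g: "gs = [g1, g2]" using l by (auto simp: length_Suc_conv)
    have "f1 \<in> cochains p r g1" "f2 \<in> cochains r q g2" using 3 assms g by (auto simp: cochain_string_def less_Suc_eq_0_disj all_conj_distrib)
    then show ?thesis using 3 g cup_cochains by (simp add: dgmu_simps)
  qed
qed

lemma K_Mu:
  assumes "cochain_string ps gs fs"
  shows "Mu KK (map S ps) (map cochain_hom fs) = cochain_hom (dgmu ps fs)"
proof -
  have l: "length ps = Suc (length fs)" "length gs = length fs" using assms by (auto simp: cochain_string_def)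
  have Mu: "Mu KK Ms ts = (case (Ms, ts) of ([M0, M1], [t]) \<Rightarrow> mod_differential AA M0 M1 t
             | ([M0, M1, M2], [t1, t2]) \<Rightarrow> mod_composition AA M0 t2 t1 | _ \<Rightarrow> 0)" for Ms ts
    by (simp add: koszul_category_def full_subcategory_def mod_category_def)
  from l(1) show ?thesis
  proof (cases rule: list_cases2)
    case 1
    then have "Mu KK (map S ps) (map cochain_hom fs) = 0" unfolding Mu by (auto split: list.splits)
    then show ?thesis using 1 by (simp only: dgmu_long cochain_hom_0)
  next
    case (2 p q f)
    then have "supp p q f" "p \<le> n" "q \<le> n" using assms by (auto simp: cochain_string_def cochains_supp)
    then show ?thesis using 2 by (simp add: Mu mod_differential_cochain_hom dgmu_simps)
  next
    case (3 p r q f1 f2)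
    then have "f1 \<in> cochains p r (gs ! 0)" "f2 \<in> cochains r q (gs ! 1)" using assms by (auto simp: cochain_string_def less_Suc_eq_0_disj all_conj_distrib)
    then show ?thesis using 3 by (simp add: Mu mod_composition_cochain_hom[OF cochains_supp cochains_supp] dgmu_simps)
  qed
qed

lemma cochain_string_insert:
  assumes f: "cochain_string ps gs fs" and i: "i < length fs" and j: "j \<in> {1..length fs - i}"
    and x: "x \<in> cochains (ps ! i) (ps ! (i + j)) g"
  shows "cochain_string (take (Suc i) ps @ drop (i + j) ps) (take i gs @ g # drop (i + j) gs) (take i fs @ x # drop (i + j) fs)"
  unfolding cochain_string_def
proof (intro conjI allI impI)
  have l: "length ps = Suc (length fs)" "length gs = length fs" "set ps \<subseteq> {0..n}"
    and m: "\<And>i. i < length fs \<Longrightarrow> fs ! i \<in> cochains (ps ! i) (ps ! Suc i) (gs ! i)" using f by (auto simp: cochain_string_def)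
  show "set (take (Suc i) ps @ drop (i + j) ps) \<subseteq> {0..n}" using l(3) by (auto dest: in_set_takeD in_set_dropD)
  show "length (take (Suc i) ps @ drop (i + j) ps) = Suc (length (take i fs @ x # drop (i + j) fs))"
    "length (take i gs @ g # drop (i + j) gs) = length (take i fs @ x # drop (i + j) fs)" using l i j by auto
  fix k assume k: "k < length (take i fs @ x # drop (i + j) fs)"
  consider "k < i" | "k = i" | "k > i" by linarith
  then show "(take i fs @ x # drop (i + j) fs) ! k \<in> cochains ((take (Suc i) ps @ drop (i + j) ps) ! k)
      ((take (Suc i) ps @ drop (i + j) ps) ! Suc k) ((take i gs @ g # drop (i + j) gs) ! k)"
  proof cases
    case 1
    then show ?thesis using m[of k] i l by (simp add: nth_append)
  next
    case 2
    moreover have "i + j \<le> length fs" using i j by auto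
    ultimately show ?thesis using x i l by (simp add: nth_append)
  next
    case 3
    then obtain k' where k': "k = Suc (i + k')" by (metis less_imp_Suc_add)
    have "i + j + k' < length fs" using k k' i j l by auto
    then show ?thesis using m[of "i + j + k'"] i j l k' by (simp add: nth_append add_ac)
  qed
qed

end

context koszul
begin

lemma K_objects: "set Ms \<subseteq> Ob KK \<Longrightarrow> \<exists>ps. Ms = map S ps \<and> set ps \<subseteq> {0..n}"
proof (induction Ms)
  case (Cons M Ms)
  then obtain ps p where "Ms = map S ps" "set ps \<subseteq> {0..n}" "M = S p" "p \<in> {0..n}" by (auto simp: K_Ob)
  then show ?case by (intro exI[of _ "p # ps"]) auto
qed simp

lemma K_lift:
  assumes ps: "set ps \<subseteq> {0..n}" and c: "composable KK (map S ps) gs ts"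
  shows "\<exists>fs. ts = map cochain_hom fs \<and> cochain_string ps gs fs"
proof -
  have l: "length ps = Suc (length gs)" "length ts = length gs"
    and t: "\<And>r. r < length gs \<Longrightarrow> ts ! r \<in> Hom KK (map S ps ! r) (map S ps ! Suc r) (gs ! r)"
    using c by (auto simp: composable_iff)
  have "\<exists>f. f \<in> cochains (ps ! r) (ps ! Suc r) (gs ! r) \<and> ts ! r = cochain_hom f" if "r < length gs" for r
  proof -
    have "ps ! r \<in> set ps" using that l by simp
    then have "ps ! r \<le> n" using ps by auto
    then show ?thesis using t[OF that] that l by (auto simp: K_Hom)
  qed
  then obtain F where F: "\<And>r. r < length gs \<Longrightarrow> F r \<in> cochains (ps ! r) (ps ! Suc r) (gs ! r) \<and> ts ! r = cochain_hom (F r)" by metis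
  have "ts = map cochain_hom (map F [0..<length gs])" using F l by (intro nth_equalityI) auto
  moreover have "cochain_string ps gs (map F [0..<length gs])" using F l ps by (simp add: cochain_string_def)
  ultimately show ?thesis by blast
qed

lemma vs_K: "vector_space (Scl KK)"
  by unfold_locales (auto simp: K_Scl vscale_def fun_eq_iff algebra_simps)

lemma cochains_add: "f \<in> cochains p q g \<Longrightarrow> f' \<in> cochains p q g \<Longrightarrow> f + f' \<in> cochains p q g"
  unfolding cochains_def by (auto simp: plus_fun_def) (metis add_0)+

lemma cochains_scale: "f \<in> cochains p q g \<Longrightarrow> (\<lambda>z. c * f z) \<in> cochains p q g"
  by (auto simp: cochains_def)

lemma sum_apply4: "(\<Sum>i\<in>I. F i) a b c d = (\<Sum>i\<in>I. F i a b c d)"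
  by (induction I rule: infinite_finite_induct) auto

lemma K_graded:
  assumes p: "p \<le> n"
  shows "graded_space (Scl KK) (Hom KK (S p) (S q))"
  unfolding graded_space_def
proof (intro conjI allI impI)
  interpret v: vector_space "Scl KK" by (rule vs_K)
  show "v.subspace (Hom KK (S p) (S q) g)" for g
  proof (rule v.subspaceI)
    show "0 \<in> Hom KK (S p) (S q) g" unfolding K_Hom[OF p] using cochain_hom_0 zero_cochains by (metis imageI)
  next
    fix x y assume "x \<in> Hom KK (S p) (S q) g" "y \<in> Hom KK (S p) (S q) g"
    then show "x + y \<in> Hom KK (S p) (S q) g" unfolding K_Hom[OF p] using cochain_hom_add cochains_add by fastforce
  next
    fix c x assume "x \<in> Hom KK (S p) (S q) g"
    then show "Scl KK c x \<in> Hom KK (S p) (S q) g" unfolding K_Hom[OF p] using cochain_hom_scale cochains_scale by fastforce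
  qed
next
  fix x g
  assume a: "(\<forall>g. x g \<in> Hom KK (S p) (S q) g) \<and> finite {g. x g \<noteq> 0} \<and> (\<Sum>g | x g \<noteq> 0. x g) = 0"
  have z: "x g' Xs b as = 0" if "int (length Xs) \<noteq> g' + 1" for g' Xs b as
  proof (rule ccontr)
    assume nz: "x g' Xs b as \<noteq> 0"
    have "x g' \<in> cochain_hom ` cochains p q g'" using a K_Hom[OF p] by blast
    then obtain f where "f \<in> cochains p q g'" "x g' = cochain_hom f" by blast
    then show False using nz cochain_hom_nonzero[of f Xs b as] cochainsD(2)[of f p q g' "rev Xs"] that by simp
  qed
  show "x g = 0"
  proof (intro ext)
    fix Xs b as i
    show "x g Xs b as i = 0 Xs b as i"
    proof (cases "int (length Xs) = g + 1 \<and> x g \<noteq> 0")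
      case False
      then show ?thesis using z by auto
    next
      case True
      have "0 = (\<Sum>g | x g \<noteq> 0. x g) Xs b as i" using a by simp
      also have "\<dots> = (\<Sum>g' | x g' \<noteq> 0. x g' Xs b as i)" by (rule sum_apply4)
      also have "\<dots> = (\<Sum>g' | x g' \<noteq> 0. if g' = g then x g Xs b as i else 0)"
        using z True by (intro sum.cong[OF refl]) auto
      also have "\<dots> = x g Xs b as i" using a True by simp
      finally show ?thesis by simp
    qed
  qed
qed

lemma bdry_add: "bdry (f + g) z = bdry f z + (bdry g z :: 'k)"
  by (simp add: bdry_def algebra_simps sum.distrib)

lemma dgmu_add:
  assumes l: "length ps = Suc (length fs)" and i: "i < length fs"
  shows "dgmu ps (fs[i := f + g]) = dgmu ps (fs[i := f]) + dgmu ps (fs[i := g])"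
  using l
proof (cases rule: list_cases2)
  case 1
  then show ?thesis using dgmu_long[of "fs[i := _]" ps] by simp
next
  case (2 p q h)
  then show ?thesis using i by (simp add: dgmu_simps fun_eq_iff dd_def bdry_add)
next
  case (3 p r q f1 f2)
  then have "i = 0 \<or> i = 1" using i by auto
  then show ?thesis using 3 by (auto simp: dgmu_simps fun_eq_iff cup_def algebra_simps sum.distrib)
qed

lemma dgmu_scale:
  assumes l: "length ps = Suc (length fs)" and i: "i < length fs"
  shows "dgmu ps (fs[i := \<lambda>z. c * f z]) = (\<lambda>z. c * dgmu ps (fs[i := f]) z)"
  using l
proof (cases rule: list_cases2)
  case 1
  then show ?thesis using dgmu_long[of "fs[i := _]" ps] by (simp add: fun_eq_iff)
next
  case (2 p q h)
  then show ?thesis using i by (simp add: dgmu_simps fun_eq_iff dd_def bdry_scale)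
next
  case (3 p r q f1 f2)
  then have "i = 0 \<or> i = 1" using i by auto
  then show ?thesis using 3 by (auto simp: dgmu_simps fun_eq_iff cup_def sum_distrib_left mult_ac)
qed

lemma cochain_string_update: "cochain_string ps gs fs \<Longrightarrow> f \<in> cochains (ps ! i) (ps ! Suc i) (gs ! i) \<Longrightarrow> cochain_string ps gs (fs[i := f])"
  unfolding cochain_string_def by (metis length_list_update nth_list_update nth_list_update_neq)

lemma K_multilinear:
  assumes X: "set Ms \<subseteq> Ob KK" "length Ms = Suc (length gs)"
  shows "multilinear_on (Scl KK) (Scl KK) (hom_spaces KK Ms gs) (Mu KK Ms)"
  unfolding multilinear_on_def
proof (intro ballI allI impI)
  fix ts i x y c
  assume ts: "ts \<in> listset (hom_spaces KK Ms gs)" and i: "i < length (hom_spaces KK Ms gs)"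
    and x: "x \<in> hom_spaces KK Ms gs ! i" and y: "y \<in> hom_spaces KK Ms gs ! i"
  obtain ps where ps: "Ms = map S ps" "set ps \<subseteq> {0..n}" using K_objects[OF X(1)] by blast
  have "composable KK (map S ps) gs ts" using ts X ps by (simp add: composable_def)
  then obtain fs where fs: "ts = map cochain_hom fs" "cochain_string ps gs fs" using K_lift[OF ps(2)] by blast
  have l: "length ps = Suc (length fs)" "length gs = length fs" using fs by (auto simp: cochain_string_def)
  have i': "i < length fs" using i l by (simp add: hom_spaces_def)
  have "ps ! i \<le> n" using ps(2) i' l by (metis atLeastAtMost_iff less_SucI nth_mem subsetD)
  then have "hom_spaces KK Ms gs ! i = cochain_hom ` cochains (ps ! i) (ps ! Suc i) (gs ! i)"
    using i' l by (simp add: hom_spaces_def ps K_Hom)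
  then obtain f g where f: "x = cochain_hom f" "f \<in> cochains (ps ! i) (ps ! Suc i) (gs ! i)"
    and g: "y = cochain_hom g" "g \<in> cochains (ps ! i) (ps ! Suc i) (gs ! i)" using x y by auto
  have M: "Mu KK Ms (ts[i := cochain_hom h]) = cochain_hom (dgmu ps (fs[i := h]))" if "h \<in> cochains (ps ! i) (ps ! Suc i) (gs ! i)" for h
    using K_Mu[OF cochain_string_update[OF fs(2) that]] by (simp add: ps fs map_update)
  show "Mu KK Ms (ts[i := x + y]) = Mu KK Ms (ts[i := x]) + Mu KK Ms (ts[i := y]) \<and>
      Mu KK Ms (ts[i := Scl KK c x]) = Scl KK c (Mu KK Ms (ts[i := x]))"
    unfolding f(1) g(1) cochain_hom_add cochain_hom_scale M[OF f(2)] M[OF g(2)] M[OF cochains_add[OF f(2) g(2)]] M[OF cochains_scale[OF f(2)]]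
    using dgmu_add[OF l(1) i'] dgmu_scale[OF l(1) i'] by simp
qed

lemma cup_degree:
  assumes "f \<in> cochains p r g"
  shows "cup f h z = sg g * (\<Sum>m<length z. f (take (Suc m) z) * h (drop m z))"
  unfolding cup_def sum_distrib_left
proof (rule sum.cong[OF refl])
  fix m assume "m \<in> {..<length z}"
  then have m: "length (take (Suc m) z) = Suc m" by simp
  show "(-1) ^ m * f (take (Suc m) z) * h (drop m z) = sg g * (f (take (Suc m) z) * h (drop m z))"
  proof (cases "f (take (Suc m) z) = 0")
    case False
    then have "g = int m" using cochainsD(2)[OF assms, of "take (Suc m) z"] m by simp
    then show ?thesis by (simp add: sg_int)
  qed simp
qed

lemma dd_dd: "supp p q f \<Longrightarrow> dd p q (dd p q f) = 0"
proof
  fix z assume f: "supp p q f"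
  have neg: "bdry (\<lambda>z. - f z) w = - bdry f w" for w by (simp add: bdry_def sum_negf)
  have "dd p q f = (\<lambda>z. if V p q z then bdry (\<lambda>z. - f z) z else 0)" by (simp add: dd_def neg fun_eq_iff)
  then have "bdry (dd p q f) z = 0" if "V p q z"
    using bdry_V_bdry[OF that, of "\<lambda>z. - f z"] suppD[OF f] by simp
  then show "dd p q (dd p q f) z = 0 z" by (simp add: dd_def[of _ _ "dd p q f"])
qed

lemma dd_cup:
  assumes f1: "f1 \<in> cochains p r g1" and f2: "f2 \<in> cochains r q g2"
  shows "dd p q (cup f1 f2) z + cup (dd p r f1) f2 z + sg (g1 - 1) * cup f1 (dd r q f2) z = 0"
proof (cases "V p q z")
  case False
  have "cup (dd p r f1) f2 z = 0" "cup f1 (dd r q f2) z = 0"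
    using suppD[OF cup_supp[OF dd_supp cochains_supp[OF f2]]] suppD[OF cup_supp[OF cochains_supp[OF f1] dd_supp]] False by blast+
  then show ?thesis using False by (simp add: dd_def)
next
  case True
  note s1 = suppD[OF cochains_supp[OF f1]] and s2 = suppD[OF cochains_supp[OF f2]]
  have "cup (dd p r f1) f2 z = - cup (bdry f1) f2 z"
    unfolding cup_def sum_negf[symmetric]
  proof (rule sum.cong[OF refl])
    fix m assume "m \<in> {..<length z}"
    then have m: "m < length z" by simp
    show "(-1) ^ m * dd p r f1 (take (Suc m) z) * f2 (drop m z) = - ((-1) ^ m * bdry f1 (take (Suc m) z) * f2 (drop m z))"
    proof (cases "f2 (drop m z) = 0")
      case False
      then have "z ! m = r" using s2[OF False] m by (simp add: V_def hd_drop_conv_nth)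
      then show ?thesis using V_take[OF True m] by (simp add: dd_def)
    qed simp
  qed
  moreover have "cup f1 (dd r q f2) z = - (sg g1 * (\<Sum>m<length z. f1 (take (Suc m) z) * bdry f2 (drop m z)))"
    unfolding cup_degree[OF f1] mult_minus_right[symmetric] sum_negf[symmetric]
  proof (rule arg_cong[of _ _ "(*) (sg g1)"], rule sum.cong[OF refl])
    fix m assume "m \<in> {..<length z}"
    then have m: "m < length z" by simp
    show "f1 (take (Suc m) z) * dd r q f2 (drop m z) = f1 (take (Suc m) z) * - bdry f2 (drop m z)"
    proof (cases "f1 (take (Suc m) z) = 0")
      case False
      then have "z ! m = r" using s1[OF False] m by (simp add: V_def take_Suc_conv_app_nth)
      then show ?thesis using V_drop[OF True m] by (simp add: dd_def)
    qed simp
  qed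
  moreover have "dd p q (cup f1 f2) z = cup (bdry f1) f2 z - (\<Sum>m<length z. f1 (take (Suc m) z) * bdry f2 (drop m z))"
    using True bdry_cup[of f1 f2 z] supp_Nil[OF cochains_supp[OF f1]] supp_Nil[OF cochains_supp[OF f2]] by (simp add: dd_def)
  moreover have "sg (g1 - 1) * (- (sg g1 * c)) = c" for c :: 'k by (auto simp: sg_def)
  ultimately show ?thesis by simp
qed

lemma cup_assoc:
  assumes f1: "f1 \<in> cochains p r g1"
  shows "cup (cup f1 f2) f3 z + sg (g1 - 1) * cup f1 (cup f2 f3) z = 0"
proof -
  have "cup f1 (cup f2 f3) z = sg g1 * cup (cup f1 f2) f3 z"
    using cup_degree[OF f1, of "cup f2 f3" z] by (simp add: cup_cup_right cup_cup_left)
  then show ?thesis by (simp only: mult.assoc[symmetric]) (simp add: sg_def)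
qed

text \<open>
  With products of one and two arguments only, the relations are those of a dg category: the
  differential squares to zero, it is a derivation, and the composition is associative, each up to
  the sign of the reduced degrees.
\<close>

lemma dg_relations:
  assumes f: "cochain_string ps gs fs" and ne: "fs \<noteq> []"
  shows "(\<Sum>i<length fs. \<Sum>j=1..length fs - i. (-1) powi star gs i *
      dgmu (take (Suc i) ps @ drop (i + j) ps)
        (take i fs @ dgmu (take (Suc j) (drop i ps)) (take j (drop i fs)) # drop (i + j) fs) z) = (0 :: 'k)"
proof -
  let ?T = "\<lambda>i j. (-1) powi star gs i * dgmu (take (Suc i) ps @ drop (i + j) ps)
        (take i fs @ dgmu (take (Suc j) (drop i ps)) (take j (drop i fs)) # drop (i + j) fs) z :: 'k"
  have l: "length ps = Suc (length fs)" "length gs = length fs" using f by (auto simp: cochain_string_def)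
  consider "length fs = 1" | "length fs = 2" | "length fs = 3" | "length fs \<ge> 4"
    using ne by (cases fs; cases "tl fs"; cases "tl (tl fs)"; cases "tl (tl (tl fs))") auto
  then show ?thesis
  proof cases
    case 1
    obtain f1 where fs: "fs = [f1]" using 1 by (auto simp: length_Suc_conv)
    obtain p q where ps: "ps = [p, q]" using 1 l by (auto simp: length_Suc_conv)
    have "f1 \<in> cochains p q (gs ! 0)" using f by (simp add: cochain_string_def fs ps)
    then show ?thesis using dd_dd[OF cochains_supp] by (simp add: fs ps star_def dgmu_simps)
  next
    case 2
    obtain f1 f2 where fs: "fs = [f1, f2]" using 2 by (auto simp: length_Suc_conv eval_nat_numeral)
    obtain p r q where ps: "ps = [p, r, q]" using 2 l by (auto simp: length_Suc_conv eval_nat_numeral)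
    have ff: "f1 \<in> cochains p r (gs ! 0)" "f2 \<in> cochains r q (gs ! 1)" using f by (auto simp: cochain_string_def fs ps less_Suc_eq_0_disj all_conj_distrib)
    have "(\<Sum>i<length fs. \<Sum>j=1..length fs - i. ?T i j) = ?T 0 1 + ?T 0 2 + ?T 1 1"
      by (simp add: fs eval_nat_numeral)
    also have "\<dots> = 0"
      using dd_cup[OF ff, of z] by (simp add: fs ps star_def dgmu_simps powi_sg eval_nat_numeral sg_def[of 0] algebra_simps)
    finally show ?thesis .
  next
    case 3
    obtain f1 f2 f3 where fs: "fs = [f1, f2, f3]" using 3 by (auto simp: length_Suc_conv eval_nat_numeral)
    obtain p0 p1 p2 p3 where ps: "ps = [p0, p1, p2, p3]" using 3 l by (auto simp: length_Suc_conv eval_nat_numeral)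
    have ff: "f1 \<in> cochains p0 p1 (gs ! 0)" using f by (auto simp: cochain_string_def fs ps)
    have "(\<Sum>i<length fs. \<Sum>j=1..length fs - i. ?T i j) = ?T 0 1 + ?T 0 2 + ?T 0 3 + (?T 1 1 + ?T 1 2) + ?T 2 1"
      by (simp add: fs eval_nat_numeral)
    also have "\<dots> = 0"
      using cup_assoc[OF ff, of f2 f3 z]
      by (simp add: fs ps star_def dgmu_def dd_zero powi_sg eval_nat_numeral sg_def[of 0])
    finally show ?thesis .
  next
    case 4
    show ?thesis
    proof (rule sum.neutral, rule ballI, rule sum.neutral, rule ballI)
      fix i j assume i: "i \<in> {..<length fs}" and j: "j \<in> {1..length fs - i}"
      let ?L = "take i fs @ dgmu (take (Suc j) (drop i ps)) (take j (drop i fs)) # drop (i + j) fs"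
      have "dgmu (take (Suc i) ps @ drop (i + j) ps) ?L = 0"
      proof (cases "j \<ge> 3")
        case True
        then have "dgmu (take (Suc j) (drop i ps)) (take j (drop i fs)) = 0" using i j by (intro dgmu_long) auto
        then show ?thesis using i j l by (intro dgmu_zero_arg) auto
      next
        case False
        then show ?thesis using i j 4 by (intro dgmu_long) auto
      qed
      then show "?T i j = 0" by (simp only: zero_fun_apply mult_zero_right)
    qed
  qed
qed

lemma K_relation_term:
  assumes f: "cochain_string ps gs fs" and i: "i < length fs" and j: "j \<in> {1..length fs - i}"
  shows "Mu KK (take (Suc i) (map S ps) @ drop (i + j) (map S ps))
      (take i (map cochain_hom fs) @ Mu KK (take (Suc j) (drop i (map S ps))) (take j (drop i (map cochain_hom fs))) # drop (i + j) (map cochain_hom fs)) =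
    cochain_hom (dgmu (take (Suc i) ps @ drop (i + j) ps)
        (take i fs @ dgmu (take (Suc j) (drop i ps)) (take j (drop i fs)) # drop (i + j) fs))"
proof -
  have l: "length ps = Suc (length fs)" using f by (simp add: cochain_string_def)
  have f': "cochain_string (take (Suc j) (drop i ps)) (take j (drop i gs)) (take j (drop i fs))"
    using cochain_string_take[OF cochain_string_drop[OF f]] i by simp
  have in1: "Mu KK (take (Suc j) (drop i (map S ps))) (take j (drop i (map cochain_hom fs))) =
      cochain_hom (dgmu (take (Suc j) (drop i ps)) (take j (drop i fs)))"
    using K_Mu[OF f'] by (simp add: take_map drop_map)
  have ij: "i + j \<le> length fs" using i j by auto
  have "hd (take (Suc j) (drop i ps)) = ps ! i" using i l by (simp add: hd_drop_conv_nth)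
  moreover have "last (take (Suc j) (drop i ps)) = ps ! (i + j)"
    using ij l by (simp add: take_Suc_conv_app_nth)
  ultimately have "dgmu (take (Suc j) (drop i ps)) (take j (drop i fs)) \<in>
      cochains (ps ! i) (ps ! (i + j)) (sum_list (take j (drop i gs)) + 2 - int (length (take j (drop i gs))))"
    using dgmu_cochains[OF f'] by simp
  from K_Mu[OF cochain_string_insert[OF f i j this]] show ?thesis
    unfolding in1 by (simp add: take_map drop_map)
qed

lemma K_relations: "ainf_relations KK"
  unfolding ainf_relations_def
proof (intro allI impI)
  fix Ms gs ts
  assume c: "composable KK Ms gs ts \<and> ts \<noteq> []"
  then obtain ps where ps: "Ms = map S ps" "set ps \<subseteq> {0..n}" using K_objects by (auto simp: composable_def)
  then obtain fs where fs: "ts = map cochain_hom fs" "cochain_string ps gs fs" using K_lift c by blast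
  have "(\<Sum>i<length ts. \<Sum>j=1..length ts - i. Scl KK ((-1) powi star gs i)
      (Mu KK (take (Suc i) Ms @ drop (i + j) Ms)
        (take i ts @ Mu KK (take (Suc j) (drop i Ms)) (take j (drop i ts)) # drop (i + j) ts))) =
    (\<Sum>i<length fs. \<Sum>j=1..length fs - i. cochain_hom (\<lambda>z. (-1) powi star gs i *
      dgmu (take (Suc i) ps @ drop (i + j) ps)
        (take i fs @ dgmu (take (Suc j) (drop i ps)) (take j (drop i fs)) # drop (i + j) fs) z))"
    unfolding fs(1) ps(1) length_map
  proof (intro sum.cong refl)
    fix i j assume "i \<in> {..<length fs}" and j: "j \<in> {1..length fs - i}"
    then have i: "i < length fs" by simp
    show "Scl KK ((-1) powi star gs i) (Mu KK (take (Suc i) (map S ps) @ drop (i + j) (map S ps))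
        (take i (map cochain_hom fs) @ Mu KK (take (Suc j) (drop i (map S ps))) (take j (drop i (map cochain_hom fs))) # drop (i + j) (map cochain_hom fs))) =
      cochain_hom (\<lambda>z. (-1) powi star gs i *
      dgmu (take (Suc i) ps @ drop (i + j) ps)
        (take i fs @ dgmu (take (Suc j) (drop i ps)) (take j (drop i fs)) # drop (i + j) fs) z)"
      unfolding K_relation_term[OF fs(2) i j] cochain_hom_scale ..
  qed
  also have "\<dots> = cochain_hom (\<Sum>i<length fs. \<Sum>j=1..length fs - i. (\<lambda>z. (-1) powi star gs i *
      dgmu (take (Suc i) ps @ drop (i + j) ps)
        (take i fs @ dgmu (take (Suc j) (drop i ps)) (take j (drop i fs)) # drop (i + j) fs) z))"
    unfolding cochain_hom_sum ..
  also have "(\<Sum>i<length fs. \<Sum>j=1..length fs - i. (\<lambda>z. (-1) powi star gs i *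
      dgmu (take (Suc i) ps @ drop (i + j) ps)
        (take i fs @ dgmu (take (Suc j) (drop i ps)) (take j (drop i fs)) # drop (i + j) fs) z)) = 0"
  proof
    fix z
    have ap: "(\<Sum>i\<in>I. G i) z = (\<Sum>i\<in>I. G i z)" for I :: "nat set" and G :: "nat \<Rightarrow> nat list \<Rightarrow> 'k"
      by (induction I rule: infinite_finite_induct) auto
    show "(\<Sum>i<length fs. \<Sum>j=1..length fs - i. (\<lambda>z. (-1) powi star gs i *
      dgmu (take (Suc i) ps @ drop (i + j) ps)
        (take i fs @ dgmu (take (Suc j) (drop i ps)) (take j (drop i fs)) # drop (i + j) fs) z)) z = 0 z"
      unfolding ap using dg_relations[OF fs(2)] c fs(1) by simp
  qed
  finally show "(\<Sum>i<length ts. \<Sum>j=1..length ts - i. Scl KK ((-1) powi star gs i)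
      (Mu KK (take (Suc i) Ms @ drop (i + j) Ms)
        (take i ts @ Mu KK (take (Suc j) (drop i Ms)) (take j (drop i ts)) # drop (i + j) ts))) = 0"
    by (simp only: cochain_hom_0)
qed

definition unit_cochain :: "nat \<Rightarrow> nat list \<Rightarrow> 'k" where
  "unit_cochain p z = (if z = [p] then 1 else 0)"

lemma unit_cochain_cochains: "unit_cochain p \<in> cochains p p 0"
  by (simp add: cochains_def unit_cochain_def V_def chain_def)

lemma dd_unit_cochain: "dd p p (unit_cochain p) = 0"
proof
  fix z
  have "bdry (unit_cochain p) z = 0" if v: "V p p z"
  proof (cases "length z = 2")
    case True
    then have "z = [p, p]" using v by (auto simp: length_Suc_conv eval_nat_numeral V_def)
    then show ?thesis by (simp add: bdry_def unit_cochain_def del_def eval_nat_numeral)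
  next
    case False
    have "unit_cochain p (del m z) = 0" if "m < length z" for m
    proof -
      have "length (del m z) \<noteq> 1" using that False by (auto simp: length_del)
      then show ?thesis by (auto simp: unit_cochain_def)
    qed
    then show ?thesis by (simp add: bdry_def)
  qed
  then show "dd p p (unit_cochain p) z = 0 z" by (simp add: dd_def)
qed

lemma cup_unit_cochain_left: "supp p q f \<Longrightarrow> cup (unit_cochain p) f = f"
proof
  fix z assume f: "supp p q f"
  show "cup (unit_cochain p) f z = f z"
  proof (cases z)
    case Nil
    then show ?thesis using supp_Nil[OF f] by (simp add: cup_def)
  next
    case (Cons x w)
    have "cup (unit_cochain p) f z = (\<Sum>m<length z. if m = 0 then (if x = p then f z else 0) else 0)"
      unfolding cup_def
    proof (rule sum.cong[OF refl])
      fix m assume "m \<in> {..<length z}"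
      then show "(-1) ^ m * unit_cochain p (take (Suc m) z) * f (drop m z) = (if m = 0 then (if x = p then f z else 0) else 0)"
        using Cons by (cases m; cases w) (auto simp: unit_cochain_def)
    qed
    also have "\<dots> = (if x = p then f z else 0)" by (simp add: Cons)
    also have "\<dots> = f z" using suppD[OF f, of z] Cons by (auto simp: V_def)
    finally show ?thesis .
  qed
qed

lemma cup_unit_cochain_right: "f \<in> cochains p q g \<Longrightarrow> cup f (unit_cochain q) = (\<lambda>z. sg g * f z)"
proof
  fix z assume f: "f \<in> cochains p q g"
  show "cup f (unit_cochain q) z = sg g * f z"
  proof (cases z rule: rev_cases)
    case Nil
    then show ?thesis using supp_Nil[OF cochains_supp[OF f]] by (simp add: cup_def)
  next
    case (snoc w x)
    have "(\<Sum>m<length z. f (take (Suc m) z) * unit_cochain q (drop m z)) = (\<Sum>m<length z. if m = length w then (if x = q then f z else 0) else 0)"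
    proof (rule sum.cong[OF refl])
      fix m assume "m \<in> {..<length z}"
      then have m: "m \<le> length w" by (simp add: snoc)
      show "f (take (Suc m) z) * unit_cochain q (drop m z) = (if m = length w then (if x = q then f z else 0) else 0)"
      proof (cases "m = length w")
        case False
        then have "length (drop m z) \<noteq> 1" using m by (simp add: snoc)
        then have "drop m z \<noteq> [q]" by (metis length_Cons list.size(3) One_nat_def)
        then have "unit_cochain q (drop m z) = 0" by (simp add: unit_cochain_def)
        then show ?thesis using False by simp
      qed (simp add: snoc unit_cochain_def)
    qed
    also have "\<dots> = (if x = q then f z else 0)" by (simp add: snoc)
    also have "\<dots> = f z" using suppD[OF cochains_supp[OF f], of z] by (auto simp: V_def snoc)
    finally show ?thesis using cup_degree[OF f] by simp
  qed
qed

lemma K_cohomologous_refl: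
  assumes "p \<le> n" "q \<le> n" "a \<in> cocycles KK (S p) (S q) g"
  shows "(a, a) \<in> cohomologous KK (S p) (S q) g"
proof -
  have "cochain_string [p, q] [g - 1] [0]" using assms(1,2) by (simp add: cochain_string_def zero_cochains)
  from K_Mu[OF this] have "Mu KK [S p, S q] [0] = 0" by (simp add: dgmu_simps dd_zero cochain_hom_0)
  moreover have "0 \<in> Hom KK (S p) (S q) (g - 1)"
    unfolding K_Hom[OF assms(1)] using cochain_hom_0 zero_cochains by (metis imageI)
  ultimately show ?thesis using assms(3) unfolding cohomologous_def by (auto intro!: bexI[of _ 0])
qed

lemma K_unit: "p \<le> n \<Longrightarrow> cohomology_unit KK (S p) (cochain_hom (unit_cochain p))"
  unfolding cohomology_unit_def
proof (intro conjI ballI allI)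
  assume p: "p \<le> n"
  have "cochain_string [p, p] [0] [unit_cochain p]" using p unit_cochain_cochains by (simp add: cochain_string_def)
  from K_Mu[OF this] have "Mu KK [S p, S p] [cochain_hom (unit_cochain p)] = 0" by (simp add: dgmu_simps dd_unit_cochain cochain_hom_0)
  then show "cochain_hom (unit_cochain p) \<in> cocycles KK (S p) (S p) 0" using unit_cochain_cochains by (simp add: cocycles_def K_Hom[OF p])
  fix Y g assume "Y \<in> Ob KK"
  then obtain q where q: "Y = S q" "q \<le> n" by (auto simp: K_Ob)
  {
    fix a assume a: "a \<in> cocycles KK (S p) Y g"
    then obtain f where f: "a = cochain_hom f" "f \<in> cochains p q g" by (auto simp: cocycles_def q K_Hom[OF p])
    have "cochain_string [p, p, q] [0, g] [unit_cochain p, f]" using p q f unit_cochain_cochains by (auto simp: cochain_string_def less_Suc_eq_0_disj)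
    from K_Mu[OF this] have "Mu KK [S p, S p, Y] [cochain_hom (unit_cochain p), a] = a"
      by (simp add: dgmu_simps cup_unit_cochain_left[OF cochains_supp[OF f(2)]] q f)
    then show "(Mu KK [S p, S p, Y] [cochain_hom (unit_cochain p), a], a) \<in> cohomologous KK (S p) Y g"
      using K_cohomologous_refl[OF p q(2)] a q by simp
  next
    fix a assume a: "a \<in> cocycles KK Y (S p) g"
    then obtain f where f: "a = cochain_hom f" "f \<in> cochains q p g" by (auto simp: cocycles_def q K_Hom[OF q(2)])
    have "cochain_string [q, p, p] [g, 0] [f, unit_cochain p]" using p q f unit_cochain_cochains by (auto simp: cochain_string_def less_Suc_eq_0_disj)
    from K_Mu[OF this] have "Mu KK [Y, S p, S p] [a, cochain_hom (unit_cochain p)] = cochain_hom (\<lambda>z. sg g * f z)"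
      by (simp add: dgmu_simps cup_unit_cochain_right[OF f(2)] q f)
    then have "Scl KK ((-1) powi g) (Mu KK [Y, S p, S p] [a, cochain_hom (unit_cochain p)]) = a"
      by (simp add: cochain_hom_scale powi_sg f sg_square flip: mult.assoc)
    then show "(Scl KK ((-1) powi g) (Mu KK [Y, S p, S p] [a, cochain_hom (unit_cochain p)]), a) \<in> cohomologous KK Y (S p) g"
      using K_cohomologous_refl[OF q(2) p] a q by simp
  }
qed

lemma K_category: "ainf_category KK"
  unfolding ainf_category_def
proof (intro conjI ballI allI impI)
  show "vector_space (Scl KK)" by (rule vs_K)
  show "graded_space (Scl KK) (Hom KK X Y)" if "X \<in> Ob KK" "Y \<in> Ob KK" for X Y
    using that K_graded by (auto simp: K_Ob)
  show "ainf_relations KK" by (rule K_relations)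
  show "\<exists>e. cohomology_unit KK X e" if "X \<in> Ob KK" for X
  proof -
    from that obtain p where "p \<le> n" "X = S p" by (auto simp: K_Ob)
    then show ?thesis using K_unit by blast
  qed
  fix Ms and gs :: "int list" assume a: "set Ms \<subseteq> Ob KK \<and> length Ms = Suc (length gs) \<and> gs \<noteq> []"
  then show "multilinear_on (Scl KK) (Scl KK) (hom_spaces KK Ms gs) (Mu KK Ms)" by (intro K_multilinear) auto
  fix ts assume ts: "ts \<in> listset (hom_spaces KK Ms gs)"
  obtain ps where ps: "Ms = map S ps" "set ps \<subseteq> {0..n}" using K_objects a by blast
  have "composable KK (map S ps) gs ts" using ts a ps by (simp add: composable_def)
  then obtain fs where fs: "ts = map cochain_hom fs" "cochain_string ps gs fs" using K_lift[OF ps(2)] by blast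
  have ne: "ps \<noteq> []" using a ps by auto
  then have "hd ps \<in> set ps" by simp
  then have "hd ps \<le> n" using ps(2) by auto
  then show "Mu KK Ms ts \<in> Hom KK (hd Ms) (last Ms) (sum_list gs + 2 - int (length gs))"
    using K_Mu[OF fs(2)] dgmu_cochains[OF fs(2)] ne by (simp add: ps(1) fs(1) hd_map last_map K_Hom)
qed

end

section \<open>The combinatorial category\<close>

context koszul
begin

lemma d_fun_least_start: "d_fun m s t x = d_fun m s t y \<longleftrightarrow> least_start m s t x = least_start m s t y"
  "least_start m s t x > 0 \<Longrightarrow> d_fun m s t x = Some (least_start m s t x - 1)"
  by (auto simp: least_start_def split: option.splits)

text \<open>
  The sequence \<open>a_seq\<close> lists the tops of the syzygies: as \<open>L\<close> is \<open>d_fun\<close> shifted by one, the term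
  \<open>d_fun (a_seq i)\<close> is the apex of slot \<open>i + 2\<close>, and the stopping rule says that this slot is empty.
\<close>

lemma a_seq_bd:
  "a_seq m s t p i = (if \<forall>u\<le>i. bd p (Suc u) < bd p u then Some (apex p i) else None)"
proof (induction i rule: nat_less_induct)
  case (1 i)
  consider "i = 0" | "i = 1" | k where "i = Suc (Suc k)" by (metis One_nat_def not0_implies_Suc)
  then show ?case
  proof cases
    case 1
    then show ?thesis by (simp add: apex_def)
  next
    case 2
    have "least_start m s t p < p \<longleftrightarrow> p \<noteq> 0" using L_le[of p] by auto
    moreover have "(\<forall>u\<le>Suc 0. bd p (Suc u) < bd p u) \<longleftrightarrow> least_start m s t p < p" by (auto simp: le_Suc_eq)
    ultimately show ?thesis using 2 by (simp add: apex_def)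
  next
    case (3 k)
    have k: "a_seq m s t p k = (if \<forall>u\<le>k. bd p (Suc u) < bd p u then Some (apex p k) else None)"
      "a_seq m s t p (Suc k) = (if \<forall>u\<le>Suc k. bd p (Suc u) < bd p u then Some (apex p (Suc k)) else None)"
      using "1.IH" 3 by auto
    show ?thesis
    proof (cases "\<forall>u\<le>Suc k. bd p (Suc u) < bd p u")
      case False
      then have "\<not> (\<forall>u\<le>Suc (Suc k). bd p (Suc u) < bd p u)" by (meson le_SucI)
      then show ?thesis using False k 3 by (auto split: option.splits)
    next
      case True
      have b: "bd p (Suc (Suc k)) = least_start m s t (apex p k)" "bd p (Suc (Suc (Suc k))) = least_start m s t (apex p (Suc k))"
        by (simp_all add: apex_def)
      have le: "bd p (Suc (Suc (Suc k))) \<le> bd p (Suc (Suc k))" by (rule bd_Suc_le)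
      have all: "(\<forall>u\<le>Suc (Suc k). bd p (Suc u) < bd p u) \<longleftrightarrow> bd p (Suc (Suc (Suc k))) < bd p (Suc (Suc k))"
        using True by (auto simp: le_Suc_eq)
      have "a_seq m s t p i = (if d_fun m s t (apex p k) \<noteq> d_fun m s t (apex p (Suc k)) then d_fun m s t (apex p k) else None)"
        using True k 3 by simp
      also have "\<dots> = (if bd p (Suc (Suc (Suc k))) < bd p (Suc (Suc k)) then Some (apex p (Suc (Suc k))) else None)"
      proof (cases "bd p (Suc (Suc (Suc k))) < bd p (Suc (Suc k))")
        case True
        then show ?thesis using b d_fun_least_start(1)[of "apex p k" "apex p (Suc k)"] d_fun_least_start(2)[of "apex p k"]
          by (simp only: apex_def) auto
      next
        case False
        then have "bd p (Suc (Suc (Suc k))) = bd p (Suc (Suc k))" using le by simp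
        then show ?thesis using b d_fun_least_start(1)[of "apex p k" "apex p (Suc k)"] by (simp only: less_irrefl if_False) simp
      qed
      finally show ?thesis by (simp only: all 3)
    qed
  qed
qed

lemma a_seq_arrow: "a_seq m s t p i = Some q \<longleftrightarrow> arrow p i q"
proof -
  have "apex p i = q \<longleftrightarrow> bd p i = Suc q" if "\<forall>u\<le>i. bd p (Suc u) < bd p u"
  proof -
    have "bd p (Suc i) < bd p i" using that by blast
    then show ?thesis by (auto simp: apex_def)
  qed
  then show ?thesis by (auto simp: a_seq_bd arrow_def)
qed

lemma eta_conn: "eta_exists m s t p q \<longleftrightarrow> conn p q"
  by (simp add: eta_exists_def a_seq_arrow conn_def)

lemma eta_deg_deg: "eta_deg m s t p q = int (deg p q)"
  by (simp add: eta_deg_def a_seq_arrow deg_def)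

abbreviation BB :: "(nat, 'k, 'k) ainf" where "BB \<equiv> B_ST n m s t"

text \<open>
  The structure constants \<open>mu\<close> after rescaling every arrow by \<open>eps\<close> of its degree; by \<open>eprod_mu\<close> these are
  the ones of \<open>B_ST\<close>.
\<close>

definition muB :: "nat list \<Rightarrow> 'k" where
  "muB js = eps (deg (hd js) (last js)) * eprod js * mu js"

lemma red_sum: "length js = Suc d \<Longrightarrow> red js = (\<Sum>r<d. int (deg (js ! r) (js ! Suc r)) - 1)"
proof (induction js arbitrary: d rule: red.induct)
  case (1 p q js)
  then obtain d' where "d = Suc d'" by (cases d) auto
  then show ?case using 1 by (simp add: sum.lessThan_Suc_shift del: sum.lessThan_Suc)
qed auto

lemma linked_nth: "length js = Suc d \<Longrightarrow> linked js \<longleftrightarrow> (\<forall>r<d. conn (js ! r) (js ! Suc r))"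
  by (simp add: linked_def successively_conv_nth)

lemma B_Ob: "Ob BB = {0..n}" and B_Scl: "Scl BB = (*)"
  by (simp_all add: B_ST_def)

lemma B_Hom: "Hom BB p q g = (if conn p q \<and> g = int (deg p q) then UNIV else {0})"
proof -
  have "(g \<ge> 0 \<and> a_seq m s t p (nat g) = Some q) \<longleftrightarrow> conn p q \<and> g = int (deg p q)"
  proof -
    have "conn p q \<longleftrightarrow> arrow p (deg p q) q" using conn_arrow conn_def by blast
    then show ?thesis using deg_eq[of p "nat g" q] by (auto simp: a_seq_arrow)
  qed
  then show ?thesis by (simp add: B_ST_def)
qed

lemma mu_nonzero: "mu js \<noteq> (0 :: 'k) \<longleftrightarrow> 2 \<le> length js \<and> linked js \<and> conn (hd js) (last js) \<and> int (deg (hd js) (last js)) = red js + 2"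
  by (simp add: mu_def)

lemma B_Mu: "length js = Suc (length cs) \<Longrightarrow> Mu BB js cs = muB js * prod_list cs"
proof -
  assume l: "length js = Suc (length cs)"
  let ?d = "length cs"
  have c: "(?d \<ge> 1 \<and> length js = Suc ?d \<and> (\<forall>r<?d. eta_exists m s t (js ! r) (js ! Suc r)) \<and>
      eta_exists m s t (hd js) (last js) \<and>
      eta_deg m s t (hd js) (last js) = (\<Sum>r<?d. eta_deg m s t (js ! r) (js ! Suc r)) + 2 - int ?d) \<longleftrightarrow> mu js \<noteq> (0 :: 'k)"
    unfolding mu_nonzero eta_conn eta_deg_deg linked_nth[OF l] red_sum[OF l]
    using l by (auto simp: sum_subtractf)
  have "js ! (?d - 1) = js ! (length js - 2)" using l by (simp add: numeral_2_eq_2)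
  moreover have "js ! ?d = last js" using l by (cases "js = []") (auto simp: last_conv_nth)
  moreover have "(-1 :: 'k) powi ((int a + 1) * int b) = (-1) ^ ((a + 1) * b)" for a b
  proof -
    have "(int a + 1) * int b = int ((a + 1) * b)" by (simp add: algebra_simps)
    then show ?thesis by (simp only: power_int_of_nat)
  qed
  ultimately show ?thesis
    unfolding B_ST_def Let_def ainf.select_convs c
    using eprod_mu[of js, where ?'k = 'k] by (simp add: muB_def eta_deg_deg)
qed

lemma B_composable:
  assumes "composable BB js gs cs"
  shows "length js = Suc (length cs)" "length gs = length cs" "set js \<subseteq> {0..n}"
    and "prod_list cs \<noteq> 0 \<Longrightarrow> linked js" "prod_list cs \<noteq> 0 \<Longrightarrow> r < length cs \<Longrightarrow> gs ! r = int (deg (js ! r) (js ! Suc r))"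
proof -
  have c: "length js = Suc (length gs)" "length cs = length gs" "set js \<subseteq> {0..n}"
    "\<And>r. r < length gs \<Longrightarrow> cs ! r \<in> Hom BB (js ! r) (js ! Suc r) (gs ! r)"
    using assms by (auto simp: composable_iff B_Ob)
  show "length js = Suc (length cs)" "length gs = length cs" "set js \<subseteq> {0..n}" using c by auto
  have nz: "conn (js ! r) (js ! Suc r) \<and> gs ! r = int (deg (js ! r) (js ! Suc r))" if "prod_list cs \<noteq> 0" "r < length cs" for r
  proof -
    have "cs ! r \<noteq> 0" using that by (metis nth_mem prod_list_zero_iff)
    then show ?thesis using c(4)[of r] c(2) that by (auto simp: B_Hom split: if_splits)
  qed
  then show "prod_list cs \<noteq> 0 \<Longrightarrow> linked js" using linked_nth[of js "length cs"] c by auto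
  show "prod_list cs \<noteq> 0 \<Longrightarrow> r < length cs \<Longrightarrow> gs ! r = int (deg (js ! r) (js ! Suc r))" using nz by blast
qed

lemma star_red:
  assumes "composable BB js gs cs" "prod_list cs \<noteq> 0" "i < length js"
  shows "star gs i = red (pre i js)"
proof -
  note c = B_composable[OF assms(1)]
  have "length (pre i js) = Suc i" using assms(3) by (simp add: length_part)
  from red_sum[OF this] show ?thesis
    unfolding star_def using c assms by (simp add: part_nth)
qed

lemma eprod_append: "eprod (xs @ y # ys) = (eprod (xs @ [y]) * eprod (y # ys) :: 'k)"
proof (induction xs rule: induct_list012)
  case (2 x)
  then show ?case by (cases ys) auto
qed auto

lemma eprod_pre_suf: "c < length j \<Longrightarrow> eprod j = (eprod (pre c j) * eprod (suf c j) :: 'k)"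
proof -
  assume c: "c < length j"
  have "eprod (take c j @ j ! c # drop (Suc c) j) = (eprod (take c j @ [j ! c]) * eprod (j ! c # drop (Suc c) j) :: 'k)"
    by (rule eprod_append)
  also have "take c j @ j ! c # drop (Suc c) j = j" by (rule id_take_nth_drop[OF c, symmetric])
  also have "take c j @ [j ! c] = pre c j" using c by (simp add: pre_def take_Suc_conv_app_nth)
  also have "j ! c # drop (Suc c) j = suf c j" using c by (simp add: suf_def Cons_nth_drop_Suc)
  finally show ?thesis .
qed

lemma eprod_ctr:
  assumes uv: "u < v" "v < length j"
  shows "eprod (ctr u v j) * (eps (deg (j ! u) (j ! v)) * eprod (blk u v j)) = (eprod j :: 'k)"
proof -
  have "ctr u v j = take u j @ j ! u # j ! v # drop (Suc v) j"
    using uv by (simp add: ctr_def take_Suc_conv_app_nth Cons_nth_drop_Suc)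
  then have "eprod (ctr u v j) = (eprod (take u j @ [j ! u]) * eprod (j ! u # j ! v # drop (Suc v) j) :: 'k)"
    using eprod_append[of "take u j" "j ! u" "j ! v # drop (Suc v) j"] by (simp only:)
  also have "take u j @ [j ! u] = pre u j" using uv by (simp add: pre_def take_Suc_conv_app_nth)
  also have "eprod (j ! u # j ! v # drop (Suc v) j) = (eps (deg (j ! u) (j ! v)) * eprod (j ! v # drop (Suc v) j) :: 'k)" by simp
  also have "j ! v # drop (Suc v) j = suf v j" using uv by (simp add: suf_def Cons_nth_drop_Suc)
  finally have "eprod (ctr u v j) = (eprod (pre u j) * (eps (deg (j ! u) (j ! v)) * eprod (suf v j)) :: 'k)" .
  moreover have "eprod j = (eprod (pre u j) * eprod (blk u v j) * eprod (suf v j) :: 'k)"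
    using eprod_pre_suf[of v j] eprod_pre_suf[of u "pre v j"] uv by (simp add: length_part pre_pre suf_pre)
  moreover have "eps (deg (j ! u) (j ! v)) * eps (deg (j ! u) (j ! v)) = (1 :: 'k)" by (rule eps_square)
  moreover have "A * (e * C) * (e * D) = A * D * C * (e * e)" for A C D e :: 'k by (simp add: mult_ac)
  ultimately show ?thesis by simp
qed

lemma muB_ctr:
  assumes uv: "u < v" "v < length j"
  shows "muB (ctr u v j) * muB (blk u v j) = eps (deg (hd j) (last j)) * eprod j * (mu (blk u v j) * mu (ctr u v j))"
  unfolding eprod_ctr[OF uv, symmetric] using part_hd_last(5-8)[of u v j] uv by (simp add: muB_def mult_ac)

lemma sum_pairs:
  "(\<Sum>i<d. \<Sum>k=1..d - i. F i (i + k)) = (\<Sum>(u, v)\<in>pairs js. F u v :: 'k)" if "length js = Suc d"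
proof -
  have "(\<Sum>i<d. \<Sum>k=1..d - i. F i (i + k)) = (\<Sum>(i, k)\<in>Sigma {..<d} (\<lambda>i. {1..d - i}). F i (i + k))"
    by (simp add: sum.Sigma)
  also have "\<dots> = (\<Sum>(u, v)\<in>pairs js. F u v)"
    by (rule sum.reindex_bij_witness[of _ "\<lambda>(u, v). (u, v - u)" "\<lambda>(i, k). (i, i + k)"])
      (use that in \<open>auto simp: pairs_def\<close>)
  finally show ?thesis .
qed

lemma prod_list_block:
  "i \<le> length cs \<Longrightarrow> prod_list (take i cs) * (prod_list (take k (drop i cs)) * prod_list (drop (i + k) cs)) = prod_list (cs :: 'k list)"
proof -
  have "cs = take i cs @ take k (drop i cs) @ drop (i + k) cs"
    by (metis append_take_drop_id drop_drop add.commute)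
  then show ?thesis by (metis prod_list.append)
qed

text \<open>
  Rescaling preserves the relations, which hold for \<open>mu\<close> as a part of the theorem \<open>maurer_cartan\<close>.
\<close>

lemma B_relations: "ainf_relations BB"
  unfolding ainf_relations_def
proof (intro allI impI)
  fix js gs and cs :: "'k list"
  assume a: "composable BB js gs cs \<and> cs \<noteq> []"
  note c = B_composable[OF conjunct1[OF a]]
  let ?d = "length cs"
  have "(\<Sum>i<?d. \<Sum>k=1..?d - i. Scl BB ((-1) powi star gs i)
      (Mu BB (take (Suc i) js @ drop (i + k) js)
        (take i cs @ Mu BB (take (Suc k) (drop i js)) (take k (drop i cs)) # drop (i + k) cs))) =
    (\<Sum>i<?d. \<Sum>k=1..?d - i. (sg (star gs i) * (mu (blk i (i + k) js) * mu (ctr i (i + k) js))) *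
        (eps (deg (hd js) (last js)) * eprod js * prod_list cs))"
  proof (intro sum.cong refl)
    fix i k assume "i \<in> {..<?d}" "k \<in> {1..?d - i}"
    then have ik: "i < ?d" "1 \<le> k" "i + k \<le> ?d" by auto
    have b: "take (Suc k) (drop i js) = blk i (i + k) js" "take (Suc i) js @ drop (i + k) js = ctr i (i + k) js"
      by (simp_all add: part_defs)
    have "Mu BB (blk i (i + k) js) (take k (drop i cs)) = muB (blk i (i + k) js) * prod_list (take k (drop i cs))"
      using ik c by (intro B_Mu) (simp add: length_part)
    moreover have "Mu BB (ctr i (i + k) js) (take i cs @ x # drop (i + k) cs) =
        muB (ctr i (i + k) js) * prod_list (take i cs @ x # drop (i + k) cs)" for x
      using ik c by (intro B_Mu) (simp add: length_part)
    moreover have "prod_list (take i cs) * (prod_list (take k (drop i cs)) * prod_list (drop (i + k) cs)) = prod_list cs"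
      using ik by (intro prod_list_block) simp
    ultimately have "Mu BB (ctr i (i + k) js) (take i cs @ Mu BB (blk i (i + k) js) (take k (drop i cs)) # drop (i + k) cs) =
        muB (ctr i (i + k) js) * muB (blk i (i + k) js) * prod_list cs"
      by (simp add: mult_ac)
    also have "\<dots> = eps (deg (hd js) (last js)) * eprod js * (mu (blk i (i + k) js) * mu (ctr i (i + k) js)) * prod_list cs"
      using ik c by (subst muB_ctr) auto
    finally show "Scl BB ((-1) powi star gs i)
        (Mu BB (take (Suc i) js @ drop (i + k) js)
          (take i cs @ Mu BB (take (Suc k) (drop i js)) (take k (drop i cs)) # drop (i + k) cs)) =
        (sg (star gs i) * (mu (blk i (i + k) js) * mu (ctr i (i + k) js))) *
        (eps (deg (hd js) (last js)) * eprod js * prod_list cs)"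
      unfolding b by (simp add: B_Scl powi_sg mult_ac)
  qed
  also have "\<dots> = 0"
  proof (cases "prod_list cs = 0")
    case False
    have "(\<Sum>i<?d. \<Sum>k=1..?d - i. (sg (star gs i) * (mu (blk i (i + k) js) * mu (ctr i (i + k) js))) *
        (eps (deg (hd js) (last js)) * eprod js * prod_list cs)) =
      (\<Sum>i<?d. \<Sum>k=1..?d - i. sg (red (pre i js)) * mu (blk i (i + k) js) * mu (ctr i (i + k) js)) *
        (eps (deg (hd js) (last js)) * eprod js * prod_list cs)"
      unfolding sum_distrib_right
      using star_red[OF conjunct1[OF a] False] c by (intro sum.cong refl) (simp add: mult.assoc)
    also have "(\<Sum>i<?d. \<Sum>k=1..?d - i. sg (red (pre i js)) * mu (blk i (i + k) js) * mu (ctr i (i + k) js)) = (ainf_defect js :: 'k)"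
      unfolding ainf_defect_def using c(1) by (intro sum_pairs)
    also have "ainf_defect js = (0 :: 'k)" using maurer_cartan by blast
    finally show ?thesis by simp
  qed simp
  finally show "(\<Sum>i<?d. \<Sum>k=1..?d - i. Scl BB ((-1) powi star gs i)
      (Mu BB (take (Suc i) js @ drop (i + k) js)
        (take i cs @ Mu BB (take (Suc k) (drop i js)) (take k (drop i cs)) # drop (i + k) cs))) = 0" .
qed

lemma prod_list_update: "i < length cs \<Longrightarrow> prod_list (cs[i := x]) = x * (prod_list (take i cs) * prod_list (drop (Suc i) cs) :: 'k)"
  by (simp add: upd_conv_take_nth_drop mult_ac)

lemma vs_B: "vector_space ((*) :: 'k \<Rightarrow> 'k \<Rightarrow> 'k)"
  by unfold_locales (auto simp: algebra_simps)

lemma B_subspace: "module.subspace ((*) :: 'k \<Rightarrow> 'k \<Rightarrow> 'k) (if Q then UNIV else {0})"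
proof -
  interpret v: vector_space "(*) :: 'k \<Rightarrow> 'k \<Rightarrow> 'k" by (rule vs_B)
  show ?thesis by (simp add: v.subspace_UNIV v.subspace_single_0)
qed

lemma B_Mu_zero: "Mu BB [p, q] [c] = 0"
  by (simp add: B_Mu muB_def mu_short)

lemma muB_unit:
  assumes "conn p q"
  shows "muB [p, p, q] = 1" "muB [p, q, q] = (-1) ^ deg p q"
proof -
  show "muB [p, p, q] = 1" "muB [p, q, q] = (-1) ^ deg p q"
    using assms by (simp_all add: muB_def mu_def linked_simps conn_refl deg_refl eps_0 eps_square)
qed

lemma B_unit: "p \<le> n \<Longrightarrow> strict_unit BB p 1"
  unfolding strict_unit_def
proof (intro conjI ballI allI impI)
  show "1 \<in> Hom BB p p 0" by (simp add: B_Hom conn_refl deg_refl)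
  show "Mu BB [p, p] [1] = 0" by (rule B_Mu_zero)
  show "Mu BB [p, p, q] [1, a] = a" if "a \<in> Hom BB p q g" for a q g
  proof (cases "a = 0")
    case False
    then have "conn p q" using that by (auto simp: B_Hom split: if_splits)
    then show ?thesis by (simp add: B_Mu muB_unit)
  qed (simp add: B_Mu)
  show "Scl BB ((-1) powi g) (Mu BB [q, p, p] [a, 1]) = a" if "a \<in> Hom BB q p g" for a q g
  proof (cases "a = 0")
    case False
    then have "conn q p" "g = int (deg q p)" using that by (auto simp: B_Hom split: if_splits)
    then show ?thesis by (simp add: B_Mu muB_unit B_Scl flip: mult.assoc power_mult_distrib)
  qed (simp add: B_Mu B_Scl)
  fix Xs gs as i
  assume a: "composable BB Xs gs as \<and> length as \<ge> 3 \<and> i < length as \<and> Xs ! i = p \<and> Xs ! Suc i = p \<and> as ! i = 1"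
  have l: "length Xs = Suc (length as)" using a B_composable(1) by blast
  have "mu Xs = (0 :: 'k)"
  proof (rule ccontr)
    assume "mu Xs \<noteq> (0 :: 'k)"
    then have "strict Xs" using matched_strict[of Xs] a l by (simp add: mu_nonzero)
    then have "\<forall>i. Suc i < length Xs \<longrightarrow> Xs ! i \<noteq> Xs ! Suc i" by (simp add: strict_def successively_conv_nth)
    then show False using a l by (metis Suc_less_eq)
  qed
  then show "Mu BB Xs as = 0" using l by (simp add: B_Mu muB_def)
qed

lemma B_category: "ainf_category BB"
  unfolding ainf_category_def
proof (intro conjI ballI allI impI)
  show "vector_space (Scl BB)" unfolding B_Scl by (rule vs_B)
  show "graded_space (Scl BB) (Hom BB p q)" for p q
    unfolding B_Scl
  proof (rule graded_space_single[OF vs_B])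
    show "module.subspace ((*) :: 'k \<Rightarrow> 'k \<Rightarrow> 'k) (Hom BB p q (int (deg p q)))"
      unfolding B_Hom by (rule B_subspace)
  qed (simp add: B_Hom)
  show "ainf_relations BB" by (rule B_relations)
  fix Xs and gs :: "int list" assume a: "set Xs \<subseteq> Ob BB \<and> length Xs = Suc (length gs) \<and> gs \<noteq> []"
  show "multilinear_on (Scl BB) (Scl BB) (hom_spaces BB Xs gs) (Mu BB Xs)"
    unfolding multilinear_on_def
  proof (intro ballI allI impI)
    fix as i x y c
    assume as: "as \<in> listset (hom_spaces BB Xs gs)" and i: "i < length (hom_spaces BB Xs gs)"
    then have "composable BB Xs gs as" using a by (simp add: composable_def)
    from B_composable(1,2)[OF this] have l: "length Xs = Suc (length as)" "i < length as" using i by (auto simp: hom_spaces_def)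
    then show "Mu BB Xs (as[i := x + y]) = Mu BB Xs (as[i := x]) + Mu BB Xs (as[i := y]) \<and>
        Mu BB Xs (as[i := Scl BB c x]) = Scl BB c (Mu BB Xs (as[i := x]))"
      by (simp add: B_Mu prod_list_update B_Scl algebra_simps)
  qed
  fix as assume "as \<in> listset (hom_spaces BB Xs gs)"
  then have as: "composable BB Xs gs as" using a by (simp add: composable_def)
  note c = B_composable[OF as]
  show "Mu BB Xs as \<in> Hom BB (hd Xs) (last Xs) (sum_list gs + 2 - int (length gs))"
  proof (cases "Mu BB Xs as = 0")
    case True
    then show ?thesis by (simp add: B_Hom)
  next
    case False
    then have nz: "mu Xs \<noteq> (0 :: 'k)" "prod_list as \<noteq> 0" using c(1) by (auto simp: B_Mu muB_def)
    have "sum_list gs = (\<Sum>r<length as. gs ! r)" using c(2) by (simp add: sum_list_sum_nth atLeast0LessThan)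
    also have "\<dots> = (\<Sum>r<length as. int (deg (Xs ! r) (Xs ! Suc r)))" using c(5)[OF nz(2)] by simp
    also have "\<dots> = red Xs + int (length gs)" using red_sum[OF c(1)] c(2) by (simp add: sum_subtractf)
    finally have "sum_list gs + 2 - int (length gs) = int (deg (hd Xs) (last Xs))" using nz(1) by (simp add: mu_nonzero)
    then show ?thesis using nz(1) by (simp add: B_Hom mu_nonzero)
  qed
next
  fix p assume "p \<in> Ob BB"
  then have u: "strict_unit BB p 1" using B_unit by (simp add: B_Ob)
  have coh: "(a, a) \<in> cohomologous BB p' q g" if "a \<in> cocycles BB p' q g" for p' q g a
  proof -
    have "0 \<in> Hom BB p' q (g - 1)" by (simp add: B_Hom)
    then show ?thesis using that unfolding cohomologous_def by (auto simp: B_Mu_zero)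
  qed
  have "cohomology_unit BB p 1"
    unfolding cohomology_unit_def
  proof (intro conjI ballI allI)
    show "1 \<in> cocycles BB p p 0" using u by (simp add: strict_unit_def cocycles_def)
    fix q g a assume q: "q \<in> Ob BB"
    show "(Mu BB [p, p, q] [1, a], a) \<in> cohomologous BB p q g" if "a \<in> cocycles BB p q g"
    proof -
      have "Mu BB [p, p, q] [1, a] = a" using u that q unfolding strict_unit_def cocycles_def by blast
      then show ?thesis using coh[OF that] by simp
    qed
    show "(Scl BB ((-1) powi g) (Mu BB [q, p, p] [a, 1]), a) \<in> cohomologous BB q p g" if "a \<in> cocycles BB q p g"
    proof -
      have "Scl BB ((-1) powi g) (Mu BB [q, p, p] [a, 1]) = a" using u that q unfolding strict_unit_def cocycles_def by blast
      then show ?thesis using coh[OF that] by simp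
    qed
  qed
  then show "\<exists>e. cohomology_unit BB p e" by blast
qed

lemma B_directed: "directed BB"
  unfolding directed_def
proof (intro conjI ballI)
  interpret v: vector_space "(*) :: 'k \<Rightarrow> 'k \<Rightarrow> 'k" by (rule vs_B)
  show "ainf_category BB" by (rule B_category)
  show "finite (Ob BB)" by (simp add: B_Ob)
  show "finite_total_dim (Scl BB) (Hom BB p q)" for p q
  proof -
    have "x \<in> v.span {1}" for x using v.span_scale[OF v.span_base, of 1 "{1}" x] by simp
    then show ?thesis unfolding finite_total_dim_def B_Scl by (intro exI[of _ "{1}"]) auto
  qed
  show "\<exists>e. strict_unit BB p e \<and> e \<noteq> 0 \<and> Hom BB p p 0 = range (\<lambda>c. Scl BB c e) \<and> (\<forall>g. g \<noteq> 0 \<longrightarrow> Hom BB p p g = {0})"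
    if "p \<in> Ob BB" for p
    using B_unit[of p] that by (intro exI[of _ 1]) (auto simp: B_Ob B_Hom conn_refl deg_refl B_Scl)
  let ?r = "{(p, q). q \<le> p \<and> p \<le> n}"
  have lin: "linear_order_on {0..n} ?r"
    by (auto simp: linear_order_on_def partial_order_on_def preorder_on_def refl_on_def trans_def
        antisym_def total_on_def)
  have ord: "(p, q) \<in> ?r" if "p \<le> n" "Hom BB p q g \<noteq> {0}" for p q g
    using that conn_le[of p q] by (auto simp: B_Hom split: if_splits)
  show "\<exists>r. linear_order_on (Ob BB) r \<and> (\<forall>X\<in>Ob BB. \<forall>Y\<in>Ob BB. (\<exists>g. Hom BB X Y g \<noteq> {0}) \<longrightarrow> (X, Y) \<in> r)"
    by (intro exI[of _ ?r] conjI ballI impI) (use lin ord in \<open>auto simp only: B_Ob atLeastAtMost_iff\<close>)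
qed

end

section \<open>The quasi-isomorphism\<close>

lemma compositions_length: "ss \<in> compositions d \<Longrightarrow> length ss \<le> d"
proof -
  have "length ss \<le> sum_list ss" if "0 \<notin> set ss" for ss :: "nat list"
    using that by (induction ss) auto
  then show "ss \<in> compositions d \<Longrightarrow> length ss \<le> d" by (auto simp: compositions_def)
qed

lemma finite_compositions: "finite (compositions d)"
proof (rule finite_subset)
  show "compositions d \<subseteq> {ss. set ss \<subseteq> {..d} \<and> length ss \<le> d}"
    using compositions_length by (auto simp: compositions_def member_le_sum_list)
  show "finite {ss. set ss \<subseteq> {..d} \<and> length ss \<le> d}" by (rule finite_lists_length_le) simp
qed

text \<open>
  A dg category has no products of three or more morphisms, so only the compositions of \<open>d\<close> with one or
  two parts contribute to the functor equation.
\<close>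

lemma sum_compositions:
  assumes d: "d \<ge> 1" and long: "\<And>ss. length ss \<ge> 3 \<Longrightarrow> f ss = (0 :: 'b::comm_monoid_add)"
  shows "(\<Sum>ss\<in>compositions d. f ss) = f [d] + (\<Sum>a=1..<d. f [a, d - a])"
proof -
  let ?B = "insert [d] ((\<lambda>a. [a, d - a]) ` {1..<d})"
  have "(\<Sum>ss\<in>compositions d. f ss) = sum f ?B"
  proof (rule sum.mono_neutral_right[OF finite_compositions])
    show "?B \<subseteq> compositions d" using d by (auto simp: compositions_def)
    show "\<forall>ss\<in>compositions d - ?B. f ss = 0"
    proof
      fix ss assume ss: "ss \<in> compositions d - ?B"
      have "length ss \<ge> 3"
      proof (rule ccontr)
        assume "\<not> length ss \<ge> 3"
        then consider "ss = []" | a where "ss = [a]" | a b where "ss = [a, b]"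
          by (cases ss; cases "tl ss"; cases "tl (tl ss)") auto
        then show False
        proof cases
          case 1
          then show ?thesis using ss d by (simp add: compositions_def)
        next
          case 2
          then show ?thesis using ss by (auto simp: compositions_def)
        next
          case (3 a b)
          then have "a \<in> {1..<d}" "b = d - a" using ss by (auto simp: compositions_def)
          then show ?thesis using ss 3 by auto
        qed
      qed
      then show "f ss = 0" by (rule long)
    qed
  qed
  also have "\<dots> = f [d] + sum f ((\<lambda>a. [a, d - a]) ` {1..<d})" by (rule sum.insert) auto
  also have "sum f ((\<lambda>a. [a, d - a]) ` {1..<d}) = (\<Sum>a=1..<d. f [a, d - a])"
    by (subst sum.reindex) (auto simp: inj_on_def)
  finally show ?thesis .
qed

context koszul
begin

text \<open>
  The component of the functor on the string \<open>js\<close> of arrows with product of coefficients \<open>c\<close>.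
\<close>

definition tau_map :: "nat list \<Rightarrow> 'k \<Rightarrow> nat list \<Rightarrow> 'k" where
  "tau_map js c z = c * eprod js * tau js z"

definition dual_functor :: "(nat, 'k, (nat, nat \<times> nat \<Rightarrow> 'k, 'k vec) amod, nat list \<Rightarrow> 'k vec \<Rightarrow> (nat \<times> nat \<Rightarrow> 'k) list \<Rightarrow> 'k vec) ainf_fun" where
  "dual_functor = \<lparr>fob = S, fmor = (\<lambda>js cs. cochain_hom (tau_map js (prod_list cs)))\<rparr>"

lemma tau_map_cochains: "tau_map js c \<in> cochains (hd js) (last js) (red js + 1)"
  using tau_V[of js, where ?'k = 'k] tau_length[of js, where ?'k = 'k] by (auto simp: cochains_def tau_map_def)

text \<open>
  The Maurer-Cartan equation with the differential of the dg category, which is zero off the chains.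
\<close>

lemma maurer_cartan_dg: "cups js z + dd (hd js) (last js) (tau js) z = (contr js z :: 'k)"
proof (cases "V (hd js) (last js) z")
  case True
  then have "mc_defect js z = (0 :: 'k)" using maurer_cartan by blast
  then show ?thesis using True by (simp add: mc_defect_def dd_def)
next
  case False
  then have "cups js z = (0 :: 'k)" "contr js z = (0 :: 'k)" using cups_V contr_V by blast+
  then show ?thesis using False by (simp add: dd_def)
qed

lemma tau_short: "length js \<le> 1 \<Longrightarrow> tau js z = (0 :: 'k)"
  using tau_linked[of js z, where ?'k = 'k] by auto

lemma cups_inner:
  assumes "length js = Suc d" "d \<ge> 1"
  shows "cups js z = (\<Sum>a=1..<d. cup (tau (pre a js)) (tau (suf a js)) z :: 'k)"
proof -
  let ?g = "\<lambda>a. cup (tau (pre a js)) (tau (suf a js)) z :: 'k"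
  have z: "tau (pre 0 js) = (\<lambda>_. 0 :: 'k)" "tau (suf d js) = (\<lambda>_. 0 :: 'k)"
    using assms by (auto simp: fun_eq_iff length_part intro!: tau_short)
  have e: "?g 0 = 0" "?g d = 0" unfolding cup_def z by simp_all
  have "cups js z = sum ?g {0..<Suc d}" using assms by (simp add: cups_def atLeast0LessThan)
  also have "\<dots> = sum ?g {0..<d} + ?g d" by simp
  also have "sum ?g {0..<d} = ?g 0 + sum ?g {Suc 0..<d}" using assms by (intro sum.atLeast_Suc_lessThan) auto
  finally show ?thesis using e by simp
qed

lemma K_Mu_long: "length ts \<ge> 3 \<Longrightarrow> Mu KK Ms ts = 0"
  by (auto simp: koszul_category_def full_subcategory_def mod_category_def split: list.splits)

lemma hd_last_bound: "set js \<subseteq> {0..n} \<Longrightarrow> i < length js \<Longrightarrow> js ! i \<le> n"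
  by (metis atLeastAtMost_iff nth_mem subsetD)

lemma dual_functor_source:
  assumes c: "composable BB js gs cs" "cs \<noteq> []"
  shows "(\<Sum>ss\<in>compositions (length cs).
      Mu KK (map (\<lambda>k. fob dual_functor (js ! offset ss k)) [0..<Suc (length ss)])
        (map (\<lambda>k. fmor dual_functor (take (Suc (ss ! k)) (drop (offset ss k) js)) (take (ss ! k) (drop (offset ss k) cs))) [0..<length ss])) =
    cochain_hom (\<lambda>z. prod_list cs * eprod js * contr js z)"
proof -
  note b = B_composable(1-3)[OF c(1)]
  define d where "d = length cs"
  have d: "d \<ge> 1" "length js = Suc d" using b c(2) by (auto simp: d_def Suc_le_eq)
  have ne: "js \<noteq> []" using d by auto
  then have hl: "js ! 0 = hd js" "js ! d = last js" using d by (simp_all add: hd_conv_nth last_conv_nth)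
  have hb: "hd js \<le> n" "last js \<le> n"
    using hd_last_bound[OF b(3), of 0] hd_last_bound[OF b(3), of d] hl d by auto
  let ?T = "\<lambda>ss. Mu KK (map (\<lambda>k. fob dual_functor (js ! offset ss k)) [0..<Suc (length ss)])
        (map (\<lambda>k. fmor dual_functor (take (Suc (ss ! k)) (drop (offset ss k) js)) (take (ss ! k) (drop (offset ss k) cs))) [0..<length ss])"
  have "(\<Sum>ss\<in>compositions d. ?T ss) = ?T [d] + (\<Sum>a=1..<d. ?T [a, d - a])"
    by (rule sum_compositions[OF d(1)]) (simp add: K_Mu_long del: upt_Suc)
  also have "?T [d] = cochain_hom (\<lambda>z. prod_list cs * eprod js * dd (hd js) (last js) (tau js) z)"
  proof -
    have "cochain_string [hd js, last js] [red js + 1] [tau_map js (prod_list cs)]"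
      using hb tau_map_cochains[of js "prod_list cs"] by (simp add: cochain_string_def)
    from K_Mu[OF this] have "Mu KK [S (hd js), S (last js)] [cochain_hom (tau_map js (prod_list cs))] = cochain_hom (dd (hd js) (last js) (tau_map js (prod_list cs)))"
      by (simp add: dgmu_simps)
    moreover have "dd (hd js) (last js) (tau_map js (prod_list cs)) = (\<lambda>z. prod_list cs * eprod js * dd (hd js) (last js) (tau js) z)"
      using bdry_scale[of "prod_list cs * eprod js" "tau js"] by (simp add: fun_eq_iff dd_def tau_map_def[abs_def])
    ultimately show ?thesis using d hl by (simp add: dual_functor_def offset_def d_def)
  qed
  also have "(\<Sum>a=1..<d. ?T [a, d - a]) = (\<Sum>a=1..<d. cochain_hom (\<lambda>z. prod_list cs * eprod js * cup (tau (pre a js)) (tau (suf a js)) z))"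
  proof (rule sum.cong[OF refl])
    fix a assume "a \<in> {1..<d}"
    then have a: "1 \<le> a" "a < d" "a < length js" using d by auto
    let ?f = "tau_map (pre a js) (prod_list (take a cs))" and ?g = "tau_map (suf a js) (prod_list (drop a cs))"
    have f: "?f \<in> cochains (hd js) (js ! a) (red (pre a js) + 1)" "?g \<in> cochains (js ! a) (last js) (red (suf a js) + 1)"
      using tau_map_cochains[of "pre a js" "prod_list (take a cs)"] tau_map_cochains[of "suf a js" "prod_list (drop a cs)"] a by (simp_all add: part_hd_last)
    have "cochain_string [hd js, js ! a, last js] [red (pre a js) + 1, red (suf a js) + 1] [?f, ?g]"
      using f hb hd_last_bound[OF b(3) a(3)]
      by (auto simp: cochain_string_def less_Suc_eq_0_disj)
    from K_Mu[OF this] have "Mu KK [S (hd js), S (js ! a), S (last js)] [cochain_hom ?f, cochain_hom ?g] = cochain_hom (cup ?f ?g)"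
      by (simp add: dgmu_simps)
    moreover have "cup ?f ?g = (\<lambda>z. prod_list cs * eprod js * cup (tau (pre a js)) (tau (suf a js)) z)"
    proof
      fix z
      have "prod_list cs = prod_list (take a cs) * prod_list (drop a cs)" by (metis append_take_drop_id prod_list.append)
      then show "cup ?f ?g z = prod_list cs * eprod js * cup (tau (pre a js)) (tau (suf a js)) z"
        unfolding eprod_pre_suf[OF a(3)] cup_def sum_distrib_left by (intro sum.cong[OF refl]) (simp add: tau_map_def mult_ac)
    qed
    moreover have "?T [a, d - a] = Mu KK [S (hd js), S (js ! a), S (last js)] [cochain_hom ?f, cochain_hom ?g]"
    proof -
      have "take (Suc (d - a)) (drop a js) = suf a js" "take (d - a) (drop a cs) = drop a cs"
        using d by (simp_all add: suf_def d_def)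
      then show ?thesis using a hl by (simp add: dual_functor_def offset_def pre_def)
    qed
    ultimately show "?T [a, d - a] = cochain_hom (\<lambda>z. prod_list cs * eprod js * cup (tau (pre a js)) (tau (suf a js)) z)" by simp
  qed
  also have "\<dots> = cochain_hom (\<Sum>a=1..<d. (\<lambda>z. prod_list cs * eprod js * cup (tau (pre a js)) (tau (suf a js)) z))"
    by (rule cochain_hom_sum)
  also have "cochain_hom (\<lambda>z. prod_list cs * eprod js * dd (hd js) (last js) (tau js) z) + \<dots> = cochain_hom (\<lambda>z. prod_list cs * eprod js * contr js z)"
  proof -
    have ap: "(\<Sum>i\<in>I. G i) z = (\<Sum>i\<in>I. G i z)" for I :: "nat set" and G :: "nat \<Rightarrow> nat list \<Rightarrow> 'k" and z
      by (induction I rule: infinite_finite_induct) auto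
    show ?thesis
      unfolding cochain_hom_add
      by (rule arg_cong[of _ _ cochain_hom], rule ext)
        (simp add: ap maurer_cartan_dg[symmetric] cups_inner[OF d(2,1)] algebra_simps flip: sum_distrib_left)
  qed
  finally show ?thesis unfolding d_def .
qed

lemma dual_functor_target:
  assumes c: "composable BB js gs cs" "cs \<noteq> []"
  shows "(\<Sum>i<length cs. \<Sum>j=1..length cs - i. Scl KK ((-1) powi star gs i)
      (fmor dual_functor (take (Suc i) js @ drop (i + j) js)
        (take i cs @ Mu BB (take (Suc j) (drop i js)) (take j (drop i cs)) # drop (i + j) cs))) =
    cochain_hom (\<lambda>z. prod_list cs * eprod js * contr js z)"
proof -
  note b = B_composable(1-3)[OF c(1)]
  let ?d = "length cs" and ?C = "prod_list cs * eprod js"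
  have "(\<Sum>i<?d. \<Sum>k=1..?d - i. Scl KK ((-1) powi star gs i)
      (fmor dual_functor (take (Suc i) js @ drop (i + k) js)
        (take i cs @ Mu BB (take (Suc k) (drop i js)) (take k (drop i cs)) # drop (i + k) cs))) =
    (\<Sum>i<?d. \<Sum>k=1..?d - i. cochain_hom (\<lambda>z. ?C * (sg (red (pre i js)) * mu (blk i (i + k) js) * tau (ctr i (i + k) js) z)))"
  proof (intro sum.cong refl)
    fix i k assume "i \<in> {..<?d}" "k \<in> {1..?d - i}"
    then have ik: "i < ?d" "1 \<le> k" "i + k \<le> ?d" by auto
    have uv: "i < i + k" "i + k < length js" using ik b by auto
    have e: "take (Suc k) (drop i js) = blk i (i + k) js" "take (Suc i) js @ drop (i + k) js = ctr i (i + k) js"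
      by (simp_all add: part_defs)
    have M: "Mu BB (blk i (i + k) js) (take k (drop i cs)) = muB (blk i (i + k) js) * prod_list (take k (drop i cs))"
      using ik b by (intro B_Mu) (simp add: length_part)
    have P: "prod_list (take i cs) * (prod_list (take k (drop i cs)) * prod_list (drop (i + k) cs)) = prod_list cs"
      using ik by (intro prod_list_block) simp
    have E: "eprod (ctr i (i + k) js) * (eps (deg (js ! i) (js ! (i + k))) * eprod (blk i (i + k) js)) = (eprod js :: 'k)"
      by (rule eprod_ctr[OF uv])
    have "prod_list (take i cs @ Mu BB (blk i (i + k) js) (take k (drop i cs)) # drop (i + k) cs) * eprod (ctr i (i + k) js) =
        (prod_list (take i cs) * (prod_list (take k (drop i cs)) * prod_list (drop (i + k) cs))) *
        (eprod (ctr i (i + k) js) * (eps (deg (js ! i) (js ! (i + k))) * eprod (blk i (i + k) js))) * mu (blk i (i + k) js)"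
      unfolding M muB_def using part_hd_last(5,6)[of i "i + k" js] uv by (simp add: mult_ac)
    then have X: "prod_list (take i cs @ Mu BB (blk i (i + k) js) (take k (drop i cs)) # drop (i + k) cs) * eprod (ctr i (i + k) js) =
        ?C * mu (blk i (i + k) js)" unfolding P E .
    have s: "(-1) powi star gs i * ?C = sg (red (pre i js)) * ?C"
    proof (cases "prod_list cs = 0")
      case False
      have "i < length js" using uv by simp
      from star_red[OF c(1) False this] show ?thesis by (simp add: powi_sg)
    qed simp
    have "Scl KK ((-1) powi star gs i)
      (fmor dual_functor (take (Suc i) js @ drop (i + k) js)
        (take i cs @ Mu BB (take (Suc k) (drop i js)) (take k (drop i cs)) # drop (i + k) cs)) =
      cochain_hom (\<lambda>z. (-1) powi star gs i * (prod_list (take i cs @ Mu BB (blk i (i + k) js) (take k (drop i cs)) # drop (i + k) cs) *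
        eprod (ctr i (i + k) js) * tau (ctr i (i + k) js) z))"
      unfolding e by (simp only: dual_functor_def ainf_fun.select_convs cochain_hom_scale tau_map_def)
    also have "\<dots> = cochain_hom (\<lambda>z. (-1) powi star gs i * ?C * (mu (blk i (i + k) js) * tau (ctr i (i + k) js) z))"
      unfolding X by (simp only: mult.assoc)
    also have "\<dots> = cochain_hom (\<lambda>z. ?C * (sg (red (pre i js)) * mu (blk i (i + k) js) * tau (ctr i (i + k) js) z))"
      unfolding s by (simp only: mult_ac)
    finally show "Scl KK ((-1) powi star gs i)
      (fmor dual_functor (take (Suc i) js @ drop (i + k) js)
        (take i cs @ Mu BB (take (Suc k) (drop i js)) (take k (drop i cs)) # drop (i + k) cs)) =
      cochain_hom (\<lambda>z. ?C * (sg (red (pre i js)) * mu (blk i (i + k) js) * tau (ctr i (i + k) js) z))" .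
  qed
  also have "\<dots> = cochain_hom (\<Sum>i<?d. \<Sum>k=1..?d - i. (\<lambda>z. ?C * (sg (red (pre i js)) * mu (blk i (i + k) js) * tau (ctr i (i + k) js) z)))"
    unfolding cochain_hom_sum ..
  also have "\<dots> = cochain_hom (\<lambda>z. ?C * contr js z)"
  proof (rule arg_cong[of _ _ cochain_hom], rule ext)
    fix z
    have ap: "(\<Sum>i\<in>I. G i) z = (\<Sum>i\<in>I. G i z)" for I :: "nat set" and G :: "nat \<Rightarrow> nat list \<Rightarrow> 'k"
      by (induction I rule: infinite_finite_induct) auto
    show "(\<Sum>i<?d. \<Sum>k=1..?d - i. (\<lambda>z. ?C * (sg (red (pre i js)) * mu (blk i (i + k) js) * tau (ctr i (i + k) js) z))) z = ?C * contr js z"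
      unfolding ap sum_distrib_left[symmetric] contr_def
      using sum_pairs[OF b(1), of "\<lambda>u v. sg (red (pre u js)) * mu (blk u v js) * tau (ctr u v js) z"] by simp
  qed
  finally show ?thesis .
qed

lemma dual_functor_functor: "ainf_functor BB KK dual_functor"
  unfolding ainf_functor_def
proof (intro conjI allI impI ballI)
  show "ainf_category BB" by (rule B_category)
  show "ainf_category KK" by (rule K_category)
  show "fob dual_functor ` Ob BB \<subseteq> Ob KK" by (simp add: dual_functor_def B_Ob K_Ob)
  fix Xs and gs :: "int list" assume a: "set Xs \<subseteq> Ob BB \<and> length Xs = Suc (length gs) \<and> gs \<noteq> []"
  show "multilinear_on (Scl BB) (Scl KK) (hom_spaces BB Xs gs) (fmor dual_functor Xs)"
    unfolding multilinear_on_def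
  proof (intro ballI allI impI)
    fix as i x y c
    assume as: "as \<in> listset (hom_spaces BB Xs gs)" and i: "i < length (hom_spaces BB Xs gs)"
    then have "composable BB Xs gs as" using a by (simp add: composable_def)
    from B_composable(1,2)[OF this] have l: "i < length as" using i by (auto simp: hom_spaces_def)
    have "tau_map Xs (prod_list (as[i := x + y])) = tau_map Xs (prod_list (as[i := x])) + tau_map Xs (prod_list (as[i := y]))"
      by (auto simp: fun_eq_iff tau_map_def prod_list_update[OF l] algebra_simps)
    moreover have "tau_map Xs (prod_list (as[i := Scl BB c x])) = (\<lambda>z. c * tau_map Xs (prod_list (as[i := x])) z)"
      by (auto simp: fun_eq_iff tau_map_def prod_list_update[OF l] B_Scl algebra_simps)
    ultimately show "fmor dual_functor Xs (as[i := x + y]) = fmor dual_functor Xs (as[i := x]) + fmor dual_functor Xs (as[i := y]) \<and>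
        fmor dual_functor Xs (as[i := Scl BB c x]) = Scl KK c (fmor dual_functor Xs (as[i := x]))"
      by (simp add: dual_functor_def cochain_hom_add cochain_hom_scale)
  qed
  fix as assume "as \<in> listset (hom_spaces BB Xs gs)"
  then have as: "composable BB Xs gs as" using a by (simp add: composable_def)
  note c = B_composable[OF as]
  have "tau_map Xs (prod_list as) \<in> cochains (hd Xs) (last Xs) (sum_list gs + 1 - int (length gs))"
  proof (cases "prod_list as = 0")
    case True
    then show ?thesis by (simp add: cochains_def tau_map_def)
  next
    case False
    have "sum_list gs = (\<Sum>r<length as. gs ! r)" using c(2) by (simp add: sum_list_sum_nth atLeast0LessThan)
    also have "\<dots> = (\<Sum>r<length as. int (deg (Xs ! r) (Xs ! Suc r)))" using c(5)[OF False] by simp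
    also have "\<dots> = red Xs + int (length gs)" using red_sum[OF c(1)] c(2) by (simp add: sum_subtractf)
    finally have "sum_list gs + 1 - int (length gs) = red Xs + 1" by simp
    then show ?thesis using tau_map_cochains[of Xs "prod_list as"] by (simp only:)
  qed
  moreover have "hd Xs \<le> n" using c(1,3) by (cases Xs) auto
  ultimately show "fmor dual_functor Xs as \<in> Hom KK (fob dual_functor (hd Xs)) (fob dual_functor (last Xs)) (sum_list gs + 1 - int (length gs))"
    by (simp add: dual_functor_def K_Hom)
next
  fix Xs gs as assume c: "composable BB Xs gs as \<and> as \<noteq> []"
  show "(\<Sum>ss\<in>compositions (length as).
      Mu KK (map (\<lambda>k. fob dual_functor (Xs ! offset ss k)) [0..<Suc (length ss)])
        (map (\<lambda>k. fmor dual_functor (take (Suc (ss ! k)) (drop (offset ss k) Xs)) (take (ss ! k) (drop (offset ss k) as))) [0..<length ss])) =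
    (\<Sum>i<length as. \<Sum>j=1..length as - i. Scl KK ((-1) powi star gs i)
      (fmor dual_functor (take (Suc i) Xs @ drop (i + j) Xs)
        (take i as @ Mu BB (take (Suc j) (drop i Xs)) (take j (drop i as)) # drop (i + j) as)))"
    unfolding dual_functor_source[OF conjunct1[OF c] conjunct2[OF c]] dual_functor_target[OF conjunct1[OF c] conjunct2[OF c]] ..
qed

subsection \<open>Bijectivity on cohomology\<close>

lemma dd_linear: "dd p q (\<lambda>z. a * f z + b * h z) z = a * dd p q f z + b * dd p q h z"
  by (simp add: dd_def bdry_def sum.distrib sum_distrib_left algebra_simps)

lemma K_Mu1: "p \<le> n \<Longrightarrow> q \<le> n \<Longrightarrow> f \<in> cochains p q g \<Longrightarrow> Mu KK [S p, S q] [cochain_hom f] = cochain_hom (dd p q f)"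
  using K_Mu[of "[p, q]" "[g]" "[f]"] by (simp add: cochain_string_def dgmu_simps)

lemma K_cocycles:
  assumes "p \<le> n" "q \<le> n"
  shows "cocycles KK (S p) (S q) g = cochain_hom ` {f \<in> cochains p q g. dd p q f = 0}"
proof -
  have "cochain_hom (dd p q f) = 0 \<longleftrightarrow> dd p q f = 0" for f
    using cochain_hom_inj[OF assms(1) dd_supp, of q 0] cochain_hom_0 by (auto simp: supp_def)
  then show ?thesis using K_Mu1[OF assms] by (auto simp: cocycles_def K_Hom[OF assms(1)] cochain_hom_0)
qed

lemma K_cohomologous:
  assumes pq: "p \<le> n" "q \<le> n" and f: "f \<in> cochains p q g" "dd p q f = 0" and f': "f' \<in> cochains p q g" "dd p q f' = 0"
  shows "(cochain_hom f, cochain_hom f') \<in> cohomologous KK (S p) (S q) g \<longleftrightarrow> (\<exists>h\<in>cochains p q (g - 1). \<forall>z. f z - f' z = dd p q h z)"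
proof -
  have "cochain_hom f - cochain_hom f' = cochain_hom (dd p q h) \<longleftrightarrow> (\<forall>z. f z - f' z = dd p q h z)" for h
  proof -
    have "cochain_hom f - cochain_hom f' = cochain_hom (f - f')" by (auto simp: fun_eq_iff cochain_hom_def vec_def algebra_simps)
    moreover have "supp p q (f - f')" using cochains_supp[OF f(1)] cochains_supp[OF f'(1)] unfolding supp_def by (metis diff_self minus_apply)
    ultimately have "cochain_hom f - cochain_hom f' = cochain_hom (dd p q h) \<longleftrightarrow> f - f' = dd p q h"
      using cochain_hom_inj[OF pq(1) _ dd_supp, of q "f - f'" h] by auto
    then show ?thesis by (simp only: fun_eq_iff[of "f - f'"] minus_apply)
  qed
  moreover have "cochain_hom f \<in> cocycles KK (S p) (S q) g" "cochain_hom f' \<in> cocycles KK (S p) (S q) g"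
    unfolding K_cocycles[OF pq] using f f' by auto
  ultimately show ?thesis using K_Mu1[OF pq] by (auto simp: cohomologous_def K_Hom[OF pq(1)])
qed

lemma K_cohomologous_class:
  assumes pq: "p \<le> n" "q \<le> n" and xy: "(x, y) \<in> cohomologous KK (S p) (S q) g"
  shows "cohomologous KK (S p) (S q) g `` {x} = cohomologous KK (S p) (S q) g `` {y}"
proof -
  let ?R = "cohomologous KK (S p) (S q) g"
  have co: "\<exists>f. f \<in> cochains p q g \<and> dd p q f = 0 \<and> u = cochain_hom f" if "(u, v) \<in> ?R \<or> (v, u) \<in> ?R" for u v
  proof -
    have "u \<in> cocycles KK (S p) (S q) g" using that by (auto simp: cohomologous_def)
    then show ?thesis unfolding K_cocycles[OF pq] by blast
  qed
  have sym: "(v, u) \<in> ?R" if r: "(u, v) \<in> ?R" for u v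
  proof -
    obtain f f' where f: "f \<in> cochains p q g" "dd p q f = 0" "u = cochain_hom f" and f': "f' \<in> cochains p q g" "dd p q f' = 0" "v = cochain_hom f'"
      using co[of u v] co[of v u] r by blast
    obtain h where h: "h \<in> cochains p q (g - 1)" "\<forall>z. f z - f' z = dd p q h z"
      using r K_cohomologous[OF pq f(1,2) f'(1,2)] f(3) f'(3) by blast
    have "f' z - f z = dd p q (\<lambda>z. - 1 * h z) z" for z
      using h(2)[rule_format, of z] dd_linear[of p q "-1" h 0 h z] by (simp add: algebra_simps)
    then show ?thesis using K_cohomologous[OF pq f'(1,2) f(1,2)] cochains_scale[OF h(1), of "-1"] f(3) f'(3) by blast
  qed
  have trans: "(u, w) \<in> ?R" if r: "(u, v) \<in> ?R" "(v, w) \<in> ?R" for u v w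
  proof -
    obtain f f' f'' where f: "f \<in> cochains p q g" "dd p q f = 0" "u = cochain_hom f" and f': "f' \<in> cochains p q g" "dd p q f' = 0" "v = cochain_hom f'"
      and f'': "f'' \<in> cochains p q g" "dd p q f'' = 0" "w = cochain_hom f''"
      using co[of u v] co[of v u] co[of w v] r by blast
    obtain h where h: "h \<in> cochains p q (g - 1)" "\<forall>z. f z - f' z = dd p q h z"
      using r(1) K_cohomologous[OF pq f(1,2) f'(1,2)] f(3) f'(3) by blast
    obtain h' where h': "h' \<in> cochains p q (g - 1)" "\<forall>z. f' z - f'' z = dd p q h' z"
      using r(2) K_cohomologous[OF pq f'(1,2) f''(1,2)] f'(3) f''(3) by blast
    have "f z - f'' z = dd p q (h + h') z" for z
      using h(2)[rule_format, of z] h'(2)[rule_format, of z] dd_linear[of p q 1 h 1 h' z] by (simp add: plus_fun_def algebra_simps)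
    then show ?thesis using K_cohomologous[OF pq f(1,2) f''(1,2)] cochains_add[OF h(1) h'(1)] f(3) f''(3) by blast
  qed
  show ?thesis using sym trans xy by blast
qed

lemma tau_cocycle: "dd p q (tau_map [p, q] a) = 0"
proof
  fix z
  have "cups [p, q] z = (0 :: 'k)" using cups_inner[of "[p, q]" 1 z] by simp
  moreover have "contr [p, q] z = (0 :: 'k)"
  proof -
    have "mu (blk u v [p, q]) = (0 :: 'k)" if "(u, v) \<in> pairs [p, q]" for u v
      using that by (intro mu_short) (auto simp: pairs_def length_part)
    then show ?thesis unfolding contr_def by (intro sum.neutral) auto
  qed
  ultimately have "dd p q (tau [p, q]) z = (0 :: 'k)" using maurer_cartan_dg[of "[p, q]" z] by simp
  moreover have "tau_map [p, q] a = (\<lambda>z. a * eprod [p, q] * tau [p, q] z + 0 * tau [p, q] z)" by (simp add: fun_eq_iff tau_map_def)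
  ultimately show "dd p q (tau_map [p, q] a) z = 0 z" by (simp only: dd_linear) simp
qed

lemma eps_nonzero: "eps i \<noteq> (0 :: 'k)"
  using eps_square[of i, where ?'k = 'k] by auto

lemma tau_map_crit: "arrow p k q \<Longrightarrow> tau_map [p, q] a (crit p k) = a * eps (deg p q)"
  using tau_single_critical[of p q "Suc k", where ?'k = 'k] deg_eq[of p k q]
  by (auto simp: tau_map_def crit_def conn_def simp del: upt_Suc tau.simps)

lemma tau_map_pair_cochains: "a \<in> Hom BB p q g \<Longrightarrow> tau_map [p, q] a \<in> cochains p q g"
proof (cases "a = 0")
  case True
  then show ?thesis by (simp add: cochains_def tau_map_def)
next
  case False
  assume "a \<in> Hom BB p q g"
  then have "g = int (deg p q)" using False by (auto simp: B_Hom split: if_splits)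
  then show ?thesis using tau_map_cochains[of "[p, q]" a] by simp
qed

text \<open>
  \<open>B_ST\<close> has zero differential and one-dimensional morphism spaces. Injectivity: the generator is sent to
  a cocycle with value \<open>1\<close> or \<open>-1\<close> on the critical chain, where coboundaries vanish. Surjectivity: subtract from a
  cocycle the multiple of this generator with the same value on the critical chain; the difference
  is exact by \<open>cocycle_exact\<close>.
\<close>

lemma cohomology_bij:
  assumes pq: "p \<le> n" "q \<le> n"
  shows "bij_betw (\<lambda>c. cohomologous KK (S p) (S q) g `` ((\<lambda>a. cochain_hom (tau_map [p, q] a)) ` c))
    (cohomology BB p q g) (cohomology KK (S p) (S q) g)"
proof -
  let ?R = "cohomologous KK (S p) (S q) g"
  have B: "cocycles BB p q g = Hom BB p q g" by (simp add: cocycles_def B_Mu_zero)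
  have z: "0 \<in> Hom BB p q (g - 1)" by (simp add: B_Hom)
  have "cohomologous BB p q g = {(a, a) | a. a \<in> Hom BB p q g}"
    unfolding cohomologous_def B using z by (auto simp: B_Mu_zero)
  then have coh: "cohomology BB p q g = (\<lambda>a. {a}) ` Hom BB p q g"
    unfolding cohomology_def B by (auto simp: quotient_def)
  have F: "tau_map [p, q] a \<in> cochains p q g" "dd p q (tau_map [p, q] a) = 0" if "a \<in> Hom BB p q g" for a
    using tau_map_pair_cochains[OF that] tau_cocycle by auto
  have inj: "a = b" if a: "a \<in> Hom BB p q g" and b: "b \<in> Hom BB p q g"
    and eq: "?R `` {cochain_hom (tau_map [p, q] a)} = ?R `` {cochain_hom (tau_map [p, q] b)}" for a b
  proof (cases "conn p q \<and> g = int (deg p q)")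
    case False
    then show ?thesis using a b by (auto simp: B_Hom split: if_splits)
  next
    case True
    have "(cochain_hom (tau_map [p, q] b), cochain_hom (tau_map [p, q] b)) \<in> ?R"
      by (rule K_cohomologous_refl[OF pq]) (use F[OF b] K_cocycles[OF pq] in blast)
    then have "(cochain_hom (tau_map [p, q] a), cochain_hom (tau_map [p, q] b)) \<in> ?R" using eq by blast
    then obtain h where h: "h \<in> cochains p q (g - 1)" "\<forall>z. tau_map [p, q] a z - tau_map [p, q] b z = dd p q h z"
      using K_cohomologous[OF pq F[OF a] F[OF b]] by blast
    have ar: "arrow p (deg p q) q" using conn_arrow True by blast
    have "dd p q h (crit p (deg p q)) = 0"
      using bdry_crit[OF ar, of h] suppD[OF cochains_supp[OF h(1)]] by (simp add: dd_def)
    then have "a * eps (deg p q) - b * eps (deg p q) = 0"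
      using h(2) tau_map_crit[OF ar] by metis
    then show ?thesis using eps_nonzero[of "deg p q"] by simp
  qed
  have surj: "\<exists>a\<in>Hom BB p q g. ?R `` {x} = ?R `` {cochain_hom (tau_map [p, q] a)}" if x: "x \<in> cocycles KK (S p) (S q) g" for x
  proof -
    obtain f where f: "f \<in> cochains p q g" "dd p q f = 0" "x = cochain_hom f" using x unfolding K_cocycles[OF pq] by blast
    define a where "a = (if conn p q \<and> g = int (deg p q) then eps (deg p q) * f (crit p (deg p q)) else 0)"
    have a: "a \<in> Hom BB p q g" by (simp add: a_def B_Hom)
    define r where "r z = 1 * f z + - 1 * tau_map [p, q] a z" for z
    have r: "r \<in> cochains p q g"
      using cochains_add[OF f(1) cochains_scale[OF F(1)[OF a], of "-1"]] by (simp add: r_def[abs_def] plus_fun_def)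
    have "r = (\<lambda>z. 1 * f z + - 1 * tau_map [p, q] a z)" by (rule ext) (rule r_def)
    then have "dd p q r z = 1 * dd p q f z + - 1 * dd p q (tau_map [p, q] a) z" for z by (simp only: dd_linear)
    then have "dd p q r z = 0" for z by (simp add: f(2) F(2)[OF a])
    then have rc: "bdry r z = 0" if v: "V p q z" for z
      using v by (metis dd_def neg_equal_0_iff_equal)
    have r0: "r (crit p k) = 0" if k: "arrow p k q" for k
    proof -
      have dk: "deg p q = k" "conn p q" using deg_eq[OF k] k by (auto simp: conn_def)
      show ?thesis
      proof (cases "g = int k")
        case True
        then have "a = eps k * f (crit p k)" using dk by (simp add: a_def)
        then have "tau_map [p, q] a (crit p k) = f (crit p k) * (eps k * eps k)" using tau_map_crit[OF k] dk by (simp add: mult_ac)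
        then show ?thesis by (simp add: r_def eps_square)
      next
        case False
        then have "f (crit p k) = 0" using cochainsD(2)[OF f(1), of "crit p k"] by (auto simp: length_crit)
        moreover have "a = 0" using False dk by (simp add: a_def)
        ultimately show ?thesis by (simp add: r_def tau_map_def)
      qed
    qed
    obtain h where h: "\<And>z. h z \<noteq> 0 \<Longrightarrow> V p q z" "\<And>z. h z \<noteq> 0 \<Longrightarrow> \<exists>u. length u = Suc (length z) \<and> r u \<noteq> 0"
      "\<And>z. V p q z \<Longrightarrow> bdry h z = r z"
      by (rule cocycle_exact[OF suppD[OF cochains_supp[OF r]] rc r0]) (assumption | rule that; blast)+
    have hf: "(\<lambda>z. - 1 * h z) \<in> cochains p q (g - 1)"
    proof (rule cochains_scale)
      have "int (length z) = g - 1 + 1" if nz: "h z \<noteq> 0" for z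
      proof -
        obtain u where "length u = Suc (length z)" "r u \<noteq> 0" using h(2)[OF nz] by blast
        then show ?thesis using cochainsD(2)[OF r, of u] by simp
      qed
      then show "h \<in> cochains p q (g - 1)" using h(1) by (simp add: cochains_def)
    qed
    have "f z - tau_map [p, q] a z = dd p q (\<lambda>z. - 1 * h z) z" for z
    proof (cases "V p q z")
      case True
      then show ?thesis using h(3)[OF True] dd_linear[of p q "-1" h 0 h z] by (simp add: dd_def r_def)
    next
      case False
      then have "f z = 0" "tau_map [p, q] a z = 0" using cochainsD(1)[OF f(1)] cochainsD(1)[OF F(1)[OF a]] by auto
      then show ?thesis using False by (simp add: dd_def)
    qed
    then have "(x, cochain_hom (tau_map [p, q] a)) \<in> ?R"
      using K_cohomologous[OF pq f(1,2) F[OF a]] hf f(3) by blast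
    then show ?thesis using K_cohomologous_class[OF pq] a by blast
  qed
  show ?thesis
    unfolding bij_betw_def
  proof
    show "inj_on (\<lambda>c. ?R `` ((\<lambda>a. cochain_hom (tau_map [p, q] a)) ` c)) (cohomology BB p q g)"
      unfolding coh using inj by (auto simp: inj_on_def)
    show "(\<lambda>c. ?R `` ((\<lambda>a. cochain_hom (tau_map [p, q] a)) ` c)) ` cohomology BB p q g = cohomology KK (S p) (S q) g"
    proof
      show "(\<lambda>c. ?R `` ((\<lambda>a. cochain_hom (tau_map [p, q] a)) ` c)) ` cohomology BB p q g \<subseteq> cohomology KK (S p) (S q) g"
      proof
        fix y assume "y \<in> (\<lambda>c. ?R `` ((\<lambda>a. cochain_hom (tau_map [p, q] a)) ` c)) ` cohomology BB p q g"
        then obtain a where a: "a \<in> Hom BB p q g" "y = ?R `` {cochain_hom (tau_map [p, q] a)}" by (auto simp: coh)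
        then have "cochain_hom (tau_map [p, q] a) \<in> cocycles KK (S p) (S q) g" using F K_cocycles[OF pq] by blast
        then show "y \<in> cohomology KK (S p) (S q) g" unfolding cohomology_def a(2) by (rule quotientI)
      qed
      show "cohomology KK (S p) (S q) g \<subseteq> (\<lambda>c. ?R `` ((\<lambda>a. cochain_hom (tau_map [p, q] a)) ` c)) ` cohomology BB p q g"
      proof
        fix y assume "y \<in> cohomology KK (S p) (S q) g"
        then obtain x where x: "x \<in> cocycles KK (S p) (S q) g" "y = ?R `` {x}" unfolding cohomology_def by (auto elim: quotientE)
        then obtain a where "a \<in> Hom BB p q g" "y = ?R `` {cochain_hom (tau_map [p, q] a)}" using surj by blast
        then show "y \<in> (\<lambda>c. ?R `` ((\<lambda>a. cochain_hom (tau_map [p, q] a)) ` c)) ` cohomology BB p q g"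
          unfolding coh by (auto intro!: image_eqI[of _ _ "{a}"])
      qed
    qed
  qed
qed

lemma dual_functor_quasi_isomorphism: "quasi_isomorphism BB KK dual_functor"
  unfolding quasi_isomorphism_def
proof (intro conjI ballI allI)
  show "ainf_functor BB KK dual_functor" by (rule dual_functor_functor)
  show "bij_betw (fob dual_functor) (Ob BB) (Ob KK)"
    using inj_on_subset[OF S_inj] by (auto simp: bij_betw_def dual_functor_def B_Ob K_Ob)
  fix p q g assume "p \<in> Ob BB" "q \<in> Ob BB"
  then show "bij_betw (\<lambda>c. cohomologous KK (fob dual_functor p) (fob dual_functor q) g `` ((\<lambda>a. fmor dual_functor [p, q] [a]) ` c))
      (cohomology BB p q g) (cohomology KK (fob dual_functor p) (fob dual_functor q) g)"
    using cohomology_bij[of p q g] by (simp add: dual_functor_def B_Ob)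
qed

lemma koszul_dual: "ainf_koszul_dual AA BB"
  unfolding ainf_koszul_dual_def using A_directed B_directed dual_functor_quasi_isomorphism by blast

end

theorem theorem4p5:
  fixes n m :: nat and s t :: "nat \<Rightarrow> nat"
  assumes "strict_mono_on {1..m} s" and "strict_mono_on {1..m} t"
    and "s ` {1..m} \<subseteq> {0..n}" and "t ` {1..m} \<subseteq> {0..n}"
    and "\<forall>j\<in>{1..m}. s j + 2 \<le> t j"
  shows "ainf_koszul_dual (A_ST n m s t :: (nat, 'k::field, nat \<times> nat \<Rightarrow> 'k) ainf)
                          (B_ST n m s t :: (nat, 'k, 'k) ainf)"
proof -
  interpret koszul n m s t "TYPE('k)"
  proof unfold_locales
    fix j assume j: "j \<in> {1..m}"
    show "s j + 2 \<le> t j" using assms(5) j by blast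
    show "t j \<le> n" using assms(4) j by (meson atLeastAtMost_iff image_subset_iff)
  qed
  show ?thesis by (rule koszul_dual)
qed

end
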